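(* Let $E\subset X^2$ be an equivalence relation that is sofic in the sense of Elek-Lippner. Then $E$ is also sofic ($M(E)$ admits a sofic embedding in some $\Pi_{k\to\omega}M_{n_k}(\mathbb{C})$).
   Context: Ultraproducts. Fix a free ultrafilter $\omega$ on $\mathbb{N}$; $Tr$ on $M_n(\mathbb{C})$ is the normalized trace, $\|x\|_2=Tr(x^*x)^{1/2}$. $\Pi_{k\to\omega}M_{n_k}(\mathbb{C})$ is the tracial ultraproduct (bounded sequences modulo those with $\lim_{k\to\omega}\|x_k\|_2=0$, with trace $\lim_{k\to\omega}Tr(x_k)$). $D_n$, $P_n\subset M_n(\mathbb{C})$ are the diagonal algebra and the group of permutation matrices; $\Pi_{k\to\omega}D_{n_k}$, $\Pi_{k\to\omega}P_{n_k}$ are the subsets of elements represented by sequences in $D_{n_k}$, resp. $P_{n_k}$. Embeddings are unital trace-preserving $*$-homomorphisms. Equivalence relations. $(X,\mathcal{B},\mu)$ is a standard Borel probability space; $E\subset X^2$ is a measurable equivalence relation with countable classes that is $\mu$-invariant (every measurable bijection $\phi:A\to B$, $A,B\subset X$, with graph in $E$ satisfies $\mu(A)=\mu(B)$). $[E]$ is the set of measurable bijections $\theta:X\to X$ with graph in $E$. $M_0(E)$ is the $*$-algebra of bounded measurable functions $a:E\to\mathbb{C}$ for which there is $n$ such that each row and each column has at most $n$ nonzero entries, with $(ab)(x,z)=\sum_y a(x,y)b(y,z)$, $a^*(x,y)=\overline{a(y,x)}$, $Tr(a)=\int_X a(x,x)\,d\mu$. $M(E)$ is the weak closure of $M_0(E)$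 in the GNS representation of $(M_0(E),Tr)$; its elements can be seen as functions on $E$. $A=\{a\in M(E): supp(a)\subset\Delta\}\simeq L^\infty(X)$, $\Delta$ the diagonal. For $\theta\in[E]$, $u_\theta(x,y)=1$ if $x=\theta(y)$ and $0$ otherwise. $\mathcal{U}(A)$ is the unitary group of $A$ and $\mathcal{N}(A)$ is the group of unitaries $u\in M(E)$ with $uAu^*=A$. $E$ is sofic if for some $(n_k)$ there is an embedding $\Theta:M(E)\to\Pi_{k\to\omega}M_{n_k}(\mathbb{C})$ with $\Theta(A)\subset\Pi_{k\to\omega}D_{n_k}$ and $\Theta(\mathcal{N}(A))\subset\Theta(\mathcal{U}(A))\cdot\Pi_{k\to\omega}P_{n_k}$. An embedding $\Theta$ is called a sofic embedding if $\Theta(A)\subset\Pi_{k\to\omega}D_{n_k}$ and $\Theta(u_\theta)\in\Pi_{k\to\omega}P_{n_k}$ for all $\theta\in[E]$. Elek-Lippner soficity. A basic sequence of projections for $L^\infty(X)$ is a family $\{e_{i,m}\}_{1\le i\le 2^m,m\ge0}$ of projections with weakly dense linear span in $L^\infty(X)$, $\mu(e_{i,m})=2^{-m}$, and $e_{2i-1,m}+e_{2i,m}=e_{i,m-1}$ for $m\ge1$; $X$ is given together with a fixed such sequence (projections are identified with subsets). An $X$-set is a finite set $Y$ with normalized counting measure together with subsets $\{e_{i,m}\}_{1\le i\le2^m,m\ge0}$, $e_{1,0}=Y$, satisfying the same summation relations. Let $\mathbb{F}_\infty=\langle\gamma_1,\gamma_2,\ldots\rangle$ be the free group, and let $W_r$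 be the set of reduced words of length at most $r$ in $\gamma_1^{\pm1},\ldots,\gamma_r^{\pm1}$. An $r$-labeled $r$-neighborhood is a finite oriented multigraph with a root such that every vertex is joined to the root by a path of length at most $r$; every vertex has a label in $\{1,\ldots,2^r\}$; the out-edges of every vertex have different colors from $\{\gamma_1^{\pm1},\ldots,\gamma_r^{\pm1}\}$; and if an edge $xy$ has color $\gamma$ then $yx$ is an edge of color $\gamma^{-1}$. $U^{r,r}$ is the finite set of isomorphism classes of these. For a measure-preserving action $\alpha$ of $\mathbb{F}_\infty$ on $X$ (or an action on an $X$-set) and a point $x$, $B_r^r(x)\in U^{r,r}$ has vertices $\{\alpha(w)x: w\in W_r\}$, root $x$, vertex $y$ labeled by the $i$ with $y\in e_{i,r}$, and an edge colored $\gamma_j^{\pm1}$ from $\alpha(w)x$ to $\alpha(\gamma_j^{\pm1}w)x$ whenever $w,\gamma_j^{\pm1}w\in W_r$. For $G\in U^{r,r}$, $T(\alpha,G)=\{x: B_r^r(x)\equiv G\}$ and $p_G(\alpha)$ is the measure of $T(\alpha,G)$. The action $\alpha$ on $X$ is sofic in the Elek-Lippner sense if there are actions $\alpha_k$ of $\mathbb{F}_\infty$ on $X$-sets with $\lim_{k\to\infty}p_G(\alpha_k)=p_G(\alpha)$ for all $r\ge1$, $G\in U^{r,r}$. $E$ is sofic in the Elek-Lippner sense if (up to null sets) it is the orbit equivalence relation of an action of $\mathbb{F}_\infty$ on $X$ that is sofic in the Elek-Lippner sense. *)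

theory Defs
  imports
    "HOL-Probability.Probability_Measure"
    "HOL-Algebra.Group_Action"
    "HOL-Algebra.Module"
    "Jordan_Normal_Form.Schur_Decomposition"
begin

section \<open>Tracial star-algebras and their GNS closures\<close>

record 'b tracial_star_alg = "(complex, 'b) module" +
  star :: "'b \<Rightarrow> 'b"
  trace :: "'b \<Rightarrow> complex"

definition tracial_embedding ::
  "'b tracial_star_alg \<Rightarrow> 'c tracial_star_alg \<Rightarrow> ('b \<Rightarrow> 'c) \<Rightarrow> bool" where
  "tracial_embedding A B \<Theta> \<longleftrightarrow>
     \<Theta> \<in> Ring.ring_hom A B \<and>
     (\<forall>c. \<forall>a\<in>carrier A. \<Theta> (c \<odot>\<^bsub>A\<^esub> a) = c \<odot>\<^bsub>B\<^esub> \<Theta> a) \<and>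
     (\<forall>a\<in>carrier A. \<Theta> (star A a) = star B (\<Theta> a)) \<and>
     (\<forall>a\<in>carrier A. trace B (\<Theta> a) = trace A a)"

definition unitaries_in :: "'b tracial_star_alg \<Rightarrow> 'b set \<Rightarrow> 'b set" where
  "unitaries_in R S =
     {u \<in> S. star R u \<otimes>\<^bsub>R\<^esub> u = \<one>\<^bsub>R\<^esub> \<and> u \<otimes>\<^bsub>R\<^esub> star R u = \<one>\<^bsub>R\<^esub>}"

definition unitary_normalizer :: "'b tracial_star_alg \<Rightarrow> 'b set \<Rightarrow> 'b set" where
  "unitary_normalizer R S =
     {u \<in> unitaries_in R (carrier R). (\<lambda>a. u \<otimes>\<^bsub>R\<^esub> a \<otimes>\<^bsub>R\<^esub> star R u) ` S = S}"

record 'h hermitian_space = "'h partial_object" +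
  vzero :: 'h
  vadd :: "'h \<Rightarrow> 'h \<Rightarrow> 'h"
  vscale :: "complex \<Rightarrow> 'h \<Rightarrow> 'h"
  inner_prod :: "'h \<Rightarrow> 'h \<Rightarrow> complex"

definition bounded_operators :: "'h hermitian_space \<Rightarrow> ('h \<Rightarrow> 'h) set" where
  "bounded_operators H =
     {T \<in> carrier H \<rightarrow>\<^sub>E carrier H.
        (\<forall>\<xi>\<in>carrier H. \<forall>\<eta>\<in>carrier H. T (vadd H \<xi> \<eta>) = vadd H (T \<xi>) (T \<eta>)) \<and>
        (\<forall>c. \<forall>\<xi>\<in>carrier H. T (vscale H c \<xi>) = vscale H c (T \<xi>)) \<and>
        (\<exists>C::real. \<forall>\<xi>\<in>carrier H.
           Re (inner_prod H (T \<xi>) (T \<xi>)) \<le> C * Re (inner_prod H \<xi> \<xi>))}"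

definition operator_adjoint :: "'h hermitian_space \<Rightarrow> ('h \<Rightarrow> 'h) \<Rightarrow> ('h \<Rightarrow> 'h)" where
  "operator_adjoint H T =
     (THE S. S \<in> bounded_operators H \<and>
        (\<forall>\<xi>\<in>carrier H. \<forall>\<eta>\<in>carrier H. inner_prod H (T \<xi>) \<eta> = inner_prod H \<xi> (S \<eta>)))"

definition weak_operator_closure ::
  "'h hermitian_space \<Rightarrow> ('h \<Rightarrow> 'h) set \<Rightarrow> ('h \<Rightarrow> 'h) set" where
  "weak_operator_closure H \<S> =
     {T \<in> bounded_operators H.
        \<forall>F (\<epsilon>::real). finite F \<and> F \<subseteq> carrier H \<times> carrier H \<and> \<epsilon> > 0 \<longrightarrow>
          (\<exists>S\<in>\<S>. \<forall>(\<xi>, \<eta>)\<in>F. cmod (inner_prod H (T \<xi>) \<eta> - inner_prod H (S \<xi>) \<eta>) < \<epsilon>)}"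

text \<open>
  The GNS Hilbert space of \<open>A\<close> is the completion of \<open>A\<close> for the inner product
  \<open>\<langle>a, b\<rangle> = trace (star b \<otimes> a)\<close>: Cauchy sequences in \<open>A\<close>, where two sequences
  are identified if their difference tends to \<open>0\<close>. In particular the elements
  of \<open>A\<close> of norm \<open>0\<close> are divided out.
\<close>

definition trace_inner :: "'b tracial_star_alg \<Rightarrow> 'b \<Rightarrow> 'b \<Rightarrow> complex" where
  "trace_inner A a b = trace A (star A b \<otimes>\<^bsub>A\<^esub> a)"

definition trace_norm2 :: "'b tracial_star_alg \<Rightarrow> 'b \<Rightarrow> real" where
  "trace_norm2 A a = sqrt (Re (trace_inner A a a))"

definition gns_cauchy :: "'b tracial_star_alg \<Rightarrow> (nat \<Rightarrow> 'b) set" where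
  "gns_cauchy A =
     {x. range x \<subseteq> carrier A \<and>
         (\<forall>\<epsilon>>0. \<exists>N. \<forall>m\<ge>N. \<forall>n\<ge>N. trace_norm2 A (x m \<ominus>\<^bsub>A\<^esub> x n) < \<epsilon>)}"

definition gns_vec :: "'b tracial_star_alg \<Rightarrow> (nat \<Rightarrow> 'b) \<Rightarrow> (nat \<Rightarrow> 'b) set" where
  "gns_vec A x =
     {y \<in> gns_cauchy A. (\<lambda>n. trace_norm2 A (x n \<ominus>\<^bsub>A\<^esub> y n)) \<longlonglongrightarrow> 0}"

definition class_rep :: "'b set \<Rightarrow> 'b" where
  "class_rep X = (SOME x. x \<in> X)"

definition gns_space :: "'b tracial_star_alg \<Rightarrow> (nat \<Rightarrow> 'b) set hermitian_space" where
  "gns_space A =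
     \<lparr> carrier = gns_vec A ` gns_cauchy A,
       vzero = gns_vec A (\<lambda>_. \<zero>\<^bsub>A\<^esub>),
       vadd = (\<lambda>\<xi> \<eta>. gns_vec A (\<lambda>n. class_rep \<xi> n \<oplus>\<^bsub>A\<^esub> class_rep \<eta> n)),
       vscale = (\<lambda>c \<xi>. gns_vec A (\<lambda>n. c \<odot>\<^bsub>A\<^esub> class_rep \<xi> n)),
       inner_prod = (\<lambda>\<xi> \<eta>. lim (\<lambda>n. trace_inner A (class_rep \<xi> n) (class_rep \<eta> n))) \<rparr>"

definition gns_unit :: "'b tracial_star_alg \<Rightarrow> (nat \<Rightarrow> 'b) set" where
  "gns_unit A = gns_vec A (\<lambda>_. \<one>\<^bsub>A\<^esub>)"

definition gns_rep ::
  "'b tracial_star_alg \<Rightarrow> 'b \<Rightarrow> ((nat \<Rightarrow> 'b) set \<Rightarrow> (nat \<Rightarrow> 'b) set)" where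
  "gns_rep A a =
     (\<lambda>\<xi>\<in>carrier (gns_space A). gns_vec A (\<lambda>n. a \<otimes>\<^bsub>A\<^esub> class_rep \<xi> n))"

text \<open>
  The weak closure of \<open>A\<close> in its GNS representation, with the vector state of
  \<open>gns_unit A\<close>, which extends the trace of \<open>A\<close>.
\<close>

definition gns_closure ::
  "'b tracial_star_alg \<Rightarrow> ((nat \<Rightarrow> 'b) set \<Rightarrow> (nat \<Rightarrow> 'b) set) tracial_star_alg" where
  "gns_closure A = (let H = gns_space A in
     \<lparr> carrier = weak_operator_closure H (gns_rep A ` carrier A),
       mult = (\<lambda>S T. compose (carrier H) S T),
       one = (\<lambda>\<xi>\<in>carrier H. \<xi>),
       zero = (\<lambda>\<xi>\<in>carrier H. vzero H),
       add = (\<lambda>S T. \<lambda>\<xi>\<in>carrier H. vadd H (S \<xi>) (T \<xi>)),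
       smult = (\<lambda>c T. \<lambda>\<xi>\<in>carrier H. vscale H c (T \<xi>)),
       star = operator_adjoint H,
       trace = (\<lambda>T. inner_prod H (T (gns_unit A)) (gns_unit A)) \<rparr>)"


section \<open>Tracial ultraproducts of matrix algebras\<close>

definition free_ultrafilter :: "nat filter \<Rightarrow> bool" where
  "free_ultrafilter \<omega> \<longleftrightarrow>
     \<omega> \<noteq> bot \<and> \<omega> \<le> cofinite \<and>
     (\<forall>P. eventually P \<omega> \<or> eventually (\<lambda>k. \<not> P k) \<omega>)"

definition ntrace :: "complex mat \<Rightarrow> complex" where
  "ntrace A = (\<Sum>i<dim_row A. A $$ (i, i)) / of_nat (dim_row A)"

definition mat_norm2 :: "complex mat \<Rightarrow> real" where
  "mat_norm2 A = sqrt (Re (ntrace (mat_adjoint A * A)))"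

text \<open>Boundedness refers to the operator norm.\<close>

definition bounded_mat_seqs :: "(nat \<Rightarrow> nat) \<Rightarrow> (nat \<Rightarrow> complex mat) set" where
  "bounded_mat_seqs n =
     {x. (\<forall>k. x k \<in> carrier_mat (n k) (n k)) \<and>
         (\<exists>C::real. \<forall>k. \<forall>v\<in>carrier_vec (n k).
            Re ((x k *\<^sub>v v) \<bullet>c (x k *\<^sub>v v)) \<le> C * Re (v \<bullet>c v))}"

definition up_class ::
  "nat filter \<Rightarrow> (nat \<Rightarrow> nat) \<Rightarrow> (nat \<Rightarrow> complex mat) \<Rightarrow> (nat \<Rightarrow> complex mat) set" where
  "up_class \<omega> n x =
     {y \<in> bounded_mat_seqs n. ((\<lambda>k. mat_norm2 (x k - y k)) \<longlongrightarrow> 0) \<omega>}"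

definition ultraproduct ::
  "nat filter \<Rightarrow> (nat \<Rightarrow> nat) \<Rightarrow> (nat \<Rightarrow> complex mat) set tracial_star_alg" where
  "ultraproduct \<omega> n =
     \<lparr> carrier = up_class \<omega> n ` bounded_mat_seqs n,
       mult = (\<lambda>X Y. up_class \<omega> n (\<lambda>k. class_rep X k * class_rep Y k)),
       one = up_class \<omega> n (\<lambda>k. 1\<^sub>m (n k)),
       zero = up_class \<omega> n (\<lambda>k. 0\<^sub>m (n k) (n k)),
       add = (\<lambda>X Y. up_class \<omega> n (\<lambda>k. class_rep X k + class_rep Y k)),
       smult = (\<lambda>c X. up_class \<omega> n (\<lambda>k. c \<cdot>\<^sub>m class_rep X k)),
       star = (\<lambda>X. up_class \<omega> n (\<lambda>k. mat_adjoint (class_rep X k))),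
       trace = (\<lambda>X. Lim \<omega> (\<lambda>k. ntrace (class_rep X k))) \<rparr>"

definition diagonal_mats :: "nat \<Rightarrow> complex mat set" where
  "diagonal_mats n = {A \<in> carrier_mat n n. diagonal_mat A}"

definition permutation_mats :: "nat \<Rightarrow> complex mat set" where
  "permutation_mats n =
     {mat n n (\<lambda>(i, j). if i = \<sigma> j then 1 else 0) | \<sigma>. bij_betw \<sigma> {..<n} {..<n}}"

definition ultraproduct_subset ::
  "nat filter \<Rightarrow> (nat \<Rightarrow> nat) \<Rightarrow> (nat \<Rightarrow> complex mat set) \<Rightarrow> (nat \<Rightarrow> complex mat) set set" where
  "ultraproduct_subset \<omega> n S = up_class \<omega> n ` {x \<in> bounded_mat_seqs n. \<forall>k. x k \<in> S k}"


section \<open>Measured equivalence relations\<close>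

definition standard_prob_space :: "'a measure \<Rightarrow> bool" where
  "standard_prob_space M \<longleftrightarrow> prob_space M \<and>
     (\<exists>T. topspace T = space M \<and> completely_metrizable_space T \<and> second_countable T \<and>
          sets M = sigma_sets (space M) {U. openin T U})"

definition invariant_equiv_rel :: "'a measure \<Rightarrow> ('a \<times> 'a) set \<Rightarrow> bool" where
  "invariant_equiv_rel M E \<longleftrightarrow>
     E \<in> sets (M \<Otimes>\<^sub>M M) \<and> equiv (space M) E \<and>
     (\<forall>x\<in>space M. countable (E `` {x})) \<and>
     (\<forall>A\<in>sets M. \<forall>B\<in>sets M. \<forall>\<phi>.
        \<phi> \<in> measurable (restrict_space M A) (restrict_space M B) \<and>
        bij_betw \<phi> A B \<and> (\<forall>x\<in>A. (x, \<phi> x) \<in> E)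
        \<longrightarrow> emeasure M A = emeasure M B)"

definition full_group :: "'a measure \<Rightarrow> ('a \<times> 'a) set \<Rightarrow> ('a \<Rightarrow> 'a) set" where
  "full_group M E =
     {\<theta> \<in> measurable M M. bij_betw \<theta> (space M) (space M) \<and> (\<forall>x\<in>space M. (x, \<theta> x) \<in> E)}"

text \<open>
  A function on \<open>E\<close> is a function on all pairs that vanishes outside \<open>E\<close>. Its
  measurability is understood modulo null sets of the base space, that is,
  with respect to the completion: every such function agrees with a Borel
  function off \<open>(N \<times> X) \<union> (X \<times> N)\<close> for a null set \<open>N\<close>, and functions that
  agree there have the same class in the GNS space, so that Borel functions
  generate the same algebra \<open>vN_rel\<close> up to the obvious identification.
\<close>

definition measurable_on_rel ::
  "'a measure \<Rightarrow> ('a \<times> 'a) set \<Rightarrow> ('a \<times> 'a \<Rightarrow> complex) set" where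
  "measurable_on_rel M E =
     {a \<in> borel_measurable (completion M \<Otimes>\<^sub>M completion M). \<forall>p. p \<notin> E \<longrightarrow> a p = 0}"

definition M0_rel ::
  "'a measure \<Rightarrow> ('a \<times> 'a) set \<Rightarrow> ('a \<times> 'a \<Rightarrow> complex) tracial_star_alg" where
  "M0_rel M E =
     \<lparr> carrier = {a \<in> measurable_on_rel M E.
          (\<exists>C. \<forall>p. cmod (a p) \<le> C) \<and>
          (\<exists>n::nat. \<forall>x.
             finite {y. a (x, y) \<noteq> 0} \<and> card {y. a (x, y) \<noteq> 0} \<le> n \<and>
             finite {y. a (y, x) \<noteq> 0} \<and> card {y. a (y, x) \<noteq> 0} \<le> n)},
       mult = (\<lambda>a b (x, z). \<Sum>y\<in>{y. a (x, y) \<noteq> 0}. a (x, y) * b (y, z)),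
       one = (\<lambda>(x, y). if x \<in> space M \<and> x = y then 1 else 0),
       zero = (\<lambda>_. 0),
       add = (\<lambda>a b p. a p + b p),
       smult = (\<lambda>c a p. c * a p),
       star = (\<lambda>a (x, y). cnj (a (y, x))),
       trace = (\<lambda>a. \<integral>x. a (x, x) \<partial>(completion M)) \<rparr>"

type_synonym 'a vN_element =
  "(nat \<Rightarrow> 'a \<times> 'a \<Rightarrow> complex) set \<Rightarrow> (nat \<Rightarrow> 'a \<times> 'a \<Rightarrow> complex) set"

definition vN_rel :: "'a measure \<Rightarrow> ('a \<times> 'a) set \<Rightarrow> 'a vN_element tracial_star_alg" where
  "vN_rel M E = gns_closure (M0_rel M E)"

text \<open>
  An operator \<open>T\<close> in \<open>vN_rel M E\<close> is seen as the function \<open>f\<close> on \<open>E\<close> that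
  represents the vector \<open>T 1\<close>: the sequences in this class converge to \<open>f\<close> in
  the norm \<open>\<parallel>a\<parallel>\<^sup>2 = Tr (a\<^sup>* a) = \<integral> \<Sum>\<^sub>y \<bar>a(y,x)\<bar>\<^sup>2 d\<mu>(x)\<close>. It is determined up to
  null sets.
\<close>

definition is_function_of ::
  "'a measure \<Rightarrow> ('a \<times> 'a) set \<Rightarrow> 'a vN_element \<Rightarrow> ('a \<times> 'a \<Rightarrow> complex) \<Rightarrow> bool" where
  "is_function_of M E T f \<longleftrightarrow>
     f \<in> measurable_on_rel M E \<and>
     (\<forall>a \<in> T (gns_unit (M0_rel M E)).
        (\<lambda>n. \<integral>\<^sup>+x. (\<integral>\<^sup>+y. ennreal ((cmod (a n (y, x) - f (y, x)))\<^sup>2)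
               \<partial>count_space (space M)) \<partial>completion M) \<longlonglongrightarrow> 0)"

definition cartan_rel :: "'a measure \<Rightarrow> ('a \<times> 'a) set \<Rightarrow> 'a vN_element set" where
  "cartan_rel M E =
     {T \<in> carrier (vN_rel M E). \<exists>f. is_function_of M E T f \<and> {p. f p \<noteq> 0} \<subseteq> Id}"

definition u_elem :: "'a measure \<Rightarrow> ('a \<times> 'a) set \<Rightarrow> ('a \<Rightarrow> 'a) \<Rightarrow> 'a vN_element" where
  "u_elem M E \<theta> =
     gns_rep (M0_rel M E) (\<lambda>(x, y). if y \<in> space M \<and> x = \<theta> y then 1 else 0)"

definition sofic_rel :: "nat filter \<Rightarrow> 'a measure \<Rightarrow> ('a \<times> 'a) set \<Rightarrow> bool" where
  "sofic_rel \<omega> M E \<longleftrightarrow>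
     (\<exists>n \<Theta>. (\<forall>k. 0 < n k) \<and>
        tracial_embedding (vN_rel M E) (ultraproduct \<omega> n) \<Theta> \<and>
        \<Theta> ` cartan_rel M E \<subseteq> ultraproduct_subset \<omega> n (\<lambda>k. diagonal_mats (n k)) \<and>
        \<Theta> ` unitary_normalizer (vN_rel M E) (cartan_rel M E) \<subseteq>
          (\<Theta> ` unitaries_in (vN_rel M E) (cartan_rel M E)) <#>\<^bsub>ultraproduct \<omega> n\<^esub>
          ultraproduct_subset \<omega> n (\<lambda>k. permutation_mats (n k)))"

definition sofic_embedding ::
  "nat filter \<Rightarrow> (nat \<Rightarrow> nat) \<Rightarrow> 'a measure \<Rightarrow> ('a \<times> 'a) set \<Rightarrow>
   ('a vN_element \<Rightarrow> (nat \<Rightarrow> complex mat) set) \<Rightarrow> bool" where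
  "sofic_embedding \<omega> n M E \<Theta> \<longleftrightarrow>
     tracial_embedding (vN_rel M E) (ultraproduct \<omega> n) \<Theta> \<and>
     \<Theta> ` cartan_rel M E \<subseteq> ultraproduct_subset \<omega> n (\<lambda>k. diagonal_mats (n k)) \<and>
     (\<forall>\<theta>\<in>full_group M E.
        \<Theta> (u_elem M E \<theta>) \<in> ultraproduct_subset \<omega> n (\<lambda>k. permutation_mats (n k)))"


section \<open>The free group on countably many generators\<close>

text \<open>
  The letter \<open>(j, True)\<close> is the generator \<open>\<gamma>\<close> with index \<open>j + 1\<close>, and
  \<open>(j, False)\<close> is its inverse.
\<close>

type_synonym letter = "nat \<times> bool"

fun inv_letter :: "letter \<Rightarrow> letter" where
  "inv_letter (j, b) = (j, \<not> b)"

definition reduced :: "letter list \<Rightarrow> bool" where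
  "reduced w \<longleftrightarrow> successively (\<lambda>c d. d \<noteq> inv_letter c) w"

fun push_letter :: "letter \<Rightarrow> letter list \<Rightarrow> letter list" where
  "push_letter c [] = [c]"
| "push_letter c (d # w) = (if d = inv_letter c then w else c # d # w)"

definition free_group :: "letter list monoid" where
  "free_group = \<lparr> carrier = {w. reduced w}, mult = foldr push_letter, one = [] \<rparr>"

lemma inv_letter_inv_letter [simp]: "inv_letter (inv_letter c) = c"
  by (cases c) auto

lemma inv_letter_neq [simp]: "inv_letter c \<noteq> c" "c \<noteq> inv_letter c"
  by (cases c; auto)+

lemma reduced_push_letter: "reduced w \<Longrightarrow> reduced (push_letter c w)"
  by (cases w) (auto simp: reduced_def successively_Cons)

lemma reduced_foldr: "reduced w \<Longrightarrow> reduced (foldr push_letter u w)"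
  by (induction u) (auto intro: reduced_push_letter)

lemma push_letter_inv:
  assumes "reduced w" shows "push_letter (inv_letter c) (push_letter c w) = w"
proof (cases w)
  case (Cons d v)
  show ?thesis
  proof (cases "d = inv_letter c")
    case True
    then show ?thesis using Cons assms by (cases v) (auto simp: reduced_def)
  qed (use Cons in auto)
qed auto

lemma push_letter_inv':
  assumes "reduced w" shows "push_letter c (push_letter (inv_letter c) w) = w"
  using push_letter_inv[OF assms, of "inv_letter c"] by simp

lemma foldr_push_letter:
  assumes "reduced w"
  shows "foldr push_letter (push_letter c u) w = push_letter c (foldr push_letter u w)"
proof (cases u)
  case (Cons d v)
  then show ?thesis
    using push_letter_inv'[OF reduced_foldr[OF assms]] by auto
qed auto

lemma foldr_push_assoc:
  "reduced w \<Longrightarrow>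
     foldr push_letter (foldr push_letter u v) w = foldr push_letter u (foldr push_letter v w)"
  by (induction u) (auto simp: foldr_push_letter)

lemma foldr_push_inv:
  "reduced w \<Longrightarrow> foldr push_letter (rev (map inv_letter u)) (foldr push_letter u w) = w"
  by (induction u arbitrary: w) (auto simp: push_letter_inv reduced_foldr)

lemma reduced_rev_inv:
  assumes "reduced w" shows "reduced (rev (map inv_letter w))"
proof -
  have "inv_letter c \<noteq> inv_letter (inv_letter d)" if "d \<noteq> inv_letter c" for c d
    using that by (cases c; cases d) auto
  with assms show ?thesis
    unfolding reduced_def successively_rev successively_map
    by (elim successively_mono)
qed

lemma foldr_push_reduced: "reduced u \<Longrightarrow> foldr push_letter u [] = u"
proof (induction u)
  case (Cons c u)
  then show ?case by (cases u) (auto simp: reduced_def)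
qed auto

lemma group_free_group: "group free_group"
proof (rule groupI)
  show "\<exists>y\<in>carrier free_group. y \<otimes>\<^bsub>free_group\<^esub> x = \<one>\<^bsub>free_group\<^esub>"
    if "x \<in> carrier free_group" for x
  proof (rule bexI[of _ "rev (map inv_letter x)"])
    show "rev (map inv_letter x) \<otimes>\<^bsub>free_group\<^esub> x = \<one>\<^bsub>free_group\<^esub>"
      using that foldr_push_inv[of "[]" x]
      by (auto simp: free_group_def foldr_push_reduced) (simp add: reduced_def)
  qed (use that in \<open>auto simp: free_group_def reduced_rev_inv\<close>)
qed (auto simp: free_group_def reduced_foldr foldr_push_assoc, simp add: reduced_def)

definition short_words :: "nat \<Rightarrow> letter list set" where
  "short_words r = {w. reduced w \<and> length w \<le> r \<and> (\<forall>c\<in>set w. fst c < r)}"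


section \<open>Elek-Lippner soficity\<close>

text \<open>
  Projections in \<open>L\<^sup>\<infinity>(X)\<close> are identified with measurable subsets, chosen such
  that the summation relations hold everywhere. The set with indices \<open>i, m\<close>
  is \<open>e i m\<close>; only the values for \<open>1 \<le> i \<le> 2\<^sup>m\<close> matter.
\<close>

definition dyadic_splitting :: "'a set \<Rightarrow> (nat \<Rightarrow> nat \<Rightarrow> 'a set) \<Rightarrow> bool" where
  "dyadic_splitting S e \<longleftrightarrow>
     e 1 0 = S \<and>
     (\<forall>m\<ge>1. \<forall>i\<in>{1..2 ^ (m - 1)}.
        e (2 * i - 1) m \<union> e (2 * i) m = e i (m - 1) \<and>
        e (2 * i - 1) m \<inter> e (2 * i) m = {})"

definition L2_functions :: "'a measure \<Rightarrow> ('a \<Rightarrow> complex) set" where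
  "L2_functions M = {\<xi> \<in> borel_measurable M. integrable M (\<lambda>x. (cmod (\<xi> x))\<^sup>2)}"

text \<open>
  The last condition is the weak density of the linear span of the projections
  \<open>e i m\<close> in \<open>L\<^sup>\<infinity>(X)\<close>, acting by multiplication on \<open>L\<^sup>2(X)\<close>.
\<close>

definition basic_sequence :: "'a measure \<Rightarrow> (nat \<Rightarrow> nat \<Rightarrow> 'a set) \<Rightarrow> bool" where
  "basic_sequence M e \<longleftrightarrow>
     dyadic_splitting (space M) e \<and>
     (\<forall>m. \<forall>i\<in>{1..2 ^ m}. e i m \<in> sets M \<and> measure M (e i m) = 1 / 2 ^ m) \<and>
     (\<forall>f \<in> borel_measurable M. (\<exists>C. \<forall>x\<in>space M. cmod (f x) \<le> C) \<longrightarrow>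
        (\<forall>F (\<epsilon>::real). finite F \<and> F \<subseteq> L2_functions M \<times> L2_functions M \<and> \<epsilon> > 0 \<longrightarrow>
          (\<exists>I (c :: nat \<times> nat \<Rightarrow> complex).
             finite I \<and> I \<subseteq> {(i, m). 1 \<le> i \<and> i \<le> 2 ^ m} \<and>
             (\<forall>(\<xi>, \<eta>)\<in>F.
                cmod (\<integral>x. (f x - (\<Sum>(i, m)\<in>I. c (i, m) * indicator (e i m) x)) *
                           \<xi> x * cnj (\<eta> x) \<partial>M) < \<epsilon>))))"

definition X_set :: "'y set \<Rightarrow> (nat \<Rightarrow> nat \<Rightarrow> 'y set) \<Rightarrow> bool" where
  "X_set Y e \<longleftrightarrow> finite Y \<and> Y \<noteq> {} \<and> dyadic_splitting Y e"

text \<open>An edge is a triple consisting of its source, its colour and its target.\<close>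

record 'v rooted_graph =
  verts :: "'v set"
  root :: 'v
  vlabel :: "'v \<Rightarrow> nat"
  edges :: "('v \<times> letter \<times> 'v) set"

definition labeled_nbhd :: "nat \<Rightarrow> 'v rooted_graph \<Rightarrow> bool" where
  "labeled_nbhd r G \<longleftrightarrow>
     finite (verts G) \<and> root G \<in> verts G \<and>
     (\<forall>(u, c, v)\<in>edges G. u \<in> verts G \<and> v \<in> verts G \<and> fst c < r) \<and>
     (\<forall>v\<in>verts G. \<exists>l\<le>r. (root G, v) \<in> {(u, u'). \<exists>c. (u, c, u') \<in> edges G} ^^ l) \<and>
     (\<forall>v\<in>verts G. vlabel G v \<in> {1..2 ^ r}) \<and>
     (\<forall>u c v v'. (u, c, v) \<in> edges G \<and> (u, c, v') \<in> edges G \<longrightarrow> v = v') \<and>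
     (\<forall>u c v. (u, c, v) \<in> edges G \<longrightarrow> (v, inv_letter c, u) \<in> edges G)"

definition nbhd_iso :: "'v rooted_graph \<Rightarrow> 'w rooted_graph \<Rightarrow> bool" where
  "nbhd_iso G G' \<longleftrightarrow>
     (\<exists>f. bij_betw f (verts G) (verts G') \<and> f (root G) = root G' \<and>
          (\<forall>v\<in>verts G. vlabel G' (f v) = vlabel G v) \<and>
          (\<forall>u\<in>verts G. \<forall>v\<in>verts G. \<forall>c.
             (u, c, v) \<in> edges G \<longleftrightarrow> (f u, c, f v) \<in> edges G'))"

definition action_nbhd ::
  "nat \<Rightarrow> (nat \<Rightarrow> nat \<Rightarrow> 'a set) \<Rightarrow> (letter list \<Rightarrow> 'a \<Rightarrow> 'a) \<Rightarrow> 'a \<Rightarrow> 'a rooted_graph" where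
  "action_nbhd r e \<alpha> x =
     \<lparr> verts = {\<alpha> w x | w. w \<in> short_words r},
       root = x,
       vlabel = (\<lambda>y. THE i. i \<in> {1..2 ^ r} \<and> y \<in> e i r),
       edges = {(\<alpha> w x, c, \<alpha> ([c] \<otimes>\<^bsub>free_group\<^esub> w) x) | w c.
                  w \<in> short_words r \<and> [c] \<otimes>\<^bsub>free_group\<^esub> w \<in> short_words r} \<rparr>"

definition nbhd_prob ::
  "'a measure \<Rightarrow> (nat \<Rightarrow> nat \<Rightarrow> 'a set) \<Rightarrow> (letter list \<Rightarrow> 'a \<Rightarrow> 'a) \<Rightarrow>
   nat \<Rightarrow> 'v rooted_graph \<Rightarrow> real" where
  "nbhd_prob N e \<alpha> r G = measure N {x \<in> space N. nbhd_iso (action_nbhd r e \<alpha> x) G}"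

definition mp_action :: "'a measure \<Rightarrow> (letter list \<Rightarrow> 'a \<Rightarrow> 'a) \<Rightarrow> bool" where
  "mp_action M \<alpha> \<longleftrightarrow>
     group_action free_group (space M) \<alpha> \<and>
     (\<forall>w\<in>carrier free_group. \<alpha> w \<in> measurable M M \<and> distr M M (\<alpha> w) = M)"

text \<open>
  Finite sets and finite graphs may be assumed to have natural numbers as their
  points; so the \<open>G\<close> below run through representatives of all isomorphism
  classes of neighborhoods.
\<close>

definition EL_sofic_action ::
  "'a measure \<Rightarrow> (nat \<Rightarrow> nat \<Rightarrow> 'a set) \<Rightarrow> (letter list \<Rightarrow> 'a \<Rightarrow> 'a) \<Rightarrow> bool" where
  "EL_sofic_action M e \<alpha> \<longleftrightarrow>
     (\<exists>(Y :: nat \<Rightarrow> nat set) d \<beta>.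
        (\<forall>k. X_set (Y k) (d k) \<and> group_action free_group (Y k) (\<beta> k)) \<and>
        (\<forall>r\<ge>1. \<forall>G :: nat rooted_graph. labeled_nbhd r G \<longrightarrow>
           (\<lambda>k. nbhd_prob (uniform_count_measure (Y k)) (d k) (\<beta> k) r G)
             \<longlonglongrightarrow> nbhd_prob M e \<alpha> r G))"

text \<open>
  Equality up to null sets of \<open>E\<close> and the orbit equivalence relation means that
  the classes of almost every point coincide; equivalently, the symmetric
  difference is null for the measure \<open>C \<mapsto> \<integral> card {y. (x,y) \<in> C} d\<mu>(x)\<close> on pairs.
\<close>

definition EL_sofic_rel ::
  "'a measure \<Rightarrow> (nat \<Rightarrow> nat \<Rightarrow> 'a set) \<Rightarrow> ('a \<times> 'a) set \<Rightarrow> bool" where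
  "EL_sofic_rel M e E \<longleftrightarrow>
     (\<exists>\<alpha>. mp_action M \<alpha> \<and> EL_sofic_action M e \<alpha> \<and>
          (AE x in M. E `` {x} = Group_Action.orbit free_group \<alpha> x))"

end

(*
Make the action of the free group follow the classes of E everywhere by letting it act
trivially on the null set where its orbits differ from the classes. Finite formal sums of
coefficient * (conditions "v y lies in e i m") * (x = w y) have values both in M0(E) and, through
the approximating X-sets, in matrices. Elek-Lippner convergence makes the traces converge, so
this is a trace-preserving relation R between a 2-norm dense *-subalgebra of M0(E) and bounded
matrix sequences. An operator T of the weak closure is approximated in 2-norm by such sums; cutting
the matrices down by a polynomial in y*y (a Bernstein polynomial of a cut-off function, so that
no spectral theorem is needed) makes them bounded in norm, and a diagonal choice
along the ultrafilter defines the image of T.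
Diagonal functions are approximated by sums with w = 1, hence by diagonal matrices. A 0/1 function
with one 1 in each row and column is approximated by matrices with entries in the natural
numbers, almost all of whose rows and columns have exactly one 1, hence by permutation
matrices. For u in the normalizer of A, each u 1_U u* lies in A; for a separating
sequence of sets U this forces the function of u to have one nonzero entry, of modulus 1,
in almost every row and column, so u is a diagonal unitary times a 0/1 function.
*)
theory Submission
  imports Defs "HOL-Analysis.L2_Norm" "HOL-Probability.Conditional_Expectation"
begin

text \<open>The obstacle is boundedness in norm. Formal sums approximate an operator
  \<open>T\<close> only in the 2-norm, and the norms of their matrices may grow along the
  approximation. The bound is regained from \<open>T\<close> itself. Let \<open>C\<close> bound the
  norm of \<open>T\<close> and let \<open>z\<close> be a cut-off function of the absolute value of
  \<open>y\<close> above about \<open>2 * C\<close>. Then \<open>y\<close> expands \<open>z\<close>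
  by almost \<open>2 * C\<close>, while \<open>T\<close>, which is close to \<open>y\<close>,
  expands it by at most \<open>C\<close>. So \<open>y * z\<close> is small in 2-norm, and
  \<open>y * (1 - z)\<close> is bounded and still close to \<open>y\<close>. Of the weak closure
  only the vector \<open>T 1\<close> and the commutation with right multiplications are used.
  Products are recovered because right multiplication by a fixed element is bounded in the 2-norm,
  adjoints because the star is isometric for it, which is traciality. For M0(E) traciality is the
  equality of row sums and column sums, a consequence of the invariance of the measure.
  \<open>R\<close> need not be a map: a function that vanishes may come from a formal sum with
  nonzero matrices, but the 2-norms of these tend to 0 since traces converge.\<close>

abbreviation MT :: "nat => complex mat set" where "MT n == carrier_mat n n"
abbreviation adj where "adj == mat_adjoint"
abbreviation nm2 where "nm2 == mat_norm2"
abbreviation cr where "cr == complex_of_real"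
abbreviation lims (infix "---->" 60) where "X ----> L == X \<longlonglongrightarrow> L"
abbreviation csum :: "('b => ennreal) => ennreal" (binder "\<Uplus>" 10) where "csum f == nn_integral (count_space UNIV) f"
abbreviation equivalent (infixr "<->" 25) where "P <-> Q == (P = Q)"
abbreviation ginv where "ginv w == inv\<^bsub>free_group\<^esub> w"
abbreviation gmult (infixl "\<cdot>" 70) where "v \<cdot> w == v \<otimes>\<^bsub>free_group\<^esub> w"


section \<open>Matrices and the normalized 2-norm\<close>

text \<open>Vectors are total functions of which only the first \<open>n\<close> values count, so
  that vectors bring no dimension conditions.\<close>

definition mv :: "nat => complex mat => (nat => complex) => nat => complex" where
 "mv n x v i = (\<Sum>j<n. x $$ (i, j) * v j)"

definition vn :: "nat => (nat => complex) => real" where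
 "vn n v = (\<Sum>j<n. (cmod (v j))^2)"

text \<open>\<open>C\<close> bounds the operator norm itself, whereas the constant in
  \<open>bounded_mat_seqs\<close> bounds its square; in this form the constants simply add and
  multiply.\<close>

definition op_bdd :: "nat => real => complex mat => bool" where
 "op_bdd n C x <-> x : MT n & 0 <= C & (ALL v. vn n (mv n x v) <= C^2 * vn n v)"

lemma op_bddD: "op_bdd n C x ==> x : MT n" "op_bdd n C x ==> 0 <= C"
 "op_bdd n C x ==> vn n (mv n x v) <= C^2 * vn n v"
 by (auto simp: op_bdd_def)

lemma Re_mult_cnj: "Re (z * cnj z) = (cmod z)^2"
 by (metis complex_norm_square Re_complex_of_real)

lemma vn_nonneg [simp]: "0 <= vn n v"
 by (simp add: vn_def sum_nonneg)

lemma vn_cong: "(!!i. i < n ==> v i = w i) ==> vn n v = vn n w"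
 by (simp add: vn_def)

lemma vn_scale: "vn n (%i. c * v i) = (cmod c)^2 * vn n v"
 by (simp add: vn_def norm_mult power_mult_distrib sum_distrib_left)

lemma vn_L2: "sqrt (vn n v) = L2_set (%i. cmod (v i)) {..<n}"
 by (simp add: vn_def L2_set_def)

lemma vn_triangle: "sqrt (vn n (%i. v i + w i)) <= sqrt (vn n v) + sqrt (vn n w)"
proof -
 have "L2_set (%i. cmod (v i + w i)) {..<n} <= L2_set (%i. cmod (v i) + cmod (w i)) {..<n}"
  by (intro L2_set_mono norm_triangle_ineq) auto
 also have "... <= L2_set (%i. cmod (v i)) {..<n} + L2_set (%i. cmod (w i)) {..<n}"
  by (rule L2_set_triangle_ineq)
 finally show ?thesis by (simp add: vn_L2)
qed

lemma index_mult_mat_sum: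
 assumes "x : carrier_mat n m" "y : carrier_mat m l" "i < n" "j < l"
 shows "(x * y) $$ (i, j) = (\<Sum>k<m. x $$ (i, k) * y $$ (k, j))"
 using assms by (auto simp: scalar_prod_def atLeast0LessThan intro!: sum.cong)

lemma mat_adjoint_carrier [simp, intro]:
 "x : carrier_mat n m ==> adj x : carrier_mat m n"
 by (auto simp: mat_adjoint_def)

lemma index_mat_adjoint [simp]:
 assumes "x : carrier_mat n m" "i < m" "j < n"
 shows "adj x $$ (i, j) = cnj (x $$ (j, i))"
 using assms by (auto simp: mat_adjoint_def mat_of_rows_def)

lemma dim_mat_adjoint [simp]: "dim_row (adj x) = dim_col x" "dim_col (adj x) = dim_row x"
 by (auto simp: mat_adjoint_def)

lemma index_mat_adjoint' [simp]:
 "i < dim_col x ==> j < dim_row x ==> adj x $$ (i, j) = cnj (x $$ (j, i))"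
 by (rule index_mat_adjoint) auto

lemma mat_adjoint_mult:
 fixes x y :: "complex mat"
 assumes "x : MT n" "y : MT n"
 shows "adj (x * y) = adj y * adj x"
 using carrier_matD[OF assms(1)] carrier_matD[OF assms(2)]
 by (intro eq_matI) (auto simp: scalar_prod_def mult.commute intro!: sum.cong)

lemma mat_adjoint_add:
 fixes x y :: "complex mat"
 assumes "x : MT n" "y : MT n"
 shows "adj (x + y) = adj x + adj y"
 using carrier_matD[OF assms(1)] carrier_matD[OF assms(2)] by (intro eq_matI) auto

lemma mat_adjoint_smult: "adj (c \<cdot>\<^sub>m x) = cnj c \<cdot>\<^sub>m adj x"
 by (intro eq_matI) auto

lemma mat_adjoint_adjoint: "adj (adj x) = (x :: complex mat)"
 by (intro eq_matI) auto

lemma mat_adjoint_one: "adj (1\<^sub>m n) = (1\<^sub>m n :: complex mat)"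
 by (intro eq_matI) auto

lemma mv_mult:
 assumes "x : MT n" "y : MT n" "i < n"
 shows "mv n (x * y) v i = mv n x (mv n y v) i"
proof -
 have "mv n (x * y) v i = (\<Sum>j<n. \<Sum>k<n. x $$ (i, k) * y $$ (k, j) * v j)"
  unfolding mv_def
  by (intro sum.cong refl)
   (use assms in \<open>simp add: index_mult_mat_sum[of _ n n _ n] sum_distrib_right del: index_mult_mat\<close>)
 also have "... = (\<Sum>k<n. \<Sum>j<n. x $$ (i, k) * y $$ (k, j) * v j)" by (rule sum.swap)
 finally show ?thesis by (simp add: mv_def sum_distrib_left mult.assoc)
qed

lemma mv_add:
 assumes "x : MT n" "y : MT n" "i < n"
 shows "mv n (x + y) v i = mv n x v i + mv n y v i"
 using assms by (simp add: mv_def distrib_right sum.distrib)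

lemma mv_smult:
 assumes "x : MT n" "i < n"
 shows "mv n (c \<cdot>\<^sub>m x) v i = c * mv n x v i"
 using assms by (simp add: mv_def sum_distrib_left mult.assoc)

lemma mv_one: "i < n ==> mv n (1\<^sub>m n) v i = v i"
 by (simp add: mv_def if_distrib if_distribR cong: if_cong sum.cong)
  (simp add: sum.delta' if_distrib[of "%x. x * _"] cong: if_cong)

lemma mv_cong: "(!!j. j < n ==> v j = w j) ==> mv n x v i = mv n x w i"
 by (simp add: mv_def)

lemma mv_adjoint:
 assumes "x : MT n"
 shows "(\<Sum>i<n. mv n x v i * cnj (w i)) = (\<Sum>i<n. v i * cnj (mv n (adj x) w i))"
proof -
 have "(\<Sum>i<n. mv n x v i * cnj (w i)) = (\<Sum>i<n. \<Sum>j<n. x $$ (i, j) * v j * cnj (w i))"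
  by (simp add: mv_def sum_distrib_right)
 also have "... = (\<Sum>j<n. \<Sum>i<n. x $$ (i, j) * v j * cnj (w i))" by (rule sum.swap)
 also have "... = (\<Sum>i<n. v i * cnj (mv n (adj x) w i))"
  using assms by (simp add: mv_def sum_distrib_left mult_ac)
 finally show ?thesis .
qed

lemma vn_eq_sum: "cr (vn n v) = (\<Sum>i<n. v i * cnj (v i))"
 unfolding vn_def of_real_sum by (intro sum.cong refl complex_norm_square)

lemma cs_vn: "cmod (\<Sum>i<n. v i * cnj (w i)) <= sqrt (vn n v) * sqrt (vn n w)"
proof -
 have "cmod (\<Sum>i<n. v i * cnj (w i)) <= (\<Sum>i<n. \<bar>cmod (v i)\<bar> * \<bar>cmod (w i)\<bar>)"
  by (rule order.trans[OF norm_sum]) (simp add: norm_mult)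
 also have "... <= sqrt (vn n v) * sqrt (vn n w)"
  unfolding vn_L2 by (rule L2_set_mult_ineq)
 finally show ?thesis .
qed

lemma op_bdd_sqrt: "op_bdd n C x ==> sqrt (vn n (mv n x v)) <= C * sqrt (vn n v)"
 by (metis op_bddD(2,3) real_sqrt_abs real_sqrt_le_mono real_sqrt_mult abs_of_nonneg)

lemma op_bddI_sqrt:
 assumes "x : MT n" "0 <= C" "!!v. sqrt (vn n (mv n x v)) <= C * sqrt (vn n v)"
 shows "op_bdd n C x"
 unfolding op_bdd_def
proof (intro conjI allI)
 fix v
 have "(sqrt (vn n (mv n x v)))^2 <= (C * sqrt (vn n v))^2"
  by (intro power_mono assms) simp
 thus "vn n (mv n x v) <= C^2 * vn n v" by (simp add: power_mult_distrib)
qed (use assms in auto)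

lemma op_bdd_mono: "op_bdd n C x ==> C <= D ==> op_bdd n D x"
 by (rule op_bddI_sqrt)
  (auto dest: op_bddD intro!: order.trans[OF op_bdd_sqrt] mult_right_mono)

lemma op_bdd_one: "op_bdd n 1 (1\<^sub>m n)"
 by (rule op_bddI_sqrt) (auto simp: mv_one cong: vn_cong)

lemma op_bdd_mult:
 assumes "op_bdd n C x" "op_bdd n D y" shows "op_bdd n (C * D) (x * y)"
proof (rule op_bddI_sqrt)
 fix v
 note c = op_bddD(1)[OF assms(1)] op_bddD(1)[OF assms(2)]
 have "sqrt (vn n (mv n (x * y) v)) = sqrt (vn n (mv n x (mv n y v)))"
  using c by (simp add: mv_mult cong: vn_cong)
 also have "... <= C * sqrt (vn n (mv n y v))" by (rule op_bdd_sqrt[OF assms(1)])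
 also have "... <= C * (D * sqrt (vn n v))"
  by (intro mult_left_mono op_bdd_sqrt assms op_bddD(2)[OF assms(1)])
 finally show "sqrt (vn n (mv n (x * y) v)) <= C * D * sqrt (vn n v)" by (simp add: mult.assoc)
qed (use op_bddD[OF assms(1)] op_bddD[OF assms(2)] in auto)

lemma op_bdd_add:
 assumes "op_bdd n C x" "op_bdd n D y" shows "op_bdd n (C + D) (x + y)"
proof (rule op_bddI_sqrt)
 fix v
 note c = op_bddD(1)[OF assms(1)] op_bddD(1)[OF assms(2)]
 have "sqrt (vn n (mv n (x + y) v)) = sqrt (vn n (%i. mv n x v i + mv n y v i))"
  using c by (simp add: mv_add cong: vn_cong)
 also have "... <= sqrt (vn n (mv n x v)) + sqrt (vn n (mv n y v))" by (rule vn_triangle)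
 also have "... <= C * sqrt (vn n v) + D * sqrt (vn n v)"
  by (intro add_mono op_bdd_sqrt assms)
 finally show "sqrt (vn n (mv n (x + y) v)) <= (C + D) * sqrt (vn n v)" by (simp add: distrib_right)
qed (use op_bddD[OF assms(1)] op_bddD[OF assms(2)] in auto)

lemma op_bdd_smult:
 assumes "op_bdd n C x" shows "op_bdd n (cmod c * C) (c \<cdot>\<^sub>m x)"
proof (rule op_bddI_sqrt)
 fix v
 have "sqrt (vn n (mv n (c \<cdot>\<^sub>m x) v)) = cmod c * sqrt (vn n (mv n x v))"
  using op_bddD(1)[OF assms] by (simp add: mv_smult vn_scale real_sqrt_mult cong: vn_cong)
 thus "sqrt (vn n (mv n (c \<cdot>\<^sub>m x) v)) <= cmod c * C * sqrt (vn n v)"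
  using op_bdd_sqrt[OF assms, of v] by (simp add: mult.assoc mult_left_mono)
qed (use op_bddD[OF assms(1)] in auto)

text \<open>With \<open>?w\<close> the adjoint applied to \<open>v\<close>, the squared norm of
  \<open>?w\<close> is the inner product of \<open>x ?w\<close> with \<open>v\<close>, hence at most
  \<open>C\<close> times the norms of \<open>?w\<close> and \<open>v\<close>; one factor
  cancels.\<close>

lemma op_bdd_adjoint:
 assumes "op_bdd n C x" shows "op_bdd n C (adj x)"
proof (rule op_bddI_sqrt)
 fix v
 note c = op_bddD(1)[OF assms]
 let ?w = "mv n (adj x) v"
 have "cr (vn n ?w) = (\<Sum>i<n. mv n x ?w i * cnj (v i))"
  by (simp add: mv_adjoint[OF c] vn_eq_sum)
 hence "vn n ?w <= cmod (\<Sum>i<n. mv n x ?w i * cnj (v i))"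
  by (metis norm_of_real abs_of_nonneg vn_nonneg order_refl)
 also have "... <= sqrt (vn n (mv n x ?w)) * sqrt (vn n v)" by (rule cs_vn)
 also have "... <= (C * sqrt (vn n ?w)) * sqrt (vn n v)"
  by (intro mult_right_mono op_bdd_sqrt assms) simp
 finally have "sqrt (vn n ?w) * sqrt (vn n ?w) <= sqrt (vn n ?w) * (C * sqrt (vn n v))"
  by (simp add: mult_ac)
 thus "sqrt (vn n ?w) <= C * sqrt (vn n v)"
  using op_bddD(2)[OF assms]
  by (metis mult_le_cancel_left_pos mult_nonneg_nonneg real_sqrt_ge_zero vn_nonneg less_eq_real_def)
qed (use op_bddD[OF assms] in auto)

lemma op_bdd_entry:
 assumes "op_bdd n C x" "i < n" "j < n" shows "cmod (x $$ (i, j)) <= C"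
proof -
 let ?v = "%k. if k = j then 1 else 0 :: complex"
 have m: "mv n x ?v i = x $$ (i, j)" for i
  using assms(3) by (simp add: mv_def if_distrib cong: if_cong)
 have "vn n ?v = 1"
  using assms(3) by (simp add: vn_def if_distrib[of "%x. (cmod x)^2"] cong: if_cong)
 hence "(\<Sum>k<n. (cmod (x $$ (k, j)))^2) <= C^2"
  using op_bddD(3)[OF assms(1), of ?v] by (simp add: m vn_def)
 moreover have "(cmod (x $$ (i, j)))^2 <= (\<Sum>k<n. (cmod (x $$ (k, j)))^2)"
  using assms(2) by (intro member_le_sum) auto
 ultimately have "(cmod (x $$ (i, j)))^2 <= C^2" by linarith
 thus ?thesis using op_bddD(2)[OF assms(1)] by (rule power2_le_imp_le)
qed

lemma bounded_mat_seqs_iff: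
 "x : bounded_mat_seqs n <-> (EX C. ALL k. op_bdd (n k) C (x k))"
proof -
 have *: "Re ((A *\<^sub>v v) \<bullet>c (A *\<^sub>v v)) = vn m (mv m A (%i. v $ i))" "Re (v \<bullet>c v) = vn m (%i. v $ i)"
  if "A : carrier_mat m m" "v : carrier_vec m" for A :: "complex mat" and v m
  using that
  by (auto simp: scalar_prod_def vn_def mv_def atLeast0LessThan row_def Re_mult_cnj simp del: Re_sum cnj_sum
    times_complex.simps intro!: sum.cong trans[OF Re_sum])
 show ?thesis
 proof
  assume L: "x : bounded_mat_seqs n"
  then obtain C where C: "!!k v. v : carrier_vec (n k) ==>
    Re ((x k *\<^sub>v v) \<bullet>c (x k *\<^sub>v v)) <= C * Re (v \<bullet>c v)"
   and c: "!!k. x k : MT (n k)" by (auto simp: bounded_mat_seqs_def)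
  \<comment> \<open>The given constant bounds squares, and it could be negative if all dimensions
    are 0.\<close>
  have "op_bdd (n k) (sqrt (max C 0)) (x k)" for k
   unfolding op_bdd_def
  proof (intro conjI allI)
   fix v
   have "vn (n k) (mv (n k) (x k) v) = vn (n k) (mv (n k) (x k) (($) (vec (n k) v)))"
    by (intro vn_cong mv_cong) auto
   also have "... <= C * vn (n k) (($) (vec (n k) v))"
    using C[of "vec (n k) v" k] *[OF c[of k], of "vec (n k) v"] by simp
   also have "vn (n k) (($) (vec (n k) v)) = vn (n k) v" by (intro vn_cong) auto
   also have "C * vn (n k) v <= max C 0 * vn (n k) v" by (intro mult_right_mono) auto
   finally show "vn (n k) (mv (n k) (x k) v) <= (sqrt (max C 0))^2 * vn (n k) v" by simp
  qed (use c in auto)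
  thus "EX C. ALL k. op_bdd (n k) C (x k)" by blast
 next
  assume "EX C. ALL k. op_bdd (n k) C (x k)"
  then obtain C where C: "!!k. op_bdd (n k) C (x k)" by blast
  thus "x : bounded_mat_seqs n"
   unfolding bounded_mat_seqs_def
   using op_bddD(1)[OF C] op_bddD(3)[OF C] by (auto simp: *[OF op_bddD(1)[OF C]] intro!: exI[of _ "C^2"])
 qed
qed

lemma ntrace_eq: "A : MT n ==> ntrace A = (\<Sum>i<n. A $$ (i, i)) / of_nat n"
 by (auto simp: ntrace_def)

text \<open>This is the normalized Hilbert-Schmidt inner product; through it \<open>nm2\<close>
  becomes an \<open>L2_set\<close> norm over index pairs and inherits the triangle and
  Cauchy-Schwarz inequalities.\<close>

lemma ntrace_adjoint_mult:
 assumes "x : MT n" "y : MT n"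
 shows "ntrace (adj y * x) = (\<Sum>i<n. \<Sum>j<n. x $$ (i, j) * cnj (y $$ (i, j))) / of_nat n"
proof -
 have "ntrace (adj y * x) = (\<Sum>j<n. (adj y * x) $$ (j, j)) / of_nat n"
  using assms by (intro ntrace_eq mult_carrier_mat mat_adjoint_carrier)
 also have "(\<Sum>j<n. (adj y * x) $$ (j, j)) = (\<Sum>j<n. \<Sum>i<n. x $$ (i, j) * cnj (y $$ (i, j)))"
  by (intro sum.cong refl)
   (use assms in \<open>simp add: index_mult_mat_sum[OF mat_adjoint_carrier[OF assms(2)] assms(1)] mult.commute del: index_mult_mat\<close>)
 finally show ?thesis by (subst sum.swap) simp
qed

lemma mat_norm2_L2:
 assumes "x : MT n"
 shows "nm2 x = L2_set (%(i, j). cmod (x $$ (i, j))) ({..<n} \<times> {..<n}) / sqrt n"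
 using assms
 by (simp add: mat_norm2_def ntrace_adjoint_mult L2_set_def sum.cartesian_product real_sqrt_divide
   case_prod_beta flip: complex_norm_square of_real_sum of_real_power)

lemma mat_norm2_sq:
 assumes "x : MT n"
 shows "(nm2 x)^2 = (\<Sum>i<n. \<Sum>j<n. (cmod (x $$ (i, j)))^2) / n"
 using assms
 by (simp add: mat_norm2_L2[OF assms] L2_set_def power_divide sum_nonneg sum.cartesian_product case_prod_beta)

lemma mat_norm2_nonneg: "x : MT n ==> 0 <= nm2 x"
 by (simp add: mat_norm2_L2)

lemma mat_norm2_sq_trace:
 assumes "x : MT n"
 shows "ntrace (adj x * x) = cr ((nm2 x)^2)"
 unfolding mat_norm2_sq[OF assms] ntrace_adjoint_mult[OF assms assms] of_real_divide of_real_sum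
  complex_norm_square by simp

lemma mat_norm2_mono:
 assumes "x : MT n" "y : MT n"
  and "!!i j. i < n ==> j < n ==> cmod (x $$ (i, j)) <= cmod (y $$ (i, j))"
 shows "nm2 x <= nm2 y"
 unfolding mat_norm2_L2[OF assms(1)] mat_norm2_L2[OF assms(2)]
 by (intro divide_right_mono L2_set_mono) (use assms in auto)

lemma mat_norm2_add:
 assumes "x : MT n" "y : MT n"
 shows "nm2 (x + y) <= nm2 x + nm2 y"
proof -
 let ?S = "{..<n} \<times> {..<n}"
 have "L2_set (%(i, j). cmod ((x + y) $$ (i, j))) ?S \<le>
   L2_set (%p. (case p of (i, j) => cmod (x $$ (i, j))) + (case p of (i, j) => cmod (y $$ (i, j)))) ?S"
  using assms by (intro L2_set_mono) (auto intro: norm_triangle_ineq)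
 also have "... <= L2_set (%(i, j). cmod (x $$ (i, j))) ?S + L2_set (%(i, j). cmod (y $$ (i, j))) ?S"
  by (rule L2_set_triangle_ineq)
 finally show ?thesis
  using assms mat_norm2_L2[OF assms(1)] mat_norm2_L2[OF assms(2)] mat_norm2_L2[of "x + y" n]
  by (simp add: divide_right_mono flip: add_divide_distrib)
qed

lemma mat_norm2_smult:
 assumes "x : MT n"
 shows "nm2 (c \<cdot>\<^sub>m x) = cmod c * nm2 x"
proof -
 have "(nm2 (c \<cdot>\<^sub>m x))^2 = (cmod c * nm2 x)^2"
  using assms by (simp add: mat_norm2_sq[of _ n] power_mult_distrib norm_mult sum_distrib_left)
 thus ?thesis
  using assms by (simp add: mat_norm2_nonneg[of _ n])
qed

lemma mat_norm2_minus_commute: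
 assumes "x : MT n" "y : MT n"
 shows "nm2 (x - y) = nm2 (y - x)"
 using assms by (intro antisym mat_norm2_mono[of _ n]) (auto simp: norm_minus_commute minus_carrier_mat)

lemma mat_norm2_triangle:
 assumes "x : MT n" "y : MT n" "z : MT n"
 shows "nm2 (x - z) <= nm2 (x - y) + nm2 (y - z)"
proof -
 have "x - z = (x - y) + (y - z)" using assms by (intro eq_matI) auto
 thus ?thesis using mat_norm2_add[of "x - y" n "y - z"] assms by (simp add: minus_carrier_mat)
qed

lemma mat_norm2_self [simp]: "x : MT n ==> nm2 (x - x) = 0"
 by (auto simp: mat_norm2_L2[of _ n] minus_carrier_mat L2_set_def case_prod_beta intro!: sum.neutral)

lemma mat_norm2_adjoint:
 assumes "x : MT n"
 shows "nm2 (adj x) = nm2 x"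
proof -
 have "(nm2 (adj x))^2 = (nm2 x)^2"
  using assms by (simp add: mat_norm2_sq[of _ n] mat_norm2_sq[OF mat_adjoint_carrier[OF assms]]) (subst sum.swap, simp)
 thus ?thesis
  using mat_norm2_nonneg[OF assms] mat_norm2_nonneg[OF mat_adjoint_carrier[OF assms]] by simp
qed

text \<open>The squared 2-norm is the sum of the squared norms of the columns up to normalization,
  and \<open>x\<close> acts on each column separately.\<close>

lemma mat_norm2_mult_left:
 assumes "op_bdd n C x" "y : MT n"
 shows "nm2 (x * y) <= C * nm2 y"
proof (rule power2_le_imp_le)
 note c = op_bddD(1)[OF assms(1)]
 have "(\<Sum>i<n. \<Sum>j<n. (cmod ((x * y) $$ (i, j)))^2) = (\<Sum>j<n. vn n (mv n x (%i. y $$ (i, j))))"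
  unfolding vn_def mv_def using c assms(2)
  by (subst sum.swap) (simp add: index_mult_mat_sum[of _ n n _ n] del: index_mult_mat)
 also have "... <= (\<Sum>j<n. C^2 * vn n (%i. y $$ (i, j)))"
  by (intro sum_mono op_bddD(3)[OF assms(1)])
 also have "... = C^2 * (\<Sum>i<n. \<Sum>j<n. (cmod (y $$ (i, j)))^2)"
  unfolding vn_def sum_distrib_left[symmetric] by (subst sum.swap) simp
 finally show "(nm2 (x * y))^2 <= (C * nm2 y)^2"
  using c assms(2) mult_carrier_mat[OF c assms(2)]
  by (simp add: mat_norm2_sq[of _ n] power_mult_distrib divide_right_mono del: index_mult_mat)
qed (use op_bddD[OF assms(1)] mat_norm2_nonneg[OF assms(2)] in auto)

lemma mat_norm2_mult_right:
 assumes "op_bdd n C x" "y : MT n"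
 shows "nm2 (y * x) <= C * nm2 y"
proof -
 note c = op_bddD(1)[OF assms(1)]
 have "nm2 (y * x) = nm2 (adj x * adj y)"
  using c assms(2) by (metis mat_adjoint_mult mat_norm2_adjoint mult_carrier_mat)
 also have "... <= C * nm2 (adj y)"
  by (rule mat_norm2_mult_left[OF op_bdd_adjoint[OF assms(1)] mat_adjoint_carrier[OF assms(2)]])
 finally show ?thesis using assms by (simp add: mat_norm2_adjoint)
qed

lemma ntrace_cs:
 assumes "x : MT n" "y : MT n"
 shows "cmod (ntrace (adj y * x)) <= nm2 x * nm2 y"
proof -
 let ?S = "{..<n} \<times> {..<n}"
 have "cmod (\<Sum>i<n. \<Sum>j<n. x $$ (i, j) * cnj (y $$ (i, j))) \<le>
   (\<Sum>p\<in>?S. \<bar>case p of (i, j) => cmod (x $$ (i, j))\<bar> * \<bar>case p of (i, j) => cmod (y $$ (i, j))\<bar>)"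
  unfolding sum.cartesian_product
  by (rule order.trans[OF norm_sum]) (simp add: norm_mult case_prod_beta)
 also have "... <= L2_set (%(i, j). cmod (x $$ (i, j))) ?S * L2_set (%(i, j). cmod (y $$ (i, j))) ?S"
  by (rule L2_set_mult_ineq)
 finally have "cmod (\<Sum>i<n. \<Sum>j<n. x $$ (i, j) * cnj (y $$ (i, j))) / real n \<le>
   L2_set (%(i, j). cmod (x $$ (i, j))) ?S * L2_set (%(i, j). cmod (y $$ (i, j))) ?S / real n"
  by (rule divide_right_mono) simp
 thus ?thesis
  unfolding ntrace_adjoint_mult[OF assms] mat_norm2_L2[OF assms(1)] mat_norm2_L2[OF assms(2)]
  by (simp add: norm_divide)
qed

lemma ntrace_add:
 assumes "x : MT n" "y : MT n"
 shows "ntrace (x + y) = ntrace x + ntrace y"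
 using assms unfolding ntrace_eq[OF assms(1)] ntrace_eq[OF assms(2)] ntrace_eq[OF add_carrier_mat[OF assms(2)]]
 by (simp add: sum.distrib add_divide_distrib)

lemma ntrace_smult: "x : MT n ==> ntrace (c \<cdot>\<^sub>m x) = c * ntrace x"
 by (simp add: ntrace_eq[of _ n] sum_distrib_left)

lemma mat_norm2_one: "0 < n ==> nm2 (1\<^sub>m n) = 1"
 unfolding mat_norm2_def mat_adjoint_one by (simp add: ntrace_eq[of _ n])

lemma ntrace_le_norm:
 assumes "x : MT n" "0 < n"
 shows "cmod (ntrace x) <= nm2 x"
 using ntrace_cs[OF assms(1) one_carrier_mat] assms(1) mat_norm2_one[OF assms(2)]
 by (simp add: mat_adjoint_one left_mult_one_mat[OF assms(1)])

section \<open>Bernstein truncation\<close>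

definition qf :: "nat => complex mat => (nat => complex) => complex" where
 "qf n A v = (\<Sum>i<n. mv n A v i * cnj (v i))"

text \<open>Positivity is expressed by the quadratic form alone; it is applied to polynomials in a
  self-adjoint matrix.\<close>

definition psd :: "nat => complex mat => bool" where
 "psd n A <-> (ALL v. 0 <= Re (qf n A v))"

text \<open>Polynomial functional calculus by Horner's scheme. Real coefficients keep the values
  self-adjoint when \<open>h\<close> is.\<close>

definition ev :: "nat => complex mat => real poly => complex mat" where
 "ev n h p = fold_coeffs (%c A. cr c \<cdot>\<^sub>m 1\<^sub>m n + h * A) p (0\<^sub>m n n)"

lemma ev_0 [simp]: "ev n h 0 = 0\<^sub>m n n"
 by (simp add: ev_def)

lemma ev_pCons:
 assumes "h : MT n"
 shows "ev n h (pCons c p) = cr c \<cdot>\<^sub>m 1\<^sub>m n + h * ev n h p"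
proof (cases "c = 0 & p = 0")
 case True
 have "0 \<cdot>\<^sub>m 1\<^sub>m n + h * 0\<^sub>m n n = (0\<^sub>m n n :: complex mat)"
  using assms by (intro eq_matI) auto
 thus ?thesis using True by simp
next
 case False
 thus ?thesis by (auto simp: ev_def)
qed

lemma ev_carrier [intro]:
 assumes "h : MT n" shows "ev n h p : MT n"
 by (induction p) (use assms in \<open>auto simp: ev_pCons\<close>)

context
 fixes n :: nat and h :: "complex mat"
 assumes h: "h : MT n"
begin

lemma ev_add: "ev n h (p + q) = ev n h p + ev n h q"
proof (induction p arbitrary: q)
 case 0
 thus ?case using h by (simp add: left_add_zero_mat[OF ev_carrier[OF h]])
next
 case (pCons a p)
 obtain b q' where q: "q = pCons b q'" by (cases q)
 have "ev n h p : MT n" "ev n h q' : MT n" using h by auto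
 moreover have "h * (ev n h p + ev n h q') = h * ev n h p + h * ev n h q'"
  using h by (intro mult_add_distrib_mat) auto
 moreover have "h * ev n h p : MT n" "h * ev n h q' : MT n"
  using h by (auto intro!: mult_carrier_mat)
 ultimately show ?case using h
  unfolding q add_pCons ev_pCons[OF h] pCons.IH
  by (intro eq_matI) (auto simp: algebra_simps)
qed

lemma ev_smult: "ev n h (Polynomial.smult c p) = cr c \<cdot>\<^sub>m ev n h p"
proof (induction p)
 case 0
 thus ?case by (intro eq_matI) auto
next
 case (pCons a p)
 have "h * (cr c \<cdot>\<^sub>m ev n h p) = cr c \<cdot>\<^sub>m (h * ev n h p)"
  using h by (intro mult_smult_distrib) auto
 moreover have "h * ev n h p : MT n"
  using h by (auto intro!: mult_carrier_mat)
 ultimately show ?case using h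
  unfolding smult_pCons ev_pCons[OF h] pCons.IH
  by (intro eq_matI) (auto simp: algebra_simps)
qed

lemma ev_mult: "ev n h (p * q) = ev n h p * ev n h q"
proof (induction p)
 case 0
 thus ?case using h by (simp add: left_mult_zero_mat[OF ev_carrier[OF h]])
next
 case (pCons a p)
 have c: "ev n h p : MT n" "ev n h q : MT n" using h by auto
 have "ev n h (pCons a p * q) = cr a \<cdot>\<^sub>m ev n h q + (0 \<cdot>\<^sub>m 1\<^sub>m n + h * (ev n h p * ev n h q))"
  by (simp add: mult_pCons_left ev_add ev_smult ev_pCons[OF h] pCons.IH)
 also have "0 \<cdot>\<^sub>m 1\<^sub>m n + h * (ev n h p * ev n h q) = h * (ev n h p * ev n h q)"
  using h c by (intro eq_matI) auto
 also have "h * (ev n h p * ev n h q) = (h * ev n h p) * ev n h q"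
  using h c by (simp add: assoc_mult_mat[of _ n n _ n _ n])
 also have "cr a \<cdot>\<^sub>m ev n h q = (cr a \<cdot>\<^sub>m 1\<^sub>m n) * ev n h q"
  using c by (simp add: mult_smult_assoc_mat[of _ n n _ n])
 also have "... + h * ev n h p * ev n h q = ev n h (pCons a p) * ev n h q"
  using h c by (simp add: ev_pCons[OF h] add_mult_distrib_mat[of _ n n _ _ n])
 finally show ?case .
qed

lemma ev_one: "ev n h 1 = 1\<^sub>m n"
 unfolding one_pCons ev_pCons[OF h] using h by (intro eq_matI) auto

lemma ev_X: "ev n h [:0, 1:] = h"
proof -
 have "ev n h [:0, 1:] = cr 0 \<cdot>\<^sub>m 1\<^sub>m n + h * ev n h 1" by (simp add: ev_pCons[OF h] one_pCons)
 thus ?thesis unfolding ev_one using h by (auto intro!: eq_matI)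
qed

lemma ev_const: "ev n h [:c:] = cr c \<cdot>\<^sub>m 1\<^sub>m n"
 using ev_smult[of c 1] ev_one by simp

lemma mv_ev_add: "i < n ==> mv n (ev n h (p + q)) v i = mv n (ev n h p) v i + mv n (ev n h q) v i"
 by (simp add: ev_add mv_add[OF ev_carrier[OF h] ev_carrier[OF h]])

lemma qf_ev_add: "qf n (ev n h (p + q)) v = qf n (ev n h p) v + qf n (ev n h q) v"
 by (simp add: qf_def mv_ev_add distrib_right sum.distrib)

lemma qf_ev_smult: "qf n (ev n h (Polynomial.smult c p)) v = cr c * qf n (ev n h p) v"
 by (simp add: qf_def ev_smult mv_smult[OF ev_carrier[OF h]] sum_distrib_left mult.assoc)

lemma qf_ev_diff: "qf n (ev n h (p - q)) v = qf n (ev n h p) v - qf n (ev n h q) v"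
 using qf_ev_add[of p "Polynomial.smult (-1) q" v] qf_ev_smult[of "-1" q v] by simp

lemma qf_ev_one: "qf n (ev n h 1) v = cr (vn n v)"
 by (simp add: qf_def ev_one mv_one vn_eq_sum)

lemma qf_ev_const: "qf n (ev n h [:c:]) v = cr (c * vn n v)"
 using qf_ev_smult[of c 1 v] by (simp add: qf_ev_one)

lemma ev_adjoint:
 assumes "adj h = h"
 shows "adj (ev n h p) = ev n h p"
proof (induction p)
 case 0
 thus ?case by (intro eq_matI) auto
next
 case (pCons a p)
 have "ev n h p * h = h * ev n h p"
  using ev_mult[of p "[:0, 1:]"] ev_mult[of "[:0, 1:]" p] by (simp add: ev_X mult.commute)
 moreover have c: "ev n h p : MT n" using h by auto
 moreover have "cr a \<cdot>\<^sub>m 1\<^sub>m n : MT n" by auto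
 ultimately show ?case
  using pCons.IH assms
  unfolding ev_pCons[OF h]
  by (subst mat_adjoint_add[OF _ mult_carrier_mat[OF h c]])
   (simp_all add: mat_adjoint_mult[OF h c] mat_adjoint_smult mat_adjoint_one)
qed

text \<open>\<open>ev n h r\<close> is self-adjoint and moves to the other side of the inner
  product; thus positivity of the form of \<open>m\<close> passes to
  \<open>r * m * r\<close>.\<close>

lemma qf_ev_conj:
 assumes "adj h = h"
 shows "qf n (ev n h (r * m * r)) v = qf n (ev n h m) (mv n (ev n h r) v)"
proof -
 let ?r = "ev n h r" and ?m = "ev n h m"
 have c: "?r : MT n" "?m : MT n" using h by auto
 have "qf n (ev n h (r * m * r)) v = (\<Sum>i<n. mv n (?r * (?m * ?r)) v i * cnj (v i))"
  using c by (simp add: qf_def ev_mult mult.assoc assoc_mult_mat[of _ n n _ n _ n])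
 also have "... = (\<Sum>i<n. mv n ?r (mv n (?m * ?r) v) i * cnj (v i))"
  using c by (intro sum.cong refl) (simp add: mv_mult[OF c(1) mult_carrier_mat[OF c(2,1)]])
 also have "... = (\<Sum>i<n. mv n (?m * ?r) v i * cnj (mv n ?r v i))"
  using mv_adjoint[OF c(1), of "mv n (?m * ?r) v" v] ev_adjoint[OF assms, of r] by simp
 also have "... = qf n ?m (mv n ?r v)"
  using c by (simp add: qf_def mv_mult)
 finally show ?thesis .
qed

end

section \<open>Certificates of positivity on the unit interval\<close>

definition bern_X :: "real poly" where "bern_X = [:0, 1:]"
definition bern_Y :: "real poly" where "bern_Y = [:1, -1:]"

lemma bern_XY: "bern_X + bern_Y = 1"
 by (simp add: bern_X_def bern_Y_def one_pCons)

text \<open>Membership is an algebraic certificate of nonnegativity on the unit interval, and it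
  survives the substitution of a positive contraction for the variable.\<close>

inductive_set bern_cone :: "real poly set" where
 zero: "0 : bern_cone"
| step: "p : bern_cone ==> 0 <= c ==> Polynomial.smult c (bern_X ^ i * bern_Y ^ j) + p : bern_cone"

lemma bern_cone_add: "p : bern_cone ==> q : bern_cone ==> p + q : bern_cone"
 by (induction p rule: bern_cone.induct) (auto simp: add.assoc intro: bern_cone.intros)

lemma bern_cone_monom: "0 <= c ==> Polynomial.smult c (bern_X ^ i * bern_Y ^ j) : bern_cone"
 using bern_cone.step[OF bern_cone.zero] by simp

lemma bern_cone_smult: "p : bern_cone ==> 0 <= c ==> Polynomial.smult c p : bern_cone"
 by (induction p rule: bern_cone.induct)
  (auto simp: smult_add_right intro!: bern_cone.intros bern_cone.zero simp del: smult_smult simp add: smult_smult)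

lemma bern_cone_mult: assumes "p : bern_cone" "q : bern_cone" shows "p * q : bern_cone"
 using assms
proof (induction p rule: bern_cone.induct)
 case (step p c i j)
 have "Polynomial.smult c (bern_X ^ i * bern_Y ^ j) * q : bern_cone"
  using step.prems
 proof (induction q rule: bern_cone.induct)
  case (step q d k l)
  have "Polynomial.smult c (bern_X ^ i * bern_Y ^ j) * Polynomial.smult d (bern_X ^ k * bern_Y ^ l) =
    Polynomial.smult (c * d) (bern_X ^ (i + k) * bern_Y ^ (j + l))"
   by (simp add: power_add mult_ac)
  thus ?case
   using step \<open>0 <= c\<close> by (auto simp: distrib_left intro!: bern_cone.step)
 qed (auto intro: bern_cone.zero)
 thus ?case using step by (simp add: distrib_right bern_cone_add)
qed (auto intro: bern_cone.zero)

lemma bern_cone_sum: "(!!i. i : I ==> f i : bern_cone) ==> sum f I : bern_cone"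
 by (induction I rule: infinite_finite_induct) (auto intro: bern_cone.zero bern_cone_add)

lemma bern_cone_X: "bern_X : bern_cone"
 using bern_cone_monom[of 1 1 0] by simp

text \<open>The even parts of the exponents form a square \<open>r * r\<close>, which
  \<open>qf_ev_conj\<close> splits off; what remains is 1, X, Y or XY. Here X becomes the adjoint of
  \<open>w\<close> times \<open>w\<close>, Y is positive because \<open>w\<close> is a contraction,
  and XY = XYX + YXY because X + Y = 1.\<close>

lemma psd_bern_cone:
 assumes w: "op_bdd n 1 w" and p: "p : bern_cone"
 shows "psd n (ev n (adj w * w) p)"
proof -
 let ?h = "adj w * w"
 have wc: "w : MT n" using op_bddD(1)[OF w] .
 have h: "?h : MT n" using wc by auto
 have adj: "mat_adjoint ?h = ?h" using wc by (simp add: mat_adjoint_mult[of _ n] mat_adjoint_adjoint)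
 have qX: "qf n (ev n ?h bern_X) v = cr (vn n (mv n w v))" for v
 proof -
  have "qf n ?h v = (\<Sum>i<n. mv n (adj w) (mv n w v) i * cnj (v i))"
   using wc by (simp add: qf_def mv_mult[OF mat_adjoint_carrier[OF wc] wc])
  also have "... = cr (vn n (mv n w v))"
   using mv_adjoint[OF mat_adjoint_carrier[OF wc], of "mv n w v" v]
   by (simp add: mat_adjoint_adjoint vn_eq_sum)
  finally show ?thesis by (simp add: bern_X_def ev_X[OF h])
 qed
 have qY: "qf n (ev n ?h bern_Y) v = cr (vn n v - vn n (mv n w v))" for v
 proof -
  have Y: "bern_Y = 1 - bern_X" using bern_XY by (simp add: algebra_simps)
  show ?thesis unfolding Y by (simp only: qf_ev_diff[OF h] qf_ev_one[OF h] qX of_real_diff)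
 qed
 have base: "psd n (ev n ?h (r * m * r))" if "!!v. 0 <= Re (qf n (ev n ?h m) v)" for r m
  using that by (simp add: psd_def qf_ev_conj[OF h adj])
 have X: "0 <= Re (qf n (ev n ?h bern_X) v)" for v by (simp add: qX)
 have Y: "0 <= Re (qf n (ev n ?h bern_Y) v)" for v using op_bddD(3)[OF w, of v] by (simp add: qY)
 have one: "0 <= Re (qf n (ev n ?h 1) v)" for v by (simp add: qf_ev_one[OF h])
 have XY: "0 <= Re (qf n (ev n ?h (bern_X * bern_Y)) v)" for v
 proof -
  have "bern_X * bern_Y = (bern_X + bern_Y) * (bern_X * bern_Y)" by (simp add: bern_XY)
  hence XYe: "bern_X * bern_Y = bern_X * bern_Y * bern_X + bern_Y * bern_X * bern_Y"
   by (simp add: algebra_simps)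
  show ?thesis
   using arg_cong[OF XYe, of "%p. qf n (ev n ?h p) v"] base[OF X, of bern_Y] base[OF Y, of bern_X]
   by (simp only: psd_def qf_ev_add[OF h]) (metis add_nonneg_nonneg plus_complex.simps(1))
 qed
 have mon: "psd n (ev n ?h (bern_X ^ i * bern_Y ^ j))" for i j
 proof -
  define r where "r = bern_X ^ (i div 2) * bern_Y ^ (j div 2)"
  have split: "p ^ i = p ^ (i mod 2) * p ^ (i div 2) * p ^ (i div 2)" for p :: "real poly" and i :: nat
  proof -
   have "p ^ (i mod 2 + i div 2 + i div 2) = p ^ (i mod 2) * p ^ (i div 2) * p ^ (i div 2)"
    by (simp only: power_add)
   moreover have "i mod 2 + i div 2 + i div 2 = i" by presburger
   ultimately show ?thesis by simp
  qed
  have "bern_X ^ i * bern_Y ^ j = r * (bern_X ^ (i mod 2) * bern_Y ^ (j mod 2)) * r"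
   unfolding r_def by (subst split[of bern_X i], subst split[of bern_Y j]) (simp only: mult_ac)
  moreover have "0 <= Re (qf n (ev n ?h (bern_X ^ (i mod 2) * bern_Y ^ (j mod 2))) v)" for v
   using X Y XY one by (cases "even i"; cases "even j") (auto simp: even_iff_mod_2_eq_zero odd_iff_mod_2_eq_one)
  ultimately show ?thesis using base by simp
 qed
 show ?thesis using p
 proof (induction p rule: bern_cone.induct)
  case zero
  thus ?case by (simp add: psd_def qf_def mv_def)
 next
  case (step p c i j)
  thus ?case using mon[of i j] by (simp add: psd_def qf_ev_add[OF h] qf_ev_smult[OF h])
 qed
qed

text \<open>The Bernstein basis. Combinations of the \<open>bern N k\<close> with coefficients
  f(k/N) approximate f, and an inequality between coefficients yields a certificate for the
  polynomials.\<close>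

definition bern :: "nat => nat => real poly" where
 "bern N k = Polynomial.smult (real (N choose k)) (bern_X ^ k * bern_Y ^ (N - k))"

lemma sum_bern: "(\<Sum>k\<le>N. bern N k) = 1"
 using binomial_ring[of bern_X bern_Y N]
 by (simp add: bern_XY bern_def mult.assoc of_nat_poly)

lemma bern_in: "0 <= c ==> Polynomial.smult c (bern N k) : bern_cone"
 by (simp add: bern_def bern_cone_monom)

text \<open>Multiplication by x or 1 - x leads to the Bernstein basis of the next degree, with the
  value of that factor at the new node. This is what makes the products below comparable coefficient
  by coefficient.\<close>

lemma X_bern: "k <= N ==> bern_X * bern N k = Polynomial.smult (real (Suc k) / real (Suc N)) (bern (Suc N) (Suc k))"
proof -
 have "real (Suc k) * real (Suc N choose Suc k) = real (Suc N) * real (N choose k)"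
  using Suc_times_binomial_eq[of N k] by (metis of_nat_mult mult.commute)
 hence "real (N choose k) = real (Suc k) / real (Suc N) * real (Suc N choose Suc k)"
  by (simp add: field_simps del: binomial_Suc_Suc)
 thus ?thesis by (simp add: bern_def mult_ac del: binomial_Suc_Suc of_nat_Suc)
qed

lemma Y_bern: "k <= N ==> bern_Y * bern N k = Polynomial.smult (real (Suc N - k) / real (Suc N)) (bern (Suc N) k)"
proof -
 assume k: "k <= N"
 have "(Suc N - k) * (Suc N choose k) = Suc N * (N choose k)"
  using binomial_absorb_comp[of "Suc N" k] by simp
 hence "real (Suc N - k) * real (Suc N choose k) = real (Suc N) * real (N choose k)"
  by (metis of_nat_mult)
 hence "real (N choose k) = real (Suc N - k) / real (Suc N) * real (Suc N choose k)"
  by (simp add: field_simps)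
 moreover have "bern_Y ^ (Suc N - k) = bern_Y * bern_Y ^ (N - k)" using k by (simp add: Suc_diff_le)
 ultimately show ?thesis by (simp add: bern_def mult_ac del: of_nat_Suc)
qed

text \<open>\<open>q\<close> is a Bernstein polynomial of the function that is 0 up to
  \<open>c\<close>, 1 from \<open>2 * c\<close> on and linear between. For this function itself x (1
  - q) is at most \<open>2 * c\<close> and (x - c) q is nonnegative; the slack of \<open>c\<close>
  and \<open>et\<close> absorbs errors of size 1/N.\<close>

lemma bernstein_truncation:
 fixes c et :: real
 assumes "0 < c" "0 < et"
 obtains q where "q : bern_cone" "1 - q : bern_cone" "[:3 * c:] - bern_X * (1 - q) : bern_cone"
  "[:et:] + (bern_X - [:c:]) * q : bern_cone"
proof -
 obtain N :: nat where N: "1 / min c et < real N" using reals_Archimedean2 by blast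
 have N0: "0 < N" using N assms by (cases N) (auto simp: divide_less_0_iff)
 have N1: "1 / real N < c" "1 / real N < et"
 proof -
  have "0 < min c et" using assms by simp
  hence "1 / real N < min c et" using N N0 by (simp add: divide_simps mult.commute split: if_splits del: min_less_iff_conj)
  thus "1 / real N < c" "1 / real N < et" by auto
 qed
 define g where "g t = max 0 (min 1 ((t - c) / c))" for t :: real
 define G where "G k = g (real k / real N)" for k
 have G01: "0 <= G k" "G k <= 1" for k by (auto simp: G_def g_def)
 have G0: "G 0 = 0" using assms by (simp add: G_def g_def)
 have Gpos: "c < real k / real N" if "0 < G k" for k
  using that assms by (auto simp: G_def g_def max_def min_def field_simps split: if_splits)
 have Gone: "G k = 1" if "2 * c <= real k / real N" for k
  using that assms by (simp add: G_def g_def field_simps)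
 \<comment> \<open>\<open>c * g\<close> is a ramp of slope at most 1, so a step of 1/N in the node
   raises it by at most 1/N.\<close>
 have GL: "c * G (Suc k) <= c * G k + 1 / real N" for k
 proof -
  have *: "c * g t = max 0 (min c (t - c))" for t
   using assms by (auto simp: g_def max_def min_def field_simps)
  have eq: "real (Suc k) / real N = real k / real N + 1 / real N" by (simp add: add_divide_distrib)
  have M: "max 0 (min c (t + d - c)) <= max 0 (min c (t - c)) + d" if "0 <= d" for t d :: real
   using that by linarith
  have "c * G (Suc k) = max 0 (min c (real k / real N + 1 / real N - c))" unfolding G_def * eq ..
  moreover have "c * G k = max 0 (min c (real k / real N - c))" unfolding G_def * ..
  ultimately show ?thesis using M[of "1 / real N" "real k / real N"] by (simp only:) simp
 qed
 \<comment> \<open>The node of index \<open>k + 1\<close> in degree \<open>N + 1\<close>; for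
   \<open>k\<close> up to \<open>N\<close> it lies between k/N and (k + 1)/N.\<close>
 define r where "r k = real (Suc k) / real (Suc N)" for k
 have r01: "0 <= r k" "k <= N ==> r k <= 1" for k by (auto simp: r_def)
 have r_ge: "real k / real N <= r k" if "k <= N" for k
  using that N0 by (simp add: r_def field_simps)
 have r_le: "r k <= real k / real N + 1 / real N" for k
  using N0 by (simp add: r_def field_simps)
 define B where "B k = bern (Suc N) (Suc k)" for k
 have one: "1 = bern (Suc N) 0 + (\<Sum>k\<le>N. B k)"
  unfolding sum_bern[of "Suc N", symmetric] B_def by (rule sum.atMost_Suc_shift)
 have const: "[:d:] = Polynomial.smult d (bern (Suc N) 0) + (\<Sum>k\<le>N. Polynomial.smult d (B k))" for d
 proof -
  have "[:d:] = Polynomial.smult d 1" by simp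
  also have "... = Polynomial.smult d (bern (Suc N) 0) + (\<Sum>k\<le>N. Polynomial.smult d (B k))"
   by (subst one) (simp add: smult_add_right smult_sum2)
  finally show ?thesis .
 qed
 define q where "q = (\<Sum>k\<le>N. Polynomial.smult (G k) (bern N k))"
 have q1: "1 - q = (\<Sum>k\<le>N. Polynomial.smult (1 - G k) (bern N k))"
  unfolding q_def by (simp add: smult_diff_left sum_subtractf sum_bern)
 have Xq: "bern_X * q = (\<Sum>k\<le>N. Polynomial.smult (G k * r k) (B k))"
  unfolding q_def B_def r_def by (simp add: sum_distrib_left X_bern del: of_nat_Suc)
 have Xq1: "bern_X * (1 - q) = (\<Sum>k\<le>N. Polynomial.smult ((1 - G k) * r k) (B k))"
  unfolding q1 B_def r_def by (simp add: sum_distrib_left X_bern del: of_nat_Suc)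
 have Yq: "bern_Y * q = (\<Sum>k\<le>N. Polynomial.smult (G (Suc k) * (1 - r k)) (B k))"
 proof -
  have "bern_Y * q = (\<Sum>k\<le>N. Polynomial.smult (G k * (real (Suc N - k) / real (Suc N))) (bern (Suc N) k))"
   unfolding q_def by (simp add: sum_distrib_left Y_bern del: of_nat_Suc)
  \<comment> \<open>The added term carries the factor \<open>Suc N - Suc N\<close>, and after the
    shift of the index the first term vanishes because \<open>G 0 = 0\<close>; the sum is then in
    terms of the \<open>B k\<close>.\<close>
  also have "... = (\<Sum>k\<le>Suc N. Polynomial.smult (G k * (real (Suc N - k) / real (Suc N))) (bern (Suc N) k))"
   by simp
  also have "... = (\<Sum>k\<le>N. Polynomial.smult (G (Suc k) * (real (Suc N - Suc k) / real (Suc N))) (B k))"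
   unfolding B_def by (subst sum.atMost_Suc_shift) (simp add: G0 del: sum.atMost_Suc)
  also have "... = (\<Sum>k\<le>N. Polynomial.smult (G (Suc k) * (1 - r k)) (B k))"
   by (intro sum.cong refl) (auto simp: r_def field_simps of_nat_diff)
  finally show ?thesis .
 qed
 have Bin: "0 <= d ==> Polynomial.smult d (B k) : bern_cone" for d k by (simp add: B_def bern_in)
 show ?thesis
 proof
  show "q : bern_cone" unfolding q_def by (intro bern_cone_sum bern_in G01)
  show "1 - q : bern_cone" unfolding q1 by (intro bern_cone_sum bern_in) (simp add: G01)
  have "[:3 * c:] - bern_X * (1 - q) = Polynomial.smult (3 * c) (bern (Suc N) 0) +
    (\<Sum>k\<le>N. Polynomial.smult (3 * c - (1 - G k) * r k) (B k))"
   unfolding const[of "3 * c"] Xq1 by (simp add: smult_diff_left sum_subtractf)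
  moreover have "0 <= 3 * c - (1 - G k) * r k" for k
  \<comment> \<open>From \<open>2 * c\<close> on the factor \<open>1 - G k\<close> is 0; below,
    \<open>r k\<close> is less than \<open>2 * c + 1 / N\<close>, hence less than
    \<open>3 * c\<close>.\<close>
  proof (cases "2 * c <= real k / real N")
   case True
   thus ?thesis using Gone[OF True] assms by simp
  next
   case False
   have "(1 - G k) * r k <= 1 * r k" by (intro mult_right_mono) (auto simp: G01 r01)
   thus ?thesis using r_le[of k] N1 False by linarith
  qed
  ultimately show "[:3 * c:] - bern_X * (1 - q) : bern_cone"
   using assms by (auto intro!: bern_cone_add bern_cone_sum Bin bern_in)
  \<comment> \<open>Homogenization: the factor X + Y = 1 raises the term \<open>c * q\<close> to
    degree \<open>N + 1\<close>, the degree of \<open>bern_X * q\<close>.\<close>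
  have "q = (bern_X + bern_Y) * q" by (simp add: bern_XY)
  hence "(bern_X - [:c:]) * q = bern_X * q - Polynomial.smult c (bern_X * q + bern_Y * q)"
   by (simp add: left_diff_distrib distrib_right)
  moreover have "(\<Sum>k\<le>N. Polynomial.smult et (B k)) + ((\<Sum>k\<le>N. Polynomial.smult (G k * r k) (B k)) -
     Polynomial.smult c ((\<Sum>k\<le>N. Polynomial.smult (G k * r k) (B k)) +
      (\<Sum>k\<le>N. Polynomial.smult (G (Suc k) * (1 - r k)) (B k)))) =
    (\<Sum>k\<le>N. Polynomial.smult (et + (G k * r k - c * (G k * r k + G (Suc k) * (1 - r k)))) (B k))"
   unfolding sum.distrib[symmetric] smult_sum2 sum_subtractf[symmetric]
   by (intro sum.cong refl) (simp only: smult_add_left smult_diff_left smult_add_right smult_smult distrib_left)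
  ultimately have "[:et:] + (bern_X - [:c:]) * q = Polynomial.smult et (bern (Suc N) 0) +
    (\<Sum>k\<le>N. Polynomial.smult (et + (G k * r k - c * (G k * r k + G (Suc k) * (1 - r k)))) (B k))"
   unfolding const[of et] Xq Yq by (simp only: add.assoc)
  moreover have "0 <= et + (G k * r k - c * (G k * r k + G (Suc k) * (1 - r k)))" if k: "k <= N" for k
  proof -
   have "c * G (Suc k) * (1 - r k) <= (c * G k + 1 / real N) * (1 - r k)"
    by (intro mult_right_mono GL) (simp add: r01 k)
   also have "... = c * G k * (1 - r k) + (1 / real N) * (1 - r k)" by (simp add: algebra_simps)
   also have "(1 / real N) * (1 - r k) <= (1 / real N) * 1" by (intro mult_left_mono) (simp_all add: r01)
   finally have 1: "c * G (Suc k) * (1 - r k) <= c * G k * (1 - r k) + 1 / real N" by simp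
   \<comment> \<open>The coefficient \<open>G k\<close> is positive only where the node lies beyond
     \<open>c\<close>.\<close>
   have 2: "c * G k <= G k * r k"
   proof (cases "G k = 0")
    case False
    hence "c < r k" using Gpos[of k] G01[of k] r_ge[OF k] by linarith
    thus ?thesis using mult_left_mono[of c "r k" "G k"] G01[of k] by (simp add: mult.commute)
   qed simp
   have "c * (G k * r k + G (Suc k) * (1 - r k)) <= c * G k + 1 / real N"
    using 1 by (simp add: algebra_simps)
   thus ?thesis using 2 N1 by linarith
  qed
  ultimately show "[:et:] + (bern_X - [:c:]) * q : bern_cone"
   using assms by (auto intro!: bern_cone_add bern_cone_sum Bin bern_in)
 qed
qed

text \<open>The diagonal entries are the values of the quadratic form at the basis vectors.\<close>

lemma psd_ntrace:
 assumes "psd n A" "A : MT n"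
 shows "0 <= Re (ntrace A)"
proof -
 have "qf n A (%k. if k = i then 1 else 0) = A $$ (i, i)" if "i < n" for i
 proof -
  have "mv n A (%k. if k = i then 1 else 0) j = A $$ (j, i)" for j
   using that by (simp add: mv_def if_distrib cong: if_cong)
  thus ?thesis using that by (simp add: qf_def if_distrib cong: if_cong)
 qed
 hence "0 <= Re (A $$ (i, i))" if "i < n" for i
  using assms(1) that unfolding psd_def by metis
 thus ?thesis by (auto simp: ntrace_eq[OF assms(2)] intro!: divide_nonneg_nonneg sum_nonneg)
qed

text \<open>\<open>z\<close> is a smoothed spectral projection for the singular values of
  \<open>y\<close> above about \<open>2 * C\<close>; after division by \<open>K\<close> the
  threshold for their squares is \<open>c = 4 * C^2 / K^2\<close>. Then \<open>y * (1 - z)\<close>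
  has squared norm at most 3 c K^2 = 12 C^2, which is below (4 C)^2, and \<open>y\<close> expands
  \<open>z\<close> by almost \<open>2 * C\<close>. The polynomial \<open>q\<close> is fixed before
  \<open>n\<close> and \<open>y\<close>, so one formal expression can serve all dimensions.\<close>

lemma matrix_truncation:
 fixes K C de :: real
 assumes "0 < K" "0 < C" "0 < de"
 obtains q where "!!n y w z. op_bdd n K y ==> w = cr (1 / K) \<cdot>\<^sub>m y ==>
   z = ev n (adj w * w) q ==>
   op_bdd n 1 z & op_bdd n (4 * C) (y * (1\<^sub>m n - z)) \<and>
   4 * C^2 * (nm2 z)^2 <= (nm2 (y * z))^2 + de^2"
proof -
 define c where "c = 4 * C^2 / K^2"
 define et where "et = de^2 / K^2"
 have c0: "0 < c" "0 < et" using assms by (auto simp: c_def et_def)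
 obtain q where q: "q : bern_cone" "1 - q : bern_cone" "[:3 * c:] - bern_X * (1 - q) : bern_cone"
  "[:et:] + (bern_X - [:c:]) * q : bern_cone"
  using bernstein_truncation[OF c0] .
 have "op_bdd n 1 z & op_bdd n (4 * C) (y * (1\<^sub>m n - z)) \<and>
   4 * C^2 * (nm2 z)^2 <= (nm2 (y * z))^2 + de^2"
  if y: "op_bdd n K y" and w: "w = cr (1 / K) \<cdot>\<^sub>m y"
   and z: "z = ev n (adj w * w) q" for n y w z
 proof -
  let ?h = "adj w * w"
  have yc: "y : MT n" using op_bddD(1)[OF y] .
  have wc: "w : MT n" using yc w by auto
  have h: "?h : MT n" using wc by auto
  have adj: "mat_adjoint ?h = ?h" using wc by (simp add: mat_adjoint_mult[of _ n] mat_adjoint_adjoint)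
  have wb: "op_bdd n 1 w" using op_bdd_smult[OF y, of "cr (1 / K)"] assms w by (simp add: norm_divide)
  note P = psd_bern_cone[OF wb]
  have zc: "z : MT n" unfolding z using h by auto
  have mvw: "mv n w v i = cr (1 / K) * mv n y v i" if "i < n" for v i
   using that unfolding w by (simp add: mv_smult[OF yc])
  have vny: "vn n (mv n y v) = K^2 * vn n (mv n w v)" for v
  proof -
   have "vn n (mv n w v) = (1 / K)^2 * vn n (mv n y v)"
    using vn_scale[of n "cr (1 / K)" "mv n y v"] assms
    by (simp add: mvw norm_divide cong: vn_cong)
   thus ?thesis using assms by (simp add: field_simps)
  qed
  have qfX: "cr (vn n (mv n w v)) = qf n (ev n ?h bern_X) v" for v
  proof -
   have "qf n ?h v = (\<Sum>i<n. mv n (adj w) (mv n w v) i * cnj (v i))"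
    using wc by (simp add: qf_def mv_mult[OF mat_adjoint_carrier[OF wc] wc])
   also have "... = cr (vn n (mv n w v))"
    using mv_adjoint[OF mat_adjoint_carrier[OF wc], of "mv n w v" v]
    by (simp add: mat_adjoint_adjoint vn_eq_sum)
   finally show ?thesis by (simp add: bern_X_def ev_X[OF h])
  qed
  have qf1: "cr (vn n (mv n (ev n ?h r) v)) = qf n (ev n ?h (r * r)) v" for r v
   using qf_ev_conj[OF h adj, of r 1 v] by (simp add: qf_ev_one[OF h])
  have z1: "op_bdd n 1 z"
   unfolding op_bdd_def
  proof (intro conjI allI zc)
   fix v
   have "1 - q * q = (1 - q) + q * (1 - q)" by (simp add: algebra_simps)
   moreover have "... : bern_cone" using q by (intro bern_cone_add bern_cone_mult)
   ultimately have "1 - q * q : bern_cone" by (simp only:)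
   hence "0 <= Re (qf n (ev n ?h (1 - q * q)) v)" using P unfolding psd_def by blast
   thus "vn n (mv n z v) <= 1^2 * vn n v"
    unfolding z by (simp add: qf_ev_diff[OF h] qf_ev_one[OF h] flip: qf1)
  qed simp
  have z': "1\<^sub>m n - z = ev n ?h (1 - q)"
  proof -
   have "ev n ?h (1 + Polynomial.smult (-1) q) = 1\<^sub>m n + (-1) \<cdot>\<^sub>m z"
    unfolding ev_add[OF h] ev_smult[OF h] ev_one[OF h] z by simp
   moreover have "1\<^sub>m n + (-1) \<cdot>\<^sub>m z = 1\<^sub>m n - z" using zc by (intro eq_matI) auto
   ultimately show ?thesis by simp
  qed
  have x4: "op_bdd n (4 * C) (y * (1\<^sub>m n - z))"
   unfolding op_bdd_def
  proof (intro conjI allI)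
   show "y * (1\<^sub>m n - z) : MT n" using yc zc by auto
   fix v
   let ?u = "mv n (ev n ?h (1 - q)) v"
   have "vn n (mv n (y * (1\<^sub>m n - z)) v) = vn n (mv n y ?u)"
    unfolding z' using yc ev_carrier[OF h] by (simp add: mv_mult[of _ n] cong: vn_cong)
   also have "... = K^2 * vn n (mv n w ?u)" by (rule vny)
   finally have 0: "vn n (mv n (y * (1\<^sub>m n - z)) v) = K^2 * vn n (mv n w ?u)" .
   have "cr (vn n (mv n w ?u)) = qf n (ev n ?h ((1 - q) * bern_X * (1 - q))) v"
    by (simp add: qfX qf_ev_conj[OF h adj])
   hence 1: "vn n (mv n w ?u) = Re (qf n (ev n ?h ((1 - q) * bern_X * (1 - q))) v)"
    by (metis Re_complex_of_real)
   have "[:3 * c:] - (1 - q) * bern_X * (1 - q) = ([:3 * c:] - bern_X * (1 - q)) + bern_X * (q * (1 - q))"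
    by (simp add: algebra_simps)
   moreover have "... : bern_cone" using q by (intro bern_cone_add bern_cone_mult bern_cone_X)
   ultimately have "[:3 * c:] - (1 - q) * bern_X * (1 - q) : bern_cone" by (simp only:)
   hence "0 <= Re (qf n (ev n ?h ([:3 * c:] - (1 - q) * bern_X * (1 - q))) v)"
    using P unfolding psd_def by blast
   hence "vn n (mv n w ?u) <= 3 * c * vn n v"
    unfolding 1 by (simp add: qf_ev_diff[OF h] qf_ev_const[OF h])
   hence "K^2 * vn n (mv n w ?u) <= K^2 * (3 * c * vn n v)" by (intro mult_left_mono) auto
   also have "... = 12 * C^2 * vn n v" using assms by (simp add: c_def)
   also have "... <= (4 * C)^2 * vn n v"
    unfolding power_mult_distrib by (intro mult_right_mono) auto
   finally show "vn n (mv n (y * (1\<^sub>m n - z)) v) <= (4 * C)^2 * vn n v" unfolding 0 .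
  qed (use assms in simp)
  have zadj: "adj z = z" unfolding z by (rule ev_adjoint[OF h adj])
  have nz: "cr ((nm2 z)^2) = ntrace (ev n ?h (q * q))"
   using mat_norm2_sq_trace[OF zc] zadj by (simp add: z ev_mult[OF h])
  have nyz: "cr ((nm2 (y * z))^2) = K^2 * ntrace (ev n ?h (bern_X * (q * q)))"
  proof -
   have yw: "y = cr K \<cdot>\<^sub>m w" using yc assms unfolding w by (intro eq_matI) auto
   have 1: "nm2 (y * z) = K * nm2 (w * z)"
    using assms wc zc
    by (simp add: yw mult_smult_assoc_mat[OF wc zc] mat_norm2_smult[OF mult_carrier_mat[OF wc zc]])
   have "adj (w * z) * (w * z) = z * (?h * z)"
    using wc zc mat_adjoint_carrier[OF wc]
    by (simp add: mat_adjoint_mult[of _ n] zadj assoc_mult_mat[of _ n n _ n _ n])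
   also have "... = ev n ?h (q * (bern_X * q))" by (simp only: ev_mult[OF h] bern_X_def ev_X[OF h] z)
   finally show ?thesis
    using mat_norm2_sq_trace[OF mult_carrier_mat[OF wc zc]]
    by (simp add: 1 power_mult_distrib mult_ac)
  qed
  \<comment> \<open>The certificate for \<open>q\<close> is linear in \<open>q\<close>, whereas the
    2-norm of \<open>z\<close> involves \<open>q * q\<close>. Multiplication by \<open>q\<close>
    produces the square, and \<open>et\<close> times \<open>1 - q\<close> restores the
    constant.\<close>
  have "[:et:] + (bern_X - [:c:]) * (q * q) = ([:et:] + (bern_X - [:c:]) * q) * q + Polynomial.smult et (1 - q)"
   by (simp add: algebra_simps smult_diff_right)
  moreover have "... : bern_cone"
   by (rule bern_cone_add[OF bern_cone_mult[OF q(4,1)] bern_cone_smult[OF q(2)]]) (use c0 in simp)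
  ultimately have "psd n (ev n ?h ([:et:] + (bern_X - [:c:]) * (q * q)))" using P by (simp only:)
  hence "0 <= Re (ntrace (ev n ?h ([:et:] + (bern_X - [:c:]) * (q * q))))"
   by (intro psd_ntrace) (use h in auto)
  moreover have "[:et:] + (bern_X - [:c:]) * (q * q) =
    (Polynomial.smult et 1 + bern_X * (q * q)) + Polynomial.smult (- c) (q * q)"
   by (simp add: algebra_simps)
  ultimately have "0 <= Re (ntrace (ev n ?h (Polynomial.smult et 1 + bern_X * (q * q)) +
    cr (- c) \<cdot>\<^sub>m ev n ?h (q * q)))"
   by (simp only: ev_add[OF h] ev_smult[OF h])
  also have "... = et * Re (ntrace (1\<^sub>m n)) + Re (ntrace (ev n ?h (bern_X * (q * q)))) - c * Re (ntrace (ev n ?h (q * q)))"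
   using ev_carrier[OF h]
   by (simp add: ev_add[OF h] ev_smult[OF h] ev_one[OF h] ev_const[OF h] ntrace_add[of _ n]
     ntrace_smult[of _ n] ntrace_smult[OF one_carrier_mat])
  also have "et * Re (ntrace (1\<^sub>m n)) <= et * 1"
   using c0 by (intro mult_left_mono) (auto simp: ntrace_def)
  finally have "0 <= et + (nm2 (y * z))^2 / K^2 - c * (nm2 z)^2"
   using arg_cong[OF nz, of Re] arg_cong[OF nyz, of Re] assms by (simp flip: of_real_power)
  hence "0 <= K^2 * (et + (nm2 (y * z))^2 / K^2 - c * (nm2 z)^2)" by simp
  also have "... = K^2 * et + K^2 * ((nm2 (y * z))^2 / K^2) - K^2 * c * (nm2 z)^2"
   by (simp add: algebra_simps)
  also have "... = de^2 + (nm2 (y * z))^2 - 4 * C^2 * (nm2 z)^2"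
   using assms by (simp add: c_def et_def)
  finally have "4 * C^2 * (nm2 z)^2 <= (nm2 (y * z))^2 + de^2" by simp
  thus ?thesis using z1 x4 by blast
 qed
 thus ?thesis by (rule that)
qed

section \<open>GNS spaces of tracial algebras\<close>

text \<open>Only the form is constrained, without vector space laws and without definiteness, so
  that the same facts serve both the algebra, where nonzero elements may have norm 0, and its
  completion.\<close>

locale semi_inner =
 fixes V :: "'v set" and vplus :: "'v => 'v => 'v" and scl :: "complex => 'v => 'v"
  and ip :: "'v => 'v => complex"
 assumes vplus_closed [simp]: "x : V ==> y : V ==> vplus x y : V"
  and scl_closed [simp]: "x : V ==> scl c x : V"
  and ip_add [simp]: "x : V ==> y : V ==> z : V ==> ip (vplus x y) z = ip x z + ip y z"
  and ip_scl [simp]: "x : V ==> z : V ==> ip (scl c x) z = c * ip x z"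
  and ip_cnj: "x : V ==> y : V ==> ip y x = cnj (ip x y)"
  and ip_pos [simp]: "x : V ==> 0 <= Re (ip x x)"
begin

definition nm :: "'v => real" where "nm x = sqrt (Re (ip x x))"
definition sb :: "'v => 'v => 'v" where "sb x y = vplus x (scl (-1) y)"

lemma sb_closed [simp]: "x : V ==> y : V ==> sb x y : V"
 by (simp add: sb_def)

lemma ip_add_right [simp]: "x : V ==> y : V ==> z : V ==> ip z (vplus x y) = ip z x + ip z y"
 by (simp add: ip_cnj[of _ z])

lemma ip_scl_right [simp]: "x : V ==> z : V ==> ip z (scl c x) = cnj c * ip z x"
 by (simp add: ip_cnj[of _ z])

lemma ip_sb [simp]: "x : V ==> y : V ==> z : V ==> ip (sb x y) z = ip x z - ip y z"
 by (simp add: sb_def)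

lemma ip_sb_right [simp]: "x : V ==> y : V ==> z : V ==> ip z (sb x y) = ip z x - ip z y"
 by (simp add: sb_def)

lemma nm_nonneg [simp]: "x : V ==> 0 <= nm x"
 by (simp add: nm_def)

lemma nm_sq: "x : V ==> (nm x)^2 = Re (ip x x)"
 by (simp add: nm_def)

lemma ip_self: "x : V ==> ip x x = cr ((nm x)^2)"
 using ip_cnj[of x x] by (simp add: nm_sq complex_eq_iff)

text \<open>Substitute for vector space laws: equations such as x - z = (x - y) + (y - z) are
  available inside norms because both sides have the same inner products.\<close>

lemma nm_cong:
 assumes "x : V" "y : V" "!!z. z : V ==> ip x z = ip y z"
 shows "nm x = nm y"
 using assms by (metis ip_cnj nm_def)

lemma cauchy_schwarz:
 assumes x: "x : V" and y: "y : V"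
 shows "cmod (ip x y) <= nm x * nm y"
proof -
 have expand: "0 <= (nm x)^2 + 2 * Re (cnj c * ip x y) + (cmod c)^2 * (nm y)^2" for c
 proof -
  have "0 <= Re (ip (vplus x (scl c y)) (vplus x (scl c y)))" by (rule ip_pos) (use x y in simp)
  also have "ip (vplus x (scl c y)) (vplus x (scl c y)) =
    ip x x + cnj c * ip x y + cnj (cnj c * ip x y) + c * cnj c * ip y y"
   using x y ip_cnj[of x y] by (simp add: algebra_simps)
  also have "c * cnj c = cr ((cmod c)^2)" by (simp only: complex_norm_square)
  finally show ?thesis using x y by (simp add: ip_self)
 qed
 show ?thesis
 proof (cases "nm y = 0")
  case True
  have "ip x y = 0"
  proof (rule ccontr)
   assume n: "ip x y ~= 0"
   \<comment> \<open>Chosen to make the quadratic expression equal to -1.\<close>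
   define t where "t = ((nm x)^2 + 1) / (2 * (cmod (ip x y))^2)"
   have "Re (cnj (- cr t * ip x y) * ip x y) = - t * (cmod (ip x y))^2"
   proof -
    have "cnj (- cr t * ip x y) * ip x y = - cr t * (ip x y * cnj (ip x y))"
     by simp
    also have "... = cr (- t * (cmod (ip x y))^2)"
     by (simp only: complex_norm_square[symmetric]) simp
    finally show ?thesis by (metis Re_complex_of_real)
   qed
   hence "0 <= (nm x)^2 - 2 * t * (cmod (ip x y))^2"
    using expand[of "- cr t * ip x y"] True by simp
   moreover have "2 * t * (cmod (ip x y))^2 = (nm x)^2 + 1" using n by (simp add: t_def)
   ultimately show False by simp
  qed
  thus ?thesis using x y by simp
 next
  case False
  hence ny: "0 < (nm y)^2" by simp
  define c where "c = - ip x y / cr ((nm y)^2)"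
  have "cnj c * ip x y = - (ip x y * cnj (ip x y)) / cr ((nm y)^2)" by (simp add: c_def)
  also have "... = cr (- ((cmod (ip x y))^2) / (nm y)^2)"
   by (simp only: complex_norm_square[symmetric]) simp
  finally have 1: "Re (cnj c * ip x y) = - ((cmod (ip x y))^2) / (nm y)^2" by (metis Re_complex_of_real)
  have "cmod c = cmod (ip x y) / (nm y)^2" by (simp add: c_def norm_divide norm_power)
  hence 2: "(cmod c)^2 * (nm y)^2 = (cmod (ip x y))^2 / (nm y)^2"
   using ny by (simp add: power2_eq_square)
  have "0 <= (nm x)^2 - (cmod (ip x y))^2 / (nm y)^2"
   using expand[of c] unfolding 1 2 by simp
  hence "(cmod (ip x y))^2 <= (nm x * nm y)^2" using ny by (simp add: field_simps power_mult_distrib)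
  thus ?thesis by (rule power2_le_imp_le) (use x y in simp)
 qed
qed

lemma nm_add: assumes "x : V" "y : V" shows "nm (vplus x y) <= nm x + nm y"
proof (rule power2_le_imp_le)
 have "Re (ip x y) <= nm x * nm y" "Re (ip y x) <= nm x * nm y"
  using cauchy_schwarz[OF assms] cauchy_schwarz[OF assms(2,1)] complex_Re_le_cmod order.trans
  by (fastforce simp: mult.commute)+
 thus "(nm (vplus x y))^2 <= (nm x + nm y)^2"
  using assms by (simp add: nm_sq power2_sum)
qed (use assms in simp)

lemma nm_scl: "x : V ==> nm (scl c x) = cmod c * nm x"
proof -
 assume x: "x : V"
 have "ip (scl c x) (scl c x) = c * cnj c * ip x x" using x by (simp add: mult_ac)
 also have "... = cr ((cmod c * nm x)^2)"
  using x by (simp only: complex_norm_square[symmetric] ip_self) (simp add: power_mult_distrib)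
 finally show ?thesis using x by (simp add: nm_def)
qed

lemma nm_sb_commute: "x : V ==> y : V ==> nm (sb x y) = nm (sb y x)"
 by (simp add: nm_def algebra_simps)

lemma nm_sb_triangle:
 assumes "x : V" "y : V" "z : V" shows "nm (sb x z) <= nm (sb x y) + nm (sb y z)"
proof -
 have "nm (sb x z) = nm (vplus (sb x y) (sb y z))" by (rule nm_cong) (use assms in auto)
 thus ?thesis using nm_add[of "sb x y" "sb y z"] assms by simp
qed

lemma nm_le_sb: assumes "x : V" "y : V" shows "nm x <= nm (sb x y) + nm y"
proof -
 have "nm x = nm (vplus (sb x y) y)" by (rule nm_cong) (use assms in auto)
 thus ?thesis using nm_add[of "sb x y" y] assms by simp
qed

lemma nm_diff_abs: assumes "x : V" "y : V" shows "\<bar>nm x - nm y\<bar> <= nm (sb x y)"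
 using nm_le_sb[OF assms] nm_le_sb[OF assms(2,1)] nm_sb_commute[OF assms] by linarith

lemma nm_sb_self [simp]: "x : V ==> nm (sb x x) = 0"
 by (simp add: nm_def)

lemma nm_sb_add:
 assumes "x : V" "y : V" "x' : V" "y' : V"
 shows "nm (sb (vplus x y) (vplus x' y')) <= nm (sb x x') + nm (sb y y')"
proof -
 have "nm (sb (vplus x y) (vplus x' y')) = nm (vplus (sb x x') (sb y y'))"
  by (rule nm_cong) (use assms in auto)
 thus ?thesis using nm_add[of "sb x x'" "sb y y'"] assms by simp
qed

lemma nm_sb_scl: "x : V ==> y : V ==> nm (sb (scl c x) (scl c y)) = cmod c * nm (sb x y)"
 using nm_scl[of "sb x y" c] nm_cong[of "sb (scl c x) (scl c y)" "scl c (sb x y)"]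
 by (simp add: algebra_simps)

text \<open>\<open>x\<close> is paired with an approximant of itself: the squared norm of
  \<open>x\<close> is then at most about \<open>K\<close> times its norm.\<close>

lemma nm_le_dense:
 assumes "x : V" "W <= V" "0 <= K"
  and dense: "!!ep. 0 < ep ==> EX y:W. nm (sb x y) < ep"
  and bd: "!!y. y : W ==> cmod (ip x y) <= K * nm y"
 shows "nm x <= K"
proof (cases "nm x = 0")
 case False
 hence pos: "0 < nm x" using nm_nonneg[OF assms(1)] by linarith
 show ?thesis
 proof (rule field_le_epsilon)
  fix e :: real assume e: "0 < e"
  define ep where "ep = min (nm x) (e * nm x / (nm x + K))"
  have ep: "0 < ep" using e pos assms(3) by (simp add: ep_def)
  obtain y where y: "y : W" "nm (sb x y) < ep" using dense[OF ep] by blast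
  have yV: "y : V" using y assms by auto
  have "(nm x)^2 = Re (ip x (sb x y)) + Re (ip x y)" using assms yV by (simp add: nm_sq)
  also have "... <= nm x * nm (sb x y) + K * nm y"
   using cauchy_schwarz[of x "sb x y"] bd[OF y(1)] complex_Re_le_cmod[of "ip x (sb x y)"]
    complex_Re_le_cmod[of "ip x y"] assms yV by simp
  also have "... <= nm x * ep + K * (nm x + ep)"
   using y pos nm_le_sb[OF yV assms(1)] nm_sb_commute[OF assms(1) yV] assms(3)
   by (intro add_mono mult_left_mono) auto
  also have "... = K * nm x + ep * (nm x + K)" by (simp add: algebra_simps)
  also have "ep * (nm x + K) <= e * nm x"
  proof -
   have "ep <= e * nm x / (nm x + K)" by (simp add: ep_def)
   thus ?thesis using pos assms(3) by (simp add: field_simps)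
  qed
  finally have "nm x * nm x <= nm x * (K + e)" by (simp add: power2_eq_square algebra_simps)
  thus "nm x <= K + e" using pos by simp
 qed
qed (use assms in simp)

end

text \<open>\<open>left_bdd\<close> is what makes the GNS representation act by bounded operators.
  Traciality is required in the form of \<open>trace_mult_star\<close>, the form in which the
  comparison of rows and columns of a function on an equivalence relation delivers it.\<close>

locale tracial_alg = ring A for A :: "'b tracial_star_alg" (structure) +
 assumes smult_closed [simp]: "a : carrier A ==> c \<odot> a : carrier A"
  and smult_add: "a : carrier A ==> b : carrier A ==> c \<odot> (a \<oplus> b) = c \<odot> a \<oplus> c \<odot> b"
  and smult_add_left: "a : carrier A ==> (c + d) \<odot> a = c \<odot> a \<oplus> d \<odot> a"
  and smult_one: "a : carrier A ==> 1 \<odot> a = a"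
  and smult_smult: "a : carrier A ==> c \<odot> (d \<odot> a) = (c * d) \<odot> a"
  and smult_mult_left: "a : carrier A ==> b : carrier A ==> (c \<odot> a) \<otimes> b = c \<odot> (a \<otimes> b)"
  and smult_mult_right: "a : carrier A ==> b : carrier A ==> a \<otimes> (c \<odot> b) = c \<odot> (a \<otimes> b)"
  and star_closed [simp]: "a : carrier A ==> star A a : carrier A"
  and star_star [simp]: "a : carrier A ==> star A (star A a) = a"
  and star_add: "a : carrier A ==> b : carrier A ==> star A (a \<oplus> b) = star A a \<oplus> star A b"
  and star_smult: "a : carrier A ==> star A (c \<odot> a) = cnj c \<odot> star A a"
  and star_mult: "a : carrier A ==> b : carrier A ==> star A (a \<otimes> b) = star A b \<otimes> star A a"
  and trace_add: "a : carrier A ==> b : carrier A ==> trace A (a \<oplus> b) = trace A a + trace A b"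
  and trace_smult: "a : carrier A ==> trace A (c \<odot> a) = c * trace A a"
  and trace_star: "a : carrier A ==> trace A (star A a) = cnj (trace A a)"
  and trace_pos: "a : carrier A ==> 0 <= Re (trace A (star A a \<otimes> a))"
  and trace_mult_star: "a : carrier A ==> trace A (a \<otimes> star A a) = trace A (star A a \<otimes> a)"
  and left_bdd: "a : carrier A ==>
   EX K. ALL b:carrier A. trace_norm2 A (a \<otimes> b) <= K * trace_norm2 A b"
begin

abbreviation tn where "tn == trace_norm2 A"
abbreviation GA where "GA == gns_space A"
abbreviation Hs where "Hs == carrier GA"

sublocale Ai: semi_inner "carrier A" "(\<oplus>)" "(\<odot>)" "trace_inner A"
 rewrites nm_eq: "semi_inner.nm (trace_inner A) = tn"
proof -
 show I: "semi_inner (carrier A) (\<oplus>) (\<odot>) (trace_inner A)"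
  by unfold_locales
   (auto simp: trace_inner_def r_distr smult_mult_right trace_add trace_smult trace_pos
    star_mult simp flip: trace_star)
 show "semi_inner.nm (trace_inner A) = tn"
  by (rule ext) (simp add: semi_inner.nm_def[OF I] trace_norm2_def)
qed

lemma smult_zero: "a : carrier A ==> 0 \<odot> a = \<zero>"
proof -
 assume a: "a : carrier A"
 have "0 \<odot> a \<oplus> 0 \<odot> a = 0 \<odot> a" using smult_add_left[OF a, of 0 0] by simp
 thus ?thesis using a by (metis add.r_cancel_one' smult_closed)
qed

lemma minus_eq_sb: "a : carrier A ==> b : carrier A ==> a \<ominus> b = Ai.sb a b"
proof -
 assume a: "a : carrier A" "b : carrier A"
 have "b \<oplus> (-1) \<odot> b = \<zero>" using smult_add_left[OF a(2), of 1 "-1"] smult_zero[OF a(2)] smult_one[OF a(2)] by simp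
 hence "\<ominus> b = (-1) \<odot> b" using a by (metis minus_equality a_comm smult_closed)
 thus ?thesis by (simp add: Ai.sb_def a_minus_def)
qed

text \<open>Traciality follows from \<open>trace_mult_star\<close> by polarization.\<close>

lemma trace_commute:
 assumes a: "a : carrier A" and b: "b : carrier A"
 shows "trace A (a \<otimes> b) = trace A (b \<otimes> a)"
proof -
 define y where "y = star A b"
 have y: "y : carrier A" "star A y = b" using b by (auto simp: y_def)
 have e: "cnj c * trace A (a \<otimes> b) + c * trace A (y \<otimes> star A a) =
   c * trace A (star A a \<otimes> y) + cnj c * trace A (b \<otimes> a)" for c
 proof -
  let ?s = "a \<oplus> c \<odot> y"
  have "trace A (?s \<otimes> star A ?s) = trace A (star A ?s \<otimes> ?s)"
   by (rule trace_mult_star) (use a y in auto)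
  moreover have "trace A (?s \<otimes> star A ?s) = trace A (a \<otimes> star A a) + cnj c * trace A (a \<otimes> b) +
    c * trace A (y \<otimes> star A a) + c * cnj c * trace A (y \<otimes> star A y)"
   using a b y by (simp add: star_add star_smult l_distr r_distr smult_mult_left smult_mult_right
    smult_smult trace_add trace_smult) (simp add: algebra_simps)
  moreover have "trace A (star A ?s \<otimes> ?s) = trace A (star A a \<otimes> a) + c * trace A (star A a \<otimes> y) +
    cnj c * trace A (b \<otimes> a) + c * cnj c * trace A (star A y \<otimes> y)"
   using a b y by (simp add: star_add star_smult l_distr r_distr smult_mult_left smult_mult_right
    smult_smult trace_add trace_smult) (simp add: algebra_simps)
  ultimately show ?thesis using trace_mult_star[OF a] trace_mult_star[OF y(1)] by simp
 qed
 have "\<i> * trace A (y \<otimes> star A a) - \<i> * trace A (a \<otimes> b) = \<i> * trace A (star A a \<otimes> y) - \<i> * trace A (b \<otimes> a)"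
  using e[of \<i>] by simp
 hence "trace A (y \<otimes> star A a) - trace A (a \<otimes> b) = trace A (star A a \<otimes> y) - trace A (b \<otimes> a)"
  by (metis (no_types, lifting) complex_i_not_zero mult_left_cancel right_diff_distrib)
 moreover have "trace A (a \<otimes> b) + trace A (y \<otimes> star A a) = trace A (star A a \<otimes> y) + trace A (b \<otimes> a)"
  using e[of 1] by simp
 moreover have "p = q" if "u - p = v - q" "p + u = v + q" for p q u v :: complex
 proof -
  have "2 * p = (p + u) - (u - p)" by simp
  also have "... = 2 * q" unfolding that by simp
  finally show ?thesis by simp
 qed
 ultimately show ?thesis by blast
qed

lemma nm_star: "a : carrier A ==> tn (star A a) = tn a"
 by (simp add: trace_norm2_def trace_inner_def trace_mult_star)

lemma star_sb: "a : carrier A ==> b : carrier A ==> star A (Ai.sb a b) = Ai.sb (star A a) (star A b)"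
 by (simp add: Ai.sb_def star_add star_smult)

lemma mult_sb: "a : carrier A ==> b : carrier A ==> c : carrier A ==> c \<otimes> Ai.sb a b = Ai.sb (c \<otimes> a) (c \<otimes> b)"
 by (simp add: Ai.sb_def r_distr smult_mult_right)

lemma sb_mult: "a : carrier A ==> b : carrier A ==> c : carrier A ==> Ai.sb a b \<otimes> c = Ai.sb (a \<otimes> c) (b \<otimes> c)"
 by (simp add: Ai.sb_def l_distr smult_mult_left)

lemma left_bddE:
 assumes "a : carrier A"
 obtains K where "0 < K" "!!b. b : carrier A ==> tn (a \<otimes> b) <= K * tn b"
proof -
 obtain K where K: "!!b. b : carrier A ==> tn (a \<otimes> b) <= K * tn b"
  using left_bdd[OF assms] by blast
 have "tn (a \<otimes> b) <= max K 1 * tn b" if "b : carrier A" for b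
  using K[OF that] mult_right_mono[of K "max K 1" "tn b"] Ai.nm_nonneg[OF that] by linarith
 thus ?thesis using that[of "max K 1"] by auto
qed

lemma right_bddE:
 assumes a: "a : carrier A"
 obtains K where "0 < K" "!!b. b : carrier A ==> tn (b \<otimes> a) <= K * tn b"
proof -
 obtain K where K: "0 < K" "!!b. b : carrier A ==> tn (star A a \<otimes> b) <= K * tn b"
  by (rule left_bddE[OF star_closed[OF a]]) blast
 have "tn (b \<otimes> a) <= K * tn b" if "b : carrier A" for b
  using K(2)[of "star A b"] that a nm_star[of "b \<otimes> a"] nm_star[OF that] by (simp add: star_mult)
 with K(1) that show ?thesis by blast
qed

lemma ip_mult_left: "a : carrier A ==> b : carrier A ==> c : carrier A ==>
  trace_inner A (a \<otimes> b) c = trace_inner A b (star A a \<otimes> c)"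
 by (simp add: trace_inner_def star_mult m_assoc)

lemma ip_mult_right: "a : carrier A ==> b : carrier A ==> c : carrier A ==>
  trace_inner A (a \<otimes> b) c = trace_inner A a (c \<otimes> star A b)"
 using trace_commute[of "star A c \<otimes> a" b] by (simp add: trace_inner_def star_mult m_assoc)


text \<open>Constant sequences embed the algebra densely in its completion; \<open>vac\<close> is
  the cyclic vector.\<close>

definition dvec :: "'b => (nat => 'b) set" where "dvec a = gns_vec A (%_. a)"

abbreviation vac where "vac == dvec \<one>"

lemma gns_cauchyD: "x : gns_cauchy A ==> x n : carrier A"
 by (auto simp: gns_cauchy_def)

lemma gns_cauchy_iff:
 "x : gns_cauchy A <-> (ALL n. x n : carrier A) \<and>
  (ALL ep>0. EX N. ALL m>=N. ALL n>=N. tn (Ai.sb (x m) (x n)) < ep)"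
 by (auto simp: gns_cauchy_def minus_eq_sb image_subset_iff)

lemma gns_vec_iff:
 "x : gns_cauchy A ==> y : gns_vec A x <->
  y : gns_cauchy A & (%n. tn (Ai.sb (x n) (y n))) ----> 0"
 by (auto simp: gns_vec_def minus_eq_sb gns_cauchyD)

lemma gns_vec_self [simp]: "x : gns_cauchy A ==> x : gns_vec A x"
 by (simp add: gns_vec_iff gns_cauchyD)

lemma null_trans:
 assumes "x : gns_cauchy A" "y : gns_cauchy A" "z : gns_cauchy A"
  and "(%n. tn (Ai.sb (x n) (y n))) ----> 0" "(%n. tn (Ai.sb (y n) (z n))) ----> 0"
 shows "(%n. tn (Ai.sb (x n) (z n))) ----> 0"
proof (rule tendsto_sandwich[OF always_eventually always_eventually tendsto_const])
 show "ALL n. tn (Ai.sb (x n) (z n)) <= tn (Ai.sb (x n) (y n)) + tn (Ai.sb (y n) (z n))"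
  using assms by (intro allI Ai.nm_sb_triangle) (auto dest: gns_cauchyD)
 show "(%n. tn (Ai.sb (x n) (y n)) + tn (Ai.sb (y n) (z n))) ----> 0"
  using tendsto_add[OF assms(4,5)] by simp
qed (use gns_cauchyD[OF assms(1)] gns_cauchyD[OF assms(3)] in simp)

lemma null_sym:
 assumes "x : gns_cauchy A" "y : gns_cauchy A" "(%n. tn (Ai.sb (x n) (y n))) ----> 0"
 shows "(%n. tn (Ai.sb (y n) (x n))) ----> 0"
 using assms by (simp add: Ai.nm_sb_commute[of "x _" "y _"] gns_cauchyD)

lemma gns_vec_eq_iff:
 assumes "x : gns_cauchy A" "y : gns_cauchy A"
 shows "gns_vec A x = gns_vec A y <-> (%n. tn (Ai.sb (x n) (y n))) ----> 0"
proof
 assume "gns_vec A x = gns_vec A y"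
 hence "y : gns_vec A x" using assms by simp
 thus "(%n. tn (Ai.sb (x n) (y n))) ----> 0" using assms by (simp add: gns_vec_iff)
next
 assume L: "(%n. tn (Ai.sb (x n) (y n))) ----> 0"
 show "gns_vec A x = gns_vec A y"
  using null_trans[OF assms(1,2) _ L] null_trans[OF assms(2,1) _ null_sym[OF assms L]]
  by (auto simp: gns_vec_iff assms)
qed

lemma const_cauchy [simp]: "a : carrier A ==> (%_. a) : gns_cauchy A"
 by (simp add: gns_cauchy_iff)

lemma class_rep_in: "x : gns_cauchy A ==> class_rep (gns_vec A x) : gns_vec A x"
 unfolding class_rep_def by (rule someI[of "%y. y : gns_vec A x" x]) simp

lemma class_rep_cauchy: "x : gns_cauchy A ==> class_rep (gns_vec A x) : gns_cauchy A"
 and class_rep_null: "x : gns_cauchy A ==>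
  (%n. tn (Ai.sb (x n) (class_rep (gns_vec A x) n))) ----> 0"
 using class_rep_in[of x] by (auto simp: gns_vec_iff)

lemma cauchy_nm_bdd:
 assumes "x : gns_cauchy A" obtains B where "0 < B" "!!n. tn (x n) <= B"
proof -
 note xc = gns_cauchyD[OF assms]
 have "EX N. ALL m>=N. ALL n>=N. tn (Ai.sb (x m) (x n)) < 1"
  using assms unfolding gns_cauchy_iff by simp
 then obtain N where N: "!!m n. m >= N ==> n >= N ==> tn (Ai.sb (x m) (x n)) < 1"
  by blast
 define B where "B = (\<Sum>n\<le>N. tn (x n)) + 1"
 have S: "0 <= (\<Sum>n\<le>N. tn (x n))" using xc by (intro sum_nonneg) simp
 have "tn (x n) <= B" for n
 proof (cases "n <= N")
  case True
  hence "tn (x n) <= (\<Sum>n\<le>N. tn (x n))" using xc by (intro member_le_sum) auto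
  thus ?thesis by (simp add: B_def)
 next
  case False
  have "tn (x N) <= (\<Sum>n\<le>N. tn (x n))" using xc by (intro member_le_sum) auto
  thus ?thesis using N[of n N] Ai.nm_le_sb[of "x n" "x N"] xc False by (simp add: B_def)
 qed
 thus ?thesis using that[of B] S by (simp add: B_def)
qed

lemma ip_diff_bound:
 assumes "a : carrier A" "b : carrier A" "a' : carrier A" "b' : carrier A"
 shows "cmod (trace_inner A a b - trace_inner A a' b') \<le>
  tn (Ai.sb a a') * tn b + tn a' * tn (Ai.sb b b')"
proof -
 have "trace_inner A a b - trace_inner A a' b' = trace_inner A (Ai.sb a a') b + trace_inner A a' (Ai.sb b b')"
  using assms by simp
 also have "cmod ... <= cmod (trace_inner A (Ai.sb a a') b) + cmod (trace_inner A a' (Ai.sb b b'))"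
  by (rule norm_triangle_ineq)
 also have "... <= tn (Ai.sb a a') * tn b + tn a' * tn (Ai.sb b b')"
  using assms by (intro add_mono Ai.cauchy_schwarz) auto
 finally show ?thesis .
qed

lemma ip_convergent:
 assumes x: "x : gns_cauchy A" and y: "y : gns_cauchy A"
 shows "convergent (%n. trace_inner A (x n) (y n))"
proof (rule Cauchy_convergent, rule metric_CauchyI)
 fix e :: real assume e: "0 < e"
 note c = gns_cauchyD[OF x] gns_cauchyD[OF y]
 obtain B where B: "0 < B" "!!n. tn (x n) <= B" using cauchy_nm_bdd[OF x] by blast
 obtain D where D: "0 < D" "!!n. tn (y n) <= D" using cauchy_nm_bdd[OF y] by blast
 obtain N where N: "!!m n. m >= N ==> n >= N ==> tn (Ai.sb (x m) (x n)) < e / (2 * D)"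
  using x e D unfolding gns_cauchy_iff by (meson divide_pos_pos mult_pos_pos zero_less_numeral)
 obtain N' where N': "!!m n. m >= N' ==> n >= N' ==> tn (Ai.sb (y m) (y n)) < e / (2 * B)"
  using y e B unfolding gns_cauchy_iff by (meson divide_pos_pos mult_pos_pos zero_less_numeral)
 show "EX M. ALL m>=M. ALL n>=M. dist (trace_inner A (x m) (y m)) (trace_inner A (x n) (y n)) < e"
 proof (intro exI[of _ "max N N'"] allI impI)
  fix m n assume mn: "max N N' <= m" "max N N' <= n"
  have "cmod (trace_inner A (x m) (y m) - trace_inner A (x n) (y n)) \<le>
   tn (Ai.sb (x m) (x n)) * tn (y m) + tn (x n) * tn (Ai.sb (y m) (y n))"
   using c by (intro ip_diff_bound) auto
  also have "... <= tn (Ai.sb (x m) (x n)) * D + B * tn (Ai.sb (y m) (y n))"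
   using c B D by (intro add_mono mult_left_mono mult_right_mono) auto
  also have "... < e / (2 * D) * D + B * (e / (2 * B))"
   using mn N[of m n] N'[of m n] B D by (intro add_strict_mono mult_strict_left_mono mult_strict_right_mono) auto
  also have "... = e" using B D by simp
  finally show "dist (trace_inner A (x m) (y m)) (trace_inner A (x n) (y n)) < e" by (simp add: dist_norm)
 qed
qed

lemma ip_null_diff:
 assumes x: "x : gns_cauchy A" "x' : gns_cauchy A" "(%n. tn (Ai.sb (x n) (x' n))) ----> 0"
  and y: "y : gns_cauchy A" "y' : gns_cauchy A" "(%n. tn (Ai.sb (y n) (y' n))) ----> 0"
 shows "(%n. trace_inner A (x n) (y n) - trace_inner A (x' n) (y' n)) ----> 0"
proof -
 note c = gns_cauchyD[OF x(1)] gns_cauchyD[OF x(2)] gns_cauchyD[OF y(1)] gns_cauchyD[OF y(2)]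
 obtain B where B: "0 < B" "!!n. tn (x' n) <= B" using cauchy_nm_bdd[OF x(2)] by blast
 obtain D where D: "0 < D" "!!n. tn (y n) <= D" using cauchy_nm_bdd[OF y(1)] by blast
 show ?thesis
 proof (rule Lim_null_comparison[OF always_eventually])
  show "ALL n. cmod (trace_inner A (x n) (y n) - trace_inner A (x' n) (y' n)) \<le>
   tn (Ai.sb (x n) (x' n)) * D + B * tn (Ai.sb (y n) (y' n))"
  proof
   fix n
   have "cmod (trace_inner A (x n) (y n) - trace_inner A (x' n) (y' n)) \<le>
    tn (Ai.sb (x n) (x' n)) * tn (y n) + tn (x' n) * tn (Ai.sb (y n) (y' n))"
    using c by (intro ip_diff_bound) auto
   also have "... <= tn (Ai.sb (x n) (x' n)) * D + B * tn (Ai.sb (y n) (y' n))"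
    using c B D by (intro add_mono mult_left_mono mult_right_mono) auto
   finally show "cmod (trace_inner A (x n) (y n) - trace_inner A (x' n) (y' n)) \<le>
    tn (Ai.sb (x n) (x' n)) * D + B * tn (Ai.sb (y n) (y' n))" .
  qed
  show "(%n. tn (Ai.sb (x n) (x' n)) * D + B * tn (Ai.sb (y n) (y' n))) ----> 0"
   using tendsto_add[OF tendsto_mult_left_zero[OF x(3)] tendsto_mult_right_zero[OF y(3)]] by simp
 qed
qed

lemma gns_carrier: "Hs = gns_vec A ` gns_cauchy A"
 by (simp add: gns_space_def)

lemma gns_in [simp]: "x : gns_cauchy A ==> gns_vec A x : Hs"
 by (simp add: gns_carrier)

text \<open>The inner product of \<open>gns_space\<close> is defined along chosen representatives;
  sequences at distance tending to 0 have the same limits of inner products, so any representatives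
  may be used.\<close>

lemma gns_inner:
 assumes x: "x : gns_cauchy A" and y: "y : gns_cauchy A"
 shows "(%n. trace_inner A (x n) (y n)) ----> inner_prod GA (gns_vec A x) (gns_vec A y)"
proof -
 let ?x = "class_rep (gns_vec A x)" and ?y = "class_rep (gns_vec A y)"
 have "(%n. trace_inner A (?x n) (?y n)) ----> inner_prod GA (gns_vec A x) (gns_vec A y)"
  using ip_convergent[OF class_rep_cauchy[OF x] class_rep_cauchy[OF y]]
  by (simp add: gns_space_def convergent_LIMSEQ_iff)
 from tendsto_add[OF this ip_null_diff[OF x class_rep_cauchy[OF x] class_rep_null[OF x]
   y class_rep_cauchy[OF y] class_rep_null[OF y]]]
 show ?thesis by simp
qed

lemma cauchy_add: "x : gns_cauchy A ==> y : gns_cauchy A ==> (%n. x n \<oplus> y n) : gns_cauchy A"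
proof -
 assume x: "x : gns_cauchy A" and y: "y : gns_cauchy A"
 note c = gns_cauchyD[OF x] gns_cauchyD[OF y]
 show ?thesis
  unfolding gns_cauchy_iff
 proof (intro conjI allI impI)
  fix e :: real assume "0 < e"
  hence e: "0 < e / 2" by simp
  obtain N where N: "!!m n. m >= N ==> n >= N ==> tn (Ai.sb (x m) (x n)) < e / 2"
   using x e unfolding gns_cauchy_iff by meson
  obtain N' where N': "!!m n. m >= N' ==> n >= N' ==> tn (Ai.sb (y m) (y n)) < e / 2"
   using y e unfolding gns_cauchy_iff by meson
  show "EX N. ALL m>=N. ALL n>=N. tn (Ai.sb (x m \<oplus> y m) (x n \<oplus> y n)) < e"
  proof (intro exI[of _ "max N N'"] allI impI)
   fix m n assume "max N N' <= m" "max N N' <= n"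
   thus "tn (Ai.sb (x m \<oplus> y m) (x n \<oplus> y n)) < e"
    using N[of m n] N'[of m n] Ai.nm_sb_add[of "x m" "y m" "x n" "y n"] c by fastforce
  qed
 qed (use c in auto)
qed

lemma cauchy_scl: "x : gns_cauchy A ==> (%n. c \<odot> x n) : gns_cauchy A"
proof -
 assume x: "x : gns_cauchy A"
 note d = gns_cauchyD[OF x]
 show ?thesis
  unfolding gns_cauchy_iff
 proof (intro conjI allI impI)
  fix e :: real assume "0 < e"
  hence e: "0 < e / (cmod c + 1)" by (simp add: add_nonneg_pos)
  obtain N where N: "!!m n. m >= N ==> n >= N ==> tn (Ai.sb (x m) (x n)) < e / (cmod c + 1)"
   using x e unfolding gns_cauchy_iff by meson
  show "EX N. ALL m>=N. ALL n>=N. tn (Ai.sb (c \<odot> x m) (c \<odot> x n)) < e"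
  proof (intro exI[of _ N] allI impI)
   fix m n assume mn: "N <= m" "N <= n"
   have "cmod c * tn (Ai.sb (x m) (x n)) <= (cmod c + 1) * tn (Ai.sb (x m) (x n))"
    using d by (intro mult_right_mono) auto
   also have "... < (cmod c + 1) * (e / (cmod c + 1))"
    using N[OF mn] by (intro mult_strict_left_mono) (auto simp: add_nonneg_pos)
   also have "... = e" by (simp add: add_nonneg_eq_0_iff)
   finally show "tn (Ai.sb (c \<odot> x m) (c \<odot> x n)) < e" using d by (simp add: Ai.nm_sb_scl)
  qed
 qed (use d in auto)
qed

lemma cauchy_mult: "a : carrier A ==> x : gns_cauchy A ==> (%n. a \<otimes> x n) : gns_cauchy A"
proof -
 assume a: "a : carrier A" and x: "x : gns_cauchy A"
 note d = gns_cauchyD[OF x]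
 obtain K where K: "0 < K" "!!b. b : carrier A ==> tn (a \<otimes> b) <= K * tn b"
  using left_bddE[OF a] by blast
 show ?thesis
  unfolding gns_cauchy_iff
 proof (intro conjI allI impI)
  fix e :: real assume "0 < e"
  hence e: "0 < e / K" using K by simp
  obtain N where N: "!!m n. m >= N ==> n >= N ==> tn (Ai.sb (x m) (x n)) < e / K"
   using x e unfolding gns_cauchy_iff by meson
  show "EX N. ALL m>=N. ALL n>=N. tn (Ai.sb (a \<otimes> x m) (a \<otimes> x n)) < e"
  proof (intro exI[of _ N] allI impI)
   fix m n assume mn: "N <= m" "N <= n"
   have "tn (Ai.sb (a \<otimes> x m) (a \<otimes> x n)) <= K * tn (Ai.sb (x m) (x n))"
    using K(2)[of "Ai.sb (x m) (x n)"] a d by (simp add: mult_sb)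
   also have "... < e" using N[OF mn] K(1) by (simp add: field_simps)
   finally show "tn (Ai.sb (a \<otimes> x m) (a \<otimes> x n)) < e" .
  qed
 qed (use d a in auto)
qed

lemma gns_vadd:
 assumes x: "x : gns_cauchy A" and y: "y : gns_cauchy A"
 shows "vadd GA (gns_vec A x) (gns_vec A y) = gns_vec A (%n. x n \<oplus> y n)"
proof -
 note c = gns_cauchyD[OF x] gns_cauchyD[OF y] gns_cauchyD[OF class_rep_cauchy[OF x]] gns_cauchyD[OF class_rep_cauchy[OF y]]
 have "(%n. tn (Ai.sb (x n \<oplus> y n) (class_rep (gns_vec A x) n \<oplus> class_rep (gns_vec A y) n))) ----> 0"
 proof (rule tendsto_sandwich[OF always_eventually always_eventually tendsto_const])
  show "ALL n. tn (Ai.sb (x n \<oplus> y n) (class_rep (gns_vec A x) n \<oplus> class_rep (gns_vec A y) n)) \<le>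
   tn (Ai.sb (x n) (class_rep (gns_vec A x) n)) + tn (Ai.sb (y n) (class_rep (gns_vec A y) n))"
   using c by (intro allI Ai.nm_sb_add) auto
  show "(%n. tn (Ai.sb (x n) (class_rep (gns_vec A x) n)) +
    tn (Ai.sb (y n) (class_rep (gns_vec A y) n))) ----> 0"
   using tendsto_add[OF class_rep_null[OF x] class_rep_null[OF y]] by simp
 qed (use c in auto)
 thus ?thesis
  using gns_vec_eq_iff[OF cauchy_add[OF x y] cauchy_add[OF class_rep_cauchy[OF x] class_rep_cauchy[OF y]]]
  by (simp add: gns_space_def)
qed

lemma gns_vscale:
 assumes x: "x : gns_cauchy A"
 shows "vscale GA c (gns_vec A x) = gns_vec A (%n. c \<odot> x n)"
proof -
 note d = gns_cauchyD[OF x] gns_cauchyD[OF class_rep_cauchy[OF x]]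
 have "(%n. tn (Ai.sb (c \<odot> x n) (c \<odot> class_rep (gns_vec A x) n))) ----> 0"
  using tendsto_mult_right_zero[OF class_rep_null[OF x], of "cmod c"] d by (simp add: Ai.nm_sb_scl)
 thus ?thesis
  using gns_vec_eq_iff[OF cauchy_scl[OF x, of c] cauchy_scl[OF class_rep_cauchy[OF x], of c]]
  by (simp add: gns_space_def)
qed

lemma gns_rep_vec:
 assumes a: "a : carrier A" and x: "x : gns_cauchy A"
 shows "gns_rep A a (gns_vec A x) = gns_vec A (%n. a \<otimes> x n)"
proof -
 note d = gns_cauchyD[OF x] gns_cauchyD[OF class_rep_cauchy[OF x]]
 obtain K where K: "0 < K" "!!b. b : carrier A ==> tn (a \<otimes> b) <= K * tn b"
  using left_bddE[OF a] by blast
 have "(%n. tn (Ai.sb (a \<otimes> x n) (a \<otimes> class_rep (gns_vec A x) n))) ----> 0"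
 proof (rule tendsto_sandwich[OF always_eventually always_eventually tendsto_const])
  show "ALL n. tn (Ai.sb (a \<otimes> x n) (a \<otimes> class_rep (gns_vec A x) n)) \<le>
   K * tn (Ai.sb (x n) (class_rep (gns_vec A x) n))"
   using K(2)[of "Ai.sb (x n) (class_rep (gns_vec A x) n)" for n] a d by (simp add: mult_sb)
  show "(%n. K * tn (Ai.sb (x n) (class_rep (gns_vec A x) n))) ----> 0"
   by (rule tendsto_mult_right_zero[OF class_rep_null[OF x]])
 qed (use d a in auto)
 thus ?thesis
  using gns_vec_eq_iff[OF cauchy_mult[OF a x] cauchy_mult[OF a class_rep_cauchy[OF x]]] x
  by (simp add: gns_rep_def)
qed

abbreviation hip where "hip == inner_prod GA"

sublocale Hi: semi_inner "Hs" "vadd GA" "vscale GA" hip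
proof
 fix xi et ze c assume "xi : Hs" "et : Hs" "ze : Hs"
 then obtain x y z where [simp]: "xi = gns_vec A x" "et = gns_vec A y" "ze = gns_vec A z"
  and c: "x : gns_cauchy A" "y : gns_cauchy A" "z : gns_cauchy A"
  by (auto simp: gns_carrier)
 note d = c[THEN gns_cauchyD]
 have "hip (vadd GA xi et) ze = hip xi ze + hip et ze"
  using LIMSEQ_unique[OF gns_inner[OF cauchy_add[OF c(1,2)] c(3)]] tendsto_add[OF gns_inner[OF c(1,3)] gns_inner[OF c(2,3)]]
  by (simp add: gns_vadd c d)
 thus "hip (vadd GA xi et) ze = hip xi ze + hip et ze" .
next
 fix xi ze c assume "xi : Hs" "ze : Hs"
 then obtain x z where [simp]: "xi = gns_vec A x" "ze = gns_vec A z"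
  and c: "x : gns_cauchy A" "z : gns_cauchy A"
  by (auto simp: gns_carrier)
 note d = c[THEN gns_cauchyD]
 show "hip (vscale GA c xi) ze = c * hip xi ze"
  using LIMSEQ_unique[OF gns_inner[OF cauchy_scl[OF c(1)] c(2)]] tendsto_mult_left[OF gns_inner[OF c(1,2)], of c]
  by (simp add: gns_vscale c d)
 have "(%n. cnj (trace_inner A (x n) (z n))) ----> cnj (hip xi ze)"
  using tendsto_cnj[OF gns_inner[OF c]] by simp
 thus "hip ze xi = cnj (hip xi ze)"
  using LIMSEQ_unique[OF gns_inner[OF c(2,1)]] d by (simp flip: Ai.ip_cnj)
next
 fix xi assume "xi : Hs"
 then obtain x where [simp]: "xi = gns_vec A x" and c: "x : gns_cauchy A"
  by (auto simp: gns_carrier)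
 note d = c[THEN gns_cauchyD]
 show "0 <= Re (hip xi xi)"
  using tendsto_Re[OF gns_inner[OF c c]] d by (simp add: LIMSEQ_le_const)
qed (auto simp: gns_carrier gns_vadd gns_vscale cauchy_add cauchy_scl)

end

context tracial_alg begin

lemma dense_in [simp]: "a : carrier A ==> dvec a : Hs"
 by (simp add: dvec_def)

lemma hip_dense [simp]: "a : carrier A ==> b : carrier A ==> hip (dvec a) (dvec b) = trace_inner A a b"
 using gns_inner[of "%_. a" "%_. b"] by (simp add: dvec_def LIMSEQ_const_iff)

lemma hnm_dense [simp]: "a : carrier A ==> Hi.nm (dvec a) = tn a"
 by (simp add: Hi.nm_def trace_norm2_def)

lemma dense_add: "a : carrier A ==> b : carrier A ==> vadd GA (dvec a) (dvec b) = dvec (a \<oplus> b)"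
 by (simp add: dvec_def gns_vadd)

lemma dense_scl: "a : carrier A ==> vscale GA c (dvec a) = dvec (c \<odot> a)"
 by (simp add: dvec_def gns_vscale)

lemma dense_sb: "a : carrier A ==> b : carrier A ==> Hi.sb (dvec a) (dvec b) = dvec (Ai.sb a b)"
 by (simp add: Hi.sb_def Ai.sb_def dense_scl dense_add)

lemma gns_unit_dense: "gns_unit A = vac"
 by (simp add: gns_unit_def dvec_def)

lemma gns_nm: "z : gns_cauchy A ==> (%n. tn (z n)) ----> Hi.nm (gns_vec A z)"
 unfolding trace_norm2_def Hi.nm_def by (intro tendsto_real_sqrt tendsto_Re gns_inner)

lemma cauchy_sb: "x : gns_cauchy A ==> y : gns_cauchy A ==> (%n. Ai.sb (x n) (y n)) : gns_cauchy A"
 by (simp add: Ai.sb_def cauchy_add cauchy_scl)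

lemma gns_sb: "x : gns_cauchy A ==> y : gns_cauchy A ==>
  Hi.sb (gns_vec A x) (gns_vec A y) = gns_vec A (%n. Ai.sb (x n) (y n))"
 by (simp add: Hi.sb_def Ai.sb_def gns_vadd gns_vscale cauchy_scl)

lemma gns_dist: "x : gns_cauchy A ==> y : gns_cauchy A ==>
  (%n. tn (Ai.sb (x n) (y n))) ----> Hi.nm (Hi.sb (gns_vec A x) (gns_vec A y))"
 by (simp add: gns_sb gns_nm cauchy_sb)

lemma gns_approx:
 assumes x: "x : gns_cauchy A"
 shows "(%n. Hi.nm (Hi.sb (gns_vec A x) (dvec (x n)))) ----> 0"
proof (rule LIMSEQ_I)
 fix e :: real assume "0 < e"
 hence e: "0 < e / 2" by simp
 obtain N where N: "!!m n. m >= N ==> n >= N ==> tn (Ai.sb (x m) (x n)) < e / 2"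
  using x e unfolding gns_cauchy_iff by meson
 note d = gns_cauchyD[OF x]
 show "EX N. ALL n>=N. norm (Hi.nm (Hi.sb (gns_vec A x) (dvec (x n))) - 0) < e"
 proof (intro exI[of _ N] allI impI)
  fix n assume n: "N <= n"
  have "(%m. tn (Ai.sb (x m) (x n))) ----> Hi.nm (Hi.sb (gns_vec A x) (dvec (x n)))"
   unfolding dvec_def using d x by (intro gns_dist) auto
  hence "Hi.nm (Hi.sb (gns_vec A x) (dvec (x n))) <= e / 2"
   by (rule LIMSEQ_le_const2) (use N n in \<open>meson less_imp_le\<close>)
  thus "norm (Hi.nm (Hi.sb (gns_vec A x) (dvec (x n))) - 0) < e"
   using d x \<open>0 < e\<close> by simp
 qed
qed

lemma gns_dense:
 assumes "xi : Hs" "0 < e"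
 shows "EX a:carrier A. Hi.nm (Hi.sb xi (dvec a)) < e"
proof -
 obtain x where x: "x : gns_cauchy A" "xi = gns_vec A x" using assms by (auto simp: gns_carrier)
 obtain n where "norm (Hi.nm (Hi.sb (gns_vec A x) (dvec (x n))) - 0) < e"
  using LIMSEQ_D[OF gns_approx[OF x(1)] assms(2)] by blast
 thus ?thesis using gns_cauchyD[OF x(1)] x by auto
qed

lemma hnm_zero_eq:
 assumes "xi : Hs" "et : Hs" "Hi.nm (Hi.sb xi et) = 0"
 shows "xi = et"
proof -
 obtain x y where x: "x : gns_cauchy A" "xi = gns_vec A x" and y: "y : gns_cauchy A" "et = gns_vec A y"
  using assms by (auto simp: gns_carrier)
 show ?thesis using gns_dist[OF x(1) y(1)] assms(3) x y by (simp add: gns_vec_eq_iff)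
qed

text \<open>A set dense in the algebra is dense in the completion. In the application
  \<open>W\<close> consists of the elements that have matrix models.\<close>

lemma hnm_le:
 assumes "xi : Hs" "0 <= K" "W <= carrier A"
  and W: "!!a e. a : carrier A ==> 0 < e ==> EX w:W. tn (Ai.sb a w) < e"
  and bd: "!!b. b : W ==> cmod (hip xi (dvec b)) <= K * tn b"
 shows "Hi.nm xi <= K"
proof (rule Hi.nm_le_dense[of _ "dvec ` W"])
 fix e :: real assume "0 < e"
 hence e: "0 < e / 2" by simp
 obtain a where a: "a : carrier A" "Hi.nm (Hi.sb xi (dvec a)) < e / 2"
  using gns_dense[OF assms(1) e] by blast
 obtain w where w: "w : W" "tn (Ai.sb a w) < e / 2" using W[OF a(1) e] by blast
 have wA: "w : carrier A" using w assms(3) by auto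
 have "Hi.nm (Hi.sb xi (dvec w)) < e"
  using Hi.nm_sb_triangle[of xi "dvec a" "dvec w"] a w assms(1) wA by (simp add: dense_sb)
 thus "EX y:dvec ` W. Hi.nm (Hi.sb xi y) < e" using w by blast
qed (use assms in auto)

lemma hip_eqI:
 assumes "xi : Hs" "et : Hs"
  and "!!b. b : carrier A ==> hip xi (dvec b) = hip et (dvec b)"
 shows "xi = et"
proof (rule hnm_zero_eq[OF assms(1,2)])
 have "Hi.nm (Hi.sb xi et) <= 0"
  by (rule hnm_le[of _ _ "carrier A"]) (use assms in \<open>auto intro!: bexI\<close>)
 thus "Hi.nm (Hi.sb xi et) = 0" using assms by (simp add: antisym)
qed

text \<open>Replacing the n-th vector by an algebra element at distance below 1/(n + 1) gives a
  Cauchy sequence in the algebra, and its class is the limit.\<close>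

lemma gns_complete:
 assumes xi: "!!n::nat. xi n : Hs"
  and cau: "!!e. 0 < e ==> EX N. ALL m>=N. ALL n>=N. Hi.nm (Hi.sb (xi m) (xi n)) < e"
 obtains et where "et : Hs" "(%n. Hi.nm (Hi.sb (xi n) et)) ----> 0"
proof -
 have "EX a:carrier A. Hi.nm (Hi.sb (xi n) (dvec a)) < 1 / real (Suc n)" for n
  by (rule gns_dense[OF xi]) simp
 then obtain a where a: "!!n. a n : carrier A" "!!n. Hi.nm (Hi.sb (xi n) (dvec (a n))) < 1 / real (Suc n)"
  by metis
 have ac: "a : gns_cauchy A"
  unfolding gns_cauchy_iff
 proof (intro conjI allI impI a)
  fix e :: real assume "0 < e"
  hence e: "0 < e / 3" by simp
  obtain N where N: "!!m n. m >= N ==> n >= N ==> Hi.nm (Hi.sb (xi m) (xi n)) < e / 3"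
   using cau[OF e] by blast
  obtain M where M: "1 / real (Suc M) < e / 3" using e nat_approx_posE by blast
  have M': "Hi.nm (Hi.sb (xi n) (dvec (a n))) < e / 3" if "M <= n" for n
  proof -
   have "1 / real (Suc n) <= 1 / real (Suc M)" using that by (simp add: field_simps)
   thus ?thesis using a(2)[of n] M by linarith
  qed
  show "EX N. ALL m>=N. ALL n>=N. tn (Ai.sb (a m) (a n)) < e"
  proof (intro exI[of _ "max N M"] allI impI)
   fix m n assume mn: "max N M <= m" "max N M <= n"
   have "tn (Ai.sb (a m) (a n)) = Hi.nm (Hi.sb (dvec (a m)) (dvec (a n)))"
    by (simp add: dense_sb a)
   also have "... <= Hi.nm (Hi.sb (dvec (a m)) (xi m)) + (Hi.nm (Hi.sb (xi m) (xi n)) + Hi.nm (Hi.sb (xi n) (dvec (a n))))"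
    using Hi.nm_sb_triangle[of "dvec (a m)" "xi m" "dvec (a n)"]
     Hi.nm_sb_triangle[of "xi m" "xi n" "dvec (a n)"] a(1) xi by fastforce
   also have "... < e"
    using M'[of m] M'[of n] N[of m n] mn Hi.nm_sb_commute[of "dvec (a m)" "xi m"] a(1) xi by simp
   finally show "tn (Ai.sb (a m) (a n)) < e" .
  qed
 qed
 show ?thesis
 proof (rule that)
  show "gns_vec A a : Hs" using ac by simp
  show "(%n. Hi.nm (Hi.sb (xi n) (gns_vec A a))) ----> 0"
  proof (rule tendsto_sandwich[OF always_eventually always_eventually tendsto_const])
   show "ALL n. Hi.nm (Hi.sb (xi n) (gns_vec A a)) <= 1 / real (Suc n) + Hi.nm (Hi.sb (gns_vec A a) (dvec (a n)))"
   proof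
    fix n
    show "Hi.nm (Hi.sb (xi n) (gns_vec A a)) <= 1 / real (Suc n) + Hi.nm (Hi.sb (gns_vec A a) (dvec (a n)))"
     using Hi.nm_sb_triangle[of "xi n" "dvec (a n)" "gns_vec A a"] a(2)[of n]
      Hi.nm_sb_commute[of "gns_vec A a" "dvec (a n)"] a(1) xi ac by simp
   qed
   show "(%n. 1 / real (Suc n) + Hi.nm (Hi.sb (gns_vec A a) (dvec (a n)))) ----> 0"
    using tendsto_add[OF lim_inverse_n' [THEN LIMSEQ_Suc] gns_approx[OF ac]] by simp
  qed (use xi ac in auto)
 qed
qed

section \<open>Bounded operators, right modularity and adjoints\<close>

lemma bopD:
 assumes "T : bounded_operators GA"
 shows "xi : Hs ==> T xi : Hs"
  and "xi : Hs ==> et : Hs ==>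
   T (vadd GA xi et) = vadd GA (T xi) (T et)"
  and "xi : Hs ==> T (vscale GA c xi) = vscale GA c (T xi)"
  and "xi : Hs ==> et : Hs ==> T (Hi.sb xi et) = Hi.sb (T xi) (T et)"
  and "T : extensional (Hs)"
 using assms by (auto simp: bounded_operators_def Hi.sb_def PiE_def)

lemma bopE:
 assumes "T : bounded_operators GA"
 obtains K where "1 <= K" "!!xi. xi : Hs ==> Hi.nm (T xi) <= K * Hi.nm xi"
proof -
 have "EX C. ALL xi:Hs. Re (hip (T xi) (T xi)) <= C * Re (hip xi xi)"
  using assms by (simp add: bounded_operators_def)
 then obtain C where C: "!!xi. xi : Hs ==> Re (hip (T xi) (T xi)) <= C * Re (hip xi xi)"
  by blast
 have "Hi.nm (T xi) <= sqrt (max C 1) * Hi.nm xi" if xi: "xi : Hs" for xi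
 proof -
  have "Re (hip (T xi) (T xi)) <= max C 1 * Re (hip xi xi)"
   using C[OF xi] mult_right_mono[of C "max C 1" "Re (hip xi xi)"] Hi.ip_pos[OF xi] by linarith
  thus ?thesis unfolding Hi.nm_def by (metis real_sqrt_le_mono real_sqrt_mult)
 qed
 thus ?thesis using that[of "sqrt (max C 1)"] by simp
qed

lemma bopI:
 assumes "T : extensional (Hs)"
  and "!!xi. xi : Hs ==> T xi : Hs"
  and "!!xi et. xi : Hs ==> et : Hs ==>
   T (vadd GA xi et) = vadd GA (T xi) (T et)"
  and "!!c xi. xi : Hs ==> T (vscale GA c xi) = vscale GA c (T xi)"
  and "!!xi. xi : Hs ==> Hi.nm (T xi) <= K * Hi.nm xi"
 shows "T : bounded_operators GA"
proof -
 have "Re (hip (T xi) (T xi)) <= K^2 * Re (hip xi xi)" if "xi : Hs" for xi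
 proof -
  have "(Hi.nm (T xi))^2 <= (K * Hi.nm xi)^2"
   using assms(5)[OF that] assms(2)[OF that] by (intro power_mono) auto
  thus ?thesis using that assms(2) by (simp add: Hi.nm_sq power_mult_distrib)
 qed
 moreover have "T : Hs \<rightarrow>\<^sub>E Hs"
  using assms(1,2) by (auto simp: PiE_def)
 ultimately show ?thesis using assms(3,4) by (simp add: bounded_operators_def) blast
qed

text \<open>Operators commuting with right multiplication; the weak closure lies in this set.\<close>

definition rmod :: "((nat => 'b) set => (nat => 'b) set) set" where
 "rmod = {T : bounded_operators GA. ALL b:carrier A. ALL c:carrier A.
  hip (T (dvec b)) (dvec c) = hip (T vac) (dvec (c \<otimes> star A b))}"

lemma rmodD:
 assumes "T : rmod"
 shows "T : bounded_operators GA"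
  and "b : carrier A ==> c : carrier A ==>
   hip (T (dvec b)) (dvec c) = hip (T vac) (dvec (c \<otimes> star A b))"
 using assms by (auto simp: rmod_def)

lemma gns_rep_dense: "a : carrier A ==> b : carrier A ==> gns_rep A a (dvec b) = dvec (a \<otimes> b)"
 by (simp add: dvec_def gns_rep_vec)

text \<open>The identity holds for left multiplications by traciality. It compares two matrix
  coefficients, and the weak closure approximates both at once through the test set
  \<open>{?p, ?q}\<close>.\<close>

lemma weak_closure_right_modular:
 assumes "T : weak_operator_closure GA (gns_rep A ` carrier A)"
 shows "T : rmod"
 unfolding rmod_def
proof (intro CollectI conjI ballI)
 show T: "T : bounded_operators GA" using assms by (simp add: weak_operator_closure_def)
 fix b c assume bc: "b : carrier A" "c : carrier A"
 let ?p = "(dvec b, dvec c)" and ?q = "(vac, dvec (c \<otimes> star A b))"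
 let ?D = "hip (T (dvec b)) (dvec c) - hip (T vac) (dvec (c \<otimes> star A b))"
 have "cmod ?D <= e" if "0 < e" for e :: real
 proof -
  have "EX S:gns_rep A ` carrier A. ALL (xi, et):{?p, ?q}. cmod (hip (T xi) et - hip (S xi) et) < e / 2"
   using assms that bc unfolding weak_operator_closure_def by (auto dest!: spec[of _ "{?p, ?q}"] spec[of _ "e / 2"])
  then obtain a where a: "a : carrier A"
   and "cmod (hip (T (dvec b)) (dvec c) - hip (gns_rep A a (dvec b)) (dvec c)) < e / 2"
   and "cmod (hip (T vac) (dvec (c \<otimes> star A b)) - hip (gns_rep A a vac) (dvec (c \<otimes> star A b))) < e / 2"
   by auto
  moreover have "hip (gns_rep A a (dvec b)) (dvec c) = hip (gns_rep A a vac) (dvec (c \<otimes> star A b))"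
   using a bc by (simp add: gns_rep_dense ip_mult_right)
  ultimately show ?thesis
   using norm_triangle_ineq4[of "hip (T (dvec b)) (dvec c) - hip (gns_rep A a (dvec b)) (dvec c)"
     "hip (T vac) (dvec (c \<otimes> star A b)) - hip (gns_rep A a vac) (dvec (c \<otimes> star A b))"]
   by simp
 qed
 hence "cmod ?D <= 0" using field_le_epsilon[of "cmod ?D" 0] by simp
 thus "hip (T (dvec b)) (dvec c) = hip (T vac) (dvec (c \<otimes> star A b))" by simp
qed

lemma gns_rep_right_modular:
 assumes a: "a : carrier A" shows "gns_rep A a : rmod"
proof -
 obtain K where K: "0 < K" "!!b. b : carrier A ==> tn (a \<otimes> b) <= K * tn b"
  using left_bddE[OF a] by blast
 have "gns_rep A a : bounded_operators GA"
 proof (rule bopI[where K = K])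
  show "gns_rep A a : extensional (Hs)" by (simp add: gns_rep_def)
  fix xi assume "xi : Hs"
  then obtain x where x: "x : gns_cauchy A" "xi = gns_vec A x" by (auto simp: gns_carrier)
  thus "gns_rep A a xi : Hs" using a by (simp add: gns_rep_vec cauchy_mult)
  show "Hi.nm (gns_rep A a xi) <= K * Hi.nm xi"
   using x a gns_nm[OF cauchy_mult[OF a x(1)]] tendsto_mult_left[OF gns_nm[OF x(1)], of K] K(2) gns_cauchyD[OF x(1)]
   by (auto simp: gns_rep_vec intro!: LIMSEQ_le[of "%n. tn (a \<otimes> x n)" _ "%n. K * tn (x n)"])
  fix c
  show "gns_rep A a (vscale GA c xi) = vscale GA c (gns_rep A a xi)"
   using x a gns_cauchyD[OF x(1)] by (simp add: gns_vscale gns_rep_vec cauchy_mult cauchy_scl smult_mult_right)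
  fix et assume "et : Hs"
  then obtain y where y: "y : gns_cauchy A" "et = gns_vec A y" by (auto simp: gns_carrier)
  show "gns_rep A a (vadd GA xi et) = vadd GA (gns_rep A a xi) (gns_rep A a et)"
   using x y a gns_cauchyD[OF x(1)] gns_cauchyD[OF y(1)]
   by (simp add: gns_vadd gns_rep_vec cauchy_mult cauchy_add r_distr)
 qed
 thus ?thesis using a by (simp add: rmod_def gns_rep_dense ip_mult_right)
qed

lemma gns_rep_compose:
 assumes "a : carrier A" "b : carrier A"
 shows "compose (Hs) (gns_rep A a) (gns_rep A b) = gns_rep A (a \<otimes> b)"
proof
 fix xi show "compose (Hs) (gns_rep A a) (gns_rep A b) xi = gns_rep A (a \<otimes> b) xi"
 proof (cases "xi : Hs")
  case True
  then obtain x where x: "x : gns_cauchy A" "xi = gns_vec A x" by (auto simp: gns_carrier)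
  thus ?thesis using assms gns_cauchyD[OF x(1)] by (simp add: compose_def gns_rep_vec cauchy_mult m_assoc)
 qed (simp add: compose_def gns_rep_def)
qed

lemma gns_rep_one: "gns_rep A \<one> = (\<lambda>xi\<in>Hs. xi)"
proof
 fix xi show "gns_rep A \<one> xi = (\<lambda>xi\<in>Hs. xi) xi"
 proof (cases "xi : Hs")
  case True
  then obtain x where x: "x : gns_cauchy A" "xi = gns_vec A x" by (auto simp: gns_carrier)
  thus ?thesis using gns_cauchyD[OF x(1)] by (simp add: gns_rep_vec)
 qed (simp add: gns_rep_def)
qed

text \<open>Both sides are bounded functionals of \<open>xi\<close> that agree on a dense set;
  \<open>M\<close> bounds their difference.\<close>

lemma adjoint_extend:
 assumes T: "T : bounded_operators GA"
  and et: "et : Hs" and ze: "ze : Hs"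
  and eq: "!!b. b : carrier A ==> hip (T (dvec b)) et = hip (dvec b) ze"
  and xi: "xi : Hs"
 shows "hip (T xi) et = hip xi ze"
proof -
 obtain K where K: "1 <= K" "!!xi. xi : Hs ==> Hi.nm (T xi) <= K * Hi.nm xi"
  using bopE[OF T] by blast
 define M where "M = K * Hi.nm et + Hi.nm ze + 1"
 have M: "0 < M" using K et ze by (simp add: M_def add_nonneg_pos)
 have "cmod (hip (T xi) et - hip xi ze) <= e" if e: "0 < e" for e :: real
 proof -
  obtain b where b: "b : carrier A" "Hi.nm (Hi.sb xi (dvec b)) < e / M"
   using gns_dense[OF xi, of "e / M"] e M by auto
  let ?d = "Hi.sb xi (dvec b)"
  have d: "?d : Hs" using b xi by simp
  have "hip (T xi) et - hip xi ze = hip (T ?d) et - hip ?d ze"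
   using eq[OF b(1)] b(1) xi et ze by (simp add: bopD[OF T])
  also have "cmod ... <= cmod (hip (T ?d) et) + cmod (hip ?d ze)" by (rule norm_triangle_ineq4)
  also have "... <= Hi.nm (T ?d) * Hi.nm et + Hi.nm ?d * Hi.nm ze"
   by (intro add_mono Hi.cauchy_schwarz) (use d et ze in \<open>auto simp: bopD[OF T]\<close>)
  also have "... <= (K * Hi.nm ?d) * Hi.nm et + Hi.nm ?d * Hi.nm ze"
   by (intro add_mono mult_right_mono K d order_refl) (use et in auto)
  also have "... <= Hi.nm ?d * M" using d by (simp add: M_def algebra_simps)
  also have "... <= e" using b(2) M by (simp add: field_simps)
  finally show ?thesis .
 qed
 hence "cmod (hip (T xi) et - hip xi ze) <= 0"
  using field_le_epsilon[of "cmod (hip (T xi) et - hip xi ze)" 0] by simp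
 thus ?thesis by simp
qed

text \<open>If \<open>T vac\<close> is the limit of \<open>a n\<close>, the adjoint must send
  \<open>dvec c\<close> to the limit of \<open>star A (a n) \<otimes> c\<close>. This sequence is
  Cauchy because the star is isometric for the 2-norm and right multiplication by \<open>c\<close>
  is bounded.\<close>

lemma adjoint_exists_dense:
 assumes T: "T : rmod" and c: "c : carrier A"
 obtains ze where "ze : Hs"
  "!!xi. xi : Hs ==> hip (T xi) (dvec c) = hip xi ze"
proof -
 note Tb = rmodD(1)[OF T]
 have "T vac : Hs" by (simp add: bopD[OF Tb])
 then obtain a where a: "a : gns_cauchy A" "T vac = gns_vec A a" by (auto simp: gns_carrier)
 note d = gns_cauchyD[OF a(1)]
 obtain K where K: "0 < K" "!!b. b : carrier A ==> tn (b \<otimes> c) <= K * tn b"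
  using right_bddE[OF c] by blast
 define z where "z n = star A (a n) \<otimes> c" for n
 have zc: "z : gns_cauchy A"
  unfolding gns_cauchy_iff
 proof (intro conjI allI impI)
  fix e :: real assume "0 < e"
  hence e: "0 < e / K" using K by simp
  obtain N where N: "!!m n. m >= N ==> n >= N ==> tn (Ai.sb (a m) (a n)) < e / K"
   using a(1) e unfolding gns_cauchy_iff by meson
  show "EX N. ALL m>=N. ALL n>=N. tn (Ai.sb (z m) (z n)) < e"
  proof (intro exI[of _ N] allI impI)
   fix m n assume mn: "N <= m" "N <= n"
   have "Ai.sb (z m) (z n) = star A (Ai.sb (a m) (a n)) \<otimes> c"
    using d c by (simp add: z_def star_sb sb_mult)
   hence "tn (Ai.sb (z m) (z n)) <= K * tn (Ai.sb (a m) (a n))"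
    using K(2)[of "star A (Ai.sb (a m) (a n))"] d nm_star[of "Ai.sb (a m) (a n)"] by simp
   also have "... < e" using N[OF mn] K(1) by (simp add: field_simps)
   finally show "tn (Ai.sb (z m) (z n)) < e" .
  qed
 qed (use d c in \<open>auto simp: z_def\<close>)
 have "hip (T (dvec b)) (dvec c) = hip (dvec b) (gns_vec A z)" if b: "b : carrier A" for b
 proof -
  have "(%n. trace_inner A (a n) (c \<otimes> star A b)) ----> hip (T vac) (dvec (c \<otimes> star A b))"
   unfolding a(2) dvec_def[of "c \<otimes> star A b"] using a(1) b c by (intro gns_inner) auto
  moreover have "(%n. trace_inner A b (z n)) ----> hip (dvec b) (gns_vec A z)"
   unfolding dvec_def using zc b by (intro gns_inner) auto
  moreover have "trace_inner A (a n) (c \<otimes> star A b) = trace_inner A b (z n)" for n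
   using b c d by (simp add: z_def flip: ip_mult_right) (simp add: ip_mult_left)
  ultimately show ?thesis using rmodD(2)[OF T b c] LIMSEQ_unique by auto
 qed
 hence "hip (T xi) (dvec c) = hip xi (gns_vec A z)" if "xi : Hs" for xi
  using adjoint_extend[OF Tb _ _ _ that] zc c by simp
 thus ?thesis using that[of "gns_vec A z"] zc by simp
qed

text \<open>The adjoint vectors of dense vectors converge by completeness. The Lipschitz bound
  \<open>bd\<close> comes from pairing the difference of two of them with itself.\<close>

lemma adjoint_exists:
 assumes T: "T : rmod" and et: "et : Hs"
 obtains ze where "ze : Hs" "!!xi. xi : Hs ==> hip (T xi) et = hip xi ze"
proof -
 note Tb = rmodD(1)[OF T]
 obtain K where K: "1 <= K" "!!xi. xi : Hs ==> Hi.nm (T xi) <= K * Hi.nm xi"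
  using bopE[OF Tb] by blast
 obtain c where c: "c : gns_cauchy A" "et = gns_vec A c" using et by (auto simp: gns_carrier)
 note d = gns_cauchyD[OF c(1)]
 have "EX ze. ze : Hs & (ALL xi:Hs. hip (T xi) (dvec (c n)) = hip xi ze)" for n
  by (rule adjoint_exists_dense[OF T d[of n]]) blast
 then obtain Z where Z: "!!n. Z n : Hs"
  "!!n xi. xi : Hs ==> hip (T xi) (dvec (c n)) = hip xi (Z n)" by metis
 have bd: "Hi.nm (Hi.sb (Z m) (Z n)) <= K * tn (Ai.sb (c m) (c n))" for m n
 proof -
  let ?w = "Hi.sb (Z m) (Z n)"
  have w: "?w : Hs" using Z by simp
  have "cr ((Hi.nm ?w)^2) = hip ?w ?w" using w by (simp add: Hi.ip_self del: Hi.ip_sb Hi.ip_sb_right)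
  also have "... = hip ?w (Z m) - hip ?w (Z n)" using Z(1) w by (simp del: Hi.ip_sb)
  also have "... = hip (T ?w) (Hi.sb (dvec (c m)) (dvec (c n)))"
   using Z(2)[OF w] w d by (simp add: bopD(1)[OF Tb])
  also have "... = hip (T ?w) (dvec (Ai.sb (c m) (c n)))" using d by (simp add: dense_sb)
  finally have "(Hi.nm ?w)^2 <= cmod (hip (T ?w) (dvec (Ai.sb (c m) (c n))))"
   by (metis norm_of_real abs_ge_self)
  also have "... <= Hi.nm (T ?w) * Hi.nm (dvec (Ai.sb (c m) (c n)))"
   using w d by (intro Hi.cauchy_schwarz) (auto simp: bopD(1)[OF Tb])
  also have "... <= (K * Hi.nm ?w) * tn (Ai.sb (c m) (c n))"
   using K(2)[OF w] d by (simp add: mult_right_mono)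
  finally have *: "Hi.nm ?w * Hi.nm ?w <= Hi.nm ?w * (K * tn (Ai.sb (c m) (c n)))"
   by (simp add: power2_eq_square mult_ac)
  show ?thesis
  proof (cases "Hi.nm ?w = 0")
   case True
   thus ?thesis using K(1) d by simp
  next
   case False
   hence "0 < Hi.nm ?w" using Hi.nm_nonneg[OF w] by linarith
   thus ?thesis using * by simp
  qed
 qed
 have cau: "EX N. ALL m>=N. ALL n>=N. Hi.nm (Hi.sb (Z m) (Z n)) < e" if "0 < e" for e
 proof -
  have "0 < e / K" using that K by simp
  then obtain N where N: "!!m n. m >= N ==> n >= N ==> tn (Ai.sb (c m) (c n)) < e / K"
   using c(1) unfolding gns_cauchy_iff by meson
  have "Hi.nm (Hi.sb (Z m) (Z n)) < e" if mn: "N <= m" "N <= n" for m n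
  proof -
   have "K * tn (Ai.sb (c m) (c n)) < e" using N[OF mn] K(1) by (simp add: field_simps)
   thus ?thesis using bd[of m n] by linarith
  qed
  thus ?thesis by blast
 qed
 obtain ze where ze: "ze : Hs" "(%n. Hi.nm (Hi.sb (Z n) ze)) ----> 0"
  by (rule gns_complete[of Z, OF Z(1) cau])
 have "hip (T xi) et = hip xi ze" if xi: "xi : Hs" for xi
 proof -
  have cont: "(%n. hip al (v n)) ----> hip al be"
   if "al : Hs" "!!n. v n : Hs" "be : Hs"
    "(%n. Hi.nm (Hi.sb (v n) be)) ----> 0" for al be v
  proof -
   have "(%n. hip al (v n) - hip al be) ----> 0"
   proof (rule Lim_null_comparison[OF always_eventually])
    show "ALL n. norm (hip al (v n) - hip al be) <= Hi.nm al * Hi.nm (Hi.sb (v n) be)"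
     using Hi.cauchy_schwarz[of al "Hi.sb (v _) be"] that by simp
    show "(%n. Hi.nm al * Hi.nm (Hi.sb (v n) be)) ----> 0" by (rule tendsto_mult_right_zero[OF that(4)])
   qed
   thus ?thesis by (simp add: LIM_zero_iff)
  qed
  have "(%n. Hi.nm (Hi.sb (dvec (c n)) et)) ----> 0"
   using gns_approx[OF c(1)] d et c(2) Hi.nm_sb_commute by simp
  hence "(%n. hip (T xi) (dvec (c n))) ----> hip (T xi) et"
   using xi et d by (intro cont) (auto simp: bopD(1)[OF Tb])
  moreover have "(%n. hip xi (Z n)) ----> hip xi ze" using xi ze Z by (intro cont) auto
  ultimately show ?thesis using Z(2)[OF xi] LIMSEQ_unique by auto
 qed
 thus ?thesis using that ze by blast
qed

text \<open>\<open>operator_adjoint\<close> is a definite description: existence comes from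
  \<open>adjoint_exists\<close>, uniqueness from the density of the vectors \<open>dvec b\<close>.
  That the adjoint is again right modular keeps all further arguments inside
  \<open>rmod\<close>.\<close>

lemma operator_adjoint:
 assumes T: "T : rmod"
 shows "operator_adjoint GA T : rmod"
  and "xi : Hs ==> et : Hs ==>
   hip (T xi) et = hip xi (operator_adjoint GA T et)"
proof -
 let ?H = "Hs"
 note Tb = rmodD(1)[OF T]
 obtain K where K: "1 <= K" "!!xi. xi : ?H ==> Hi.nm (T xi) <= K * Hi.nm xi"
  using bopE[OF Tb] by blast
 have uniq: "ze = ze'" if "ze : ?H" "ze' : ?H" "!!xi. xi : ?H ==> hip xi ze = hip xi ze'" for ze ze'
  by (rule hip_eqI) (use that Hi.ip_cnj[of "dvec _"] in simp_all)
 have "EX ze. ze : ?H & (ALL xi:?H. hip (T xi) et = hip xi ze)" if "et : ?H" for et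
  by (rule adjoint_exists[OF T that]) blast
 then obtain S0 where S0: "!!et. et : ?H ==> S0 et : ?H"
  "!!xi et. xi : ?H ==> et : ?H ==> hip (T xi) et = hip xi (S0 et)" by metis
 define S where "S = restrict S0 ?H"
 have S: "S et : ?H" "xi : ?H ==> hip xi (S et) = hip (T xi) et" if "et : ?H" for xi et
  using S0 that by (auto simp: S_def)
 note Tc = bopD(1)[OF Tb]
 have Sb: "S : bounded_operators GA"
 proof (rule bopI[where K = K])
  show "S : extensional ?H" by (simp add: S_def)
  fix xi assume xi: "xi : ?H"
  show "S xi : ?H" using S xi by simp
  show "S (vscale GA c xi) = vscale GA c (S xi)" for c
   by (rule uniq) (use xi S Tc in auto)
  show "S (vadd GA xi et) = vadd GA (S xi) (S et)" if "et : ?H" for et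
   by (rule uniq) (use xi S that Tc in auto)
  have "(Hi.nm (S xi))^2 = cmod (hip (T (S xi)) xi)"
   using S[OF xi] by (metis Hi.ip_self norm_of_real abs_of_nonneg zero_le_power2)
  also have "... <= Hi.nm (T (S xi)) * Hi.nm xi" using S xi Tc by (intro Hi.cauchy_schwarz) auto
  also have "... <= (K * Hi.nm (S xi)) * Hi.nm xi" using S xi K by (intro mult_right_mono) auto
  finally have *: "Hi.nm (S xi) * Hi.nm (S xi) <= Hi.nm (S xi) * (K * Hi.nm xi)" by (simp add: power2_eq_square mult_ac)
  show "Hi.nm (S xi) <= K * Hi.nm xi"
  proof (cases "Hi.nm (S xi) = 0")
   case True
   thus ?thesis using K(1) xi by simp
  next
   case False
   hence "0 < Hi.nm (S xi)" using Hi.nm_nonneg[OF S(1)[OF xi]] by linarith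
   thus ?thesis using * by simp
  qed
 qed
 have "operator_adjoint GA T = S"
  unfolding operator_adjoint_def
 proof (rule the_equality)
  show "S : bounded_operators GA & (ALL xi:?H. ALL et:?H. hip (T xi) et = hip xi (S et))"
   using Sb S by auto
  fix S' assume S': "S' : bounded_operators GA & (ALL xi:?H. ALL et:?H. hip (T xi) et = hip xi (S' et))"
  hence S'b: "S' : bounded_operators GA" by blast
  show "S' = S"
  proof (rule extensionalityI[OF bopD(5)[OF S'b]])
   show "S : extensional ?H" by (simp add: S_def)
   fix et assume et: "et : ?H"
   show "S' et = S et"
    by (rule uniq) (use S' et S bopD(1)[OF S'b] in auto)
  qed
 qed
 moreover have "S : rmod"
  unfolding rmod_def
 proof (intro CollectI conjI ballI Sb)
  fix b c assume bc: "b : carrier A" "c : carrier A"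
  have "hip (S (dvec b)) (dvec c) = cnj (hip (T (dvec c)) (dvec b))"
   using S(2)[OF dense_in[OF bc(1)] dense_in[OF bc(2)]] S(1)[OF dense_in[OF bc(1)]] bc Hi.ip_cnj[of "dvec c" "S (dvec b)"] by simp
  also have "... = cnj (hip (T vac) (dvec (b \<otimes> star A c)))"
   using rmodD(2)[OF T bc(2,1)] by simp
  also have "... = cnj (hip (T (dvec (c \<otimes> star A b))) vac)"
   using rmodD(2)[OF T, of "c \<otimes> star A b" \<one>] bc by (simp add: star_mult)
  also have "... = hip (S vac) (dvec (c \<otimes> star A b))"
   using S(2)[OF dense_in[OF one_closed] dense_in[of "c \<otimes> star A b"]] S(1)[OF dense_in[OF one_closed]] bc Hi.ip_cnj[of "dvec (c \<otimes> star A b)" "S vac"] by simp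
  finally show "hip (S (dvec b)) (dvec c) = hip (S vac) (dvec (c \<otimes> star A b))" .
 qed
 ultimately show "operator_adjoint GA T : rmod"
  and "xi : ?H ==> et : ?H ==> hip (T xi) et = hip xi (operator_adjoint GA T et)"
  using S by auto
qed

lemma adjoint_gns_rep:
 assumes a: "a : carrier A"
 shows "operator_adjoint GA (gns_rep A a) = gns_rep A (star A a)"
proof (rule extensionalityI)
 let ?T = "gns_rep A a" and ?S = "operator_adjoint GA (gns_rep A a)"
 let ?H = "Hs"
 note T = gns_rep_right_modular[OF a]
 note R = gns_rep_right_modular[OF star_closed[OF a]]
 note Sb = rmodD(1)[OF operator_adjoint(1)[OF T]]
 show "?S : extensional ?H" by (rule bopD(5)[OF Sb])
 show "gns_rep A (star A a) : extensional ?H" by (simp add: gns_rep_def)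
 fix xi assume xi: "xi : ?H"
 show "?S xi = gns_rep A (star A a) xi"
 proof (rule hip_eqI)
  show c: "?S xi : ?H" "gns_rep A (star A a) xi : ?H"
   using xi bopD(1)[OF Sb] bopD(1)[OF rmodD(1)[OF R]] by auto
  fix b assume b: "b : carrier A"
  have "hip (?S xi) (dvec b) = cnj (hip (dvec (a \<otimes> b)) xi)"
   using operator_adjoint(2)[OF T, of "dvec b" xi] a b xi c Hi.ip_cnj[of "dvec b" "?S xi"]
   by (simp add: gns_rep_dense)
  also have "... = hip xi (dvec (a \<otimes> b))" using a b xi Hi.ip_cnj[of "dvec (a \<otimes> b)" xi] by simp
  also have "... = hip (gns_rep A (star A a) xi) (dvec b)"
   by (rule adjoint_extend[OF rmodD(1)[OF R], symmetric])
    (use a b xi in \<open>auto simp: gns_rep_dense ip_mult_left\<close>)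
  finally show "hip (?S xi) (dvec b) = hip (gns_rep A (star A a) xi) (dvec b)" .
 qed
qed

text \<open>Paired with \<open>c\<close>, the vector T b - a b equals T 1 - a paired with
  \<open>c \<otimes> star A b\<close>. So the values of \<open>T\<close> are controlled by
  approximants of the single vector \<open>T vac\<close>, at the price of the bound \<open>K\<close>
  for right multiplication, which has to be known only on the dense set \<open>W\<close>.\<close>

lemma rmod_mult_close:
 assumes T: "T : rmod" and a: "a : carrier A" and b: "b : carrier A"
  and "W <= carrier A" "!!a e. a : carrier A ==> 0 < e ==> EX w:W. tn (Ai.sb a w) < e"
  and K: "0 <= K" "!!c. c : W ==> tn (c \<otimes> star A b) <= K * tn c"
 shows "Hi.nm (Hi.sb (T (dvec b)) (dvec (a \<otimes> b))) <= K * Hi.nm (Hi.sb (T vac) (dvec a))"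
proof (rule hnm_le[where W = W])
 note Tb = rmodD(1)[OF T]
 let ?d = "Hi.sb (T vac) (dvec a)"
 have d: "?d : Hs" using a by (simp add: bopD(1)[OF Tb])
 show "0 <= K * Hi.nm ?d" using K d by simp
 fix c assume c: "c : W"
 hence cA: "c : carrier A" using assms by auto
 have "hip (Hi.sb (T (dvec b)) (dvec (a \<otimes> b))) (dvec c) = hip ?d (dvec (c \<otimes> star A b))"
  using rmodD(2)[OF T b cA] a b cA by (simp add: bopD(1)[OF Tb] ip_mult_right)
 also have "cmod ... <= Hi.nm ?d * tn (c \<otimes> star A b)"
  using Hi.cauchy_schwarz[OF d, of "dvec (c \<otimes> star A b)"] b cA by simp
 also have "... <= Hi.nm ?d * (K * tn c)" using d K(2)[OF c] by (intro mult_left_mono) auto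
 finally show "cmod (hip (Hi.sb (T (dvec b)) (dvec (a \<otimes> b))) (dvec c)) <= K * Hi.nm ?d * tn c"
  by (simp add: mult_ac)
qed (use assms bopD(1)[OF rmodD(1)[OF T]] in auto)

text \<open>By traciality the star moves to the test element up to conjugation, and it preserves the
  2-norm of the test element.\<close>

lemma adjoint_close:
 assumes T: "T : rmod" and a: "a : carrier A"
 shows "Hi.nm (Hi.sb (operator_adjoint GA T vac) (dvec (star A a)))
  <= Hi.nm (Hi.sb (T vac) (dvec a))"
proof (rule hnm_le[where W = "carrier A"])
 note Tb = rmodD(1)[OF T] and S = operator_adjoint[OF T]
 let ?S = "operator_adjoint GA T"
 note Sb = rmodD(1)[OF S(1)]
 let ?d = "Hi.sb (T vac) (dvec a)"
 have d: "?d : Hs" using a by (simp add: bopD(1)[OF Tb])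
 show "Hi.sb (?S vac) (dvec (star A a)) : Hs"
  using a by (simp add: bopD(1)[OF Sb])
 show "0 <= Hi.nm ?d" using d by simp
 fix c assume c: "c : carrier A"
 have "hip (?S vac) (dvec c) = cnj (hip (T (dvec c)) vac)"
  using S(2)[of "dvec c" "vac"] c Hi.ip_cnj[of "dvec c" "?S vac"]
  by (simp add: bopD(1)[OF Sb])
 also have "hip (T (dvec c)) vac = hip (T vac) (dvec (star A c))"
  using rmodD(2)[OF T c, of \<one>] c by simp
 finally have 1: "hip (?S vac) (dvec c) = cnj (hip (T vac) (dvec (star A c)))" .
 have 2: "trace_inner A (star A a) c = cnj (trace_inner A a (star A c))"
  using a c trace_star[of "c \<otimes> a"] trace_commute[of "star A c" "star A a"] by (simp add: trace_inner_def star_mult)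
 have "hip (Hi.sb (?S vac) (dvec (star A a))) (dvec c) = cnj (hip ?d (dvec (star A c)))"
  using a c 1 2 by (simp add: bopD(1)[OF Tb] bopD(1)[OF Sb])
 hence "cmod (hip (Hi.sb (?S vac) (dvec (star A a))) (dvec c)) = cmod (hip ?d (dvec (star A c)))"
  by simp
 also have "... <= Hi.nm ?d * tn c"
  using Hi.cauchy_schwarz[OF d, of "dvec (star A c)"] c by (simp add: nm_star)
 finally show "cmod (hip (Hi.sb (?S vac) (dvec (star A a))) (dvec c)) <= Hi.nm ?d * tn c" .
qed (auto intro!: bexI)

end

section \<open>Extension to the weak closure\<close>

text \<open>Diagonal choice: at index \<open>k\<close> one \<open>x\<close> satisfies as many
  initial conditions as possible, but at most \<open>k\<close> of them, so that the maximum
  \<open>N k\<close> exists. Since \<open>F\<close> refines \<open>sequentially\<close>,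
  \<open>N k\<close> eventually exceeds every \<open>j\<close>. The condition \<open>Q\<close> alone
  is the case of no conditions.\<close>

lemma filter_saturation:
 fixes P :: "nat => nat => 'x => bool" and Q :: "nat => 'x => bool"
 assumes F: "F <= sequentially"
  and Q: "!!k. EX x. Q k x"
  and P: "!!J. eventually (%k. EX x. Q k x & (ALL j<=J. P j k x)) F"
 obtains x where "!!k. Q k (x k)" "!!j. eventually (%k. P j k (x k)) F"
proof -
 define ok where "ok k J x <-> Q k x & (ALL j<J. P j k x)" for k J x
 define N where "N k = (GREATEST J. J <= k & (EX x. ok k J x))" for k
 have ex: "EX x. ok k (N k) x" for k
 proof -
  have "0 <= k & (EX x. ok k 0 x)" using Q by (auto simp: ok_def)
  hence "N k <= k & (EX x. ok k (N k) x)"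
   unfolding N_def by (rule GreatestI_nat[where b = k]) auto
  thus ?thesis by blast
 qed
 define x where "x k = (SOME x. ok k (N k) x)" for k
 have x: "ok k (N k) (x k)" for k unfolding x_def by (rule someI_ex[OF ex])
 have "eventually (%k. P j k (x k)) F" for j
 proof -
  have "eventually (%k. Suc j <= k) F" using F by (auto simp: le_filter_def eventually_ge_at_top)
  thus ?thesis using P[of j]
  proof eventually_elim
   case (elim k)
   hence "Suc j <= k & (EX x. ok k (Suc j) x)" by (auto simp: ok_def less_Suc_eq_le)
   hence "Suc j <= N k" unfolding N_def by (rule Greatest_le_nat[where b = k]) auto
   thus ?case using x[of k] by (auto simp: ok_def)
  qed
 qed
 thus ?thesis using that x by (auto simp: ok_def)
qed

section \<open>Representatives in the tracial ultraproduct\<close>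

lemma bounded_mat_seqs_carrier: "x : bounded_mat_seqs n ==> x k : MT (n k)"
 by (simp add: bounded_mat_seqs_def)

lemma bounded_mat_seqsE:
 assumes "x : bounded_mat_seqs n" obtains C where "1 <= C" "!!k. op_bdd (n k) C (x k)"
proof -
 obtain C where C: "!!k. op_bdd (n k) C (x k)" using assms by (auto simp: bounded_mat_seqs_iff)
 hence "op_bdd (n k) (max C 1) (x k)" for k by (rule op_bdd_mono) simp
 thus ?thesis using that[of "max C 1"] by simp
qed

lemma bounded_mat_seqs_mult: "x : bounded_mat_seqs n ==> y : bounded_mat_seqs n ==> (%k. x k * y k) : bounded_mat_seqs n"
 by (auto simp: bounded_mat_seqs_iff intro: op_bdd_mult)

lemma bounded_mat_seqs_add: "x : bounded_mat_seqs n ==> y : bounded_mat_seqs n ==> (%k. x k + y k) : bounded_mat_seqs n"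
 by (auto simp: bounded_mat_seqs_iff intro: op_bdd_add)

lemma bounded_mat_seqs_smult: "x : bounded_mat_seqs n ==> (%k. c \<cdot>\<^sub>m x k) : bounded_mat_seqs n"
 by (auto simp: bounded_mat_seqs_iff intro: op_bdd_smult)

lemma bounded_mat_seqs_adjoint: "x : bounded_mat_seqs n ==> (%k. adj (x k)) : bounded_mat_seqs n"
 by (auto simp: bounded_mat_seqs_iff intro: op_bdd_adjoint)

lemma bounded_mat_seqs_one: "(%k. 1\<^sub>m (n k)) : bounded_mat_seqs n"
 by (auto simp: bounded_mat_seqs_iff intro: op_bdd_one)

lemma tendsto_norm2_zero_iff:
 assumes "!!k. x k : MT (n k)" "!!k. y k : MT (n k)"
 shows "((%k. nm2 (x k - y k)) \<longlongrightarrow> 0) F <->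
  (ALL e>0. eventually (%k. nm2 (x k - y k) < e) F)"
proof -
 have "0 <= nm2 (x k - y k)" for k
  using assms by (intro mat_norm2_nonneg[of _ "n k"] minus_carrier_mat)
 thus ?thesis by (simp add: tendsto_iff dist_norm)
qed

lemma norm2_zero_trans:
 assumes "!!k. x k : MT (n k)" "!!k. y k : MT (n k)" "!!k. z k : MT (n k)"
  and xy: "((%k. nm2 (x k - y k)) \<longlongrightarrow> 0) F" and yz: "((%k. nm2 (y k - z k)) \<longlongrightarrow> 0) F"
 shows "((%k. nm2 (x k - z k)) \<longlongrightarrow> 0) F"
proof (rule tendsto_sandwich[OF always_eventually always_eventually tendsto_const])
 show "ALL k. nm2 (x k - z k) <= nm2 (x k - y k) + nm2 (y k - z k)"
  using assms by (auto intro!: mat_norm2_triangle)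
 show "((%k. nm2 (x k - y k) + nm2 (y k - z k)) \<longlongrightarrow> 0) F"
  using tendsto_add[OF xy yz] by simp
 show "ALL k. 0 <= nm2 (x k - z k)"
  using assms by (auto intro!: mat_norm2_nonneg minus_carrier_mat)
qed

lemma norm2_zero_sym:
 assumes "!!k. x k : MT (n k)" "!!k. y k : MT (n k)"
  and xy: "((%k. nm2 (x k - y k)) \<longlongrightarrow> 0) F"
 shows "((%k. nm2 (y k - x k)) \<longlongrightarrow> 0) F"
 using xy mat_norm2_minus_commute[OF assms(1,2)] by simp

lemma up_class_iff:
 "y : up_class om n x <-> y : bounded_mat_seqs n & ((%k. nm2 (x k - y k)) \<longlongrightarrow> 0) om"
 by (simp add: up_class_def)

lemma up_class_self: "x : bounded_mat_seqs n ==> x : up_class om n x"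
 using mat_norm2_self[OF bounded_mat_seqs_carrier[of x n]] by (simp add: up_class_iff)

lemma class_rep_up:
 assumes "x : bounded_mat_seqs n"
 shows "class_rep (up_class om n x) : bounded_mat_seqs n"
  and "((%k. nm2 (x k - class_rep (up_class om n x) k)) \<longlongrightarrow> 0) om"
proof -
 have "class_rep (up_class om n x) : up_class om n x"
  unfolding class_rep_def by (rule someI[of "%y. y : up_class om n x" x]) (rule up_class_self[OF assms])
 thus "class_rep (up_class om n x) : bounded_mat_seqs n"
  and "((%k. nm2 (x k - class_rep (up_class om n x) k)) \<longlongrightarrow> 0) om"
  by (auto simp: up_class_iff)
qed

lemma up_class_eqI:
 assumes x: "x : bounded_mat_seqs n" and y: "y : bounded_mat_seqs n"
  and xy: "((%k. nm2 (x k - y k)) \<longlongrightarrow> 0) om"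
 shows "up_class om n x = up_class om n y"
proof -
 note c = bounded_mat_seqs_carrier
 have "((%k. nm2 (x k - z k)) \<longlongrightarrow> 0) om <-> ((%k. nm2 (y k - z k)) \<longlongrightarrow> 0) om"
  if z: "z : bounded_mat_seqs n" for z
  using norm2_zero_trans[of x n y z, OF c[OF x] c[OF y] c[OF z] xy]
   norm2_zero_trans[of y n x z, OF c[OF y] c[OF x] c[OF z] norm2_zero_sym[of x n y, OF c[OF x] c[OF y] xy]]
  by blast
 thus ?thesis by (auto simp: up_class_iff)
qed

text \<open>\<open>R\<close> relates an element to the matrix sequences of all formal expressions
  for it, so it need not be single valued. Convergence of traces makes any two such sequences agree
  in 2-norm along \<open>om\<close>.\<close>

locale matrix_approx = tracial_alg A for A :: "'b tracial_star_alg" (structure) +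
 fixes om :: "nat filter" and n :: "nat => nat" and R :: "('b \<times> (nat => complex mat)) set"
 assumes omega_bot: "om ~= bot" and omega_seq: "om <= sequentially" and n_pos: "!!k. 0 < n k"
  and R_carrier: "(a, x) : R ==> a : carrier A"
  and R_bdd: "(a, x) : R ==> x : bounded_mat_seqs n"
  and R_one: "(\<one>, %k. 1\<^sub>m (n k)) : R"
  and R_add: "(a, x) : R ==> (b, y) : R ==> (a \<oplus> b, %k. x k + y k) : R"
  and R_smult: "(a, x) : R ==> (c \<odot> a, %k. c \<cdot>\<^sub>m x k) : R"
  and R_mult: "(a, x) : R ==> (b, y) : R ==> (a \<otimes> b, %k. x k * y k) : R"
  and R_star: "(a, x) : R ==> (star A a, %k. adj (x k)) : R"
  and R_trace: "(a, x) : R ==> ((%k. ntrace (x k)) \<longlongrightarrow> trace A a) om"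
  and R_dense: "a : carrier A ==> 0 < e ==> EX b y. (b, y) : R & tn (Ai.sb a b) < e"
begin

lemma R_mat: "(a, x) : R ==> x k : MT (n k)"
 using R_bdd bounded_mat_seqs_carrier by blast

lemma R_sb: "(a, x) : R ==> (b, y) : R ==> (Ai.sb a b, %k. x k - y k) : R"
proof -
 assume R: "(a, x) : R" "(b, y) : R"
 have "(%k. x k - y k) = (%k. x k + (-1) \<cdot>\<^sub>m y k)"
 proof
  fix k show "x k - y k = x k + (-1) \<cdot>\<^sub>m y k"
   using R_mat[OF R(1), of k] R_mat[OF R(2), of k] by (intro eq_matI) auto
 qed
 thus ?thesis using R_add[OF R(1) R_smult[OF R(2)]] by (simp add: Ai.sb_def)
qed

lemma R_norm: assumes "(a, x) : R" shows "((%k. nm2 (x k)) \<longlongrightarrow> tn a) om"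
 unfolding mat_norm2_def trace_norm2_def trace_inner_def
 by (intro tendsto_real_sqrt tendsto_Re R_trace R_mult R_star assms)

lemma R_dist: "(a, x) : R ==> (b, y) : R ==> ((%k. nm2 (x k - y k)) \<longlongrightarrow> tn (Ai.sb a b)) om"
 by (intro R_norm R_sb)

lemma R_fst_dense:
 assumes "a : carrier A" "0 < e" shows "EX w:fst ` R. tn (Ai.sb a w) < e"
proof -
 obtain b y where "(b, y) : R" "tn (Ai.sb a b) < e" using R_dense[OF assms] by blast
 thus ?thesis by (auto intro!: bexI[of _ "(b, y)"])
qed

lemma R_fst: "fst ` R <= carrier A"
 using R_carrier by auto

text \<open>A norm bound for the matrices of \<open>b\<close> passes to the 2-norm limit and so
  bounds right multiplication in the algebra. The limit is available for elements with matrices,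
  hence the restriction to the first components of \<open>R\<close>.\<close>

lemma R_mult_bound:
 assumes b: "(b, z) : R" and z: "!!k. op_bdd (n k) D (z k)" and c: "c : fst ` R"
 shows "tn (c \<otimes> star A b) <= D * tn c"
proof -
 obtain w where w: "(c, w) : R" using c by auto
 have "((%k. nm2 (w k * adj (z k))) \<longlongrightarrow> tn (c \<otimes> star A b)) om"
  by (intro R_norm R_mult R_star w b)
 moreover have "((%k. D * nm2 (w k)) \<longlongrightarrow> D * tn c) om"
  by (intro tendsto_mult_left R_norm w)
 moreover have "nm2 (w k * adj (z k)) <= D * nm2 (w k)" for k
  by (intro mat_norm2_mult_right[of "n k"] op_bdd_adjoint z R_mat[OF w])
 ultimately show ?thesis by (intro tendsto_le[OF omega_bot]) auto
qed

lemma R_mult_close: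
 assumes T: "T : rmod" and a: "a : carrier A"
  and b: "(b, z) : R" and z: "!!k. op_bdd (n k) D (z k)"
 shows "Hi.nm (Hi.sb (T (dvec b)) (dvec (a \<otimes> b))) <= D * Hi.nm (Hi.sb (T vac) (dvec a))"
 by (rule rmod_mult_close[OF T a R_carrier[OF b] R_fst R_fst_dense _ R_mult_bound[OF b z]])
  (use op_bddD(2)[OF z] in auto)

lemma R_ev:
 assumes "(h, x) : R" shows "EX b. (b, %k. ev (n k) (x k) p) : R"
proof (induction p)
 case 0
 have "(%k. 0 \<cdot>\<^sub>m 1\<^sub>m (n k)) = (%k. 0\<^sub>m (n k) (n k) :: complex mat)" by (intro ext eq_matI) auto
 thus ?case using R_smult[OF R_one, of 0] by auto
next
 case (pCons c p)
 then obtain b where b: "(b, %k. ev (n k) (x k) p) : R" by blast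
 show ?case
  using R_add[OF R_smult[OF R_one, of "cr c"] R_mult[OF assms b]]
  by (auto simp: ev_pCons[OF R_mat[OF assms]])
qed

text \<open>Let \<open>b\<close> be the element whose matrices are \<open>z\<close>. The expansion
  property gives 2 C |b| <= |a b| + de in 2-norm, while |a b| <= |T b| + de <= C |b| + de because
  \<open>T vac\<close> is close to \<open>a\<close> and \<open>z\<close> is a contraction. Hence |a
  b| < 4 de, and the matrices of a b are exactly what separates \<open>y\<close> from its truncation
  \<open>y * (1 - z)\<close>.\<close>

lemma truncation:
 assumes T: "T : rmod" and C: "1 <= C" "!!xi. xi : Hs ==> Hi.nm (T xi) <= C * Hi.nm xi"
  and a: "(a, y) : R" and de: "0 < de" "Hi.nm (Hi.sb (T vac) (dvec a)) < de"
 shows "EX x. (ALL k. op_bdd (n k) (4 * C) (x k)) & eventually (%k. nm2 (x k - y k) < 4 * de) om"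
proof -
 note Tb = rmodD(1)[OF T]
 obtain K where K: "1 <= K" "!!k. op_bdd (n k) K (y k)" using bounded_mat_seqsE[OF R_bdd[OF a]] by blast
 have "0 < K" "0 < C" using K C by auto
 then obtain q where q: "!!n y w z. op_bdd n K y ==> w = cr (1 / K) \<cdot>\<^sub>m y ==>
   z = ev n (adj w * w) q ==>
   op_bdd n 1 z & op_bdd n (4 * C) (y * (1\<^sub>m n - z)) \<and>
   4 * C^2 * (nm2 z)^2 <= (nm2 (y * z))^2 + de^2"
  using matrix_truncation[of K C de] de(1) by blast
 define w where "w k = cr (1 / K) \<cdot>\<^sub>m y k" for k
 define z where "z k = ev (n k) (adj (w k) * w k) q" for k
 have z: "op_bdd (n k) 1 (z k)" "op_bdd (n k) (4 * C) (y k * (1\<^sub>m (n k) - z k))"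
  "4 * C^2 * (nm2 (z k))^2 <= (nm2 (y k * z k))^2 + de^2" for k
  using q[OF K(2) w_def z_def] by blast+
 have wR: "(cr (1 / K) \<odot> a, w) : R" unfolding w_def by (rule R_smult[OF a])
 obtain b where b: "(b, z) : R"
  unfolding z_def using R_ev[OF R_mult[OF R_star[OF wR] wR]] by blast
 have aA: "a : carrier A" and bA: "b : carrier A" using R_carrier a b by auto
 have ab: "((%k. nm2 (y k * z k)) \<longlongrightarrow> tn (a \<otimes> b)) om" by (intro R_norm R_mult a b)
 have "4 * C^2 * (tn b)^2 <= (tn (a \<otimes> b))^2 + de^2"
 proof (rule tendsto_le[OF omega_bot _ _ always_eventually])
  show "((%k. 4 * C^2 * (nm2 (z k))^2) \<longlongrightarrow> 4 * C^2 * (tn b)^2) om"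
   by (intro tendsto_intros R_norm[OF b])
  show "((%k. (nm2 (y k * z k))^2 + de^2) \<longlongrightarrow> (tn (a \<otimes> b))^2 + de^2) om"
   by (intro tendsto_intros ab)
 qed (use z(3) in blast)
 also have "... <= (tn (a \<otimes> b) + de)^2" using de aA bA by (simp add: power2_sum)
 finally have "(2 * C * tn b)^2 <= (tn (a \<otimes> b) + de)^2" by (simp add: power_mult_distrib)
 hence 1: "2 * C * tn b <= tn (a \<otimes> b) + de"
  by (rule power2_le_imp_le) (use de aA bA in simp)
 have "tn (a \<otimes> b) = Hi.nm (dvec (a \<otimes> b))" using aA bA by simp
 also have "... <= Hi.nm (Hi.sb (dvec (a \<otimes> b)) (T (dvec b))) + Hi.nm (T (dvec b))"
  using aA bA by (intro Hi.nm_le_sb) (auto simp: bopD(1)[OF Tb])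
 also have "Hi.nm (Hi.sb (dvec (a \<otimes> b)) (T (dvec b))) = Hi.nm (Hi.sb (T (dvec b)) (dvec (a \<otimes> b)))"
  using aA bA by (intro Hi.nm_sb_commute) (auto simp: bopD(1)[OF Tb])
 also have "... <= 1 * Hi.nm (Hi.sb (T vac) (dvec a))" by (rule R_mult_close[OF T aA b z(1)])
 also have "... < de" using de by simp
 also have "Hi.nm (T (dvec b)) <= C * tn b" using C(2)[of "dvec b"] bA by simp
 finally have 2: "tn (a \<otimes> b) < de + C * tn b" by simp
 have "tn (a \<otimes> b) < 4 * de" using 1 2 de(1) by (simp add: mult.assoc)
 hence e: "eventually (%k. nm2 (y k * z k) < 4 * de) om" using ab by (simp add: order_tendstoD)
 have "nm2 (y k * (1\<^sub>m (n k) - z k) - y k) = nm2 (y k * z k)" for k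
 proof -
  note c = R_mat[OF a, of k] R_mat[OF b, of k]
  have yz: "y k * z k : MT (n k)" using c by auto
  have "y k * (1\<^sub>m (n k) - z k) = y k - y k * z k"
   using c by (simp add: mult_minus_distrib_mat[OF c(1) one_carrier_mat c(2)])
  hence "y k * (1\<^sub>m (n k) - z k) - y k = (-1) \<cdot>\<^sub>m (y k * z k)"
   using c yz by (intro eq_matI) auto
  thus ?thesis using mat_norm2_smult[OF yz, of "-1"] by simp
 qed
 thus ?thesis using e z(2) by (auto intro!: exI[of _ "%k. y k * (1\<^sub>m (n k) - z k)"])
qed

text \<open>The closure of \<open>R\<close> in the 2-norms of both sides. Boundedness of
  \<open>Y\<close> in norm is stated separately where it matters.\<close>

definition approx :: "(nat => complex mat) => (nat => 'b) set => bool" where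
 "approx Y xi <-> (ALL k. Y k : MT (n k)) \<and>
  (ALL e>0. EX a y. (a, y) : R & Hi.nm (Hi.sb xi (dvec a)) < e \<and>
    eventually (%k. nm2 (Y k - y k) < e) om)"

lemma approxE:
 assumes "approx Y xi" "0 < e"
 obtains a y where "(a, y) : R" "Hi.nm (Hi.sb xi (dvec a)) < e" "eventually (%k. nm2 (Y k - y k) < e) om"
 using assms unfolding approx_def by blast

lemma approx_mat: "approx Y xi ==> Y k : MT (n k)"
 by (simp add: approx_def)

lemma approx_R: assumes "(a, y) : R" shows "approx y (dvec a)"
 unfolding approx_def
 using R_mat[OF assms] R_carrier[OF assms] mat_norm2_self[OF R_mat[OF assms]]
 by (auto intro!: exI[of _ a] exI[of _ y] assms)

text \<open>Approximants of \<open>T vac\<close> at distances 2^-j are truncated one at a time with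
  the same norm bound; saturation then finds one bounded sequence close to all of them.\<close>

lemma approx_exists:
 assumes T: "T : rmod"
 shows "EX Y:bounded_mat_seqs n. approx Y (T vac)"
proof -
 note Tb = rmodD(1)[OF T]
 obtain C where C: "1 <= C" "!!xi. xi : Hs ==> Hi.nm (T xi) <= C * Hi.nm xi"
  using bopE[OF Tb] by blast
 define xi where "xi = T vac"
 have xi: "xi : Hs" by (simp add: xi_def bopD(1)[OF Tb])
 define de where "de j = (1 / 2 :: real) ^ j" for j :: nat
 have de: "0 < de j" for j by (simp add: de_def)
 have mono: "de i <= de j" if "j <= i" for i j using that by (simp add: de_def power_decreasing)
 have "EX a y. (a, y) : R & Hi.nm (Hi.sb xi (dvec a)) < de j" for j
 proof -
  have d2: "0 < de j / 2" using de by simp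
  obtain b where b: "b : carrier A" "Hi.nm (Hi.sb xi (dvec b)) < de j / 2"
   using gns_dense[OF xi d2] by blast
  obtain a y where a: "(a, y) : R" "tn (Ai.sb b a) < de j / 2" using R_dense[OF b(1) d2] by blast
  have "Hi.nm (Hi.sb xi (dvec a)) < de j"
   using Hi.nm_sb_triangle[of xi "dvec b" "dvec a"] a b R_carrier[OF a(1)] xi by (simp add: dense_sb)
  thus ?thesis using a by blast
 qed
 then obtain a y where a: "!!j. (a j, y j) : R" "!!j. Hi.nm (Hi.sb xi (dvec (a j))) < de j"
  by metis
 have aA: "a j : carrier A" for j using R_carrier a by blast
 have yy: "eventually (%k. nm2 (y i k - y j k) < 3 * de j) om" if ij: "j <= i" for i j
 proof -
  have "tn (Ai.sb (a i) (a j)) = Hi.nm (Hi.sb (dvec (a i)) (dvec (a j)))"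
   by (simp add: dense_sb aA)
  also have "... <= Hi.nm (Hi.sb (dvec (a i)) xi) + Hi.nm (Hi.sb xi (dvec (a j)))"
   using xi aA by (intro Hi.nm_sb_triangle) auto
  also have "... < de i + de j"
   using a(2)[of i] a(2)[of j] Hi.nm_sb_commute[OF xi dense_in[OF aA[of i]]] by simp
  also have "... <= 3 * de j" using mono[OF ij] de[of j] by simp
  finally show ?thesis using R_dist[OF a(1)[of i] a(1)[of j]] by (simp add: order_tendstoD)
 qed
 \<comment> \<open>7 = 4 + 3: truncation moves \<open>y J\<close> by less than
   \<open>4 * de J\<close>, and \<open>y J\<close> is within \<open>3 * de j\<close> of
   \<open>y j\<close> for \<open>j\<close> up to \<open>J\<close>. The bound \<open>4 * C\<close>
   does not depend on \<open>J\<close>.\<close>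
 have "eventually (%k. EX x. op_bdd (n k) (4 * C) x & (ALL j<=J. nm2 (x - y j k) < 7 * de j)) om" for J
 proof -
  obtain x where x: "!!k. op_bdd (n k) (4 * C) (x k)" "eventually (%k. nm2 (x k - y J k) < 4 * de J) om"
   using truncation[OF T C a(1)[of J] de[of J]] a(2)[of J] xi_def by blast
  have "eventually (%k. ALL j:{..J}. nm2 (y J k - y j k) < 3 * de j) om"
   by (intro eventually_ball_finite) (auto intro: yy)
  thus ?thesis using x(2)
  proof eventually_elim
   case (elim k)
   have "nm2 (x k - y j k) < 7 * de j" if "j <= J" for j
    using mat_norm2_triangle[OF op_bddD(1)[OF x(1)[of k]] R_mat[OF a(1)[of J]] R_mat[OF a(1)[of j]]]
     elim(2) elim(1)[THEN bspec, of j] mono[OF that] that by simp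
   thus ?case using x(1) by blast
  qed
 qed
 moreover have "EX x. op_bdd (n k) (4 * C) x" for k
  by (rule exI[of _ "1\<^sub>m (n k)"]) (rule op_bdd_mono[OF op_bdd_one], use C in simp)
 ultimately obtain x where x: "!!k. op_bdd (n k) (4 * C) (x k)"
  "!!j. eventually (%k. nm2 (x k - y j k) < 7 * de j) om"
  using filter_saturation[OF omega_seq, of "%k x. op_bdd (n k) (4 * C) x" "%j k x. nm2 (x - y j k) < 7 * de j"] by blast
 have "approx x xi"
  unfolding approx_def
 proof (intro conjI allI impI)
  show "x k : MT (n k)" for k using op_bddD(1)[OF x(1)] .
  fix e :: real assume e: "0 < e"
  then obtain j where j: "de j < e / 7" unfolding de_def using real_arch_pow_inv[of "e / 7" "1 / 2"] by auto
  have "eventually (%k. nm2 (x k - y j k) < e) om"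
   using x(2)[of j] by eventually_elim (use j in linarith)
  moreover have "Hi.nm (Hi.sb xi (dvec (a j))) < e" using a(2)[of j] j e by linarith
  ultimately show "EX a y. (a, y) : R & Hi.nm (Hi.sb xi (dvec a)) < e & eventually (%k. nm2 (x k - y k) < e) om"
   using a(1) by blast
 qed
 moreover have "x : bounded_mat_seqs n" using x(1) by (auto simp: bounded_mat_seqs_iff)
 ultimately show ?thesis unfolding xi_def by blast
qed

text \<open>Allows the passage to the representative that \<open>class_rep\<close> picks in the
  ultraproduct.\<close>

lemma approx_cong:
 assumes Y: "approx Y xi" and Y': "!!k. Y' k : MT (n k)"
  and lim: "((%k. nm2 (Y k - Y' k)) \<longlongrightarrow> 0) om"
 shows "approx Y' xi"
 unfolding approx_def
proof (intro conjI allI impI Y')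
 fix e :: real assume "0 < e"
 hence e: "0 < e / 2" by simp
 obtain a y where a: "(a, y) : R" "Hi.nm (Hi.sb xi (dvec a)) < e / 2"
  "eventually (%k. nm2 (Y k - y k) < e / 2) om" using approxE[OF Y e] .
 have "eventually (%k. nm2 (Y k - Y' k) < e / 2) om" using lim e by (rule order_tendstoD)
 hence "eventually (%k. nm2 (Y' k - y k) < e) om" using a(3)
 proof eventually_elim
  case (elim k)
  thus ?case
   using mat_norm2_triangle[OF Y'[of k] approx_mat[OF Y, of k] R_mat[OF a(1), of k]]
    mat_norm2_minus_commute[OF Y'[of k] approx_mat[OF Y, of k]] by simp
 qed
 thus "EX a y. (a, y) : R & Hi.nm (Hi.sb xi (dvec a)) < e & eventually (%k. nm2 (Y' k - y k) < e) om"
  using a e by (intro exI[of _ a] exI[of _ y]) auto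
qed

text \<open>Distances in the algebra are the limits of distances of the matrices, and two elements
  near \<open>xi\<close> are near each other. So a vector determines its class in the
  ultraproduct.\<close>

lemma approx_unique:
 assumes Y: "approx Y xi" and Y': "approx Y' xi" and xi: "xi : Hs"
 shows "((%k. nm2 (Y k - Y' k)) \<longlongrightarrow> 0) om"
 unfolding tendsto_norm2_zero_iff[of Y n Y', OF approx_mat[OF Y] approx_mat[OF Y']]
proof (intro allI impI)
 fix e :: real assume "0 < e"
 hence e: "0 < e / 4" by simp
 obtain a y where a: "(a, y) : R" "Hi.nm (Hi.sb xi (dvec a)) < e / 4"
  "eventually (%k. nm2 (Y k - y k) < e / 4) om" using approxE[OF Y e] .
 obtain b z where b: "(b, z) : R" "Hi.nm (Hi.sb xi (dvec b)) < e / 4"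
  "eventually (%k. nm2 (Y' k - z k) < e / 4) om" using approxE[OF Y' e] .
 have ab: "a : carrier A" "b : carrier A" using R_carrier a b by auto
 have "tn (Ai.sb a b) < e / 2"
  using Hi.nm_sb_triangle[of "dvec a" xi "dvec b"] Hi.nm_sb_commute[of xi "dvec a"] a(2) b(2) ab xi
  by (simp add: dense_sb)
 hence "eventually (%k. nm2 (y k - z k) < e / 2) om" by (rule order_tendstoD(2)[OF R_dist[OF a(1) b(1)]])
 thus "eventually (%k. nm2 (Y k - Y' k) < e) om" using a(3) b(3)
 proof eventually_elim
  case (elim k)
  note c = approx_mat[OF Y, of k] approx_mat[OF Y', of k] R_mat[OF a(1), of k] R_mat[OF b(1), of k]
  show ?case
   using mat_norm2_triangle[OF c(1,3,2)] mat_norm2_triangle[OF c(3,4,2)] mat_norm2_minus_commute[OF c(2,4)] elim by simp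
 qed
qed

lemma approx_add:
 assumes Y: "approx Y xi" and Y': "approx Y' xi'"
  and xi: "xi : Hs" "xi' : Hs"
 shows "approx (%k. Y k + Y' k) (vadd GA xi xi')"
 unfolding approx_def
proof (intro conjI allI impI)
 show "Y k + Y' k : MT (n k)" for k using approx_mat[OF Y] approx_mat[OF Y'] by auto
 fix e :: real assume "0 < e"
 hence e: "0 < e / 2" by simp
 obtain a y where a: "(a, y) : R" "Hi.nm (Hi.sb xi (dvec a)) < e / 2"
  "eventually (%k. nm2 (Y k - y k) < e / 2) om" using approxE[OF Y e] .
 obtain b z where b: "(b, z) : R" "Hi.nm (Hi.sb xi' (dvec b)) < e / 2"
  "eventually (%k. nm2 (Y' k - z k) < e / 2) om" using approxE[OF Y' e] .
 have ab: "a : carrier A" "b : carrier A" using R_carrier a b by auto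
 have "Hi.nm (Hi.sb (vadd GA xi xi') (dvec (a \<oplus> b))) < e"
  using Hi.nm_sb_add[of xi xi' "dvec a" "dvec b"] a(2) b(2) ab xi by (simp add: dense_add)
 moreover have "eventually (%k. nm2 ((Y k + Y' k) - (y k + z k)) < e) om" using a(3) b(3)
 proof eventually_elim
  case (elim k)
  note c = approx_mat[OF Y, of k] approx_mat[OF Y', of k] R_mat[OF a(1), of k] R_mat[OF b(1), of k]
  have "(Y k + Y' k) - (y k + z k) = (Y k - y k) + (Y' k - z k)" using c by (intro eq_matI) auto
  thus ?case using mat_norm2_add[of "Y k - y k" "n k" "Y' k - z k"] c elim by (simp add: minus_carrier_mat)
 qed
 ultimately show "EX a y. (a, y) : R & Hi.nm (Hi.sb (vadd GA xi xi') (dvec a)) < e \<and>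
   eventually (%k. nm2 (Y k + Y' k - y k) < e) om"
  using R_add[OF a(1) b(1)] by blast
qed

lemma approx_smult:
 assumes Y: "approx Y xi" and xi: "xi : Hs"
 shows "approx (%k. c \<cdot>\<^sub>m Y k) (vscale GA c xi)"
 unfolding approx_def
proof (intro conjI allI impI)
 show "c \<cdot>\<^sub>m Y k : MT (n k)" for k using approx_mat[OF Y] by auto
 fix e :: real assume e0: "0 < e"
 define M where "M = cmod c + 1"
 have M: "0 < M" by (simp add: M_def add_nonneg_pos)
 have e: "0 < e / M" using e0 M by simp
 have bd: "cmod c * t < e" if "0 <= t" "t < e / M" for t
 proof -
  have "cmod c * t <= M * t" using that by (intro mult_right_mono) (auto simp: M_def)
  also have "... < e" using that M by (simp add: field_simps)
  finally show ?thesis .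
 qed
 obtain a y where a: "(a, y) : R" "Hi.nm (Hi.sb xi (dvec a)) < e / M"
  "eventually (%k. nm2 (Y k - y k) < e / M) om" using approxE[OF Y e] .
 have aA: "a : carrier A" using R_carrier a by auto
 have "Hi.nm (Hi.sb (vscale GA c xi) (dvec (c \<odot> a))) < e"
  using Hi.nm_sb_scl[of xi "dvec a" c] a(2) aA xi by (simp add: dense_scl bd)
 moreover have "eventually (%k. nm2 (c \<cdot>\<^sub>m Y k - c \<cdot>\<^sub>m y k) < e) om" using a(3)
 proof eventually_elim
  case (elim k)
  note m = approx_mat[OF Y, of k] R_mat[OF a(1), of k]
  have d: "Y k - y k : MT (n k)" using m by (auto simp: minus_carrier_mat)
  have "c \<cdot>\<^sub>m Y k - c \<cdot>\<^sub>m y k = c \<cdot>\<^sub>m (Y k - y k)" using m by (intro eq_matI) (auto simp: algebra_simps)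
  thus ?case using mat_norm2_smult[OF d, of c] bd[OF mat_norm2_nonneg[OF d] elim] by simp
 qed
 ultimately show "EX a y. (a, y) : R & Hi.nm (Hi.sb (vscale GA c xi) (dvec a)) < e \<and>
   eventually (%k. nm2 (c \<cdot>\<^sub>m Y k - y k) < e) om"
  using R_smult[OF a(1)] by blast
qed

lemma approx_mult:
 assumes S: "S : rmod" and Y: "approx Y (S vac)" "Y : bounded_mat_seqs n"
  and Y': "approx Y' et" and et: "et : Hs"
 shows "approx (%k. Y k * Y' k) (S et)"
 unfolding approx_def
proof (intro conjI allI impI)
 note Sb = rmodD(1)[OF S]
 show "Y k * Y' k : MT (n k)" for k
  by (rule mult_carrier_mat[OF approx_mat[OF Y(1)] approx_mat[OF Y']])
 fix e :: real assume e: "0 < e"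
 obtain K where K: "1 <= K" "!!xi. xi : Hs ==> Hi.nm (S xi) <= K * Hi.nm xi"
  using bopE[OF Sb] by blast
 obtain C where C: "1 <= C" "!!k. op_bdd (n k) C (Y k)" using bounded_mat_seqsE[OF Y(2)] by blast
 define d where "d = e / (2 * (K + C))"
 have d: "0 < d" using e K C by (simp add: d_def)
 obtain b z where b: "(b, z) : R" "Hi.nm (Hi.sb et (dvec b)) < d"
  "eventually (%k. nm2 (Y' k - z k) < d) om" using approxE[OF Y' d] .
 obtain D where D: "1 <= D" "!!k. op_bdd (n k) D (z k)" using bounded_mat_seqsE[OF R_bdd[OF b(1)]] by blast
 \<comment> \<open>The order of choices matters: \<open>b\<close> and the norm bound
   \<open>D\<close> of its matrices are fixed first, then \<open>a\<close> is chosen with an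
   accuracy that depends on \<open>D\<close>.\<close>
 have d2: "0 < e / (2 * D)" using e D by simp
 obtain a y where a: "(a, y) : R" "Hi.nm (Hi.sb (S vac) (dvec a)) < e / (2 * D)"
  "eventually (%k. nm2 (Y k - y k) < e / (2 * D)) om" using approxE[OF Y(1) d2] .
 have ab: "a : carrier A" "b : carrier A" using R_carrier a b by auto
 have Kd: "K * d < e / 2" "C * d < e / 2" using e K C by (auto simp: d_def field_simps)
 have "Hi.nm (Hi.sb (S et) (dvec (a \<otimes> b))) \<le>
   Hi.nm (Hi.sb (S et) (S (dvec b))) + Hi.nm (Hi.sb (S (dvec b)) (dvec (a \<otimes> b)))"
  using ab et by (intro Hi.nm_sb_triangle) (auto simp: bopD(1)[OF Sb])
 also have "Hi.nm (Hi.sb (S et) (S (dvec b))) <= K * Hi.nm (Hi.sb et (dvec b))"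
  using K(2)[of "Hi.sb et (dvec b)"] ab et by (simp add: bopD(4)[OF Sb])
 also have "... <= K * d" using K b(2) by simp
 also have "Hi.nm (Hi.sb (S (dvec b)) (dvec (a \<otimes> b))) <= D * Hi.nm (Hi.sb (S vac) (dvec a))"
  by (rule R_mult_close[OF S ab(1) b(1) D(2)])
 also have "... <= D * (e / (2 * D))" using D a(2) by (intro mult_left_mono) auto
 finally have "Hi.nm (Hi.sb (S et) (dvec (a \<otimes> b))) < e" using Kd D by simp
 moreover have "eventually (%k. nm2 (Y k * Y' k - y k * z k) < e) om" using a(3) b(3)
 proof eventually_elim
  case (elim k)
  note c = approx_mat[OF Y(1), of k] approx_mat[OF Y', of k] R_mat[OF a(1), of k] R_mat[OF b(1), of k]
  have m: "Y k * Y' k : MT (n k)" "Y k * z k : MT (n k)"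
   "y k * z k : MT (n k)" using c by auto
  have "nm2 (Y k * Y' k - y k * z k) <= nm2 (Y k * Y' k - Y k * z k) + nm2 (Y k * z k - y k * z k)"
   by (rule mat_norm2_triangle[OF m])
  also have "Y k * Y' k - Y k * z k = Y k * (Y' k - z k)"
   using mult_minus_distrib_mat[OF c(1,2,4)] by simp
  also have "Y k * z k - y k * z k = (Y k - y k) * z k"
   using minus_mult_distrib_mat[OF c(1,3,4)] by simp
  also have "nm2 (Y k * (Y' k - z k)) <= C * nm2 (Y' k - z k)"
   using c by (intro mat_norm2_mult_left[OF C(2)]) (auto simp: minus_carrier_mat)
  also have "... <= C * d" using C elim by simp
  also have "nm2 ((Y k - y k) * z k) <= D * nm2 (Y k - y k)"
   using c by (intro mat_norm2_mult_right[OF D(2)]) (auto simp: minus_carrier_mat)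
  also have "... <= D * (e / (2 * D))" using D elim by (intro mult_left_mono) auto
  finally show ?case using Kd D by simp
 qed
 ultimately show "EX a y. (a, y) : R & Hi.nm (Hi.sb (S et) (dvec a)) < e \<and>
   eventually (%k. nm2 (Y k * Y' k - y k) < e) om"
  using R_mult[OF a(1) b(1)] by blast
qed

lemma approx_star:
 assumes T: "T : rmod" and Y: "approx Y (T vac)"
 shows "approx (%k. adj (Y k)) (operator_adjoint GA T vac)"
 unfolding approx_def
proof (intro conjI allI impI)
 show "adj (Y k) : MT (n k)" for k using approx_mat[OF Y] by auto
 fix e :: real assume e: "0 < e"
 obtain a y where a: "(a, y) : R" "Hi.nm (Hi.sb (T vac) (dvec a)) < e"
  "eventually (%k. nm2 (Y k - y k) < e) om" using approxE[OF Y e] .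
 have "Hi.nm (Hi.sb (operator_adjoint GA T vac) (dvec (star A a))) < e"
  using adjoint_close[OF T R_carrier[OF a(1)]] a(2) by linarith
 moreover have "nm2 (adj (Y k) - adj (y k)) = nm2 (Y k - y k)" for k
 proof -
  note c = approx_mat[OF Y, of k] R_mat[OF a(1), of k]
  have "adj (Y k) - adj (y k) = adj (Y k - y k)"
   using carrier_matD[OF c(1)] carrier_matD[OF c(2)] by (intro eq_matI) auto
  thus ?thesis using mat_norm2_adjoint[of "Y k - y k" "n k"] c by (simp add: minus_carrier_mat)
 qed
 ultimately show "EX a y. (a, y) : R & Hi.nm (Hi.sb (operator_adjoint GA T vac) (dvec a)) < e \<and>
   eventually (%k. nm2 (adj (Y k) - y k) < e) om"
  using R_star[OF a(1)] a(3) by (intro exI[of _ "star A a"] exI[of _ "%k. adj (y k)"]) simp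
qed

lemma approx_trace:
 assumes Y: "approx Y xi" and xi: "xi : Hs"
 shows "((%k. ntrace (Y k)) \<longlongrightarrow> hip xi vac) om"
 unfolding tendsto_iff
proof (intro allI impI)
 have star1: "star A \<one> = \<one>" by (metis l_one one_closed r_one star_closed star_mult star_star)
 fix e :: real assume e0: "0 < e"
 \<comment> \<open>The norm of the unit is not assumed to be 1; \<open>N\<close> dominates both this
   norm and 1.\<close>
 define N where "N = tn \<one> + 2"
 have N: "2 <= N" by (simp add: N_def)
 have e: "0 < e / (3 * N)" using e0 N by simp
 obtain a y where a: "(a, y) : R" "Hi.nm (Hi.sb xi (dvec a)) < e / (3 * N)"
  "eventually (%k. nm2 (Y k - y k) < e / (3 * N)) om" using approxE[OF Y e] .
 have aA: "a : carrier A" using R_carrier a by auto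
 have tr: "trace_inner A a \<one> = trace A a" using aA by (simp add: trace_inner_def star1)
 have "cmod (hip xi vac - trace A a) = cmod (hip (Hi.sb xi (dvec a)) vac)"
  using aA xi by (simp add: tr)
 also have "... <= Hi.nm (Hi.sb xi (dvec a)) * tn \<one>"
  using Hi.cauchy_schwarz[of "Hi.sb xi (dvec a)" "vac"] aA xi by simp
 also have "... <= e / (3 * N) * N" using a(2) aA xi e N by (intro mult_mono) (auto simp: N_def)
 also have "... = e / 3" using N by simp
 finally have 1: "cmod (hip xi vac - trace A a) <= e / 3" .
 have "eventually (%k. dist (ntrace (y k)) (trace A a) < e / 3) om"
  by (rule tendstoD[OF R_trace[OF a(1)]]) (use e0 in simp)
 thus "eventually (%k. dist (ntrace (Y k)) (hip xi vac) < e) om" using a(3)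
 proof eventually_elim
  case (elim k)
  note c = approx_mat[OF Y, of k] R_mat[OF a(1), of k]
  have "Y k = (Y k - y k) + y k" using c by (intro eq_matI) auto
  hence "ntrace (Y k) = ntrace (Y k - y k) + ntrace (y k)"
   using ntrace_add[of "Y k - y k" "n k" "y k"] c by (simp add: minus_carrier_mat)
  hence "cmod (ntrace (Y k) - ntrace (y k)) <= nm2 (Y k - y k)"
   using ntrace_le_norm[of "Y k - y k" "n k"] c n_pos by (simp add: minus_carrier_mat)
  also have "... < e / (3 * N)" using elim by simp
  also have "... <= e / 3" using e0 N by (intro divide_left_mono) auto
  finally have "cmod (ntrace (Y k) - ntrace (y k)) < e / 3" .
  hence "dist (ntrace (Y k)) (ntrace (y k)) < e / 3" "dist (trace A a) (hip xi vac) <= e / 3"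
   using 1 by (auto simp: dist_norm norm_minus_commute)
  thus ?case
   using elim dist_triangle[of "ntrace (Y k)" "hip xi vac" "ntrace (y k)"]
    dist_triangle[of "ntrace (y k)" "hip xi vac" "trace A a"] e0 by linarith
 qed
qed

text \<open>By \<open>approx_unique\<close> the class is independent of the choice of
  \<open>Y\<close>; it depends on \<open>T\<close> only through the vector
  \<open>T vac\<close>.\<close>

definition extension :: "((nat => 'b) set => (nat => 'b) set) => (nat => complex mat) set" where
 "extension T = up_class om n (SOME Y. Y : bounded_mat_seqs n & approx Y (T vac))"

lemma extension_eq:
 assumes "Y : bounded_mat_seqs n" "approx Y (T vac)" "T vac : Hs"
 shows "extension T = up_class om n Y"
proof -
 let ?Y = "SOME Y. Y : bounded_mat_seqs n & approx Y (T vac)"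
 have Y: "?Y : bounded_mat_seqs n & approx ?Y (T vac)"
  by (rule someI[of "%Y. Y : bounded_mat_seqs n & approx Y (T vac)" Y]) (use assms in blast)
 thus ?thesis
  unfolding extension_def using up_class_eqI[OF _ assms(1) approx_unique[OF _ assms(2,3)]] by blast
qed

lemma extension_rep:
 assumes T: "T : rmod"
 shows "extension T : carrier (ultraproduct om n)"
  and "class_rep (extension T) : bounded_mat_seqs n"
  and "approx (class_rep (extension T)) (T vac)"
  and "extension T = up_class om n (class_rep (extension T))"
proof -
 obtain Y where Y: "Y : bounded_mat_seqs n" "approx Y (T vac)" using approx_exists[OF T] by blast
 have T1: "T vac : Hs" by (simp add: bopD(1)[OF rmodD(1)[OF T]])
 have eq: "extension T = up_class om n Y" using extension_eq Y T1 by blast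
 show "extension T : carrier (ultraproduct om n)" using Y by (simp add: eq ultraproduct_def)
 show r: "class_rep (extension T) : bounded_mat_seqs n" using class_rep_up[OF Y(1)] by (simp add: eq)
 show a: "approx (class_rep (extension T)) (T vac)"
  unfolding eq by (rule approx_cong[OF Y(2)]) (use class_rep_up[OF Y(1)] bounded_mat_seqs_carrier in auto)
 show "extension T = up_class om n (class_rep (extension T))"
  using extension_eq r a T1 by blast
qed

lemma extension_compose:
 assumes S: "S : rmod" and T: "T : rmod"
 shows "extension (compose (Hs) S T) = extension S \<otimes>\<^bsub>ultraproduct om n\<^esub> extension T"
proof -
 let ?X = "class_rep (extension S)" and ?Y = "class_rep (extension T)"
 have T1: "T vac : Hs" by (simp add: bopD(1)[OF rmodD(1)[OF T]])
 have ST1: "S (T vac) : Hs" using T1 by (simp add: bopD(1)[OF rmodD(1)[OF S]])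
 have "approx (%k. ?X k * ?Y k) (S (T vac))"
  by (rule approx_mult[OF S extension_rep(3,2)[OF S] extension_rep(3)[OF T] T1])
 hence "extension (compose (Hs) S T) = up_class om n (%k. ?X k * ?Y k)"
  by (intro extension_eq bounded_mat_seqs_mult extension_rep S T) (simp_all add: compose_eq ST1)
 thus ?thesis by (simp add: ultraproduct_def)
qed

lemma tracial_embedding_extension:
 "tracial_embedding (gns_closure A) (ultraproduct om n) extension"
proof -
 let ?H = "GA" and ?U = "ultraproduct om n" and ?V = "gns_closure A"
 have car: "T : rmod" if "T : carrier ?V" for T
  using that by (simp add: gns_closure_def Let_def weak_closure_right_modular)
 have T1: "T vac : carrier ?H" if "T : carrier ?V" for T
  by (simp add: bopD(1)[OF rmodD(1)[OF car[OF that]]])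
 have u: "vac : carrier ?H" by simp
 show ?thesis
  unfolding tracial_embedding_def
 proof (intro conjI allI ballI ring_hom_memI)
  fix S T assume S: "S : carrier ?V" and T: "T : carrier ?V"
  show "extension S : carrier ?U" by (rule extension_rep(1)[OF car[OF S]])
  show "extension (S \<otimes>\<^bsub>?V\<^esub> T) = extension S \<otimes>\<^bsub>?U\<^esub> extension T"
   using extension_compose[OF car[OF S] car[OF T]] by (simp add: gns_closure_def Let_def)
  have "approx (%k. class_rep (extension S) k + class_rep (extension T) k) (vadd ?H (S vac) (T vac))"
   by (intro approx_add extension_rep car S T T1)
  hence "extension (\<lambda>xi\<in>carrier ?H. vadd ?H (S xi) (T xi)) =
    up_class om n (%k. class_rep (extension S) k + class_rep (extension T) k)"
   by (intro extension_eq bounded_mat_seqs_add extension_rep car S T) (simp_all add: T1 S T)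
  thus "extension (S \<oplus>\<^bsub>?V\<^esub> T) = extension S \<oplus>\<^bsub>?U\<^esub> extension T"
   by (simp add: gns_closure_def Let_def ultraproduct_def)
  fix c
  have "approx (%k. c \<cdot>\<^sub>m class_rep (extension T) k) (vscale ?H c (T vac))"
   by (intro approx_smult extension_rep car T T1)
  hence "extension (\<lambda>xi\<in>carrier ?H. vscale ?H c (T xi)) = up_class om n (%k. c \<cdot>\<^sub>m class_rep (extension T) k)"
   by (intro extension_eq bounded_mat_seqs_smult extension_rep car T) (simp_all add: T1 T)
  thus "extension (c \<odot>\<^bsub>?V\<^esub> T) = c \<odot>\<^bsub>?U\<^esub> extension T"
   by (simp add: gns_closure_def Let_def ultraproduct_def)
  have A: "operator_adjoint ?H T : rmod" by (rule operator_adjoint(1)[OF car[OF T]])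
  have "approx (%k. adj (class_rep (extension T) k)) (operator_adjoint ?H T vac)"
   by (intro approx_star extension_rep car T)
  hence "extension (operator_adjoint ?H T) = up_class om n (%k. adj (class_rep (extension T) k))"
   by (intro extension_eq bounded_mat_seqs_adjoint extension_rep car T)
    (simp_all add: bopD(1)[OF rmodD(1)[OF A]])
  thus "extension (star ?V T) = star ?U (extension T)"
   by (simp add: gns_closure_def Let_def ultraproduct_def)
  have "((%k. ntrace (class_rep (extension T) k)) \<longlongrightarrow> hip (T vac) vac) om"
   by (intro approx_trace extension_rep car T T1)
  hence "Lim om (%k. ntrace (class_rep (extension T) k)) = hip (T vac) vac"
   by (rule tendsto_Lim[OF omega_bot])
  thus "trace ?U (extension T) = trace ?V T"
   by (simp add: gns_closure_def Let_def ultraproduct_def gns_unit_dense)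
 next
  have "extension (\<lambda>xi\<in>carrier ?H. xi) = up_class om n (%k. 1\<^sub>m (n k))"
   by (intro extension_eq bounded_mat_seqs_one) (simp_all add: approx_R R_one)
  thus "extension \<one>\<^bsub>?V\<^esub> = \<one>\<^bsub>?U\<^esub>"
   by (simp add: gns_closure_def Let_def ultraproduct_def)
 qed
qed

end

section \<open>Measured orbit equivalence relations\<close>

text \<open>Sums over a class become series over an enumeration, which makes their measurability in
  the base point accessible.\<close>

lemma nn_integral_count_space_suminf:
 fixes f :: "'a => ennreal" and ph :: "nat => 'a"
 assumes bij: "bij_betw ph {i. P i} B" and f: "!!y. y ~: B ==> f y = 0"
 shows "(\<Uplus>y. f y) = (\<Sum>i. if P i then f (ph i) else 0)"
proof -
 have "(\<Uplus>y. f y) = (\<Uplus>y. f y * indicator B y)"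
  by (intro nn_integral_cong) (auto simp: f split: split_indicator)
 also have "... = (\<integral>\<^sup>+y. f y \<partial>count_space B)"
  by (simp add: nn_integral_count_space_indicator)
 also have "... = (\<integral>\<^sup>+i. f (ph i) \<partial>count_space {i. P i})"
  by (rule nn_integral_bij_count_space[OF bij, symmetric])
 also have "... = (\<Uplus>i. f (ph i) * indicator {i. P i} i)"
  by (simp add: nn_integral_count_space_indicator)
 also have "... = (\<Sum>i. f (ph i) * indicator {i. P i} i)" by (rule nn_integral_count_space_nat)
 also have "... = (\<Sum>i. if P i then f (ph i) else 0)"
  by (intro suminf_cong) (auto split: split_indicator)
 finally show ?thesis .
qed

lemma nn_integral_count_space_finite_support:
 fixes f :: "'a => real"
 assumes "finite S" "!!y. y ~: S ==> f y = 0" "!!y. 0 <= f y"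
 shows "(\<Uplus>y. ennreal (f y)) = ennreal (\<Sum>y\<in>S. f y)"
 using assms by (subst nn_integral_count_space'[where A = S]) (auto simp: sum_ennreal)

abbreviation FG :: "letter list set" where "FG == carrier free_group"

text \<open>Measurability refers to the completion because the action is altered on a null set that
  is only known to lie in the completion. The sequence \<open>U\<close> separates points; it
  represents the standardness of the space and makes the diagonal measurable.\<close>

locale orbit_relation = prob_space M for M :: "'a measure" +
 fixes E :: "('a * 'a) set" and act :: "letter list => 'a => 'a" and U :: "nat => 'a set"
 assumes U_sets: "!!i. U i : sets M"
  and U_sep: "!!x y. x : space M ==> y : space M ==> (!!i. x : U i <-> y : U i) ==> x = y"
  and equivE: "equiv (space M) E"
  and countE: "!!x. x : space M ==> countable (E `` {x})"
  and act_one: "!!x. x : space M ==> act [] x = x"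
  and act_mult: "!!v w x. v : FG ==> w : FG ==> x : space M ==> act (v \<cdot> w) x = act v (act w x)"
  and act_meas: "!!w. w : FG ==> act w : measurable (completion M) (completion M)"
  and act_distr: "!!w. w : FG ==> distr (completion M) (completion M) (act w) = completion M"
  and act_E: "!!w x. w : FG ==> x : space M ==> (x, act w x) : E"
  and AE_orbit: "AE x in M. E `` {x} = {act w x |w. w : FG}"
begin

abbreviation N :: "'a measure" where "N == completion M"
abbreviation BM where "BM == borel_measurable (N \<Otimes>\<^sub>M N)"

sublocale N: prob_space N
 by standard (simp add: emeasure_space_1)

sublocale FG: group free_group by (rule group_free_group)

lemma E_space: "(x, y) : E ==> x : space M" "(x, y) : E ==> y : space M"
 using equivE unfolding equiv_def refl_on_def by auto

lemma E_refl: "x : space M ==> (x, x) : E"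
 using equivE by (meson equiv_def refl_onD)

lemma E_sym: "(x, y) : E ==> (y, x) : E"
 using equivE by (meson equiv_def symE)

lemma E_trans: "(x, y) : E ==> (y, z) : E ==> (x, z) : E"
 using equivE by (meson equiv_def transE)

lemma act_space [simp]: "w : FG ==> x : space M ==> act w x : space M"
 using act_E E_space by blast

lemma one_FG [simp]: "[] : FG"
 using FG.one_closed by (simp add: free_group_def)

lemma act_inv [simp]:
 assumes "w : FG" "x : space M"
 shows "act (ginv w) (act w x) = x" "act w (act (ginv w) x) = x"
proof -
 have one: "\<one>\<^bsub>free_group\<^esub> = []" by (simp add: free_group_def)
 show "act (ginv w) (act w x) = x" "act w (act (ginv w) x) = x"
  using assms act_mult[of "ginv w" w x] act_mult[of w "ginv w" x]
  by (simp_all add: FG.l_inv FG.r_inv one act_one)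
qed

definition X0 :: "'a set" where "X0 = {x : space M. E `` {x} = {act w x |w. w : FG}}"

lemma null_X0: "space M - X0 : null_sets N"
proof -
 have "{x : space N. ~ E `` {x} = {act w x |w. w : FG}} : null_sets N"
  using AE_completion[OF AE_orbit] unfolding completion.AE_iff_null_sets .
 moreover have "{x : space N. ~ E `` {x} = {act w x |w. w : FG}} = space M - X0" by (auto simp: X0_def)
 ultimately show ?thesis by simp
qed

lemma null_subset: "A <= space M - X0 ==> A : sets N"
 using completion.complete2[OF _ null_X0] by auto

lemma X0_sub: "X0 <= space M"
 by (auto simp: X0_def)

lemma X0_sets [measurable]: "X0 : sets N"
proof -
 have "X0 = space N - (space M - X0)" using X0_sub by auto
 thus ?thesis using null_X0 by (metis null_setsD2 sets.compl_sets)
qed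

lemma AE_X0: "AE x in N. x : X0"
 using AE_not_in[OF null_X0] AE_space[of N] by eventually_elim auto

lemma X0_E: "x : X0 ==> (x, y) : E ==> y : X0"
proof -
 assume x: "x : X0" and xy: "(x, y) : E"
 then obtain w where w: "w : FG" "y = act w x" by (auto simp: X0_def)
 have xs: "x : space M" using x X0_sub by auto
 have "E `` {y} = E `` {x}" using equiv_class_eq[OF equivE xy] by simp
 also have "... = {act v x |v. v : FG}" using x by (simp add: X0_def)
 also have "... = {act v y |v. v : FG}"
 proof safe
  fix v assume v: "v : FG"
  have "act v x = act (v \<cdot> ginv w) y" using v w xs by (simp add: act_mult)
  thus "EX u. act v x = act u y & u : FG" using v w by blast
 next
  fix v assume v: "v : FG"
  have "act v y = act (v \<cdot> w) x" using v w xs by (simp add: act_mult)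
  thus "EX u. act v y = act u x & u : FG" using v w by blast
 qed
 finally show "y : X0" using xy E_space by (auto simp: X0_def)
qed

definition fw :: "nat => letter list" where "fw = from_nat_into FG"

lemma range_fw: "range fw = FG"
 unfolding fw_def by (rule range_from_nat_into) (use one_FG in \<open>auto simp del: one_FG\<close>)

lemma fw_FG [simp]: "fw i : FG"
 using range_fw by auto

text \<open>Enumerates every class, with repetitions. On \<open>X0\<close> group elements are used,
  as they preserve the measure; off \<open>X0\<close> any enumeration will do, because subsets of a
  null set are measurable in the completion.\<close>

definition g :: "nat => 'a => 'a" where
 "g i x = (if x : X0 then act (fw i) x else from_nat_into (E `` {x}) i)"

lemma range_g: "x : space M ==> range (%i. g i x) = E `` {x}"
proof (cases "x : X0")
 case True
 hence "range (%i. g i x) = (%w. act w x) ` range fw" by (auto simp: g_def)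
 also have "... = E `` {x}" using True unfolding range_fw by (auto simp: X0_def)
 finally show ?thesis .
next
 case False
 assume x: "x : space M"
 have "E `` {x} ~= {}" using E_refl[OF x] by auto
 thus ?thesis using False countE[OF x] by (simp add: g_def range_from_nat_into)
qed

lemma g_E: "x : space M ==> (x, g i x) : E"
 using range_g by blast

lemma g_meas [measurable]: "g i : measurable N N"
proof (rule measurableI)
 fix x assume "x : space N"
 thus "g i x : space N" using g_E[of x i] E_space by auto
next
 fix B assume B: "B : sets N"
 have "g i -` B Int space N = (X0 Int (act (fw i) -` B Int space N)) Un (g i -` B Int (space M - X0))"
  using X0_sub by (auto simp: g_def)
 moreover have "act (fw i) -` B Int space N : sets N" by (rule measurable_sets[OF act_meas B]) simp
 moreover have "g i -` B Int (space M - X0) : sets N" by (rule null_subset) auto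
 ultimately show "g i -` B Int space N : sets N" by auto
qed

lemma diag_meas: "{p : space (N \<Otimes>\<^sub>M N). fst p = snd p} : sets (N \<Otimes>\<^sub>M N)"
proof -
 have [measurable]: "U i : sets N" for i using U_sets by auto
 have "{p : space (N \<Otimes>\<^sub>M N). fst p = snd p} = {p : space (N \<Otimes>\<^sub>M N). ALL i. fst p : U i <-> snd p : U i}"
  using U_sep by (auto simp: space_pair_measure)
 also have "... : sets (N \<Otimes>\<^sub>M N)" by measurable
 finally show ?thesis .
qed

lemma eq_meas [measurable (raw)]:
 assumes [measurable]: "f : measurable L N" "h : measurable L N"
 shows "Measurable.pred L (%x. f x = h x)"
proof -
 have "(%x. (f x, h x)) -` {p : space (N \<Otimes>\<^sub>M N). fst p = snd p} Int space L : sets L"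
  by (rule measurable_sets[OF _ diag_meas]) measurable
 also have "(%x. (f x, h x)) -` {p : space (N \<Otimes>\<^sub>M N). fst p = snd p} Int space L = {x : space L. f x = h x}"
  using measurable_space[OF assms(1)] measurable_space[OF assms(2)] by (auto simp: space_pair_measure)
 finally show ?thesis by (simp add: pred_def)
qed

text \<open>Keeps the first occurrence of each point in the enumeration of a class, so that the
  graphs of the \<open>g i\<close> over the \<open>D i\<close> partition \<open>E\<close>.\<close>

definition D :: "nat => 'a set" where "D i = {x : space M. ALL j<i. g j x ~= g i x}"

lemma D_sets [measurable]: "D i : sets N"
proof -
 have "D i = {x : space N. ALL j<i. g j x ~= g i x}" unfolding D_def space_completion ..
 also have "... : sets N" by measurable
 finally show ?thesis .
qed

lemma D_less: "x : D j ==> i < j ==> g i x ~= g j x"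
 by (simp add: D_def)

lemma bij_g:
 assumes x: "x : space M" shows "bij_betw (%i. g i x) {i. x : D i} (E `` {x})"
 unfolding bij_betw_def
proof
 show "inj_on (%i. g i x) {i. x : D i}"
 proof (rule inj_onI, rule ccontr)
  fix i j assume "i : {i. x : D i}" "j : {i. x : D i}" "g i x = g j x" "i ~= j"
  thus False using D_less[of x i j] D_less[of x j i] by (cases i j rule: linorder_cases) auto
 qed
 show "(%i. g i x) ` {i. x : D i} = E `` {x}"
 proof
  show "(%i. g i x) ` {i. x : D i} <= E `` {x}" using g_E[OF x] by auto
  show "E `` {x} <= (%i. g i x) ` {i. x : D i}"
  proof
   fix y assume "y : E `` {x}"
   then obtain i where i: "g i x = y" using range_g[OF x] by (metis imageE)
   define k where "k = (LEAST i. g i x = y)"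
   have k: "g k x = y" unfolding k_def by (rule LeastI[of "%i. g i x = y", OF i])
   have nk: "g j x ~= y" if "j < k" for j using not_less_Least[OF that[unfolded k_def]] .
   have "x : D k"
    unfolding D_def
   proof (intro CollectI conjI allI impI x)
    fix j assume "j < k" thus "g j x ~= g k x" unfolding k by (rule nk)
   qed
   with k show "y : (%i. g i x) ` {i. x : D i}" by blast
  qed
 qed
qed

lemma count_eq:
 assumes "x : space M" "!!y. (x, y) ~: E ==> f y = 0"
 shows "(\<Uplus>y. f y) = (\<Sum>i. if x : D i then f (g i x) else 0)"
 by (rule nn_integral_count_space_suminf[OF bij_g[OF assms(1)]]) (use assms(2) in auto)

lemma count_meas [measurable]:
 assumes [measurable]: "F : BM" and F: "!!x y. (x, y) ~: E ==> F (x, y) = 0"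
 shows "(%x. \<Uplus>y. F (x, y)) : borel_measurable N"
  "(%x. \<Uplus>y. F (y, x)) : borel_measurable N"
proof -
 have "(%x. \<Sum>i. if x : D i then F (x, g i x) else 0) : borel_measurable N"
  "(%x. \<Sum>i. if x : D i then F (g i x, x) else 0) : borel_measurable N" by measurable
 thus "(%x. \<Uplus>y. F (x, y)) : borel_measurable N"
  "(%x. \<Uplus>y. F (y, x)) : borel_measurable N"
  using F E_sym by (subst measurable_cong[OF count_eq], auto)+
qed

text \<open>On each piece of the partition of \<open>E\<close>, substitution by the inverse group
  element preserves the measure. For almost every \<open>y\<close> the shifted pieces list the class
  of \<open>y\<close> again without repetition, so row sums turn into column sums.\<close>

lemma mass_transport:
 assumes F_meas [measurable]: "F : BM" and F: "!!x y. (x, y) ~: E ==> F (x, y) = 0"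
 shows "(\<integral>\<^sup>+x. (\<Uplus>y. F (x, y)) \<partial>N) = (\<integral>\<^sup>+x. (\<Uplus>y. F (y, x)) \<partial>N)"
proof -
 define h where "h i x = (if x : D i then F (x, g i x) else 0)" for i x
 have hm [measurable]: "h i : borel_measurable N" for i unfolding h_def by measurable
 let ?v = "%i. ginv (fw i)"
 have am [measurable]: "act (?v i) : measurable N N" for i by (rule act_meas) simp
 have "(\<integral>\<^sup>+x. (\<Uplus>y. F (x, y)) \<partial>N) = (\<integral>\<^sup>+x. (\<Sum>i. h i x) \<partial>N)"
  unfolding h_def by (intro nn_integral_cong count_eq) (auto simp: F)
 also have "... = (\<Sum>i. \<integral>\<^sup>+x. h i x \<partial>N)" by (rule nn_integral_suminf) measurable
 also have "... = (\<Sum>i. \<integral>\<^sup>+y. h i (act (?v i) y) \<partial>N)"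
 proof (rule suminf_cong)
  fix i
  have "(\<integral>\<^sup>+x. h i x \<partial>N) = (\<integral>\<^sup>+x. h i x \<partial>distr N N (act (?v i)))" by (simp add: act_distr)
  also have "... = (\<integral>\<^sup>+y. h i (act (?v i) y) \<partial>N)" by (rule nn_integral_distr) measurable
  finally show "(\<integral>\<^sup>+x. h i x \<partial>N) = (\<integral>\<^sup>+y. h i (act (?v i) y) \<partial>N)" .
 qed
 also have "... = (\<integral>\<^sup>+y. (\<Sum>i. h i (act (?v i) y)) \<partial>N)" by (rule nn_integral_suminf[symmetric]) measurable
 also have "... = (\<integral>\<^sup>+y. (\<Uplus>x. F (x, y)) \<partial>N)"
 proof (rule nn_integral_cong_AE, use AE_X0 in eventually_elim)
  fix y assume y: "y : X0"
  hence ys: "y : space M" using X0_sub by auto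
  have v: "act (?v i) y : X0" "g i (act (?v i) y) = y" for i
  proof -
   show "act (?v i) y : X0" by (rule X0_E[OF y act_E]) (use ys in auto)
   thus "g i (act (?v i) y) = y" using ys by (simp add: g_def)
  qed
  have bij: "bij_betw (%i. act (?v i) y) {i. act (?v i) y : D i} (E `` {y})"
   unfolding bij_betw_def
  proof
   show "inj_on (%i. act (?v i) y) {i. act (?v i) y : D i}"
   proof (rule inj_onI, clarify)
    fix i j assume ij: "act (?v i) y : D i" "act (?v j) y : D j" "act (?v i) y = act (?v j) y"
    hence "g i (act (?v i) y) = g j (act (?v i) y)" using v(2)[of i] v(2)[of j] by simp
    thus "i = j"
     using ij D_less[of "act (?v i) y" i j] D_less[of "act (?v i) y" j i]
     by (cases i j rule: linorder_cases) auto
   qed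
   show "(%i. act (?v i) y) ` {i. act (?v i) y : D i} = E `` {y}"
   proof
    show "(%i. act (?v i) y) ` {i. act (?v i) y : D i} <= E `` {y}"
     using act_E[OF _ ys] by auto
    show "E `` {y} <= (%i. act (?v i) y) ` {i. act (?v i) y : D i}"
    proof
     fix x assume "x : E `` {y}"
     hence x: "x : X0" "(x, y) : E" using X0_E[OF y] E_sym by auto
     hence xs: "x : space M" using X0_sub by auto
     have "y : (%i. g i x) ` {i. x : D i}" using bij_g[OF xs] x by (auto simp: bij_betw_def)
     then obtain i where i: "x : D i" "g i x = y" by blast
     hence "act (?v i) y = x" using x xs by (auto simp: g_def)
     thus "x : (%i. act (?v i) y) ` {i. act (?v i) y : D i}" using i by (intro image_eqI[of _ _ i]) auto
    qed
   qed
  qed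
  have "(\<Uplus>x. F (x, y)) = (\<Sum>i. if act (?v i) y : D i then F (act (?v i) y, y) else 0)"
   by (rule nn_integral_count_space_suminf[OF bij]) (use F E_sym in auto)
  also have "... = (\<Sum>i. h i (act (?v i) y))" by (intro suminf_cong) (simp add: h_def v)
  finally show "(\<Sum>i. h i (act (?v i) y)) = (\<Uplus>x. F (x, y))" ..
 qed
 finally show ?thesis .
qed

end

section \<open>The tracial star-algebra M0(E)\<close>

context orbit_relation begin

abbreviation A0 :: "('a * 'a => complex) tracial_star_alg" where "A0 == M0_rel M E"
abbreviation nrm where "nrm == trace_norm2 A0"
abbreviation mult0 (infixl "\<star>" 70) where "a \<star> b == a \<otimes>\<^bsub>A0\<^esub> b"
abbreviation one0 where "one0 == \<one>\<^bsub>A0\<^esub>"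

definition rs :: "('a * 'a => complex) => 'a => 'a set" where "rs a x = {y. a (x, y) ~= 0}"
definition cs :: "('a * 'a => complex) => 'a => 'a set" where "cs a x = {y. a (y, x) ~= 0}"

lemma A0_iff: "a : carrier A0 <-> a : BM & (ALL p. p ~: E --> a p = 0) \<and>
  (EX C. ALL p. cmod (a p) <= C) \<and>
  (\<exists>n::nat. ALL x. finite (rs a x) & card (rs a x) <= n & finite (cs a x) & card (cs a x) <= n)"
 by (simp add: M0_rel_def measurable_on_rel_def rs_def cs_def)

lemma A0_meas: "a : carrier A0 ==> a : BM"
 and A0_zero: "a : carrier A0 ==> p ~: E ==> a p = 0"
 unfolding A0_iff by blast+

lemma A0_fin: assumes "a : carrier A0" shows "finite (rs a x)" "finite (cs a x)"
 using assms by (auto simp: A0_iff)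

lemma A0E:
 assumes "a : carrier A0"
 obtains C n where "1 <= C" "!!p. cmod (a p) <= C" "!!x. card (rs a x) <= n" "!!x. card (cs a x) <= n" "1 <= (n::nat)"
proof -
 obtain C n where C: "!!p. cmod (a p) <= C" and n: "!!x. card (rs a x) <= n" "!!x. card (cs a x) <= n"
  using assms unfolding A0_iff by blast
 show ?thesis
  by (rule that[of "max C 1" "max n 1"]) (use C n in \<open>auto simp: le_max_iff_disj\<close>)
qed

lemma A0I:
 assumes "a : BM" "!!p. p ~: E ==> a p = 0" "!!p. cmod (a p) <= C"
  "!!x. finite (rs a x) & card (rs a x) <= n" "!!x. finite (cs a x) & card (cs a x) <= n"
 shows "a : carrier A0"
 unfolding A0_iff using assms by blast

lemma A0_sel: "\<zero>\<^bsub>A0\<^esub> = (%_. 0)" "a \<oplus>\<^bsub>A0\<^esub> b = (%p. a p + b p)" "c \<odot>\<^bsub>A0\<^esub> a = (%p. c * a p)"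
 "star A0 a = (%(x, y). cnj (a (y, x)))" "trace A0 a = (\<integral>x. a (x, x) \<partial>N)"
 "one0 = (%(x, y). if x : space M & x = y then 1 else 0)"
 "(a \<star> b) (x, z) = (\<Sum>y\<in>rs a x. a (x, y) * b (y, z))"
 by (auto simp: M0_rel_def rs_def)

lemma A0_mult_rows:
 assumes "finite S" "rs a x <= S"
 shows "(a \<star> b) (x, z) = (\<Sum>y\<in>S. a (x, y) * b (y, z))"
 unfolding A0_sel using assms by (intro sum.mono_neutral_left) (auto simp: rs_def)

text \<open>The product is defined by sums over a row of the left factor. Evaluation over a column
  of the right factor is what associativity, distributivity and adjoints call for.\<close>

lemma A0_mult_cols:
 assumes "finite (rs a x)" "finite S" "cs b z <= S"
 shows "(a \<star> b) (x, z) = (\<Sum>y\<in>S. a (x, y) * b (y, z))"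
proof -
 have "(a \<star> b) (x, z) = (\<Sum>y\<in>rs a x Un S. a (x, y) * b (y, z))"
  using assms by (intro A0_mult_rows) auto
 also have "... = (\<Sum>y\<in>S. a (x, y) * b (y, z))"
  using assms by (intro sum.mono_neutral_right) (auto simp: cs_def)
 finally show ?thesis .
qed

lemma zero_A0: "\<zero>\<^bsub>A0\<^esub> : carrier A0"
 by (rule A0I[of _ 0 0]) (auto simp: A0_sel rs_def cs_def)

lemma add_A0: assumes a: "a : carrier A0" and b: "b : carrier A0" shows "a \<oplus>\<^bsub>A0\<^esub> b : carrier A0"
proof -
 obtain C n where C: "1 <= C" "!!p. cmod (a p) <= C" "!!x. card (rs a x) <= n" "!!x. card (cs a x) <= n" by (rule A0E[OF a]) blast
 obtain C' n' where C': "1 <= C'" "!!p. cmod (b p) <= C'" "!!x. card (rs b x) <= n'" "!!x. card (cs b x) <= n'" by (rule A0E[OF b]) blast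
 have [measurable]: "a : BM" "b : BM" using A0_meas a b by auto
 have r: "rs (a \<oplus>\<^bsub>A0\<^esub> b) x <= rs a x Un rs b x" and c: "cs (a \<oplus>\<^bsub>A0\<^esub> b) x <= cs a x Un cs b x" for x
  by (auto simp: rs_def cs_def A0_sel)
 show ?thesis
 proof (rule A0I[of _ "C + C'" "n + n'"])
  show "a \<oplus>\<^bsub>A0\<^esub> b : BM" unfolding A0_sel by measurable
  show "cmod ((a \<oplus>\<^bsub>A0\<^esub> b) p) <= C + C'" for p
   unfolding A0_sel by (intro norm_triangle_le add_mono C C')
  fix x
  have "card (rs (a \<oplus>\<^bsub>A0\<^esub> b) x) <= card (rs a x Un rs b x)" using A0_fin a b by (intro card_mono r) auto
  also have "... <= n + n'" using card_Un_le[of "rs a x" "rs b x"] C(3)[of x] C'(3)[of x] by linarith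
  finally show "finite (rs (a \<oplus>\<^bsub>A0\<^esub> b) x) & card (rs (a \<oplus>\<^bsub>A0\<^esub> b) x) <= n + n'"
   using finite_subset[OF r] A0_fin a b by auto
  have "card (cs (a \<oplus>\<^bsub>A0\<^esub> b) x) <= card (cs a x Un cs b x)" using A0_fin a b by (intro card_mono c) auto
  also have "... <= n + n'" using card_Un_le[of "cs a x" "cs b x"] C(4)[of x] C'(4)[of x] by linarith
  finally show "finite (cs (a \<oplus>\<^bsub>A0\<^esub> b) x) & card (cs (a \<oplus>\<^bsub>A0\<^esub> b) x) <= n + n'"
   using finite_subset[OF c] A0_fin a b by auto
 qed (use A0_zero[OF a] A0_zero[OF b] in \<open>simp add: A0_sel\<close>)
qed

lemma smult_A0: assumes a: "a : carrier A0" shows "c \<odot>\<^bsub>A0\<^esub> a : carrier A0"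
proof -
 obtain C n where C: "1 <= C" "!!p. cmod (a p) <= C" "!!x. card (rs a x) <= n" "!!x. card (cs a x) <= n" by (rule A0E[OF a]) blast
 have [measurable]: "a : BM" using A0_meas a by auto
 have r: "rs (c \<odot>\<^bsub>A0\<^esub> a) x <= rs a x" and cc: "cs (c \<odot>\<^bsub>A0\<^esub> a) x <= cs a x" for x
  by (auto simp: rs_def cs_def A0_sel)
 show ?thesis
 proof (rule A0I[of _ "cmod c * C" n])
  show "c \<odot>\<^bsub>A0\<^esub> a : BM" unfolding A0_sel by measurable
  show "cmod ((c \<odot>\<^bsub>A0\<^esub> a) p) <= cmod c * C" for p
   unfolding A0_sel norm_mult by (intro mult_left_mono C) simp
  show "finite (rs (c \<odot>\<^bsub>A0\<^esub> a) x) & card (rs (c \<odot>\<^bsub>A0\<^esub> a) x) <= n" for x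
   using finite_subset[OF r] A0_fin[OF a] card_mono[OF _ r[of x]] C(3)[of x] by (meson order_trans)
  show "finite (cs (c \<odot>\<^bsub>A0\<^esub> a) x) & card (cs (c \<odot>\<^bsub>A0\<^esub> a) x) <= n" for x
   using finite_subset[OF cc] A0_fin[OF a] card_mono[OF _ cc[of x]] C(4)[of x] by (meson order_trans)
 qed (use A0_zero[OF a] in \<open>simp add: A0_sel\<close>)
qed

lemma star_A0: assumes a: "a : carrier A0" shows "star A0 a : carrier A0"
proof -
 obtain C n where C: "1 <= C" "!!p. cmod (a p) <= C" "!!x. card (rs a x) <= n" "!!x. card (cs a x) <= n" by (rule A0E[OF a]) blast
 have [measurable]: "a : BM" using A0_meas a by auto
 have r: "rs (star A0 a) x = cs a x" and cc: "cs (star A0 a) x = rs a x" for x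
  by (auto simp: rs_def cs_def A0_sel)
 show ?thesis
 proof (rule A0I[of _ C n])
  have [measurable]: "cnj : borel_measurable borel"
   by (intro borel_measurable_continuous_onI continuous_intros)
  show "star A0 a : BM" unfolding A0_sel by measurable
  show "finite (rs (star A0 a) x) & card (rs (star A0 a) x) <= n" for x unfolding r using A0_fin[OF a] C by blast
  show "finite (cs (star A0 a) x) & card (cs (star A0 a) x) <= n" for x unfolding cc using A0_fin[OF a] C by blast
 qed (use A0_zero[OF a] E_sym C in \<open>auto simp: A0_sel\<close>)
qed

lemma one_A0: "one0 : carrier A0"
proof (rule A0I[of _ 1 1])
 have [measurable]: "Measurable.pred (N \<Otimes>\<^sub>M N) (%p. fst p = snd p)"
  by (rule eq_meas[OF measurable_fst measurable_snd])
 have "(%p. if fst p = snd p then 1 else 0 :: complex) : BM"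
  by measurable
 also have "?this <-> one0 : BM"
  unfolding A0_sel by (rule measurable_cong) (auto simp: space_pair_measure)
 finally show "one0 : BM" .
 fix x
 have "rs one0 x <= {x}" "cs one0 x <= {x}" by (auto simp: rs_def cs_def A0_sel split: if_splits)
 thus "finite (rs one0 x) & card (rs one0 x) <= 1" "finite (cs one0 x) & card (cs one0 x) <= 1"
  using card_mono[of "{x}"] finite_subset[of _ "{x}"] by auto
qed (use E_refl in \<open>auto simp: A0_sel\<close>)

lemma mult_A0: assumes a: "a : carrier A0" and b: "b : carrier A0" shows "a \<star> b : carrier A0"
proof -
 obtain C n where C: "1 <= C" "!!p. cmod (a p) <= C" "!!x. card (rs a x) <= n" "!!x. card (cs a x) <= n" by (rule A0E[OF a]) blast
 obtain C' n' where C': "1 <= C'" "!!p. cmod (b p) <= C'" "!!x. card (rs b x) <= n'" "!!x. card (cs b x) <= n'" by (rule A0E[OF b]) blast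
 have [measurable]: "a : BM" "b : BM" using A0_meas a b by auto
 have rsub: "rs (a \<star> b) x <= (\<Union>y\<in>rs a x. rs b y)" for x
 proof
  fix z assume "z : rs (a \<star> b) x"
  hence "(\<Sum>y\<in>rs a x. a (x, y) * b (y, z)) ~= 0" by (simp add: rs_def[of "a \<star> b"] A0_sel)
  then obtain y where "y : rs a x" "a (x, y) * b (y, z) ~= 0" using sum.neutral by force
  thus "z : (\<Union>y\<in>rs a x. rs b y)" by (auto simp: rs_def)
 qed
 hence csub: "cs (a \<star> b) z <= (\<Union>y\<in>cs b z. cs a y)" for z
  by (force simp: cs_def rs_def)
 show ?thesis
 proof (rule A0I[of _ "real n * (C * C')" "n * n' + n' * n"])
  \<comment> \<open>The sum over the varying finite set \<open>rs a x\<close> is rewritten as a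
    series over the enumeration \<open>g\<close>, whose terms are measurable in both
    variables.\<close>
  have eq: "(a \<star> b) (x, z) = (\<Sum>i. if x : D i then a (x, g i x) * b (g i x, z) else 0)"
   if x: "x : space M" for x z
  proof -
   let ?I = "{i. x : D i & g i x : rs a x}"
   have inj: "inj_on (%i. g i x) {i. x : D i}" using bij_g[OF x] by (simp add: bij_betw_def)
   have img: "(%i. g i x) ` ?I = rs a x"
    using bij_g[OF x] A0_zero[OF a] unfolding bij_betw_def by (force simp: rs_def)
   have injI: "inj_on (%i. g i x) ?I" by (rule inj_on_subset[OF inj]) auto
   have fin: "finite ?I" using finite_imageD[OF _ injI] A0_fin[OF a] by (simp add: img)
   have "(\<Sum>i. if x : D i then a (x, g i x) * b (g i x, z) else 0) =
     (\<Sum>i\<in>?I. if x : D i then a (x, g i x) * b (g i x, z) else 0)"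
    by (rule suminf_finite[OF fin]) (auto simp: rs_def)
   also have "... = (\<Sum>i\<in>?I. a (x, g i x) * b (g i x, z))" by (rule sum.cong) auto
   also have "... = (\<Sum>y\<in>(%i. g i x) ` ?I. a (x, y) * b (y, z))" by (simp only: sum.reindex[OF injI] comp_def)
   also have "... = (\<Sum>y\<in>rs a x. a (x, y) * b (y, z))" by (simp only: img)
   finally show ?thesis by (simp add: A0_sel)
  qed
  have "(%p. \<Sum>i. if fst p : D i then a (fst p, g i (fst p)) * b (g i (fst p), snd p) else 0) : BM"
   by measurable
  also have "?this <-> a \<star> b : BM"
   by (rule measurable_cong) (auto simp: space_pair_measure eq cong: if_cong)
  finally show "a \<star> b : BM" .
  fix p :: "'a * 'a"
  obtain x z where p: "p = (x, z)" by (cases p)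
  show "(a \<star> b) p = 0" if "p ~: E"
  proof (rule ccontr)
   assume "(a \<star> b) p ~= 0"
   then obtain y where "y : rs a x" "z : rs b y" using rsub[of x] by (auto simp: p rs_def[of "a \<star> b"])
   hence "(x, y) : E" "(y, z) : E" using A0_zero a b by (auto simp: rs_def)
   thus False using that E_trans by (auto simp: p)
  qed
  have "cmod ((a \<star> b) p) <= (\<Sum>y\<in>rs a x. cmod (a (x, y) * b (y, z)))"
   unfolding p A0_sel by (rule norm_sum)
  also have "... <= (\<Sum>y\<in>rs a x. C * C')"
   unfolding norm_mult by (intro sum_mono mult_mono C C') (use C in auto)
  also have "... <= real n * (C * C')" using C(1,3) C'(1) by (simp add: mult_right_mono)
  finally show "cmod ((a \<star> b) p) <= real n * (C * C')" .
 next
  fix x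
  have fin: "finite (\<Union>y\<in>rs a x. rs b y)" using A0_fin a b by auto
  have "card (rs (a \<star> b) x) <= card (\<Union>y\<in>rs a x. rs b y)" by (rule card_mono[OF fin rsub])
  also have "... <= (\<Sum>y\<in>rs a x. card (rs b y))" by (rule card_UN_le) (use A0_fin a in auto)
  also have "... <= (\<Sum>y\<in>rs a x. n')" by (intro sum_mono C')
  also have "... <= n * n'" using C(3)[of x] by simp
  finally show "finite (rs (a \<star> b) x) & card (rs (a \<star> b) x) <= n * n' + n' * n"
   using finite_subset[OF rsub fin] by simp
  have fin: "finite (\<Union>y\<in>cs b x. cs a y)" using A0_fin a b by auto
  have "card (cs (a \<star> b) x) <= card (\<Union>y\<in>cs b x. cs a y)" by (rule card_mono[OF fin csub])
  also have "... <= (\<Sum>y\<in>cs b x. card (cs a y))" by (rule card_UN_le) (use A0_fin b in auto)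
  also have "... <= (\<Sum>y\<in>cs b x. n)" by (intro sum_mono C)
  also have "... <= n' * n" using C'(4)[of x] by simp
  finally show "finite (cs (a \<star> b) x) & card (cs (a \<star> b) x) <= n * n' + n' * n"
   using finite_subset[OF csub fin] by simp
 qed
qed

lemma ring_A0: "ring A0"
proof (rule ringI)
 show "abelian_group A0"
 proof (rule abelian_groupI)
  fix a assume a: "a : carrier A0"
  show "EX b:carrier A0. b \<oplus>\<^bsub>A0\<^esub> a = \<zero>\<^bsub>A0\<^esub>"
   by (rule bexI[OF _ smult_A0[OF a, of "-1"]]) (simp add: A0_sel)
 qed (auto simp: add_A0 zero_A0, auto simp: A0_sel algebra_simps)
 show "monoid A0"
 proof (rule monoidI)
  fix a b c assume a: "a : carrier A0" and b: "b : carrier A0" and c: "c : carrier A0"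
  show "a \<star> b \<star> c = a \<star> (b \<star> c)"
  proof
   fix p :: "'a * 'a"
   obtain x w where p: "p = (x, w)" by (cases p)
   let ?S = "rs a x" and ?T = "cs c w"
   note f = A0_fin[OF a] A0_fin[OF b] A0_fin[OF c] A0_fin[OF mult_A0[OF a b]] A0_fin[OF mult_A0[OF b c]]
   have "(a \<star> b \<star> c) (x, w) = (\<Sum>z\<in>?T. (a \<star> b) (x, z) * c (z, w))"
    by (rule A0_mult_cols) (use f in auto)
   also have "... = (\<Sum>z\<in>?T. \<Sum>y\<in>?S. a (x, y) * b (y, z) * c (z, w))"
    by (simp add: A0_sel sum_distrib_right)
   also have "... = (\<Sum>y\<in>?S. \<Sum>z\<in>?T. a (x, y) * b (y, z) * c (z, w))" by (rule sum.swap)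
   also have "... = (\<Sum>y\<in>?S. a (x, y) * (b \<star> c) (y, w))"
    using A0_mult_cols[OF f(3) f(6) subset_refl] by (simp add: sum_distrib_left mult.assoc)
   also have "... = (a \<star> (b \<star> c)) (x, w)" by (simp add: A0_sel(7)[of a])
   finally show "(a \<star> b \<star> c) p = (a \<star> (b \<star> c)) p" by (simp add: p)
  qed
 next
  fix a assume a: "a : carrier A0"
  show "one0 \<star> a = a"
  proof
   fix p :: "'a * 'a"
   obtain x w where p: "p = (x, w)" by (cases p)
   have "(one0 \<star> a) (x, w) = (\<Sum>y\<in>{x}. one0 (x, y) * a (y, w))"
    by (rule A0_mult_rows) (auto simp: rs_def A0_sel split: if_splits)
   thus "(one0 \<star> a) p = a p" using A0_zero[OF a, of "(x, w)"] E_space by (auto simp: p A0_sel(6))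
  qed
  show "a \<star> one0 = a"
  proof
   fix p :: "'a * 'a"
   obtain x w where p: "p = (x, w)" by (cases p)
   have "(a \<star> one0) (x, w) = (\<Sum>y\<in>{w}. a (x, y) * one0 (y, w))"
    by (rule A0_mult_cols) (auto simp: cs_def A0_sel(6) A0_fin[OF a] split: if_splits)
   thus "(a \<star> one0) p = a p" using A0_zero[OF a, of "(x, w)"] E_space by (auto simp: p A0_sel(6))
  qed
 qed (auto simp: mult_A0 one_A0)
 fix a b c assume a: "a : carrier A0" and b: "b : carrier A0" and c: "c : carrier A0"
 show "(a \<oplus>\<^bsub>A0\<^esub> b) \<star> c = a \<star> c \<oplus>\<^bsub>A0\<^esub> b \<star> c"
 proof
  fix p :: "'a * 'a"
  obtain x w where p: "p = (x, w)" by (cases p)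
  note col = A0_mult_cols[OF _ A0_fin(2)[OF c] subset_refl]
  show "((a \<oplus>\<^bsub>A0\<^esub> b) \<star> c) p = (a \<star> c \<oplus>\<^bsub>A0\<^esub> b \<star> c) p"
   using a b by (simp add: p A0_sel(2) col A0_fin add_A0[unfolded A0_sel] sum.distrib distrib_right)
 qed
 show "c \<star> (a \<oplus>\<^bsub>A0\<^esub> b) = c \<star> a \<oplus>\<^bsub>A0\<^esub> c \<star> b"
  by (rule ext) (auto simp: A0_sel sum.distrib distrib_left)
qed

text \<open>The squared norm of L^2(E), with values in \<open>ennreal\<close> so that it makes sense
  for functions outside the algebra.\<close>

definition qn :: "('a * 'a => complex) => ennreal" where
 "qn a = (\<integral>\<^sup>+x. (\<Uplus>y. ennreal ((cmod (a (y, x)))^2)) \<partial>N)"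

lemma trace_star_mult:
 assumes a: "a : carrier A0"
 obtains r where "0 <= r" "trace A0 (star A0 a \<star> a) = cr r" "qn a = ennreal r"
proof -
 obtain C n where C: "1 <= C" "!!p. cmod (a p) <= C" "!!x. card (rs a x) <= n" "!!x. card (cs a x) <= n" by (rule A0E[OF a]) blast
 have [measurable]: "a : BM" using A0_meas a by auto
 define r where "r x = (\<Sum>y\<in>cs a x. (cmod (a (y, x)))^2)" for x
 have r0: "0 <= r x" for x by (simp add: r_def sum_nonneg)
 have e: "ennreal (r x) = (\<Uplus>y. ennreal ((cmod (a (y, x)))^2))" for x
  unfolding r_def
  by (rule nn_integral_count_space_finite_support[symmetric]) (use A0_fin[OF a] in \<open>auto simp: cs_def\<close>)
 have "(%x. \<Uplus>y. ennreal ((cmod (a (y, x)))^2)) : borel_measurable N"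
  by (rule count_meas(2)[of "%p. ennreal ((cmod (a p))^2)"]) (auto simp: A0_zero[OF a])
 hence "(%x. enn2real (ennreal (r x))) : borel_measurable N" unfolding e by measurable
 hence rm: "r : borel_measurable N" using r0 by simp
 have rb: "r x <= real n * C^2" for x
 proof -
  have "r x <= (\<Sum>y\<in>cs a x. C^2)" unfolding r_def by (intro sum_mono power_mono C) simp
  also have "... <= real n * C^2" using C(4)[of x] by (simp add: mult_right_mono)
  finally show ?thesis .
 qed
 have ri: "integrable N r"
  by (rule N.integrable_const_bound[of _ "real n * C^2"]) (use rm r0 rb in auto)
 have diag: "(star A0 a \<star> a) (x, x) = cr (r x)" for x
 proof -
  have "rs (star A0 a) x = cs a x" by (auto simp: rs_def cs_def A0_sel)
  hence "(star A0 a \<star> a) (x, x) = (\<Sum>y\<in>cs a x. a (y, x) * cnj (a (y, x)))"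
   by (simp add: A0_sel mult.commute)
  thus ?thesis unfolding r_def of_real_sum by (simp only: complex_norm_square[symmetric])
 qed
 show ?thesis
 proof (rule that[of "\<integral>x. r x \<partial>N"])
  show "0 <= (\<integral>x. r x \<partial>N)" using r0 by simp
  show "trace A0 (star A0 a \<star> a) = cr (\<integral>x. r x \<partial>N)"
   unfolding A0_sel(5) diag by simp
  show "qn a = ennreal (\<integral>x. r x \<partial>N)"
   unfolding qn_def e[symmetric] by (rule nn_integral_eq_integral[OF ri]) (use r0 in auto)
 qed
qed

text \<open>Mass transport of the squared modulus; this is the traciality of M0(E).\<close>

lemma qn_star:
 assumes a: "a : carrier A0" shows "qn (star A0 a) = qn a"
proof -
 have [measurable]: "a : BM" using A0_meas a by auto
 show ?thesis
  using mass_transport[of "%p. ennreal ((cmod (a p))^2)"] A0_zero[OF a]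
  by (simp add: qn_def A0_sel)
qed

lemma norm2_qn:
 assumes a: "a : carrier A0"
 shows "ennreal ((nrm a)^2) = qn a" "0 <= nrm a"
proof -
 obtain r where r: "0 <= r" "trace A0 (star A0 a \<star> a) = cr r" "qn a = ennreal r"
  by (rule trace_star_mult[OF a])
 show "ennreal ((nrm a)^2) = qn a" "0 <= nrm a"
  using r by (simp_all add: trace_norm2_def trace_inner_def)
qed

text \<open>A Schur test: Cauchy-Schwarz in a row with at most \<open>n\<close> entries gives one
  factor \<open>n\<close>, and counting the rows that meet a given column gives the other. The
  resulting bound is \<open>n * C\<close>.\<close>

lemma left_bdd_A0:
 assumes a: "a : carrier A0"
 shows "EX K. ALL b:carrier A0. nrm (a \<star> b) <= K * nrm b"
proof -
 obtain C n where C: "1 <= C" "!!p. cmod (a p) <= C" "!!x. card (rs a x) <= n" "!!x. card (cs a x) <= n" by (rule A0E[OF a]) blast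
 have "nrm (a \<star> b) <= (real n * C) * nrm b" if b: "b : carrier A0" for b
 proof -
  have ab: "a \<star> b : carrier A0" by (rule mult_A0[OF a b])
  have pt: "(\<Uplus>y. ennreal ((cmod ((a \<star> b) (y, x)))^2)) \<le>
    ennreal ((real n * C)^2) * (\<Uplus>y. ennreal ((cmod (b (y, x)))^2))" for x
  proof -
   let ?S = "cs b x"
   let ?T = "cs (a \<star> b) x"
   have S: "finite ?S" using A0_fin b by auto
   have T: "finite ?T" using A0_fin ab by auto
   have row: "(cmod ((a \<star> b) (y, x)))^2 <= (\<Sum>z\<in>?S. if a (y, z) ~= 0 then real n * C^2 * (cmod (b (z, x)))^2 else 0)" for y
   proof -
    let ?Z = "?S Int rs a y"
    have "(a \<star> b) (y, x) = (\<Sum>z\<in>?S. a (y, z) * b (z, x))"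
     by (rule A0_mult_cols) (use S A0_fin[OF a] in auto)
    also have "... = (\<Sum>z\<in>?Z. a (y, z) * b (z, x))"
     using S by (intro sum.mono_neutral_right) (auto simp: rs_def)
    finally have "cmod ((a \<star> b) (y, x)) <= (\<Sum>z\<in>?Z. cmod (a (y, z) * b (z, x)))"
     by (simp add: norm_sum)
    also have "... <= (\<Sum>z\<in>?Z. (C * cmod (b (z, x))) * 1)"
     unfolding norm_mult mult_1_right by (intro sum_mono mult_right_mono C) simp
    finally have "(cmod ((a \<star> b) (y, x)))^2 <= (\<Sum>z\<in>?Z. (C * cmod (b (z, x))) * 1)^2"
     by (intro power_mono) auto
    also have "... <= (\<Sum>z\<in>?Z. (C * cmod (b (z, x)))^2) * (\<Sum>z\<in>?Z. 1^2)" by (rule Cauchy_Schwarz_ineq_sum)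
    also have "... <= (\<Sum>z\<in>?Z. (C * cmod (b (z, x)))^2) * real n"
    proof (intro mult_left_mono)
     have "card ?Z <= n" using card_mono[OF A0_fin(1)[OF a], of ?Z y] C(3)[of y] by auto
     thus "(\<Sum>z\<in>?Z. 1^2) <= real n" by simp
    qed (simp add: sum_nonneg)
    also have "... = (\<Sum>z\<in>?Z. real n * C^2 * (cmod (b (z, x)))^2)"
     by (simp add: sum_distrib_left power_mult_distrib mult_ac)
    also have "... = (\<Sum>z\<in>?S. if a (y, z) ~= 0 then real n * C^2 * (cmod (b (z, x)))^2 else 0)"
     using S by (intro sum.mono_neutral_cong_left) (auto simp: rs_def)
    finally show ?thesis .
   qed
   have "(\<Sum>y\<in>?T. (cmod ((a \<star> b) (y, x)))^2) \<le>
     (\<Sum>y\<in>?T. \<Sum>z\<in>?S. if a (y, z) ~= 0 then real n * C^2 * (cmod (b (z, x)))^2 else 0)"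
    by (intro sum_mono row)
   also have "... = (\<Sum>z\<in>?S. \<Sum>y\<in>?T. if a (y, z) ~= 0 then real n * C^2 * (cmod (b (z, x)))^2 else 0)"
    by (rule sum.swap)
   also have "... = (\<Sum>z\<in>?S. real (card (?T Int cs a z)) * (real n * C^2 * (cmod (b (z, x)))^2))"
    using T by (intro sum.cong refl) (simp add: sum.If_cases cs_def)
   also have "... <= (\<Sum>z\<in>?S. real n * (real n * C^2 * (cmod (b (z, x)))^2))"
   proof (intro sum_mono mult_right_mono)
    fix z
    have "card (?T Int cs a z) <= n" using card_mono[OF A0_fin(2)[OF a], of "?T Int cs a z" z] C(4)[of z] by auto
    thus "real (card (?T Int cs a z)) <= real n" by simp
   qed simp
   also have "... = (real n * C)^2 * (\<Sum>z\<in>?S. (cmod (b (z, x)))^2)"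
    by (simp add: sum_distrib_left power2_eq_square mult_ac)
   finally have "ennreal (\<Sum>y\<in>?T. (cmod ((a \<star> b) (y, x)))^2) <= ennreal ((real n * C)^2 * (\<Sum>z\<in>?S. (cmod (b (z, x)))^2))"
    by (rule ennreal_leI)
   also have "... = ennreal ((real n * C)^2) * ennreal (\<Sum>z\<in>?S. (cmod (b (z, x)))^2)"
    by (simp add: ennreal_mult sum_nonneg)
   also have "ennreal (\<Sum>z\<in>?S. (cmod (b (z, x)))^2) = (\<Uplus>y. ennreal ((cmod (b (y, x)))^2))"
    by (rule nn_integral_count_space_finite_support[symmetric]) (use S in \<open>auto simp: cs_def\<close>)
   also have "ennreal (\<Sum>y\<in>?T. (cmod ((a \<star> b) (y, x)))^2) =
     (\<Uplus>y. ennreal ((cmod ((a \<star> b) (y, x)))^2))"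
    by (rule nn_integral_count_space_finite_support[symmetric]) (use T in \<open>auto simp: cs_def\<close>)
   finally show ?thesis .
  qed
  have [measurable]: "b : BM" using A0_meas b by auto
  have "qn (a \<star> b) <= (\<integral>\<^sup>+x. ennreal ((real n * C)^2) * (\<Uplus>y. ennreal ((cmod (b (y, x)))^2)) \<partial>N)"
   unfolding qn_def by (intro nn_integral_mono pt)
  also have "... = ennreal ((real n * C)^2) * qn b"
   unfolding qn_def
   by (intro nn_integral_cmult count_meas(2)[of "%p. ennreal ((cmod (b p))^2)"]) (auto simp: A0_zero[OF b])
  finally have "ennreal ((nrm (a \<star> b))^2) <= ennreal ((real n * C * nrm b)^2)"
   using C by (simp add: norm2_qn[OF ab] power_mult_distrib ennreal_mult flip: norm2_qn(1)[OF b])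
  hence "(nrm (a \<star> b))^2 <= (real n * C * nrm b)^2" by simp
  thus ?thesis by (rule power2_le_imp_le) (use norm2_qn(2)[OF b] C in simp)
 qed
 thus ?thesis by blast
qed

lemma integrable_diag:
 assumes a: "a : carrier A0" shows "integrable N (%x. a (x, x))"
proof -
 obtain C n where C: "1 <= C" "!!p. cmod (a p) <= C" by (rule A0E[OF a]) blast
 have [measurable]: "a : BM" using A0_meas a by auto
 show ?thesis by (rule N.integrable_const_bound[of _ C]) (use C in auto)
qed

sublocale A0: tracial_alg A0
proof (intro tracial_alg.intro tracial_alg_axioms.intro ring_A0 smult_A0 star_A0 left_bdd_A0)
 fix a b :: "'a * 'a => complex" and c d :: complex
 assume a: "a : carrier A0"
 show "(c + d) \<odot>\<^bsub>A0\<^esub> a = c \<odot>\<^bsub>A0\<^esub> a \<oplus>\<^bsub>A0\<^esub> d \<odot>\<^bsub>A0\<^esub> a" "1 \<odot>\<^bsub>A0\<^esub> a = a" "c \<odot>\<^bsub>A0\<^esub> (d \<odot>\<^bsub>A0\<^esub> a) = (c * d) \<odot>\<^bsub>A0\<^esub> a"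
  "star A0 (star A0 a) = a" "star A0 (c \<odot>\<^bsub>A0\<^esub> a) = cnj c \<odot>\<^bsub>A0\<^esub> star A0 a"
  by (auto simp: A0_sel distrib_right mult.assoc)
 show "trace A0 (c \<odot>\<^bsub>A0\<^esub> a) = c * trace A0 a" by (simp add: A0_sel)
 show "trace A0 (star A0 a) = cnj (trace A0 a)" by (simp add: A0_sel)
 obtain r where r: "0 <= r" "trace A0 (star A0 a \<star> a) = cr r" "qn a = ennreal r"
  by (rule trace_star_mult[OF a])
 obtain r' where r': "0 <= r'" "trace A0 (star A0 (star A0 a) \<star> star A0 a) = cr r'" "qn (star A0 a) = ennreal r'"
  by (rule trace_star_mult[OF star_A0[OF a]])
 have ss: "star A0 (star A0 a) = a" by (auto simp: A0_sel)
 show "0 <= Re (trace A0 (star A0 a \<star> a))" using r by simp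
 show "trace A0 (a \<star> star A0 a) = trace A0 (star A0 a \<star> a)"
  using r r' qn_star[OF a] by (simp add: ss)
 assume b: "b : carrier A0"
 show "c \<odot>\<^bsub>A0\<^esub> (a \<oplus>\<^bsub>A0\<^esub> b) = c \<odot>\<^bsub>A0\<^esub> a \<oplus>\<^bsub>A0\<^esub> c \<odot>\<^bsub>A0\<^esub> b" "star A0 (a \<oplus>\<^bsub>A0\<^esub> b) = star A0 a \<oplus>\<^bsub>A0\<^esub> star A0 b"
  by (auto simp: A0_sel distrib_left)
 show "trace A0 (a \<oplus>\<^bsub>A0\<^esub> b) = trace A0 a + trace A0 b"
  using integrable_diag[OF a] integrable_diag[OF b] by (simp add: A0_sel)
 note col = A0_mult_cols[OF _ A0_fin(2)[OF b] subset_refl]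
 show "(c \<odot>\<^bsub>A0\<^esub> a) \<star> b = c \<odot>\<^bsub>A0\<^esub> (a \<star> b)" "a \<star> (c \<odot>\<^bsub>A0\<^esub> b) = c \<odot>\<^bsub>A0\<^esub> (a \<star> b)"
 proof -
  have "((c \<odot>\<^bsub>A0\<^esub> a) \<star> b) (x, z) = c * (a \<star> b) (x, z)" for x z
   using col[OF A0_fin(1)[OF smult_A0[OF a]], of c x z] col[OF A0_fin(1)[OF a], of x z]
   by (simp add: A0_sel(3) sum_distrib_left mult.assoc)
  thus "(c \<odot>\<^bsub>A0\<^esub> a) \<star> b = c \<odot>\<^bsub>A0\<^esub> (a \<star> b)" by (auto simp: A0_sel(3))
  show "a \<star> (c \<odot>\<^bsub>A0\<^esub> b) = c \<odot>\<^bsub>A0\<^esub> (a \<star> b)" by (rule ext) (auto simp: A0_sel sum_distrib_left mult_ac)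
 qed
 show "star A0 (a \<star> b) = star A0 b \<star> star A0 a"
 proof
  fix p :: "'a * 'a"
  obtain x z where p: "p = (x, z)" by (cases p)
  have "rs (star A0 b) x = cs b x" by (auto simp: rs_def cs_def A0_sel)
  hence "(star A0 b \<star> star A0 a) (x, z) = (\<Sum>y\<in>cs b x. cnj (b (y, x)) * cnj (a (z, y)))"
   by (simp add: A0_sel)
  also have "... = cnj ((a \<star> b) (z, x))"
   using col[OF A0_fin(1)[OF a], of z x] by (simp add: mult.commute)
  finally show "star A0 (a \<star> b) p = (star A0 b \<star> star A0 a) p" by (simp add: p A0_sel(4))
 qed
qed

lemma A0_sb: "a : carrier A0 ==> b : carrier A0 ==> A0.Ai.sb a b = (%p. a p - b p)"
 by (simp add: A0.Ai.sb_def A0_sel)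

end

section \<open>Local patterns of actions\<close>

context
 notes split_paired_Ex [simp del] and split_paired_All [simp del]
begin

text \<open>Only the equations of an action on \<open>Z\<close>. Nothing is said about values
  outside \<open>Z\<close>, so an action that is modified pointwise still qualifies.\<close>

definition fg_act :: "'z set => (letter list => 'z => 'z) => bool" where
 "fg_act Z ga <-> (ALL w:carrier free_group. ALL z:Z. ga w z : Z) & (ALL z:Z. ga [] z = z) \<and>
  (ALL v:carrier free_group. ALL w:carrier free_group. ALL z:Z. ga (v \<cdot> w) z = ga v (ga w z))"

lemma fg_actD:
 assumes "fg_act Z ga"
 shows "w : carrier free_group ==> z : Z ==> ga w z : Z" "z : Z ==> ga [] z = z"
  "v : carrier free_group ==> w : carrier free_group ==> z : Z ==> ga (v \<cdot> w) z = ga v (ga w z)"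
 using assms by (auto simp: fg_act_def)

lemma one_free_group: "\<one>\<^bsub>free_group\<^esub> = []"
 by (simp add: free_group_def)

lemma fg_act_group_action:
 assumes "group_action free_group Z ga" shows "fg_act Z ga"
proof -
 interpret group_action free_group Z ga by fact
 show ?thesis
  unfolding fg_act_def
  using element_image composition_rule id_eq_one one_free_group by (metis restrict_apply')
qed

lemma short_words_FG: "w : short_words r ==> w : carrier free_group"
 by (simp add: short_words_def free_group_def)

lemma Nil_short: "[] : short_words r"
 by (simp add: short_words_def reduced_def)

lemma Cons_short: "c # w : short_words r ==> w : short_words r"
 by (cases w) (auto simp: short_words_def reduced_def)

lemma Cons_mult: "c # w : short_words r ==> [c] \<cdot> w = c # w"
 by (cases w) (auto simp: short_words_def reduced_def free_group_def)

lemma letter_FG [simp]: "[c] : carrier free_group"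
 by (simp add: free_group_def reduced_def)

lemma finite_short: "finite (short_words r)"
proof (rule finite_subset)
 show "short_words r <= {w. set w <= {..<r} \<times> UNIV & length w <= r}"
  by (auto simp: short_words_def)
 show "finite {w. set w <= {..<r} \<times> (UNIV :: bool set) & length w <= r}"
  by (rule finite_lists_length_le) auto
qed

lemma short_words_mono: "r <= r' ==> short_words r <= short_words r'"
 by (fastforce simp: short_words_def)

lemma short_words_exhaust: "w : carrier free_group ==> EX r. w : short_words r"
proof -
 assume w: "w : carrier free_group"
 have "ALL c:set w. fst c < Suc (Max (insert 0 (fst ` set w)))" by (simp add: less_Suc_eq_le)
 hence "ALL c:set w. fst c < max (length w) (Suc (Max (insert 0 (fst ` set w))))" by fastforce
 thus ?thesis using w by (intro exI[of _ "max (length w) (Suc (Max (insert 0 (fst ` set w))))"])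
  (simp add: short_words_def free_group_def)
qed

text \<open>The index of the ancestor \<open>k\<close> levels up in the dyadic tree. The sets 2i - 1
  and 2i are the halves of the set i, hence the parent \<open>(j + 1) div 2\<close>.\<close>

fun anc :: "nat => nat => nat" where
 "anc j 0 = j"
| "anc j (Suc k) = anc ((j + 1) div 2) k"

lemma dyadic_parent:
 assumes "dyadic_splitting S d" "1 <= j" "j <= 2 ^ Suc r"
 shows "d j (Suc r) <= d ((j + 1) div 2) r" "1 <= (j + 1) div 2" "(j + 1) div 2 <= 2 ^ r"
proof -
 let ?i = "(j + 1) div 2"
 show i: "1 <= ?i" "?i <= 2 ^ r" using assms by auto
 have "d (2 * ?i - 1) (Suc r) Un d (2 * ?i) (Suc r) = d ?i r"
  using assms(1) i unfolding dyadic_splitting_def by (auto dest!: conjunct2 spec[of _ "Suc r"])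
 moreover have "j = 2 * ?i - 1 \<or> j = 2 * ?i" using assms(2) by presburger
 ultimately show "d j (Suc r) <= d ?i r" by (metis Un_upper1 Un_upper2)
qed

lemma dyadic_unique:
 assumes d: "dyadic_splitting S d" and y: "y : S"
 shows "\<exists>!i. i : {1..2 ^ r} & y : d i r"
proof (induction r)
 case 0
 show ?case using d y by (auto simp: dyadic_splitting_def intro!: ex1I[of _ 1])
next
 case (Suc r)
 then obtain i where i: "i : {1..2 ^ r}" "y : d i r" and u: "!!i'. i' : {1..2 ^ r} ==> y : d i' r ==> i' = i"
  by blast
 have s: "d (2 * i - 1) (Suc r) Un d (2 * i) (Suc r) = d i r" "d (2 * i - 1) (Suc r) Int d (2 * i) (Suc r) = {}"
  using d i(1) unfolding dyadic_splitting_def by (auto dest!: conjunct2 spec[of _ "Suc r"])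
 have c: "j = 2 * i - 1 \<or> j = 2 * i" if "j : {1..2 ^ Suc r}" "y : d j (Suc r)" for j
 proof -
  have "(j + 1) div 2 = i" using that dyadic_parent[OF d, of j r] by (intro u) auto
  thus ?thesis using that by auto
 qed
 have r1: "2 * i - 1 : {1..2 ^ Suc r}" "2 * i : {1..2 ^ Suc r}" using i by auto
 consider "y : d (2 * i - 1) (Suc r)" "y ~: d (2 * i) (Suc r)" | "y : d (2 * i) (Suc r)" "y ~: d (2 * i - 1) (Suc r)"
  using s i by blast
 thus ?case
 proof cases
  case 1
  thus ?thesis using c r1 by (intro ex1I[of _ "2 * i - 1"]) auto
 next
  case 2
  thus ?thesis using c r1 by (intro ex1I[of _ "2 * i"]) auto
 qed
qed

lemma dyadic_anc:
 assumes d: "dyadic_splitting S d"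
 shows "k <= r ==> 1 <= j ==> j <= 2 ^ r ==> y : d j r ==>
  y : d (anc j k) (r - k) & 1 <= anc j k & anc j k <= 2 ^ (r - k)"
proof (induction k arbitrary: j r)
 case (Suc k)
 then obtain r' where r: "r = Suc r'" by (cases r) auto
 show ?case
  using Suc.IH[of r' "(j + 1) div 2"] dyadic_parent[OF d, of j r'] Suc.prems by (auto simp: r)
qed auto

text \<open>The point lies in the ancestor, and the sets of one level are disjoint. So a label at
  level \<open>r\<close> decides membership at every coarser level.\<close>

lemma dyadic_anc_iff:
 assumes d: "dyadic_splitting S d" and y: "y : S" "y : d j r" and "1 <= j" "j <= 2 ^ r" "m <= r" "1 <= i" "i <= 2 ^ m"
 shows "y : d i m <-> anc j (r - m) = i"
 using dyadic_anc[OF d, of "r - m" r j y] dyadic_unique[OF d y(1), of m] assms by auto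

definition label :: "(nat => nat => 'z set) => nat => 'z => nat" where
 "label d r y = (THE i. i : {1..2 ^ r} & y : d i r)"

lemma label:
 assumes d: "dyadic_splitting S d" and y: "y : S"
 shows "label d r y : {1..2 ^ r}" "y : d (label d r y) r" "i : {1..2 ^ r} ==> label d r y = i <-> y : d i r"
 using theI'[OF dyadic_unique[OF d y, of r]] dyadic_unique[OF d y, of r] unfolding label_def by auto

text \<open>A complete invariant of the neighborhood up to isomorphism: which words lead to the same
  vertex, and the labels of the vertices reached. Patterns of points of different spaces can be
  compared by equality, and there are finitely many for each \<open>r\<close>.\<close>

definition pattern :: "(letter list => 'z => 'z) => (nat => nat => 'z set) => nat => 'z =>
  (letter list \<times> letter list) set \<times> (letter list => nat)" where
 "pattern ga d r x = ({(v, w) : short_words r \<times> short_words r. ga v x = ga w x},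
  \<lambda>w\<in>short_words r. label d r (ga w x))"

definition patterns :: "nat => ((letter list \<times> letter list) set \<times> (letter list => nat)) set" where
 "patterns r = Pow (short_words r \<times> short_words r) \<times> (short_words r \<rightarrow>\<^sub>E {1..2 ^ r})"

lemma finite_patterns: "finite (patterns r)"
 unfolding patterns_def by (intro finite_cartesian_product finite_PiE) (auto simp: finite_short)

lemma pattern_in:
 assumes "fg_act Z ga" "dyadic_splitting Z d" "x : Z" shows "pattern ga d r x : patterns r"
 using label(1)[OF assms(2)] fg_actD(1)[OF assms(1)] short_words_FG assms(3)
 by (auto simp: pattern_def patterns_def)

lemma pattern_eqD:
 assumes "pattern ga d r x = pattern ga' d' r x'"
 shows "v : short_words r ==> w : short_words r ==> ga v x = ga w x <-> ga' v x' = ga' w x'"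
  "w : short_words r ==> label d r (ga w x) = label d' r (ga' w x')"
proof -
 assume v: "v : short_words r" and w: "w : short_words r"
 have "(v, w) : fst (pattern ga d r x) <-> (v, w) : fst (pattern ga' d' r x')" using assms by simp
 thus "ga v x = ga w x <-> ga' v x' = ga' w x'" using v w by (simp add: pattern_def)
next
 assume w: "w : short_words r"
 have "snd (pattern ga d r x) w = snd (pattern ga' d' r x') w" using assms by simp
 thus "label d r (ga w x) = label d' r (ga' w x')" using w by (simp add: pattern_def)
qed

lemma verts_action: "verts (action_nbhd r d ga x) = (%w. ga w x) ` short_words r"
 by (auto simp: action_nbhd_def)

lemma vlabel_action: "vlabel (action_nbhd r d ga x) = label d r"
 by (simp add: action_nbhd_def label_def fun_eq_iff)

lemma edges_action: "(u, c, v) : edges (action_nbhd r d ga x) <->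
  (EX w. w : short_words r & [c] \<cdot> w : short_words r & u = ga w x & v = ga ([c] \<cdot> w) x)"
 unfolding action_nbhd_def by (simp del: split_paired_Ex) blast

text \<open>The isomorphism sends \<open>ga w x\<close> to \<open>ga' w x'\<close>; it is well
  defined and injective because the coincidences of words agree.\<close>

lemma pattern_imp_iso:
 assumes act: "fg_act Z ga" "fg_act Z' ga'" and x: "x : Z" "x' : Z'"
  and P: "pattern ga d r x = pattern ga' d' r x'"
 shows "nbhd_iso (action_nbhd r d ga x) (action_nbhd r d' ga' x')"
proof -
 note eq = pattern_eqD(1)[OF P] and lab = pattern_eqD(2)[OF P]
 define f where "f y = ga' (SOME w. w : short_words r & ga w x = y) x'" for y
 have f: "f (ga w x) = ga' w x'" if w: "w : short_words r" for w
 proof -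
  let ?s = "SOME v. v : short_words r & ga v x = ga w x"
  have "?s : short_words r & ga ?s x = ga w x" by (rule someI[of _ w]) (use w in simp)
  thus ?thesis unfolding f_def using eq w by blast
 qed
 show ?thesis
  unfolding nbhd_iso_def
 proof (intro exI[of _ f] conjI ballI allI)
  show "bij_betw f (verts (action_nbhd r d ga x)) (verts (action_nbhd r d' ga' x'))"
   unfolding bij_betw_def verts_action by (auto simp: inj_on_def f eq image_image)
  show "f (root (action_nbhd r d ga x)) = root (action_nbhd r d' ga' x')"
   using f[OF Nil_short] fg_actD(2)[OF act(1) x(1)] fg_actD(2)[OF act(2) x(2)] by (simp add: action_nbhd_def)
  fix u assume u: "u : verts (action_nbhd r d ga x)"
  then obtain w where w: "w : short_words r" "u = ga w x" by (auto simp: verts_action)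
  thus "vlabel (action_nbhd r d' ga' x') (f u) = vlabel (action_nbhd r d ga x) u"
   by (simp add: vlabel_action f lab)
  fix v c assume "v : verts (action_nbhd r d ga x)"
  then obtain w' where w': "w' : short_words r" "v = ga w' x" by (auto simp: verts_action)
  show "(u, c, v) : edges (action_nbhd r d ga x) <-> (f u, c, f v) : edges (action_nbhd r d' ga' x')"
   unfolding edges_action w(2) w'(2) f[OF w(1)] f[OF w'(1)] using eq w(1) w'(1) by blast
 qed
qed

text \<open>An isomorphism respects root and colours, and a colour determines the target of an edge.
  So by induction along words it can only send \<open>ga w x\<close> to
  \<open>ga' w x'\<close>.\<close>

lemma iso_imp_pattern:
 assumes act: "fg_act Z ga" "fg_act Z' ga'" and x: "x : Z" "x' : Z'"
  and iso: "nbhd_iso (action_nbhd r d ga x) (action_nbhd r d' ga' x')"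
 shows "pattern ga d r x = pattern ga' d' r x'"
proof -
 let ?G = "action_nbhd r d ga x" and ?G' = "action_nbhd r d' ga' x'"
 obtain f where f: "bij_betw f (verts ?G) (verts ?G')" "f (root ?G) = root ?G'"
  "!!v. v : verts ?G ==> vlabel ?G' (f v) = vlabel ?G v"
  "!!u v c. u : verts ?G ==> v : verts ?G ==> (u, c, v) : edges ?G <-> (f u, c, f v) : edges ?G'"
  using iso unfolding nbhd_iso_def by blast
 have fw: "f (ga w x) = ga' w x'" if "w : short_words r" for w
  using that
 proof (induction w)
  case Nil
  thus ?case using f(2) fg_actD(2)[OF act(1) x(1)] fg_actD(2)[OF act(2) x(2)] by (simp add: action_nbhd_def)
 next
  case (Cons c w)
  have w: "w : short_words r" and cw: "[c] \<cdot> w = c # w"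
   using Cons_short[OF Cons.prems] Cons_mult[OF Cons.prems] by auto
  have "(ga w x, c, ga (c # w) x) : edges ?G" unfolding edges_action using w cw Cons.prems by metis
  hence "(f (ga w x), c, f (ga (c # w) x)) : edges ?G'"
   using f(4)[of "ga w x" "ga (c # w) x" c] w Cons.prems by (auto simp: verts_action)
  then obtain u where u: "u : short_words r" "ga' w x' = ga' u x'" "f (ga (c # w) x) = ga' ([c] \<cdot> u) x'"
   unfolding edges_action Cons.IH[OF w] by blast
  hence "f (ga (c # w) x) = ga' [c] (ga' w x')"
   using fg_actD(3)[OF act(2) letter_FG short_words_FG[OF u(1)] x(2)] by simp
  also have "... = ga' (c # w) x'" using fg_actD(3)[OF act(2) letter_FG short_words_FG[OF w] x(2)] cw by metis
  finally show ?case .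
 qed
 have "ga v x = ga w x <-> ga' v x' = ga' w x'" if "v : short_words r" "w : short_words r" for v w
  using f(1) that unfolding bij_betw_def verts_action inj_on_def by (metis fw imageI)
 moreover have "label d r (ga w x) = label d' r (ga' w x')" if "w : short_words r" for w
  using f(3)[of "ga w x"] that by (auto simp: verts_action vlabel_action fw)
 ultimately show ?thesis by (auto simp: pattern_def restrict_def fun_eq_iff)
qed

lemma nbhd_iso_trans:
 assumes "nbhd_iso G G'" "nbhd_iso G' G''" shows "nbhd_iso G G''"
proof -
 obtain f where f: "bij_betw f (verts G) (verts G')" "f (root G) = root G'"
  "!!v. v : verts G ==> vlabel G' (f v) = vlabel G v"
  "!!u v c. u : verts G ==> v : verts G ==> (u, c, v) : edges G <-> (f u, c, f v) : edges G'"
  using assms(1) unfolding nbhd_iso_def by blast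
 obtain h where h: "bij_betw h (verts G') (verts G'')" "h (root G') = root G''"
  "!!v. v : verts G' ==> vlabel G'' (h v) = vlabel G' v"
  "!!u v c. u : verts G' ==> v : verts G' ==> (u, c, v) : edges G' <-> (h u, c, h v) : edges G''"
  using assms(2) unfolding nbhd_iso_def by blast
 have fv: "f v : verts G'" if "v : verts G" for v using f(1) that by (auto simp: bij_betw_def)
 show ?thesis
  unfolding nbhd_iso_def
  by (rule exI[of _ "h \<circ> f"]) (use f h fv bij_betw_trans[OF f(1) h(1)] in auto)
qed

text \<open>Elek-Lippner convergence is stated for graphs on natural numbers, so neighborhoods are
  transported there.\<close>

definition nat_copy :: "('v => nat) => 'v rooted_graph => nat rooted_graph" where
 "nat_copy ph G = \<lparr> verts = ph ` verts G, root = ph (root G), vlabel = (%i. vlabel G (inv_into (verts G) ph i)),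
  edges = {(ph u, c, ph v) |u c v. (u, c, v) : edges G} \<rparr>"

lemma nat_copy:
 assumes inj: "inj_on ph (verts G)" and G: "labeled_nbhd r G"
 shows "labeled_nbhd r (nat_copy ph G)" "nbhd_iso G (nat_copy ph G)" "nbhd_iso (nat_copy ph G) G"
proof -
 note L = G[unfolded labeled_nbhd_def]
 have ed: "u : verts G" "v : verts G" "fst c < r" if "(u, c, v) : edges G" for u c v using L that by blast+
 have E: "(ph u, c, ph v) : edges (nat_copy ph G) <-> (u, c, v) : edges G" if "u : verts G" "v : verts G" for u v c
 proof
  assume "(ph u, c, ph v) : edges (nat_copy ph G)"
  then obtain u' v' where uv: "ph u = ph u'" "ph v = ph v'" "(u', c, v') : edges G"
   by (auto simp: nat_copy_def)
  hence "u = u'" "v = v'" using inj_onD[OF inj] that ed[OF uv(3)] by blast+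
  thus "(u, c, v) : edges G" using uv by simp
 qed (auto simp: nat_copy_def)
 have l: "vlabel (nat_copy ph G) (ph v) = vlabel G v" if "v : verts G" for v
  using inj that by (simp add: nat_copy_def)
 have bij: "bij_betw ph (verts G) (verts (nat_copy ph G))" using inj by (simp add: bij_betw_def nat_copy_def)
 have root: "root G : verts G" using L by blast
 show "nbhd_iso G (nat_copy ph G)"
  unfolding nbhd_iso_def
  by (intro exI[of _ ph] conjI ballI allI bij) (auto simp: l E, simp add: nat_copy_def)
 show "nbhd_iso (nat_copy ph G) G"
  unfolding nbhd_iso_def
 proof (intro exI[of _ "inv_into (verts G) ph"] conjI ballI allI bij_betw_inv_into[OF bij])
  show "inv_into (verts G) ph (root (nat_copy ph G)) = root G" using inj root by (simp add: nat_copy_def)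
  fix i assume "i : verts (nat_copy ph G)"
  then obtain u where u: "u : verts G" "i = ph u" by (auto simp: nat_copy_def)
  thus "vlabel G (inv_into (verts G) ph i) = vlabel (nat_copy ph G) i" using inj by (simp add: l)
  fix j c assume "j : verts (nat_copy ph G)"
  then obtain v where v: "v : verts G" "j = ph v" by (auto simp: nat_copy_def)
  show "(i, c, j) : edges (nat_copy ph G) <-> (inv_into (verts G) ph i, c, inv_into (verts G) ph j) : edges G"
   using u v inj by (simp add: E)
 qed
 have path: "(ph u, ph v) : {(u, u'). EX c. (u, c, u') : edges (nat_copy ph G)} ^^ l"
  if "(u, v) : {(u, u'). EX c. (u, c, u') : edges G} ^^ l" for u v l
  using that
 proof (induction l arbitrary: v)
  case (Suc l)
  then obtain u' c where "(u, u') : {(u, u'). EX c. (u, c, u') : edges G} ^^ l" "(u', c, v) : edges G" by auto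
  thus ?case using Suc.IH[of u'] E[of u' v c] ed(1,2)[of u' c v] by (auto intro!: relcompI)
 qed simp
 show "labeled_nbhd r (nat_copy ph G)"
  unfolding labeled_nbhd_def
 proof (intro conjI ballI allI impI)
  show "finite (verts (nat_copy ph G))" "root (nat_copy ph G) : verts (nat_copy ph G)"
   using L by (auto simp: nat_copy_def)
  show "case p of (u, c, v) => u : verts (nat_copy ph G) & v : verts (nat_copy ph G) & fst c < r"
   if "p : edges (nat_copy ph G)" for p
   using that ed by (auto simp: nat_copy_def) 
  fix i assume "i : verts (nat_copy ph G)"
  then obtain u where u: "u : verts G" "i = ph u" by (auto simp: nat_copy_def)
  obtain l where "l <= r" "(root G, u) : {(u, u'). EX c. (u, c, u') : edges G} ^^ l" using L u(1) by blast
  thus "EX l<=r. (root (nat_copy ph G), i) : {(u, u'). EX c. (u, c, u') : edges (nat_copy ph G)} ^^ l"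
   using path u by (auto simp: nat_copy_def)
  show "vlabel (nat_copy ph G) i : {1..2 ^ r}" using u L by (simp add: l)
 next
  fix i c j j' assume "(i, c, j) : edges (nat_copy ph G) & (i, c, j') : edges (nat_copy ph G)"
  hence e: "(i, c, j) : edges (nat_copy ph G)" "(i, c, j') : edges (nat_copy ph G)" by auto
  obtain u v where "i = ph u" "j = ph v" "(u, c, v) : edges G" using e(1) by (auto simp: nat_copy_def)
  moreover obtain u' v' where "i = ph u'" "j' = ph v'" "(u', c, v') : edges G" using e(2) by (auto simp: nat_copy_def)
  moreover from calculation have "u = u'" using inj ed by (metis inj_onD)
  ultimately show "j = j'" using L by blast
 next
  fix i c j assume "(i, c, j) : edges (nat_copy ph G)"
  then obtain u v where "i = ph u" "j = ph v" "(u, c, v) : edges G" by (auto simp: nat_copy_def)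
  moreover from this have "(v, inv_letter c, u) : edges G" using L by blast
  ultimately show "(j, inv_letter c, i) : edges (nat_copy ph G)" by (auto simp: nat_copy_def)
 qed
qed

lemma labeled_action_nbhd:
 assumes act: "fg_act Z ga" and d: "dyadic_splitting Z d" and x: "x : Z"
 shows "labeled_nbhd r (action_nbhd r d ga x)"
proof -
 interpret FG: group free_group by (rule group_free_group)
 let ?G = "action_nbhd r d ga x"
 \<comment> \<open>A cancelled letter is bounded by \<open>r\<close> too, since its inverse is then
   the first letter of \<open>w\<close>.\<close>
 have letter: "fst c < r" if "w : short_words r" "[c] \<cdot> w : short_words r" for c w
 proof (cases w)
  case Nil
  thus ?thesis using that by (simp add: short_words_def free_group_def)
 next
  case (Cons a v)
  thus ?thesis using that by (cases c) (auto simp: short_words_def free_group_def split: if_splits)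
 qed
 have nx: "ga ([c] \<cdot> w) x = ga [c] (ga w x)" if "w : short_words r" for c w
  using fg_actD(3)[OF act letter_FG short_words_FG[OF that] x] .
 have path: "(x, ga w x) : {(u, u'). EX c. (u, c, u') : edges ?G} ^^ length w" if "w : short_words r" for w
  using that
 proof (induction w)
  case Nil
  thus ?case using fg_actD(2)[OF act x] by simp
 next
  case (Cons c w)
  have "(ga w x, c, ga (c # w) x) : edges ?G"
   unfolding edges_action using Cons_short[OF Cons.prems] Cons_mult[OF Cons.prems] Cons.prems by metis
  hence "(ga w x, ga (c # w) x) : {(u, u'). EX c. (u, c, u') : edges ?G}" by blast
  thus ?case
   unfolding length_Cons relpow.simps(2) using Cons.IH[OF Cons_short[OF Cons.prems]] by (rule relcompI[rotated])
 qed
 show ?thesis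
  unfolding labeled_nbhd_def
 proof (intro conjI ballI allI impI)
  show "finite (verts ?G)" by (simp add: verts_action finite_short)
  show "root ?G : verts ?G"
   unfolding verts_action
   by (rule image_eqI[of _ _ "[]"]) (use fg_actD(2)[OF act x] Nil_short[of r] in \<open>simp_all add: action_nbhd_def\<close>)
  show "case p of (u, c, v) => u : verts ?G & v : verts ?G & fst c < r" if "p : edges ?G" for p
   using that letter by (cases p) (auto simp: edges_action verts_action)
  fix v assume "v : verts ?G"
  then obtain w where w: "w : short_words r" "v = ga w x" by (auto simp: verts_action)
  hence "length w <= r" by (simp add: short_words_def)
  thus "EX l<=r. (root ?G, v) : {(u, u'). EX c. (u, c, u') : edges ?G} ^^ l"
   using path[OF w(1)] w(2) by (auto simp: action_nbhd_def)
  show "vlabel ?G v : {1..2 ^ r}"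
   unfolding vlabel_action w(2) using label(1)[OF d fg_actD(1)[OF act short_words_FG[OF w(1)] x]] .
 next
  fix u c v v' assume "(u, c, v) : edges ?G & (u, c, v') : edges ?G"
  thus "v = v'" unfolding edges_action using nx by metis
 next
  fix u c v assume "(u, c, v) : edges ?G"
  then obtain w where w: "w : short_words r" "[c] \<cdot> w : short_words r" "u = ga w x" "v = ga ([c] \<cdot> w) x"
   unfolding edges_action by blast
  have "[inv_letter c] \<cdot> ([c] \<cdot> w) = w"
   using w(1) by (simp add: free_group_def short_words_def push_letter_inv)
  thus "(v, inv_letter c, u) : edges ?G" unfolding edges_action using w by metis
 qed
qed

text \<open>One graph has to serve both the points of the measure space and those of the X-sets,
  hence the two copies of the characterization at different types.\<close>

lemma pattern_graph:
 assumes act: "fg_act Z ga" and d: "dyadic_splitting Z d" and x: "x : Z"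
 obtains G :: "nat rooted_graph" where "labeled_nbhd r G"
  "!!(Z' :: 'w set) ga' d' y. fg_act Z' ga' ==> y : Z' ==>
   nbhd_iso (action_nbhd r d' ga' y) G <-> pattern ga' d' r y = pattern ga d r x"
  "!!(Z' :: 'u set) ga' d' y. fg_act Z' ga' ==> y : Z' ==>
   nbhd_iso (action_nbhd r d' ga' y) G <-> pattern ga' d' r y = pattern ga d r x"
proof -
 let ?G = "action_nbhd r d ga x"
 note L = labeled_action_nbhd[OF act d x, of r]
 obtain ph :: "_ => nat" where ph: "inj_on ph (verts ?G)"
  using finite_imp_inj_to_nat_seg[of "verts ?G"] by (auto simp: verts_action finite_short)
 note C = nat_copy[OF ph L]
 show ?thesis
 proof (rule that[of "nat_copy ph ?G"])
  show "labeled_nbhd r (nat_copy ph ?G)" by (rule C(1))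
  fix Z' :: "'w set" and ga' d' y assume y: "fg_act Z' ga'" "y : Z'"
  show "nbhd_iso (action_nbhd r d' ga' y) (nat_copy ph ?G) <-> pattern ga' d' r y = pattern ga d r x"
   using nbhd_iso_trans[OF _ C(3)] nbhd_iso_trans[OF _ C(2)]
    pattern_imp_iso[OF y(1) act y(2) x] iso_imp_pattern[OF y(1) act y(2) x] by blast
 next
  fix Z' :: "'u set" and ga' d' y assume y: "fg_act Z' ga'" "y : Z'"
  show "nbhd_iso (action_nbhd r d' ga' y) (nat_copy ph ?G) <-> pattern ga' d' r y = pattern ga d r x"
   using nbhd_iso_trans[OF _ C(3)] nbhd_iso_trans[OF _ C(2)]
    pattern_imp_iso[OF y(1) act y(2) x] iso_imp_pattern[OF y(1) act y(2) x] by blast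
 qed
qed

text \<open>The condition under which a monomial has a nonzero entry at (x, y): all membership
  conditions refer to the source \<open>y\<close>, and \<open>w\<close> leads from \<open>y\<close>
  to \<open>x\<close>.\<close>

definition kern :: "(letter list => 'z => 'z) => (nat => nat => 'z set) =>
  (letter list \<times> nat \<times> nat) list => letter list => 'z => 'z => bool" where
 "kern ga d D w x y <-> (ALL (v, i, m):set D. ga v y : d i m) & x = ga w y"

definition valid :: "(letter list \<times> nat \<times> nat) list => bool" where
 "valid D <-> (ALL (v, i, m):set D. v : carrier free_group & 1 <= i & i <= 2 ^ m)"

text \<open>Reads \<open>kern\<close> on the diagonal off a pattern: \<open>anc\<close> turns labels
  of level \<open>r\<close> into labels of level \<open>m\<close>, and a fixed point of
  \<open>w\<close> is a coincidence of \<open>w\<close> with the empty word.\<close>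

definition good :: "(letter list \<times> nat \<times> nat) list => letter list => nat =>
  (letter list \<times> letter list) set \<times> (letter list => nat) => bool" where
 "good D w r P <-> (ALL (v, i, m):set D. anc (snd P v) (r - m) = i) & ([], w) : fst P"

lemma kern_pattern:
 assumes act: "fg_act Z ga" and d: "dyadic_splitting Z d" and x: "x : Z" and w: "w : short_words r"
  and D: "!!v i m. (v, i, m) : set D ==> v : short_words r & m <= r & 1 <= i & i <= 2 ^ m"
 shows "kern ga d D w x x <-> good D w r (pattern ga d r x)"
proof -
 have "ga v x : d i m <-> anc (snd (pattern ga d r x) v) (r - m) = i" if vim: "(v, i, m) : set D" for v i m
 proof -
  note vD = D[OF vim]
  have vx: "ga v x : Z" using fg_actD(1)[OF act short_words_FG x] vD by blast
  have "snd (pattern ga d r x) v = label d r (ga v x)" using vD by (simp add: pattern_def)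
  thus ?thesis
   using dyadic_anc_iff[OF d vx label(2)[OF d vx], of r m i] label(1)[OF d vx, of r] vD by simp
 qed
 moreover have "x = ga w x <-> ([], w) : fst (pattern ga d r x)"
  using fg_actD(2)[OF act x] w Nil_short[of r] by (simp add: pattern_def)
 ultimately show ?thesis unfolding kern_def good_def by blast
qed

text \<open>A single radius has to dominate the lengths and the letters of all words and the levels
  of all dyadic sets that occur.\<close>

lemma radius_exists:
 assumes "valid D" "w : carrier free_group"
 obtains r where "1 <= r" "w : short_words r"
  "!!v i m. (v, i, m) : set D ==> v : short_words r & m <= r & 1 <= i & i <= 2 ^ m"
proof -
 have "EX r0. ALL r>=r0. v : short_words r & m <= r" if v: "v : carrier free_group" for v m
 proof -
  obtain r1 where "v : short_words r1" using short_words_exhaust[OF v] by blast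
  thus ?thesis using short_words_mono by (intro exI[of _ "max r1 m"]) auto
 qed
 then obtain f where f: "!!v m r. v : carrier free_group ==> f v m <= r ==> v : short_words r & m <= r"
  by metis
 define r where "r = Max (insert 1 (insert (f w 0) ((%(v, i, m). f v m) ` set D)))"
 have le: "t <= r" if "t : insert 1 (insert (f w 0) ((%(v, i, m). f v m) ` set D))" for t
  unfolding r_def by (rule Max_ge) (use that in auto)
 show ?thesis
 proof (rule that)
  show "1 <= r" by (rule le) simp
  show "w : short_words r" using f[OF assms(2), of 0 r] le[of "f w 0"] by simp
  fix v i m assume vim: "(v, i, m) : set D"
  hence "f v m <= r" by (intro le) force
  thus "v : short_words r & m <= r & 1 <= i & i <= 2 ^ m"
   using f[of v m r] vim assms(1) by (auto simp: valid_def)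
 qed
qed

lemma measure_kern:
 fixes \<mu> :: "'z measure"
 assumes "finite_measure \<mu>" and act: "fg_act (space \<mu>) ga" and d: "dyadic_splitting (space \<mu>) d" and w: "w : short_words r"
  and D: "!!v i m. (v, i, m) : set D ==> v : short_words r & m <= r & 1 <= i & i <= 2 ^ m"
  and meas: "!!P. {x : space \<mu>. pattern ga d r x = P} : sets \<mu>"
 shows "measure \<mu> {x : space \<mu>. kern ga d D w x x} =
  (\<Sum>P | P : patterns r & good D w r P. measure \<mu> {x : space \<mu>. pattern ga d r x = P})"
proof -
 have "{x : space \<mu>. kern ga d D w x x} = (\<Union>P\<in>{P : patterns r. good D w r P}. {x : space \<mu>. pattern ga d r x = P})"
  using kern_pattern[OF act d _ w D] pattern_in[OF act d] by auto
 moreover have "finite {P : patterns r. good D w r P}" using finite_patterns by simp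
 moreover have "disjoint_family_on (%P. {x : space \<mu>. pattern ga d r x = P}) {P : patterns r. good D w r P}"
  by (auto simp: disjoint_family_on_def)
 moreover have "(%P. {x : space \<mu>. pattern ga d r x = P}) ` {P : patterns r. good D w r P} <= sets \<mu>"
  using meas by blast
 ultimately show ?thesis
  by (simp only: finite_measure.finite_measure_finite_Union[OF assms(1)])
qed

text \<open>Coincidence of two orbit points is a countable conjunction over the separating sets, and
  prescribing a label is membership in one dyadic set.\<close>

lemma pattern_measurable:
 fixes U :: "nat => 'z set"
 assumes U: "!!i. U i : sets \<mu>"
  and sep: "!!x y. x : space \<mu> ==> y : space \<mu> ==> (!!i. x : U i <-> y : U i) ==> x = y"
  and act: "fg_act (space \<mu>) ga" and d: "dyadic_splitting (space \<mu>) d"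
  and ga: "!!w. w : carrier free_group ==> ga w : measurable \<mu> \<mu>"
  and e: "!!m i. i : {1..2 ^ m} ==> d i m : sets \<mu>"
 shows "{x : space \<mu>. pattern ga d r x = P} : sets \<mu>"
proof (cases "P : patterns r")
 case True
 obtain P1 P2 where P: "P = (P1, P2)" by (cases P)
 have P12: "P1 <= short_words r \<times> short_words r" "P2 : short_words r \<rightarrow>\<^sub>E {1..2 ^ r}"
  using True by (auto simp: P patterns_def)
 have "pattern ga d r x = P <-> (ALL v:short_words r. ALL w:short_words r. (ga v x = ga w x) <-> (v, w) : P1) \<and>
   (ALL w:short_words r. ga w x : d (P2 w) r)" (is "?L <-> ?R") if x: "x : space \<mu>" for x
 proof -
  have "{(v, w) : short_words r \<times> short_words r. ga v x = ga w x} = P1 <->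
    (ALL v:short_words r. ALL w:short_words r. (ga v x = ga w x) <-> (v, w) : P1)"
   using P12(1) by auto
  moreover have "(\<lambda>w\<in>short_words r. label d r (ga w x)) = P2 <-> (ALL w:short_words r. label d r (ga w x) = P2 w)"
  proof
   assume R: "ALL w:short_words r. label d r (ga w x) = P2 w"
   show "(\<lambda>w\<in>short_words r. label d r (ga w x)) = P2"
    by (rule extensionalityI[of _ "short_words r"]) (use R P12(2) in \<open>auto simp: PiE_def\<close>)
  qed auto
  moreover have "(ALL w:short_words r. label d r (ga w x) = P2 w) <-> (ALL w:short_words r. ga w x : d (P2 w) r)"
  proof (intro ball_cong refl)
   fix w assume w: "w : short_words r"
   show "label d r (ga w x) = P2 w <-> ga w x : d (P2 w) r"
    by (rule label(3)[OF d fg_actD(1)[OF act short_words_FG[OF w] x]]) (use P12(2) w in auto)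
  qed
  ultimately show ?thesis by (simp only: pattern_def P prod.inject)
 qed
 hence "{x : space \<mu>. pattern ga d r x = P} =
   {x : space \<mu>. (ALL v:short_words r. ALL w:short_words r. (ga v x = ga w x) <-> (v, w) : P1) \<and>
   (ALL w:short_words r. ga w x : d (P2 w) r)}" by blast
 also have "... : sets \<mu>"
 proof (intro sets.sets_Collect_conj sets.sets_Collect_finite_All' finite_short)
  fix w assume w: "w : short_words r"
  have [measurable]: "ga w : measurable \<mu> \<mu>" "U i : sets \<mu>" for i using ga short_words_FG[OF w] U by auto
  have "d (P2 w) r : sets \<mu>" using P12(2) w by (intro e) auto
  thus "{x : space \<mu>. ga w x : d (P2 w) r} : sets \<mu>" by measurable
  fix v assume v: "v : short_words r"
  have [measurable]: "ga v : measurable \<mu> \<mu>" using ga short_words_FG[OF v] by auto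
  have eq: "ga v x = ga w x <-> (ALL i. ga v x : U i <-> ga w x : U i)" if x: "x : space \<mu>" for x
   using sep[OF fg_actD(1)[OF act short_words_FG[OF v] x] fg_actD(1)[OF act short_words_FG[OF w] x]] by auto
  have "{x : space \<mu>. ga v x = ga w x} = {x : space \<mu>. ALL i. ga v x : U i <-> ga w x : U i}"
   by (intro Collect_cong conj_cong refl eq)
  also have "... : sets \<mu>" by measurable
  finally have "{x : space \<mu>. ga v x = ga w x} : sets \<mu>" .
  thus "{x : space \<mu>. (ga v x = ga w x) <-> (v, w) : P1} : sets \<mu>"
   by (cases "(v, w) : P1") (auto intro: sets.sets_Collect_neg)
 qed (use Nil_short in blast)+
 finally show ?thesis .
next
 case False
 hence emp: "{x : space \<mu>. pattern ga d r x = P} = {}" using pattern_in[OF act d] by auto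
 show ?thesis unfolding emp by (rule sets.empty_sets)
qed

text \<open>The event \<open>kern\<close> on the diagonal only depends on the neighborhood of a point,
 so its probability converges by hypothesis.\<close>

lemma kern_convergence:
 fixes \<mu> :: "'z measure" and U :: "nat => 'z set" and Y :: "nat => nat set"
 assumes "prob_space \<mu>" and U: "!!i. U i : sets \<mu>"
  and sep: "!!x y. x : space \<mu> ==> y : space \<mu> ==> (!!i. x : U i <-> y : U i) ==> x = y"
  and act: "fg_act (space \<mu>) ga" and e: "dyadic_splitting (space \<mu>) e"
  and ga: "!!w. w : carrier free_group ==> ga w : measurable \<mu> \<mu>"
  and em: "!!m i. i : {1..2 ^ m} ==> e i m : sets \<mu>"
  and Y: "!!k. X_set (Y k) (d k)" "!!k. fg_act (Y k) (be k)"
  and conv: "!!r (G :: nat rooted_graph). 1 <= r ==> labeled_nbhd r G ==>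
   (%k. nbhd_prob (uniform_count_measure (Y k)) (d k) (be k) r G) ----> nbhd_prob \<mu> e ga r G"
  and D: "valid D" and w: "w : carrier free_group"
 shows "(%k. real (card {y : Y k. kern (be k) (d k) D w y y}) / real (card (Y k))) ---->
  measure \<mu> {x : space \<mu>. kern ga e D w x x}"
proof -
 obtain r where r: "1 <= r" "w : short_words r"
  "!!v i m. (v, i, m) : set D ==> v : short_words r & m <= r & 1 <= i & i <= 2 ^ m"
  by (rule radius_exists[OF D w]) blast
 let ?u = "%k. uniform_count_measure (Y k)"
 have fin: "finite (Y k)" "Y k ~= {}" "dyadic_splitting (Y k) (d k)" for k using Y(1)[of k] by (auto simp: X_set_def)
 have sp: "space (?u k) = Y k" "sets (?u k) = Pow (Y k)" for k by (simp_all add: uniform_count_measure_def space_point_measure sets_point_measure)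
 have fm: "finite_measure (?u k)" for k
  using prob_space_uniform_count_measure[OF fin(1,2)] by (simp add: prob_space.axioms)
 have m1: "measure (?u k) A = real (card A) / real (card (Y k))" if "A <= Y k" for A k
  using measure_uniform_count_measure[OF fin(1) that] .
 have conv_pat: "(%k. measure (?u k) {y : Y k. pattern (be k) (d k) r y = P}) ----> measure \<mu> {x : space \<mu>. pattern ga e r x = P}" for P
 proof -
  \<comment> \<open>A graph with pattern \<open>P\<close> is obtained from any point that has it, in
    the space or in some X-set; a pattern that occurs nowhere has probability 0 throughout.\<close>
  consider x where "x : space \<mu>" "pattern ga e r x = P" | k y where "y : Y k" "pattern (be k) (d k) r y = P"
   | "!!x. x : space \<mu> ==> pattern ga e r x ~= P" "!!k y. y : Y k ==> pattern (be k) (d k) r y ~= P" by blast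
  hence "(EX G :: nat rooted_graph. labeled_nbhd r G \<and>
    (ALL x:space \<mu>. nbhd_iso (action_nbhd r e ga x) G <-> pattern ga e r x = P) \<and>
    (ALL k. ALL y:Y k. nbhd_iso (action_nbhd r (d k) (be k) y) G <-> pattern (be k) (d k) r y = P)) \<or>
    (ALL x:space \<mu>. pattern ga e r x ~= P) & (ALL k. ALL y:Y k. pattern (be k) (d k) r y ~= P)"
  proof cases
   case (1 x)
   obtain G :: "nat rooted_graph" where G: "labeled_nbhd r G"
    "!!(Z' :: 'z set) ga' d' y. fg_act Z' ga' ==> y : Z' ==>
     nbhd_iso (action_nbhd r d' ga' y) G <-> pattern ga' d' r y = pattern ga e r x"
    "!!(Z' :: nat set) ga' d' y. fg_act Z' ga' ==> y : Z' ==>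
     nbhd_iso (action_nbhd r d' ga' y) G <-> pattern ga' d' r y = pattern ga e r x"
    by (rule pattern_graph[OF act e 1(1), of r]) (rule that)
   have "labeled_nbhd r G \<and>
     (ALL x:space \<mu>. nbhd_iso (action_nbhd r e ga x) G <-> pattern ga e r x = P) \<and>
     (ALL k. ALL y:Y k. nbhd_iso (action_nbhd r (d k) (be k) y) G <-> pattern (be k) (d k) r y = P)"
    using G(1) G(2)[OF act] G(3)[OF Y(2)] unfolding 1(2) by blast
   thus ?thesis by blast
  next
   case (2 k z)
   obtain G :: "nat rooted_graph" where G: "labeled_nbhd r G"
    "!!(Z' :: 'z set) ga' d' y. fg_act Z' ga' ==> y : Z' ==>
     nbhd_iso (action_nbhd r d' ga' y) G <-> pattern ga' d' r y = pattern (be k) (d k) r z"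
    "!!(Z' :: nat set) ga' d' y. fg_act Z' ga' ==> y : Z' ==>
     nbhd_iso (action_nbhd r d' ga' y) G <-> pattern ga' d' r y = pattern (be k) (d k) r z"
    by (rule pattern_graph[OF Y(2) fin(3) 2(1), of r]) (rule that)
   have "labeled_nbhd r G \<and>
     (ALL x:space \<mu>. nbhd_iso (action_nbhd r e ga x) G <-> pattern ga e r x = P) \<and>
     (ALL k. ALL y:Y k. nbhd_iso (action_nbhd r (d k) (be k) y) G <-> pattern (be k) (d k) r y = P)"
    using G(1) G(2)[OF act] G(3)[OF Y(2)] unfolding 2(2) by blast
   thus ?thesis by blast
  qed blast
  then consider (G) G :: "nat rooted_graph" where "labeled_nbhd r G"
    "!!x. x : space \<mu> ==> nbhd_iso (action_nbhd r e ga x) G <-> pattern ga e r x = P"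
    "!!k y. y : Y k ==> nbhd_iso (action_nbhd r (d k) (be k) y) G <-> pattern (be k) (d k) r y = P"
   | (no) "!!x. x : space \<mu> ==> pattern ga e r x ~= P" "!!k y. y : Y k ==> pattern (be k) (d k) r y ~= P"
   by blast
  thus ?thesis
  proof cases
   case G
   have "{y : Y k. nbhd_iso (action_nbhd r (d k) (be k) y) G} = {y : Y k. pattern (be k) (d k) r y = P}" for k
    using G(3) by blast
   moreover have "{x : space \<mu>. nbhd_iso (action_nbhd r e ga x) G} = {x : space \<mu>. pattern ga e r x = P}"
    using G(2) by blast
   ultimately show ?thesis using conv[OF r(1) G(1)] by (simp add: nbhd_prob_def sp)
  next
   case no
   have "{y : Y k. pattern (be k) (d k) r y = P} = {}" for k using no(2) by blast
   moreover have "{x : space \<mu>. pattern ga e r x = P} = {}" using no(1) by blast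
   ultimately show ?thesis by (simp only: measure_empty tendsto_const)
  qed
 qed
 have "measure (?u k) {y : space (?u k). kern (be k) (d k) D w y y} =
   (\<Sum>P | P : patterns r & good D w r P. measure (?u k) {y : space (?u k). pattern (be k) (d k) r y = P})" for k
  by (rule measure_kern[OF fm _ _ r(2,3)]) (use fin Y in \<open>auto simp: sp\<close>)
 hence 1: "real (card {y : Y k. kern (be k) (d k) D w y y}) / real (card (Y k)) =
   (\<Sum>P | P : patterns r & good D w r P. measure (?u k) {y : Y k. pattern (be k) (d k) r y = P})" for k
  using m1[of "{y : Y k. kern (be k) (d k) D w y y}" k] by (simp add: sp)
 have 2: "measure \<mu> {x : space \<mu>. kern ga e D w x x} =
   (\<Sum>P | P : patterns r & good D w r P. measure \<mu> {x : space \<mu>. pattern ga e r x = P})"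
  by (rule measure_kern[OF _ act e r(2,3) pattern_measurable[where U = U, OF U sep act e ga em]])
   (use assms(1) in \<open>auto simp: prob_space.axioms\<close>)
 show ?thesis unfolding 1 2 by (intro tendsto_sum conv_pat)
qed

end

section \<open>Matrix models of formal sums\<close>

text \<open>A triple is a coefficient, a list of conditions (v, i, m) and a word. The sums stay
  formal because the same expression is evaluated in the space and in every X-set, where different
  terms may coincide.\<close>

type_synonym fsum = "(complex \<times> (letter list \<times> nat \<times> nat) list \<times> letter list) list"

definition wf_fsum :: "fsum => bool" where
 "wf_fsum s <-> (ALL (c, Q, w):set s. valid Q & w : FG)"

definition tval :: "(letter list => 'z => 'z) => (nat => nat => 'z set) =>
  complex \<times> (letter list \<times> nat \<times> nat) list \<times> letter list => 'z => 'z => complex" where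
 "tval ga d t x y = (case t of (c, Q, w) => if kern ga d Q w x y then c else 0)"

definition fval :: "(letter list => 'z => 'z) => (nat => nat => 'z set) => fsum => 'z => 'z => complex" where
 "fval ga d s x y = (\<Sum>t\<leftarrow>s. tval ga d t x y)"

text \<open>Turns conditions on the point \<open>w z\<close> into conditions on \<open>z\<close>, as
  needed for products and adjoints of monomials.\<close>

definition shift :: "letter list => (letter list \<times> nat \<times> nat) list => (letter list \<times> nat \<times> nat) list" where
 "shift w Q = map (%(v, i, m). (v \<cdot> w, i, m)) Q"

fun tmul where
 "tmul (c, Q, w) (c', Q', w') = (c * c', Q' @ shift w' Q, w \<cdot> w')"

definition fmul :: "fsum => fsum => fsum" where
 "fmul s s' = concat (map (%t'. map (%t. tmul t t') s) s')"

fun tstar where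
 "tstar (c, Q, w) = (cnj c, shift (ginv w) Q, ginv w)"

definition fscale :: "complex => fsum => fsum" where
 "fscale c s = map (%(c', Q, w). (c * c', Q, w)) s"

lemma fval_append: "fval ga d (s @ s') x y = fval ga d s x y + fval ga d s' x y"
 by (simp add: fval_def)

lemma fval_Cons: "fval ga d (t # s) x y = tval ga d t x y + fval ga d s x y"
 by (simp add: fval_def)

lemma fval_Nil [simp]: "fval ga d [] x y = 0"
 by (simp add: fval_def)

lemma fval_scale: "fval ga d (fscale c s) x y = c * fval ga d s x y"
 by (induction s) (auto simp: fscale_def fval_Cons tval_def algebra_simps)

interpretation FG: group free_group by (rule group_free_group)

lemma shift_valid: "valid Q ==> w : FG ==> valid (shift w Q)"
 by (auto simp: valid_def shift_def)

lemma wf_mul: "wf_fsum s ==> wf_fsum s' ==> wf_fsum (fmul s s')"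
 by (fastforce simp: wf_fsum_def fmul_def valid_def shift_def)

lemma wf_star: "wf_fsum s ==> wf_fsum (map tstar s)"
 by (auto simp: wf_fsum_def shift_valid)

lemma wf_scale: "wf_fsum s ==> wf_fsum (fscale c s)"
 by (auto simp: wf_fsum_def fscale_def)

lemma kern_shift:
 assumes "fg_act Z ga" "z : Z" "valid Q" "w : FG"
 shows "(ALL (v, i, m):set (shift w Q). ga v z : d i m) <-> (ALL (v, i, m):set Q. ga v (ga w z) : d i m)"
 using assms by (fastforce simp: shift_def valid_def fg_actD(3)[OF assms(1)])

text \<open>Only the intermediate point to which the second word sends \<open>z\<close> contributes
  to the sum.\<close>

lemma tval_mul:
 assumes act: "fg_act Z ga" and "wf_fsum [t]" "wf_fsum [t']" and z: "z : Z"
  and S: "finite S" "ga (snd (snd t')) z : S"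
 shows "tval ga d (tmul t t') x z = (\<Sum>y\<in>S. tval ga d t x y * tval ga d t' y z)"
proof -
 obtain c Q w c' Q' w' where t: "t = (c, Q, w)" "t' = (c', Q', w')" by (metis surj_pair)
 have v: "valid Q" "w : FG" "valid Q'" "w' : FG" using assms(2,3) by (auto simp: t wf_fsum_def)
 have "(\<Sum>y\<in>S. tval ga d t x y * tval ga d t' y z) = (\<Sum>y\<in>{ga w' z}. tval ga d t x y * tval ga d t' y z)"
  using S by (intro sum.mono_neutral_right) (auto simp: t tval_def kern_def)
 also have "kern ga d (Q' @ shift w' Q) (w \<cdot> w') x z <->
   kern ga d Q w x (ga w' z) & kern ga d Q' w' (ga w' z) z"
  unfolding kern_def set_append ball_Un kern_shift[OF act z v(1,4)] fg_actD(3)[OF act v(2,4) z] by blast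
 hence "(\<Sum>y\<in>{ga w' z}. tval ga d t x y * tval ga d t' y z) = tval ga d (tmul t t') x z"
  by (simp add: t tval_def)
 finally show ?thesis ..
qed

lemma fval_mul_row:
 assumes act: "fg_act Z ga" and s: "wf_fsum s" and t': "wf_fsum [t']" and z: "z : Z"
  and S: "finite S" "ga (snd (snd t')) z : S"
 shows "fval ga d (map (%t. tmul t t') s) x z = (\<Sum>y\<in>S. fval ga d s x y * tval ga d t' y z)"
 using s
proof (induction s)
 case (Cons t s)
 hence "wf_fsum [t]" "wf_fsum s" by (auto simp: wf_fsum_def)
 thus ?case
  using Cons.IH tval_mul[OF act _ t' z S, of t d x]
  by (simp add: fval_Cons distrib_right sum.distrib)
qed simp

text \<open>\<open>S\<close> is any finite set containing the intermediate points: in the algebra it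
  is enlarged by a row support, for matrices it is the whole X-set.\<close>

lemma fval_mul:
 assumes act: "fg_act Z ga" and s: "wf_fsum s" and s': "wf_fsum s'" and z: "z : Z"
  and S: "finite S" "!!t'. t' : set s' ==> ga (snd (snd t')) z : S"
 shows "fval ga d (fmul s s') x z = (\<Sum>y\<in>S. fval ga d s x y * fval ga d s' y z)"
 using s' S(2)
proof (induction s')
 case (Cons t' s')
 have t': "wf_fsum [t']" "wf_fsum s'" using Cons.prems(1) by (auto simp: wf_fsum_def)
 have "fval ga d (fmul s s') x z = (\<Sum>y\<in>S. fval ga d s x y * fval ga d s' y z)"
  using Cons.IH[OF t'(2)] Cons.prems(2) by simp
 moreover have "fval ga d (map (%t. tmul t t') s) x z = (\<Sum>y\<in>S. fval ga d s x y * tval ga d t' y z)"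
  by (rule fval_mul_row[OF act s t'(1) z S(1)]) (use Cons.prems(2) in simp)
 ultimately show ?case
  by (simp add: fmul_def fval_append fval_Cons distrib_left sum.distrib)
qed (simp add: fmul_def)

lemma fval_star:
 assumes act: "fg_act Z ga" and s: "wf_fsum s" and xy: "x : Z" "y : Z"
 shows "fval ga d (map tstar s) y x = cnj (fval ga d s x y)"
 using s
proof (induction s)
 case (Cons t s)
 obtain c Q w where t: "t = (c, Q, w)" by (metis surj_pair)
 have v: "valid Q" "w : FG" using Cons.prems by (auto simp: t wf_fsum_def)
 let ?w = "ginv w"
 have i: "?w : FG" using v by simp
 have inv: "y = ga ?w x <-> x = ga w y"
  using fg_actD(3)[OF act i v(2) xy(2)] fg_actD(3)[OF act v(2) i xy(1)] fg_actD(2)[OF act] xy v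
  by (auto simp: FG.l_inv FG.r_inv one_free_group)
 have "kern ga d (shift ?w Q) ?w y x <-> kern ga d Q w x y"
  using kern_shift[OF act xy(1) v(1) i, of d] inv by (auto simp: kern_def)
 hence "tval ga d (tstar t) y x = cnj (tval ga d t x y)" by (simp add: t tval_def)
 thus ?case using Cons by (auto simp: fval_Cons wf_fsum_def)
qed simp

text \<open>Elek-Lippner soficity in the form in which it is used: convergence for the diagonal
  events of monomials takes the place of neighborhood statistics, and density of dyadic sets in
  measure that of weak density.\<close>

locale sofic_model = orbit_relation M E act U for M :: "'a measure" and E act U +
 fixes e :: "nat => nat => 'a set" and Y :: "nat => nat set" and d :: "nat => nat => nat => nat set"
  and be :: "nat => letter list => nat => nat" and om :: "nat filter"
 assumes dyadic: "dyadic_splitting (space M) e"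
  and e_sets: "!!i m. i : {1..2 ^ m} ==> e i m : sets M"
  and e_dense: "!!B ep. B : sets M ==> 0 < ep ==> EX m I. I <= {1..2 ^ m} \<and>
   measure M ((B - (\<Union>i\<in>I. e i m)) Un ((\<Union>i\<in>I. e i m) - B)) < ep"
  and Y: "!!k. X_set (Y k) (d k)" and be: "!!k. fg_act (Y k) (be k)"
  and conv: "!!Q w. valid Q ==> w : FG ==>
   (%k. real (card {y : Y k. kern (be k) (d k) Q w y y}) / real (card (Y k))) ---->
   measure (completion M) {x : space M. kern act e Q w x x}"
  and omega_bot: "om ~= bot" and omega_seq: "om <= sequentially"
begin

lemma act_fg: "fg_act (space M) act"
 unfolding fg_act_def using act_space act_one act_mult by blast

definition n :: "nat => nat" where "n k = card (Y k)"
definition h :: "nat => nat => nat" where "h k = from_nat_into (Y k)"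

lemma Y_fin: "finite (Y k)" "Y k ~= {}" "dyadic_splitting (Y k) (d k)"
 using Y[of k] by (auto simp: X_set_def)

lemma n_pos: "0 < n k"
 using Y_fin[of k] by (simp add: n_def card_gt_0_iff)

lemma h_bij: "bij_betw (h k) {..<n k} (Y k)"
 unfolding h_def n_def by (rule bij_betw_from_nat_into_finite[OF Y_fin(1)])

lemma h_in: "i < n k ==> h k i : Y k"
 using h_bij[of k] by (auto simp: bij_betw_def)

definition aX :: "fsum => 'a * 'a => complex" where
 "aX s = (%(x, y). if x : space M & y : space M then fval act e s x y else 0)"

definition aY :: "fsum => nat => complex mat" where
 "aY s k = mat (n k) (n k) (%(i, j). fval (be k) (d k) s (h k i) (h k j))"

lemma aY_carrier [simp]: "aY s k : MT (n k)"
 by (simp add: aY_def)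

lemma kern_meas [measurable]:
 assumes "valid Q" "w : FG"
 shows "Measurable.pred (N \<Otimes>\<^sub>M N) (%p. kern act e Q w (fst p) (snd p))"
proof -
 have [measurable]: "act w : measurable N N" by (rule act_meas) fact
 have 1: "Measurable.pred (N \<Otimes>\<^sub>M N) (%p. fst p = act w (snd p))"
  by (rule eq_meas) measurable
 have 2: "Measurable.pred (N \<Otimes>\<^sub>M N) (%p. ALL t:set Q. case t of (v, i, m) => act v (snd p) : e i m)"
 proof (rule pred_intros_finite(3))
  fix t assume t: "t : set Q"
  obtain v i m where vim: "t = (v, i, m)" by (metis surj_pair)
  have v: "v : FG" "i : {1..2 ^ m}" using assms(1) t by (auto simp: vim valid_def)
  have [measurable]: "act v : measurable N N" by (rule act_meas[OF v(1)])
  have [measurable]: "e i m : sets N" using e_sets[OF v(2)] by auto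
  show "Measurable.pred (N \<Otimes>\<^sub>M N) (%p. case t of (v, i, m) => act v (snd p) : e i m)"
   unfolding vim prod.case by measurable
 qed simp
 show ?thesis unfolding kern_def using 1 2 by measurable
qed

lemma aX_meas: "wf_fsum s ==> aX s : BM"
proof (induction s)
 case Nil
 have "aX [] = (%_. 0)" by (auto simp: aX_def)
 thus ?case by simp
next
 case (Cons t s)
 obtain c Q w where t: "t = (c, Q, w)" by (metis surj_pair)
 have v: "valid Q" "w : FG" "wf_fsum s" using Cons.prems by (auto simp: t wf_fsum_def)
 have [measurable]: "aX s : BM" by (rule Cons.IH[OF v(3)])
 have [measurable]: "Measurable.pred (N \<Otimes>\<^sub>M N) (%p. kern act e Q w (fst p) (snd p))"
  by (rule kern_meas[OF v(1,2)])
 have "(%p. (if kern act e Q w (fst p) (snd p) then c else 0) + aX s p) : BM"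
  by measurable
 also have "?this <-> ?case"
  by (rule measurable_cong) (auto simp: space_pair_measure aX_def fval_Cons tval_def t)
 finally show ?case .
qed

lemma fval_nz: "fval ga d' s x y ~= 0 ==> EX c Q w. (c, Q, w) : set s & x = ga w y"
proof (induction s)
 case (Cons t s)
 thus ?case by (cases t) (auto simp: fval_Cons tval_def kern_def split: if_splits)
qed simp

text \<open>Each monomial contributes at most one entry to a row or column, since group elements act
  injectively; hence the bound \<open>length s\<close>.\<close>

lemma aX_carrier: assumes s: "wf_fsum s" shows "aX s : carrier A0"
proof (rule A0I[of _ "\<Sum>t\<leftarrow>s. cmod (fst t)" "length s"])
 show "aX s : BM" by (rule aX_meas[OF s])
 show "aX s p = 0" if "p ~: E" for p
 proof (rule ccontr)
  obtain x y where p: "p = (x, y)" by (cases p)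
  assume "aX s p ~= 0"
  hence xy: "x : space M" "y : space M" "fval act e s x y ~= 0" by (auto simp: aX_def p split: if_splits)
  then obtain c Q w where "(c, Q, w) : set s" "x = act w y" using fval_nz[OF xy(3)] by blast
  hence "(y, x) : E" using act_E[of w y] s xy by (auto simp: wf_fsum_def)
  thus False using that E_sym by (simp add: p)
 qed
 show "cmod (aX s p) <= (\<Sum>t\<leftarrow>s. cmod (fst t))" for p
 proof -
  have "cmod (fval act e s x y) <= (\<Sum>t\<leftarrow>s. cmod (fst t))" for x y
  proof (induction s)
   case (Cons t s)
   have "cmod (tval act e t x y) <= cmod (fst t)" by (auto simp: tval_def split: prod.split)
   thus ?case using Cons norm_triangle_ineq[of "tval act e t x y" "fval act e s x y"] by (simp add: fval_Cons)
  qed simp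
  moreover have "0 <= (\<Sum>t\<leftarrow>s. cmod (fst t))" by (rule sum_list_nonneg) auto
  ultimately show ?thesis by (cases p) (simp add: aX_def)
 qed
 fix x
 have "rs (aX s) x <= (%(c, Q, w). act (ginv w) x) ` set s"
 proof
  fix y assume "y : rs (aX s) x"
  hence xy: "x : space M" "y : space M" "fval act e s x y ~= 0" by (auto simp: rs_def aX_def split: if_splits)
  then obtain c Q w where w: "(c, Q, w) : set s" "x = act w y" using fval_nz[OF xy(3)] by blast
  hence "w : FG" using s by (auto simp: wf_fsum_def)
  hence "y = act (ginv w) x" using w xy by simp
  thus "y : (%(c, Q, w). act (ginv w) x) ` set s" using w(1) by force
 qed
 from finite_subset[OF this] card_mono[OF _ this] card_image_le[of "set s" "%(c, Q, w). act (ginv w) x"] card_length[of s]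
 show "finite (rs (aX s) x) & card (rs (aX s) x) <= length s" by auto
 have "cs (aX s) x <= (%(c, Q, w). act w x) ` set s"
 proof
  fix y assume "y : cs (aX s) x"
  hence xy: "x : space M" "y : space M" "fval act e s y x ~= 0" by (auto simp: cs_def aX_def split: if_splits)
  then obtain c Q w where w: "(c, Q, w) : set s" "y = act w x" using fval_nz[OF xy(3)] by blast
  thus "y : (%(c, Q, w). act w x) ` set s" by force
 qed
 from finite_subset[OF this] card_mono[OF _ this] card_image_le[of "set s" "%(c, Q, w). act w x"] card_length[of s]
 show "finite (cs (aX s) x) & card (cs (aX s) x) <= length s" by auto
qed

lemma aX_mult:
 assumes s: "wf_fsum s" "wf_fsum s'" shows "aX (fmul s s') = aX s \<star> aX s'"
proof
 fix p :: "'a * 'a"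
 obtain x z where p: "p = (x, z)" by (cases p)
 note fin = A0_fin[OF aX_carrier[OF s(1)]] A0_fin[OF aX_carrier[OF s(2)]]
 show "aX (fmul s s') p = (aX s \<star> aX s') p"
 proof (cases "x : space M & z : space M")
  case True
  let ?S = "rs (aX s) x Un (%t. act (snd (snd t)) z) ` set s'"
  have S: "finite ?S" "?S <= space M"
  proof -
   show "finite ?S" using fin by simp
   show "?S <= space M" using s(2) True by (auto simp: rs_def aX_def wf_fsum_def split: if_splits)
  qed
  have "(aX s \<star> aX s') (x, z) = (\<Sum>y\<in>?S. aX s (x, y) * aX s' (y, z))"
   by (rule A0_mult_rows) (use S in auto)
  also have "... = (\<Sum>y\<in>?S. fval act e s x y * fval act e s' y z)"
   using S True by (intro sum.cong refl) (auto simp: aX_def)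
  also have "... = fval act e (fmul s s') x z"
   by (rule fval_mul[OF act_fg s, symmetric]) (use S True in auto)
  finally show ?thesis using True by (simp add: p aX_def)
 next
  case False
  have "(aX s \<star> aX s') (x, z) = 0"
   using False by (auto simp: A0_sel(7) aX_def intro!: sum.neutral)
  thus ?thesis using False by (auto simp: p aX_def)
 qed
qed

lemma aX_add: "aX (s @ s') = aX s \<oplus>\<^bsub>A0\<^esub> aX s'"
 by (auto simp: aX_def A0_sel fval_append fun_eq_iff)

lemma aX_scale: "aX (fscale c s) = c \<odot>\<^bsub>A0\<^esub> aX s"
 by (auto simp: aX_def A0_sel fval_scale fun_eq_iff)

lemma aX_star: "wf_fsum s ==> aX (map tstar s) = star A0 (aX s)"
 by (auto simp: aX_def A0_sel fval_star[OF act_fg] fun_eq_iff)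

lemma aX_one: "aX [(1, [], [])] = one0"
 by (auto simp: aX_def A0_sel fval_def tval_def kern_def act_one fun_eq_iff)

lemma aY_mult:
 assumes s: "wf_fsum s" "wf_fsum s'" shows "aY (fmul s s') k = aY s k * aY s' k"
proof (rule eq_matI)
 fix i j assume "i < dim_row (aY s k * aY s' k)" "j < dim_col (aY s k * aY s' k)"
 hence ij: "i < n k" "j < n k" by (auto simp: aY_def)
 have "fval (be k) (d k) (fmul s s') (h k i) (h k j) =
   (\<Sum>y\<in>Y k. fval (be k) (d k) s (h k i) y * fval (be k) (d k) s' y (h k j))"
  by (rule fval_mul[OF be s h_in[OF ij(2)] Y_fin(1)])
   (use s(2) fg_actD(1)[OF be _ h_in[OF ij(2)]] in \<open>auto simp: wf_fsum_def\<close>)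
 also have "... = (\<Sum>l<n k. fval (be k) (d k) s (h k i) (h k l) * fval (be k) (d k) s' (h k l) (h k j))"
  by (rule sum.reindex_bij_betw[OF h_bij, symmetric])
 also have "... = (aY s k * aY s' k) $$ (i, j)"
  using ij by (simp add: index_mult_mat_sum[OF aY_carrier aY_carrier] del: index_mult_mat) (simp add: aY_def)
 finally show "aY (fmul s s') k $$ (i, j) = (aY s k * aY s' k) $$ (i, j)" using ij by (simp add: aY_def)
qed (auto simp: aY_def)

lemma aY_add: "aY (s @ s') k = aY s k + aY s' k"
 by (rule eq_matI) (auto simp: aY_def fval_append)

lemma aY_scale: "aY (fscale c s) k = c \<cdot>\<^sub>m aY s k"
 by (rule eq_matI) (auto simp: aY_def fval_scale)

lemma aY_star: "wf_fsum s ==> aY (map tstar s) k = adj (aY s k)"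
 by (rule eq_matI) (auto simp: aY_def fval_star[OF be] h_in)

lemma aY_one: "aY [(1, [], [])] k = 1\<^sub>m (n k)"
proof (rule eq_matI)
 fix i j assume "i < dim_row (1\<^sub>m (n k))" "j < dim_col (1\<^sub>m (n k))"
 hence ij: "i < n k" "j < n k" by auto
 have "h k i = h k j <-> i = j" using h_bij[of k] ij by (auto simp: bij_betw_def inj_on_def)
 thus "aY [(1, [], [])] k $$ (i, j) = 1\<^sub>m (n k) $$ (i, j)"
  using ij fg_actD(2)[OF be h_in[OF ij(2)]] by (simp add: aY_def fval_def tval_def kern_def)
qed (auto simp: aY_def)

text \<open>\<open>A\<close> is \<open>c\<close> times the matrix of a partial bijection. Monomials
  have such matrices in every X-set, which bounds the norms of a formal sum uniformly in
  \<open>k\<close>.\<close>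

lemma op_bdd_partial:
 assumes A: "A : carrier_mat m m" and f: "inj_on f {j. j < m & P j}" "!!j. j < m ==> P j ==> f j < m"
  and Aij: "!!i j. i < m ==> j < m ==> A $$ (i, j) = (if P j & i = f j then c else 0)"
 shows "op_bdd m (cmod c) A"
proof -
 let ?J = "{j. j < m & P j}"
 have "vn m (mv m A v) <= (cmod c)^2 * vn m v" for v
 proof -
  have mvf: "mv m A v (f j) = c * v j" if j: "j : ?J" for j
  proof -
   have "mv m A v (f j) = (\<Sum>l<m. if l = j then c * v l else 0)"
    unfolding mv_def
   proof (intro sum.cong refl)
    fix l assume "l : {..<m}"
    thus "A $$ (f j, l) * v l = (if l = j then c * v l else 0)"
     using j f(2)[of j] inj_onD[OF f(1), of j l] by (auto simp: Aij)
   qed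
   thus ?thesis using j by simp
  qed
  have z: "mv m A v i = 0" if "i < m" "i ~: f ` ?J" for i
   unfolding mv_def by (rule sum.neutral) (use that in \<open>auto simp: Aij\<close>)
  have "vn m (mv m A v) = (\<Sum>i\<in>f ` ?J. (cmod (mv m A v i))^2)"
   unfolding vn_def by (intro sum.mono_neutral_right) (use f(2) z in auto)
  also have "... = (\<Sum>j\<in>?J. (cmod c)^2 * (cmod (v j))^2)"
   by (subst sum.reindex[OF f(1)]) (auto simp: mvf norm_mult power_mult_distrib intro!: sum.cong)
  also have "... <= (\<Sum>j<m. (cmod c)^2 * (cmod (v j))^2)" by (intro sum_mono2) auto
  finally show ?thesis by (simp add: vn_def sum_distrib_left)
 qed
 thus ?thesis using A by (simp add: op_bdd_def)
qed

lemma aY_bdd: "wf_fsum s ==> EX C. ALL k. op_bdd (n k) C (aY s k)"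
proof (induction s)
 case Nil
 have "aY [] k = 0 \<cdot>\<^sub>m 1\<^sub>m (n k)" for k by (rule eq_matI) (auto simp: aY_def)
 hence "op_bdd (n k) 0 (aY [] k)" for k using op_bdd_smult[OF op_bdd_one[of "n k"], of 0] by simp
 thus ?case by blast
next
 case (Cons t s)
 obtain c Q w where t: "t = (c, Q, w)" by (metis surj_pair)
 have v: "valid Q" "w : FG" "wf_fsum s" using Cons.prems by (auto simp: t wf_fsum_def)
 obtain C where C: "!!k. op_bdd (n k) C (aY s k)" using Cons.IH[OF v(3)] by blast
 have "op_bdd (n k) (cmod c + C) (aY (t # s) k)" for k
 proof -
  define f where "f j = inv_into {..<n k} (h k) (be k w (h k j))" for j
  have bw: "be k w (h k j) : Y k" if "j < n k" for j using fg_actD(1)[OF be v(2) h_in[OF that]] .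
  have f: "f j < n k" "h k (f j) = be k w (h k j)" if "j < n k" for j
  proof -
   have img: "be k w (h k j) : h k ` {..<n k}"
    using bw[OF that] bij_betw_imp_surj_on[OF h_bij[of k]] by simp
   show "f j < n k" using inv_into_into[OF img] by (simp add: f_def)
   show "h k (f j) = be k w (h k j)" unfolding f_def by (rule f_inv_into_f[OF img])
  qed
  have fi: "h k i = be k w (h k j) <-> i = f j" if "i < n k" "j < n k" for i j
   using f[OF that(2)] that h_bij[of k] by (auto simp: bij_betw_def inj_on_def)
  let ?P = "%j. ALL (v, i, m):set Q. be k v (h k j) : d k i m"
  have "op_bdd (n k) (cmod c) (aY [t] k)"
  proof (rule op_bdd_partial[of _ _ f ?P])
   show "inj_on f {j. j < n k & ?P j}"
   proof (rule inj_onI)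
    fix i j assume ij: "i : {j. j < n k & ?P j}" "j : {j. j < n k & ?P j}" "f i = f j"
    hence "be k w (h k i) = be k w (h k j)" using f(2)[of i] f(2)[of j] by auto
    hence "be k (ginv w) (be k w (h k i)) = be k (ginv w) (be k w (h k j))" by simp
    hence "h k i = h k j"
     using fg_actD(3)[OF be[of k], of "ginv w" w] fg_actD(2)[OF be[of k]] h_in ij v(2)
     by (auto simp: FG.l_inv one_free_group)
    thus "i = j" using ij h_bij[of k] by (auto simp: bij_betw_def inj_on_def)
   qed
   show "aY [t] k $$ (i, j) = (if ?P j & i = f j then c else 0)" if "i < n k" "j < n k" for i j
    using that fi[OF that] by (simp add: aY_def fval_def tval_def kern_def t)
  qed (use f in auto)
  thus ?thesis using op_bdd_add[OF _ C[of k], of "cmod c" "aY [t] k"] aY_add[of "[t]" s k] by simp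
 qed
 thus ?case by blast
qed

lemma diag_meas_kern: "valid Q ==> w : FG ==> {x : space M. kern act e Q w x x} : sets N"
proof -
 assume v: "valid Q" "w : FG"
 have [measurable]: "Measurable.pred (N \<Otimes>\<^sub>M N) (%p. kern act e Q w (fst p) (snd p))"
  by (rule kern_meas[OF v])
 have "{x : space N. (%p. kern act e Q w (fst p) (snd p)) (x, x)} : sets N" by measurable
 thus ?thesis by simp
qed

text \<open>By linearity a monomial suffices: its normalized trace is the coefficient times the
  proportion of points where \<open>kern\<close> holds on the diagonal.\<close>

lemma trace_convergence:
 "wf_fsum s ==> (%k. ntrace (aY s k)) ----> trace A0 (aX s)"
proof (induction s)
 case Nil
 have "ntrace (aY [] k) = 0" for k by (simp add: ntrace_eq[OF aY_carrier]) (simp add: aY_def)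
 moreover have "trace A0 (aX []) = 0" by (simp add: A0_sel aX_def cong: if_cong)
 ultimately show ?case by simp
next
 case (Cons t s)
 obtain c Q w where t: "t = (c, Q, w)" by (metis surj_pair)
 have v: "valid Q" "w : FG" "wf_fsum s" "wf_fsum [t]" using Cons.prems by (auto simp: t wf_fsum_def)
 have "ntrace (aY [t] k) = c * cr (real (card {y : Y k. kern (be k) (d k) Q w y y}) / real (card (Y k)))" for k
 proof -
  have "(\<Sum>i<n k. aY [t] k $$ (i, i)) = (\<Sum>i<n k. tval (be k) (d k) t (h k i) (h k i))"
   by (intro sum.cong refl) (simp add: aY_def fval_def)
  also have "... = (\<Sum>y\<in>Y k. tval (be k) (d k) t y y)" by (rule sum.reindex_bij_betw[OF h_bij])
  also have "... = c * of_nat (card {y : Y k. kern (be k) (d k) Q w y y})"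
   using Y_fin(1)[of k] by (simp add: t tval_def sum.If_cases Int_def conj_commute)
  finally show ?thesis by (simp add: ntrace_eq[OF aY_carrier] n_def)
 qed
 moreover have "trace A0 (aX [t]) = c * cr (measure N {x : space M. kern act e Q w x x})"
 proof -
  let ?K = "{x : space M. kern act e Q w x x}"
  have K: "?K : sets N" by (rule diag_meas_kern[OF v(1,2)])
  have "trace A0 (aX [t]) = (\<integral>x. c * cr (indicator ?K x) \<partial>N)"
   unfolding A0_sel by (rule Bochner_Integration.integral_cong) (auto simp: aX_def fval_def tval_def t split: split_indicator)
  also have "... = c * cr (measure N ?K)"
   using K Int_absorb2[of ?K "space M"] by simp
  finally show ?thesis .
 qed
 moreover have "(%k. c * cr (real (card {y : Y k. kern (be k) (d k) Q w y y}) / real (card (Y k)))) ---->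
   c * cr (measure N {x : space M. kern act e Q w x x})"
  by (intro tendsto_mult_left tendsto_of_real conv v)
 ultimately have "(%k. ntrace (aY [t] k) + ntrace (aY s k)) ----> trace A0 (aX [t]) + trace A0 (aX s)"
  using Cons.IH[OF v(3)] by (intro tendsto_add) simp_all
 moreover have "ntrace (aY (t # s) k) = ntrace (aY [t] k) + ntrace (aY s k)" for k
  using aY_add[of "[t]" s k] ntrace_add[OF aY_carrier aY_carrier] by simp
 moreover have "trace A0 (aX (t # s)) = trace A0 (aX [t]) + trace A0 (aX s)"
  using aX_add[of "[t]" s] A0.trace_add[OF aX_carrier[OF v(4)] aX_carrier[OF v(3)]] by simp
 ultimately show ?case by simp
qed

definition R :: "(('a * 'a => complex) \<times> (nat => complex mat)) set" where
 "R = {(aX s, aY s) |s. wf_fsum s}"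

end

section \<open>Density of formal sums in M0(E)\<close>

context sofic_model begin

lemma nrm_add: "a : carrier A0 ==> b : carrier A0 ==> nrm (%p. a p + b p) <= nrm a + nrm b"
 using A0.Ai.nm_add[of a b] by (simp add: A0_sel)

lemma nrm_less_iff:
 assumes "a : carrier A0" "0 < ep" shows "nrm a < ep <-> qn a < ennreal (ep^2)"
proof -
 have "qn a < ennreal (ep^2) <-> (nrm a)^2 < ep^2"
  unfolding norm2_qn(1)[OF assms(1), symmetric] using assms(2) by (simp add: ennreal_less_iff)
 also have "... <-> nrm a < ep"
  using norm2_qn(2)[OF assms(1)] assms(2) by (metis less_imp_le power2_less_imp_less power_strict_mono zero_less_numeral)
 finally show ?thesis ..
qed

lemma minus_A0: "a : carrier A0 ==> b : carrier A0 ==> (%p. a p - b p) : carrier A0"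
 using A0.Ai.sb_closed[of a b] by (simp add: A0_sb)

lemma plus_A0: "a : carrier A0 ==> b : carrier A0 ==> (%p. a p + b p) : carrier A0"
 using add_A0[of a b] by (simp add: A0_sel)

definition loc :: "('a => complex) => letter list => 'a * 'a => complex" where
 "loc f w = (%(x, y). if y : space M & x = act w y then f y else 0)"

lemma loc_A0:
 assumes f [measurable]: "f : borel_measurable N" and C: "!!y. cmod (f y) <= C" and w: "w : FG"
 shows "loc f w : carrier A0"
proof (rule A0I[of _ C 1])
 have [measurable]: "act w : measurable N N" by (rule act_meas[OF w])
 have [measurable]: "Measurable.pred (N \<Otimes>\<^sub>M N) (%p. fst p = act w (snd p))" by (rule eq_meas) measurable
 have "(%p. if fst p = act w (snd p) then f (snd p) else 0) : BM" by measurable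
 also have "?this <-> loc f w : BM"
  by (rule measurable_cong) (auto simp: loc_def space_pair_measure)
 finally show "loc f w : BM" .
 show "loc f w p = 0" if "p ~: E" for p
  using that act_E[OF w] E_sym by (cases p) (auto simp: loc_def)
 show "cmod (loc f w p) <= C" for p
  using C[of undefined] C[of "snd p"] norm_ge_zero[of "f undefined"] order_trans[OF norm_ge_zero C]
  by (cases p) (auto simp: loc_def)
 fix x
 have sub: "rs (loc f w) x <= {act (ginv w) x}" "cs (loc f w) x <= {act w x}"
  using w by (auto simp: rs_def cs_def loc_def split: if_splits)
 show "finite (rs (loc f w) x) & card (rs (loc f w) x) <= 1" "finite (cs (loc f w) x) & card (cs (loc f w) x) <= 1"
  using card_mono[OF _ sub(1)] card_mono[OF _ sub(2)] finite_subset[OF sub(1)] finite_subset[OF sub(2)] by simp_all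
qed

lemma qn_loc:
 assumes w: "w : FG" shows "qn (loc f w) = (\<integral>\<^sup>+y. ennreal ((cmod (f y))^2) \<partial>N)"
 unfolding qn_def
proof (rule nn_integral_cong)
 fix y assume y: "y : space N"
 have "(\<Uplus>x. ennreal ((cmod (loc f w (x, y)))^2)) = ennreal (\<Sum>x\<in>{act w y}. (cmod (loc f w (x, y)))^2)"
  by (rule nn_integral_count_space_finite_support) (auto simp: loc_def)
 thus "(\<Uplus>x. ennreal ((cmod (loc f w (x, y)))^2)) = ennreal ((cmod (f y))^2)"
  using y by (simp add: loc_def)
qed

lemma loc_diff: "(%p. loc f w p - loc f' w p) = loc (%y. f y - f' y) w"
 by (auto simp: loc_def fun_eq_iff)

text \<open>Coefficients 1 give matrices with natural number entries, on which the rounding to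
  permutation matrices relies.\<close>

definition unit_fsum :: "fsum => bool" where
 "unit_fsum s <-> (ALL (c, Q, w):set s. c = 1)"

text \<open>For the empty word the matrices are diagonal; this is how elements of the diagonal
  subalgebra are approximated.\<close>

definition const_word :: "letter list => fsum => bool" where
 "const_word w s <-> (ALL (c, Q, w'):set s. w' = w)"

text \<open>\<open>main_part\<close> replaces \<open>B\<close> up to a null set by a set of
  \<open>M\<close>, which is close in measure to a union of dyadic sets of one level. These are
  disjoint, so the sum of their indicators is an indicator. Accuracy \<open>ep^2\<close> in measure
  is accuracy \<open>ep\<close> in 2-norm.\<close>

lemma approx_indicator:
 assumes B: "B : sets N" and w: "w : FG" and ep: "0 < ep"
 shows "EX s. wf_fsum s & unit_fsum s & const_word w s \<and>
  nrm (%p. aX s p - loc (%y. indicator B y) w p) < ep"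
proof -
 define B' where "B' = main_part M B"
 have B': "B' : sets M" "B' <= B" "B - B' : null_sets N"
 proof -
  show "B' : sets M" using B by (simp add: B'_def)
  have eq: "B = B' Un null_part M B" "B' Int null_part M B = {}"
   using main_part_null_part_Un[OF B] main_part_null_part_Int[OF B] by (simp_all add: B'_def)
  thus "B' <= B" by blast
  obtain Z where Z: "Z : null_sets M" "null_part M B <= Z" using null_part[OF B] by blast
  have "Z : null_sets N" "B - B' <= Z" using null_setsD2 eq Z by (auto simp: null_sets_def)
  thus "B - B' : null_sets N" using completion.complete2 null_sets_subset[of Z N "B - B'"] by blast
 qed
 obtain m I where I: "I <= {1..2 ^ m}" "measure M ((B' - (\<Union>i\<in>I. e i m)) Un ((\<Union>i\<in>I. e i m) - B')) < ep^2"
  using e_dense[OF B'(1), of "ep^2"] ep by auto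
 define V where "V = (\<Union>i\<in>I. e i m)"
 have finI: "finite I" using I finite_subset by blast
 have V: "V : sets M" unfolding V_def using I e_sets finI by (intro sets.finite_UN) auto
 define s :: fsum where "s = map (%i. (1, [([], i, m)], w)) (sorted_list_of_set I)"
 have s: "wf_fsum s" "unit_fsum s" "const_word w s"
  using I w finI by (auto simp: s_def wf_fsum_def unit_fsum_def const_word_def valid_def)
 have aX: "aX s = loc (%y. indicator V y) w"
 proof
  fix p :: "'a * 'a"
  obtain x y where p: "p = (x, y)" by (cases p)
  show "aX s p = loc (%y. indicator V y) w p"
  proof (cases "x : space M & y : space M")
   case True
   have "fval act e s x y = (\<Sum>i\<leftarrow>sorted_list_of_set I. if y : e i m & x = act w y then 1 else 0)"
    using True by (simp add: fval_def s_def tval_def kern_def act_one comp_def)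
   also have "... = (\<Sum>i\<in>I. if y : e i m & x = act w y then 1 else 0)"
    using finI by (subst sum_list_distinct_conv_sum_set) auto
   also have "... = (if x = act w y then indicator V y else 0)"
   proof (cases "y : V")
    case True
    then obtain i where i: "i : I" "y : e i m" by (auto simp: V_def)
    have "y : e j m <-> j = i" if "j : I" for j
     using dyadic_unique[OF dyadic, of y m] \<open>x : space M & y : space M\<close> i I(1) that by blast
    hence "(\<Sum>j\<in>I. if y : e j m & x = act w y then 1 else 0) = (\<Sum>j\<in>I. if j = i then (if x = act w y then 1 else 0 :: complex) else 0)"
     by (intro sum.cong refl) auto
    thus ?thesis using True i finI by simp
   next
    case False
    thus ?thesis by (auto simp: V_def intro!: sum.neutral)
   qed
   finally show ?thesis using True by (simp add: p aX_def loc_def)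
  next
   case False
   thus ?thesis using w by (auto simp: p aX_def loc_def)
  qed
 qed
 have A: "(%p. aX s p - loc (%y. indicator B y) w p) : carrier A0"
  by (rule minus_A0[OF aX_carrier[OF s(1)] loc_A0[of _ 1]]) (use B w in \<open>auto split: split_indicator\<close>)
 have "qn (%p. aX s p - loc (%y. indicator B y) w p) = (\<integral>\<^sup>+y. ennreal ((cmod (indicator V y - indicator B y))^2) \<partial>N)"
  unfolding aX loc_diff qn_loc[OF w] ..
 also have "... = (\<integral>\<^sup>+y. indicator ((B' - V) Un (V - B')) y \<partial>N)"
 proof (rule nn_integral_cong_AE, use AE_not_in[OF B'(3)] in eventually_elim)
  fix y assume "y ~: B - B'"
  thus "ennreal ((cmod (indicator V y - indicator B y))^2) = indicator ((B' - V) Un (V - B')) y"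
   using B'(2) by (auto split: split_indicator)
 qed
 also have "... = emeasure N ((B' - V) Un (V - B'))"
  using B' V by (intro nn_integral_indicator) auto
 also have "... = emeasure M ((B' - V) Un (V - B'))"
  using B' V by (subst emeasure_completion) auto
 also have "... < ennreal (ep^2)"
  using I(2) unfolding V_def[symmetric] emeasure_eq_measure by (simp add: ennreal_less_iff)
 finally have "nrm (%p. aX s p - loc (%y. indicator B y) w p) < ep"
  using nrm_less_iff[OF A ep] by simp
 thus ?thesis using s by blast
qed

definition approximable :: "letter list => ('a => complex) => bool" where
 "approximable w f <-> (ALL ep>0. EX s. wf_fsum s & const_word w s & nrm (%p. aX s p - loc f w p) < ep)"

lemma approximable_add:
 assumes f: "f : borel_measurable N" "!!y. cmod (f y) <= C" "approximable w f"
  and f': "f' : borel_measurable N" "!!y. cmod (f' y) <= C'" "approximable w f'" and w: "w : FG"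
 shows "approximable w (%y. f y + f' y)"
 unfolding approximable_def
proof (intro allI impI)
 fix ep :: real assume "0 < ep"
 hence ep: "0 < ep / 2" by simp
 obtain s where s: "wf_fsum s" "const_word w s" "nrm (%p. aX s p - loc f w p) < ep / 2" using f(3) ep unfolding approximable_def by blast
 obtain s' where s': "wf_fsum s'" "const_word w s'" "nrm (%p. aX s' p - loc f' w p) < ep / 2" using f'(3) ep unfolding approximable_def by blast
 have "(%p. aX (s @ s') p - loc (%y. f y + f' y) w p) = (%p. (aX s p - loc f w p) + (aX s' p - loc f' w p))"
  by (auto simp: aX_add A0_sel loc_def fun_eq_iff)
 moreover have "nrm (%p. (aX s p - loc f w p) + (aX s' p - loc f' w p)) <= nrm (%p. aX s p - loc f w p) + nrm (%p. aX s' p - loc f' w p)"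
  by (intro nrm_add minus_A0 aX_carrier s s' loc_A0[OF f(1,2) w] loc_A0[OF f'(1,2) w])
 ultimately have "nrm (%p. aX (s @ s') p - loc (%y. f y + f' y) w p) < ep" using s(3) s'(3) by simp
 moreover have "wf_fsum (s @ s')" "const_word w (s @ s')" using s s' by (auto simp: wf_fsum_def const_word_def)
 ultimately show "EX s. wf_fsum s & const_word w s & nrm (%p. aX s p - loc (%y. f y + f' y) w p) < ep" by blast
qed

lemma approximable_indicator:
 assumes B: "B : sets N" and w: "w : FG" shows "approximable w (%y. c * indicator B y)"
 unfolding approximable_def
proof (intro allI impI)
 fix ep :: real assume ep: "0 < ep"
 have e: "0 < ep / (cmod c + 1)" using ep by (simp add: add_nonneg_pos)
 obtain s where s: "wf_fsum s" "const_word w s" "nrm (%p. aX s p - loc (%y. indicator B y) w p) < ep / (cmod c + 1)"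
  using approx_indicator[OF B w e] by blast
 let ?a = "%p. aX s p - loc (%y. indicator B y) w p"
 have A: "?a : carrier A0"
  by (rule minus_A0[OF aX_carrier[OF s(1)] loc_A0[of _ 1]]) (use B w in \<open>auto split: split_indicator\<close>)
 have "(%p. aX (fscale c s) p - loc (%y. c * indicator B y) w p) = c \<odot>\<^bsub>A0\<^esub> ?a"
  by (auto simp: aX_scale A0_sel loc_def fun_eq_iff algebra_simps)
 hence "nrm (%p. aX (fscale c s) p - loc (%y. c * indicator B y) w p) = cmod c * nrm ?a"
  using A0.Ai.nm_scl[OF A, of c] by simp
 also have "... <= (cmod c + 1) * nrm ?a" using A0.Ai.nm_nonneg[OF A] by (intro mult_right_mono) auto
 also have "... < (cmod c + 1) * (ep / (cmod c + 1))"
  by (rule mult_strict_left_mono[OF s(3)]) (simp add: add_nonneg_pos)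
 also have "... = ep" using norm_ge_zero[of c] by (simp add: add_nonneg_eq_0_iff)
 finally have "nrm (%p. aX (fscale c s) p - loc (%y. c * indicator B y) w p) < ep" .
 moreover have "const_word w (fscale c s)" using s(2) by (auto simp: const_word_def fscale_def)
 ultimately show "EX s. wf_fsum s & const_word w s & nrm (%p. aX s p - loc (%y. c * indicator B y) w p) < ep"
  using wf_scale[OF s(1)] by blast
qed

lemma approximable_sum:
 assumes "finite G" "!!q. q : G ==> B q : sets N" "w : FG"
 shows "approximable w (%y. \<Sum>q\<in>G. c q * indicator (B q) y)"
 using assms(1,2)
proof (induction G rule: finite_induct)
 case empty
 show ?case using approximable_indicator[of "{}" w 0] assms(3) by simp
next
 case (insert q G)
 have bd: "cmod (\<Sum>q\<in>G. c q * indicator (B q) y) <= (\<Sum>q\<in>G. cmod (c q))" for y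
  by (rule order.trans[OF norm_sum]) (auto simp: norm_mult intro!: sum_mono split: split_indicator)
 have "approximable w (%y. c q * indicator (B q) y + (\<Sum>q\<in>G. c q * indicator (B q) y))"
 proof (rule approximable_add[of _ "cmod (c q)" _ _ "\<Sum>q\<in>G. cmod (c q)"])
  show "(%y. c q * indicator (B q) y) : borel_measurable N" using insert by auto
  show "(%y. \<Sum>q\<in>G. c q * indicator (B q) y) : borel_measurable N"
   by (rule borel_measurable_sum) (use insert in auto)
 qed (use insert bd assms(3) approximable_indicator in \<open>auto simp: norm_mult split: split_indicator\<close>)
 thus ?case unfolding sum.insert[OF insert(1,2)] .
qed

text \<open>Rounding real and imaginary parts down to a grid of mesh \<open>de = ep / 8\<close>
  gives a simple function at distance at most \<open>2 * de\<close>, which is below the allowed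
  \<open>ep / 2\<close>. The integer \<open>K\<close> bounds the grid points that can occur.\<close>

lemma approximable_bounded:
 assumes f [measurable]: "f : borel_measurable N" and C: "!!y. cmod (f y) <= C" and w: "w : FG"
 shows "approximable w f"
 unfolding approximable_def
proof (intro allI impI)
 fix ep :: real assume ep: "0 < ep"
 define de where "de = ep / 8"
 have de: "0 < de" using ep by (simp add: de_def)
 define K where "K = \<lceil>C / de\<rceil> + 1"
 define G where "G = {-K..K} \<times> {-K..K}"
 define B where "B q = {y : space N. \<lfloor>Re (f y) / de\<rfloor> = fst q & \<lfloor>Im (f y) / de\<rfloor> = snd q}" for q :: "int \<times> int"
 define c where "c q = Complex (de * of_int (fst q)) (de * of_int (snd q))" for q :: "int \<times> int"
 define f' where "f' y = (\<Sum>q\<in>G. c q * indicator (B q) y)" for y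
 have Bm: "B q : sets N" for q unfolding B_def by measurable
 have "approximable w f'" unfolding f'_def by (rule approximable_sum[OF _ Bm w]) (simp add: G_def)
 then obtain s where s: "wf_fsum s" "const_word w s" "nrm (%p. aX s p - loc f' w p) < ep / 2"
  using ep unfolding approximable_def by (meson half_gt_zero)
 have close: "cmod (f' y - f y) <= 2 * de" if y: "y : space N" for y
 proof -
  define q where "q = (\<lfloor>Re (f y) / de\<rfloor>, \<lfloor>Im (f y) / de\<rfloor>)"
  have ran: "\<lfloor>t / de\<rfloor> : {-K..K}" if "\<bar>t\<bar> <= C" for t
  proof -
   have "t / de <= C / de" "- (C / de) <= t / de" using that de by (auto simp: field_simps)
   thus ?thesis unfolding K_def by (simp, linarith)
  qed
  have qG: "q : G"
   using ran[of "Re (f y)"] ran[of "Im (f y)"] C[of y] abs_Re_le_cmod[of "f y"] abs_Im_le_cmod[of "f y"]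
   by (simp add: q_def G_def)
  have "f' y = (\<Sum>q'\<in>G. if q' = q then c q else 0)"
   unfolding f'_def by (intro sum.cong refl) (use y in \<open>auto simp: B_def q_def split: split_indicator\<close>)
  hence f'y: "f' y = c q" using qG by (simp add: G_def)
  have fl: "\<bar>de * of_int \<lfloor>t / de\<rfloor> - t\<bar> <= de" for t
  proof -
   have "of_int \<lfloor>t / de\<rfloor> <= t / de" "t / de <= of_int \<lfloor>t / de\<rfloor> + 1" by linarith+
   hence "de * of_int \<lfloor>t / de\<rfloor> <= de * (t / de)" "de * (t / de) <= de * (of_int \<lfloor>t / de\<rfloor> + 1)"
    using de by (intro mult_left_mono; simp)+
   hence "de * of_int \<lfloor>t / de\<rfloor> <= t" "t <= de * of_int \<lfloor>t / de\<rfloor> + de" using de by (simp_all add: distrib_left)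
   thus ?thesis by linarith
  qed
  have "cmod (f' y - f y) <= \<bar>Re (f' y - f y)\<bar> + \<bar>Im (f' y - f y)\<bar>" by (rule cmod_le)
  also have "... <= de + de" using fl[of "Re (f y)"] fl[of "Im (f y)"] by (simp add: f'y c_def q_def)
  finally show ?thesis by simp
 qed
 have f'm: "f' : borel_measurable N" unfolding f'_def using Bm by (intro borel_measurable_sum) auto
 have f'b: "cmod (f' y) <= (\<Sum>q\<in>G. cmod (c q))" for y
  unfolding f'_def by (rule order.trans[OF norm_sum]) (auto simp: norm_mult intro!: sum_mono split: split_indicator)
 note L = loc_A0[OF f C w] loc_A0[OF f'm f'b w]
 have "qn (%p. loc f' w p - loc f w p) = (\<integral>\<^sup>+y. ennreal ((cmod (f' y - f y))^2) \<partial>N)"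
  unfolding loc_diff qn_loc[OF w] ..
 also have "... <= (\<integral>\<^sup>+y. ennreal ((2 * de)^2) \<partial>N)"
  by (intro nn_integral_mono ennreal_leI power_mono close) auto
 also have "... = ennreal ((2 * de)^2)" by (simp add: N.emeasure_space_1[unfolded space_completion])
 also have "... < ennreal ((ep / 2)^2)"
  using ep by (intro ennreal_lessI power_strict_mono) (auto simp: de_def)
 finally have "nrm (%p. loc f' w p - loc f w p) < ep / 2" using nrm_less_iff[OF minus_A0[OF L(2,1)] half_gt_zero[OF ep]] by blast
 moreover have "(%p. aX s p - loc f w p) = (%p. (aX s p - loc f' w p) + (loc f' w p - loc f w p))" by simp
 moreover have "nrm (%p. (aX s p - loc f' w p) + (loc f' w p - loc f w p)) <= nrm (%p. aX s p - loc f' w p) + nrm (%p. loc f' w p - loc f w p)"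
  by (intro nrm_add minus_A0 aX_carrier s L)
 ultimately have "nrm (%p. aX s p - loc f w p) < ep" using s(3) by simp
 thus "EX s. wf_fsum s & const_word w s & nrm (%p. aX s p - loc f w p) < ep" using s by blast
qed

lemma approx_loc:
 assumes f: "f : borel_measurable N" and C: "!!y. cmod (f y) <= C" and w: "w : FG" and ep: "0 < ep"
 shows "EX s. wf_fsum s & ((ALL y. f y : {0, 1}) --> unit_fsum s) & nrm (%p. aX s p - loc f w p) < ep"
proof (cases "ALL y. f y : {0, 1}")
 case True
 let ?B = "{y : space N. f y = 1}"
 have [measurable]: "f : borel_measurable N" by fact
 have B: "?B : sets N" by measurable
 have "loc f w = loc (%y. indicator ?B y) w"
  using True by (auto simp: loc_def fun_eq_iff split: split_indicator)
 thus ?thesis using approx_indicator[OF B w ep] by auto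
next
 case False
 thus ?thesis using approximable_bounded[OF f C w] ep unfolding approximable_def by blast
qed

text \<open>\<open>a\<close> is cut along the partition of \<open>E\<close> into graphs of
  \<open>g i\<close> over \<open>D i\<close>. Each column is finite, so the tails tend to 0 by
  dominated convergence and finitely many pieces suffice. A 0/1 function has 0/1 pieces, for which
  coefficients 1 suffice.\<close>

lemma dense_aX:
 assumes a: "a : carrier A0" and ep: "0 < ep"
 shows "EX s. wf_fsum s & ((ALL p. a p : {0, 1}) --> unit_fsum s) & nrm (%p. aX s p - a p) < ep"
proof -
 have [measurable]: "a : BM" by (rule A0_meas[OF a])
 obtain C n where C: "1 <= C" "!!p. cmod (a p) <= C" "!!x. card (rs a x) <= n" "!!x. card (cs a x) <= n" by (rule A0E[OF a]) blast
 define f where "f i y = (if y : D i then a (g i y, y) else 0)" for i y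
 have fm: "f i : borel_measurable N" for i unfolding f_def by measurable
 have fb: "cmod (f i y) <= C" for i y using C by (simp add: f_def)
 define S where "S J p = (\<Sum>i<J. loc (f i) (fw i) p)" for J p
 have SA: "S J : carrier A0" for J
 proof (induction J)
  case 0
  have "S 0 = \<zero>\<^bsub>A0\<^esub>" by (simp add: S_def A0_sel fun_eq_iff)
  thus ?case by (simp add: zero_A0)
 next
  case (Suc J)
  have "S (Suc J) = (%p. S J p + loc (f J) (fw J) p)" by (simp add: S_def fun_eq_iff)
  thus ?case using plus_A0[OF Suc loc_A0[OF fm fb fw_FG]] by simp
 qed
 \<comment> \<open>For \<open>y\<close> in \<open>X0\<close> this is the squared norm of what the
   first \<open>J\<close> pieces miss of column \<open>y\<close>.\<close>
 define T where "T J y = (\<Sum>i. if y : D i then (if J <= i then ennreal ((cmod (a (g i y, y)))^2) else 0) else 0)" for J y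
 have ptw: "(\<Uplus>x. ennreal ((cmod (S J (x, y) - a (x, y)))^2)) = T J y" if y: "y : X0" for J y
 proof -
  have ys: "y : space M" using y X0_sub by auto
  have "(\<Uplus>x. ennreal ((cmod (S J (x, y) - a (x, y)))^2)) =
    (\<Sum>i. if y : D i then ennreal ((cmod (S J (g i y, y) - a (g i y, y)))^2) else 0)"
  proof (rule count_eq[OF ys])
   fix x assume "(y, x) ~: E"
   hence "(x, y) ~: E" using E_sym by blast
   thus "ennreal ((cmod (S J (x, y) - a (x, y)))^2) = 0" using A0_zero[OF SA] A0_zero[OF a] by simp
  qed
  also have "... = T J y"
   unfolding T_def
  proof (intro suminf_cong if_cong refl)
   fix j assume j: "y : D j"
   have "S J (g j y, y) = (\<Sum>i<J. if i = j then a (g j y, y) else 0)"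
    unfolding S_def
   proof (intro sum.cong refl)
    fix i
    have "act (fw i) y = g i y" using y by (simp add: g_def)
    moreover have "i = j" if "g i y = g j y" "y : D i"
     using that j D_less[of y i j] D_less[of y j i] by (cases i j rule: linorder_cases) auto
    ultimately show "loc (f i) (fw i) (g j y, y) = (if i = j then a (g j y, y) else 0)"
     using ys j by (auto simp: loc_def f_def)
   qed
   thus "ennreal ((cmod (S J (g j y, y) - a (g j y, y)))^2) = (if J <= j then ennreal ((cmod (a (g j y, y)))^2) else 0)"
    by auto
  qed
  finally show ?thesis .
 qed
 have Tm [measurable]: "T J : borel_measurable N" for J unfolding T_def by measurable
 have T0: "T 0 y = (\<Uplus>x. ennreal ((cmod (a (x, y)))^2))" if "y : space N" for y
  unfolding T_def using that by (subst count_eq[of y]) (use A0_zero[OF a] E_sym in \<open>auto cong: if_cong\<close>)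
 have T0i: "(\<integral>\<^sup>+y. T 0 y \<partial>N) < \<infinity>"
 proof -
  have "(\<integral>\<^sup>+y. T 0 y \<partial>N) = qn a" unfolding qn_def by (intro nn_integral_cong T0)
  also have "... < \<infinity>" unfolding norm2_qn(1)[OF a, symmetric] by simp
  finally show ?thesis .
 qed
 have "(%J. \<integral>\<^sup>+y. T J y \<partial>N) ----> (\<integral>\<^sup>+y. 0 \<partial>N)"
 proof (rule nn_integral_dominated_convergence[OF _ _ _ _ T0i])
  show "AE y in N. T J y <= T 0 y" for J
   unfolding T_def by (intro AE_I2 suminf_le) auto
  show "AE y in N. (%J. T J y) ----> 0"
  proof (rule AE_I2)
   fix y assume "y : space N"
   hence y: "y : space M" by simp
   have inj: "inj_on (%i. g i y) {i. y : D i}" using bij_g[OF y] by (simp add: bij_betw_def)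
   have "finite {i. y : D i & a (g i y, y) ~= 0}"
   proof (rule finite_imageD)
    show "finite ((%i. g i y) ` {i. y : D i & a (g i y, y) ~= 0})"
     by (rule finite_subset[OF _ A0_fin(2)[OF a, of y]]) (auto simp: cs_def)
    show "inj_on (%i. g i y) {i. y : D i & a (g i y, y) ~= 0}" by (rule inj_on_subset[OF inj]) auto
   qed
   then obtain J0 where J0: "!!i. y : D i ==> a (g i y, y) ~= 0 ==> i < J0"
    using finite_nat_set_iff_bounded by (metis (mono_tags, lifting) mem_Collect_eq)
   have "T J y = 0" if "J0 <= J" for J
   proof -
    have "(%i. if y : D i then (if J <= i then ennreal ((cmod (a (g i y, y)))^2) else 0) else 0) = (%_. 0)"
     using J0 that by (fastforce simp: fun_eq_iff)
    thus ?thesis by (simp add: T_def)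
   qed
   hence "eventually (%J. T J y = 0) sequentially" by (auto simp: eventually_sequentially)
   thus "(%J. T J y) ----> 0" by (rule tendsto_eventually)
  qed
 qed measurable
 hence "(%J. \<integral>\<^sup>+y. T J y \<partial>N) ----> 0" by simp
 moreover have "0 < ennreal ((ep / 2)^2)" using ep by simp
 ultimately have "eventually (%J. (\<integral>\<^sup>+y. T J y \<partial>N) < ennreal ((ep / 2)^2)) sequentially" by (rule order_tendstoD)
 then obtain J where J: "(\<integral>\<^sup>+y. T J y \<partial>N) < ennreal ((ep / 2)^2)" by (auto simp: eventually_sequentially)
 have "qn (%p. S J p - a p) = (\<integral>\<^sup>+y. T J y \<partial>N)"
  unfolding qn_def by (rule nn_integral_cong_AE, use AE_X0 in eventually_elim) (rule ptw)
 hence SJ: "nrm (%p. S J p - a p) < ep / 2" using J nrm_less_iff[OF minus_A0[OF SA a] half_gt_zero[OF ep]] by simp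
 have "EX s. wf_fsum s & ((ALL p. a p : {0, 1}) --> unit_fsum s) & nrm (%p. aX s p - S K p) < et" if "0 < et" for K et
  using that
 proof (induction K arbitrary: et)
  case 0
  have "(%p. aX [] p - S 0 p) = (%p. 0)" by (auto simp: aX_def S_def fun_eq_iff)
  moreover have "nrm (%p. 0) = 0" using nrm_less_iff[OF zero_A0] by (simp add: trace_norm2_def trace_inner_def A0_sel)
  ultimately show ?case using 0 by (intro exI[of _ "[]"]) (auto simp: wf_fsum_def unit_fsum_def)
 next
  case (Suc K)
  have e: "0 < et / 2" using Suc.prems by simp
  obtain s where s: "wf_fsum s" "(ALL p. a p : {0, 1}) --> unit_fsum s" "nrm (%p. aX s p - S K p) < et / 2"
   using Suc.IH[OF e] by blast
  obtain s' where s': "wf_fsum s'" "(ALL y. f K y : {0, 1}) --> unit_fsum s'" "nrm (%p. aX s' p - loc (f K) (fw K) p) < et / 2"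
   using approx_loc[OF fm fb fw_FG e] by blast
  have "(%p. aX (s @ s') p - S (Suc K) p) = (%p. (aX s p - S K p) + (aX s' p - loc (f K) (fw K) p))"
   by (auto simp: aX_add A0_sel S_def fun_eq_iff)
  moreover have "nrm (%p. (aX s p - S K p) + (aX s' p - loc (f K) (fw K) p)) <= nrm (%p. aX s p - S K p) + nrm (%p. aX s' p - loc (f K) (fw K) p)"
   by (intro nrm_add minus_A0 aX_carrier s s' SA loc_A0[OF fm fb fw_FG])
  ultimately have "nrm (%p. aX (s @ s') p - S (Suc K) p) < et" using s(3) s'(3) by simp
  moreover have "wf_fsum (s @ s')" using s s' by (auto simp: wf_fsum_def)
  moreover have "unit_fsum (s @ s')" if a01: "ALL p. a p : {0, 1}"
  proof -
   have "ALL y. f K y : {0, 1}" using a01 by (simp add: f_def)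
   thus ?thesis using s(2) s'(2) a01 by (auto simp: unit_fsum_def)
  qed
  ultimately show ?case by blast
 qed
 then obtain s where s: "wf_fsum s" "(ALL p. a p : {0, 1}) --> unit_fsum s" "nrm (%p. aX s p - S J p) < ep / 2"
  using half_gt_zero[OF ep] by blast
 have "nrm (%p. (aX s p - S J p) + (S J p - a p)) <= nrm (%p. aX s p - S J p) + nrm (%p. S J p - a p)"
  by (intro nrm_add minus_A0 aX_carrier s SA a)
 hence "nrm (%p. aX s p - a p) < ep" using s(3) SJ by simp
 thus ?thesis using s by blast
qed

lemma R_I: "wf_fsum s ==> (aX s, aY s) : R"
 by (auto simp: R_def)

lemma R_E:
 assumes "(a, x) : R" obtains s where "wf_fsum s" "a = aX s" "x = aY s"
 using assms unfolding R_def by blast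

sublocale MA: matrix_approx A0 om n R
proof (intro matrix_approx.intro matrix_approx_axioms.intro A0.tracial_alg_axioms)
 fix a b x y c
 show "a : carrier A0" if "(a, x) : R" using that aX_carrier by (auto simp: R_def)
 show "x : bounded_mat_seqs n" if "(a, x) : R" using that aY_bdd by (auto simp: R_def bounded_mat_seqs_iff)
 show "(one0, %k. 1\<^sub>m (n k)) : R"
  unfolding R_def using aX_one aY_one
  by (intro CollectI exI[of _ "[(1, [], [])]"]) (auto simp: wf_fsum_def valid_def)
 show "(c \<odot>\<^bsub>A0\<^esub> a, %k. c \<cdot>\<^sub>m x k) : R" "(star A0 a, %k. adj (x k)) : R" if r: "(a, x) : R"
 proof -
  obtain s where s: "wf_fsum s" "a = aX s" "x = aY s" by (rule R_E[OF r])
  have "aY (fscale c s) = (%k. c \<cdot>\<^sub>m x k)" "aY (map tstar s) = (%k. adj (x k))"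
   using aY_scale aY_star[OF s(1)] s(3) by blast+
  with R_I[OF wf_scale[OF s(1)], of c] R_I[OF wf_star[OF s(1)]]
  show "(c \<odot>\<^bsub>A0\<^esub> a, %k. c \<cdot>\<^sub>m x k) : R" "(star A0 a, %k. adj (x k)) : R"
   unfolding s(2) by (simp_all only: aX_scale aX_star[OF s(1)])
 qed
 show "((%k. ntrace (x k)) \<longlongrightarrow> trace A0 a) om" if "(a, x) : R"
  using that trace_convergence tendsto_mono[OF omega_seq] by (auto simp: R_def)
 show "EX b y. (b, y) : R & nrm (A0.Ai.sb a b) < ep" if r: "a : carrier A0" "0 < ep" for ep
 proof -
  obtain s where s: "wf_fsum s" "nrm (%p. aX s p - a p) < ep" using dense_aX[OF r] by blast
  hence "nrm (A0.Ai.sb a (aX s)) < ep"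
   using A0.Ai.nm_sb_commute[OF r(1) aX_carrier[OF s(1)]] A0_sb[OF aX_carrier[OF s(1)] r(1)] by simp
  thus ?thesis using s(1) by (auto simp: R_def)
 qed
 assume r: "(a, x) : R" "(b, y) : R"
 obtain s where s1: "wf_fsum s" "a = aX s" "x = aY s" by (rule R_E[OF r(1)])
 obtain s' where s2: "wf_fsum s'" "b = aX s'" "y = aY s'" by (rule R_E[OF r(2)])
 note s = s1(2,3,1) s2(2,3,1)
 have w: "wf_fsum (s @ s')" "wf_fsum (fmul s s')" using wf_mul[OF s(3,6)] s(3,6) by (simp_all add: wf_fsum_def ball_Un)
 have "aY (s @ s') = (%k. x k + y k)" "aY (fmul s s') = (%k. x k * y k)"
  unfolding s(2,5) using aY_add aY_mult[OF s(3,6)] by blast+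
 with R_I[OF w(1)] R_I[OF w(2)]
 show "(a \<oplus>\<^bsub>A0\<^esub> b, %k. x k + y k) : R" "(a \<star> b, %k. x k * y k) : R"
  unfolding s(1,4) by (simp_all only: aX_add aX_mult[OF s(3,6)])
qed (rule omega_bot omega_seq n_pos)+

end

section \<open>Rounding to permutations\<close>

text \<open>Completing the square; the parameter \<open>t\<close> decides which of the two terms
  keeps a factor near 1.\<close>

lemma cmod_add_sq_le:
 assumes "0 < (t :: real)" shows "(cmod (z + w))^2 <= (1 + t) * (cmod z)^2 + (1 + 1 / t) * (cmod w)^2"
proof -
 have "(cmod (z + w))^2 <= (cmod z + cmod w)^2" by (intro power_mono norm_triangle_ineq) simp
 also have "... = (1 + t) * (cmod z)^2 + (1 + 1 / t) * (cmod w)^2 - (t * cmod z - cmod w)^2 / t"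
  using assms by (simp add: field_simps power2_eq_square)
 also have "... <= (1 + t) * (cmod z)^2 + (1 + 1 / t) * (cmod w)^2" using assms by simp
 finally show ?thesis .
qed

lemma sum_cmod_sq_le:
 "(\<Sum>i\<in>I. (cmod (v i))^2) <= 5 / 4 * (\<Sum>i\<in>I. (cmod (u i))^2) + 5 * (\<Sum>i\<in>I. (cmod (u i - v i))^2)"
proof -
 have "(cmod (v i))^2 <= 5 / 4 * (cmod (u i))^2 + 5 * (cmod (u i - v i))^2" for i
  using cmod_add_sq_le[of "1 / 4" "u i" "v i - u i"] by (simp add: norm_minus_commute)
 hence "(\<Sum>i\<in>I. (cmod (v i))^2) <= (\<Sum>i\<in>I. 5 / 4 * (cmod (u i))^2 + 5 * (cmod (u i - v i))^2)"
  by (intro sum_mono)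
 thus ?thesis by (simp add: sum.distrib sum_distrib_left)
qed

text \<open>The sum \<open>?q\<close> of the squares of the entries is a natural number. The weights
  5/4 and 5, from \<open>t = 1/4\<close>, bound it by 25/16 + 5/16 < 2 and also show that it is
  positive. So it is 1, and exactly one entry is 1.\<close>

lemma near_unit_nat_vector:
 fixes m :: "'i => nat" and u :: "'i => complex"
 assumes fin: "finite I" and u: "\<bar>(\<Sum>i\<in>I. (cmod (u i))^2) - 1\<bar> < 1 / 4"
  and d: "(\<Sum>i\<in>I. (cmod (u i - of_nat (m i)))^2) < 1 / 16"
 shows "EX i:I. m i = 1 & (ALL j:I. j ~= i --> m j = 0)"
proof -
 let ?q = "\<Sum>i\<in>I. (m i)^2"
 have q: "real ?q = (\<Sum>i\<in>I. (cmod (of_nat (m i)))^2)" by simp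
 have "real ?q <= 5 / 4 * (\<Sum>i\<in>I. (cmod (u i))^2) + 5 * (\<Sum>i\<in>I. (cmod (u i - of_nat (m i)))^2)"
  unfolding q by (rule sum_cmod_sq_le)
 hence "real ?q < 2" using u d by linarith
 moreover have "(\<Sum>i\<in>I. (cmod (u i))^2) <= 5 / 4 * real ?q + 5 * (\<Sum>i\<in>I. (cmod (u i - of_nat (m i)))^2)"
  unfolding q using sum_cmod_sq_le[of u I "%i. of_nat (m i)"] by (simp add: norm_minus_commute)
 hence "0 < real ?q" using u d by linarith
 ultimately have "?q < 2" "0 < ?q" by (simp_all only: of_nat_0_less_iff of_nat_less_numeral_iff)
 hence "?q = 1" by linarith
 then obtain i where i: "i : I" "(m i)^2 = 1" "ALL j:I. i ~= j --> (m j)^2 = 0"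
  unfolding sum_eq_1_iff[OF fin] by blast
 thus ?thesis by (intro bexI[of _ i]) (auto simp: power2_eq_1_iff)
qed

text \<open>Markov's inequality for the counting measure.\<close>

lemma card_large_le:
 assumes "finite I" "!!i. i : I ==> 0 <= (f i :: real)" "(\<Sum>i\<in>I. f i) <= S" "0 < t"
 shows "real (card {i : I. t <= f i}) <= S / t"
proof -
 have "t * real (card {i : I. t <= f i}) = (\<Sum>i\<in>{i : I. t <= f i}. t)" by simp
 also have "... <= (\<Sum>i\<in>{i : I. t <= f i}. f i)" by (intro sum_mono) auto
 also have "... <= (\<Sum>i\<in>I. f i)" by (intro sum_mono2) (use assms in auto)
 finally show ?thesis using assms by (simp add: field_simps)
qed

text \<open>\<open>p j\<close> is both the squared norm of column \<open>j\<close> of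
  \<open>P\<close> and a diagonal entry of its adjoint times \<open>P\<close>. By Markov's
  inequality at most 16 e^2 n columns have \<open>p j\<close> at distance 1/4 or more from 1, and at
  most 16 e^2 n have squared distance 1/16 or more from the column of \<open>y\<close>.\<close>

lemma near_isometry_columns:
 assumes P: "P : MT n" and y: "y : MT n" and n: "0 < n" and e: "0 <= e"
  and nat: "!!i j. i < n ==> j < n ==> y $$ (i, j) = of_nat (m i j)"
  and iso: "nm2 (adj P * P - 1\<^sub>m n) <= e" and near: "nm2 (P - y) <= e"
 shows "EX B ta. B <= {..<n} & real (card B) <= 32 * e^2 * n \<and>
  (ALL j:{..<n} - B. ta j < n & m (ta j) j = 1 & (ALL i<n. i ~= ta j --> m i j = 0))"
proof -
 define p where "p j = (\<Sum>i<n. (cmod (P $$ (i, j)))^2)" for j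
 define dd where "dd j = (\<Sum>i<n. (cmod (P $$ (i, j) - of_nat (m i j)))^2)" for j
 define B1 where "B1 = {j : {..<n}. 1 / 16 <= \<bar>p j - 1\<bar>^2}"
 define B2 where "B2 = {j : {..<n}. 1 / 16 <= dd j}"
 have c: "adj P * P - 1\<^sub>m n : MT n" "P - y : MT n" using P y by (auto intro!: minus_carrier_mat)
 have "(\<Sum>j<n. \<bar>p j - 1\<bar>^2) <= (\<Sum>j<n. \<Sum>i<n. (cmod ((adj P * P - 1\<^sub>m n) $$ (j, i)))^2)"
 proof (rule sum_mono)
  fix j assume j: "j : {..<n}"
  have "(adj P * P) $$ (j, j) = (\<Sum>k<n. adj P $$ (j, k) * P $$ (k, j))"
   by (rule index_mult_mat_sum) (use P j in auto)
  also have "... = (\<Sum>k<n. P $$ (k, j) * cnj (P $$ (k, j)))"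
   using P j by (intro sum.cong refl) (auto simp: mult.commute)
  also have "... = cr (p j)" unfolding p_def of_real_sum by (simp only: complex_norm_square[symmetric])
  finally have "(adj P * P - 1\<^sub>m n) $$ (j, j) = cr (p j - 1)" using P j by simp
  hence "\<bar>p j - 1\<bar>^2 = (cmod ((adj P * P - 1\<^sub>m n) $$ (j, j)))^2" by (simp only: norm_of_real)
  also have "... <= (\<Sum>i<n. (cmod ((adj P * P - 1\<^sub>m n) $$ (j, i)))^2)"
   by (rule member_le_sum[of j "{..<n}" "%i. (cmod ((adj P * P - 1\<^sub>m n) $$ (j, i)))^2"]) (use j in auto)
  finally show "\<bar>p j - 1\<bar>^2 <= (\<Sum>i<n. (cmod ((adj P * P - 1\<^sub>m n) $$ (j, i)))^2)" .
 qed
 also have "... = (nm2 (adj P * P - 1\<^sub>m n))^2 * n" using n unfolding mat_norm2_sq[OF c(1)] by simp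
 also have "... <= e^2 * n" by (intro mult_right_mono power_mono iso mat_norm2_nonneg[OF c(1)]) simp
 finally have "real (card B1) <= (e^2 * n) / (1 / 16)" unfolding B1_def by (intro card_large_le) auto
 moreover have "(\<Sum>j<n. dd j) <= e^2 * n"
 proof -
  have "(\<Sum>j<n. dd j) = (\<Sum>i<n. \<Sum>j<n. (cmod ((P - y) $$ (i, j)))^2)"
   unfolding dd_def by (subst sum.swap) (use y nat in \<open>auto intro!: sum.cong\<close>)
  also have "... = (nm2 (P - y))^2 * n" using n unfolding mat_norm2_sq[OF c(2)] by simp
  also have "... <= e^2 * n" by (intro mult_right_mono power_mono near mat_norm2_nonneg[OF c(2)]) simp
  finally show ?thesis .
 qed
 hence "real (card B2) <= (e^2 * n) / (1 / 16)" unfolding B2_def by (intro card_large_le) (auto simp: dd_def sum_nonneg)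
 moreover have "real (card (B1 Un B2)) <= real (card B1) + real (card B2)" using card_Un_le[of B1 B2] by linarith
 ultimately have B: "real (card (B1 Un B2)) <= 32 * e^2 * n" by simp
 define ta where "ta j = (SOME i. i < n & m i j = 1 & (ALL l<n. l ~= i --> m l j = 0))" for j
 have "ta j < n & m (ta j) j = 1 & (ALL i<n. i ~= ta j --> m i j = 0)" if j: "j : {..<n} - (B1 Un B2)" for j
 proof -
  have "\<bar>p j - 1\<bar>^2 < (1 / 4)^2" "dd j < 1 / 16" using j by (auto simp: B1_def B2_def power2_eq_square)
  hence "\<bar>p j - 1\<bar> < 1 / 4" "dd j < 1 / 16" using power2_less_imp_less[of "\<bar>p j - 1\<bar>" "1 / 4"] by simp_all
  hence "EX i:{..<n}. m i j = 1 & (ALL l:{..<n}. l ~= i --> m l j = 0)"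
   unfolding p_def dd_def by (intro near_unit_nat_vector) auto
  hence "EX i. i < n & m i j = 1 & (ALL l<n. l ~= i --> m l j = 0)" by auto
  thus ?thesis unfolding ta_def by (rule someI_ex)
 qed
 thus ?thesis using B by (intro exI[of _ "B1 Un B2"] exI[of _ ta]) (auto simp: B1_def B2_def)
qed

text \<open>The complements of domain and image have the same finite size.\<close>

lemma bij_betw_extend:
 assumes "finite A" "J <= A" "inj_on f J" "f ` J <= A"
 shows "EX si. bij_betw si A A & (ALL j:J. si j = f j)"
proof -
 have "card (A - J) = card (A - f ` J)"
  using assms by (simp add: card_Diff_subset card_image finite_subset)
 then obtain g where g: "bij_betw g (A - J) (A - f ` J)"
  using finite_same_card_bij[of "A - J" "A - f ` J"] assms(1) by blast
 let ?si = "%j. if j : J then f j else g j"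
 have "bij_betw ?si (J Un (A - J)) (f ` J Un (A - f ` J))"
 proof (rule bij_betw_combine)
  show "bij_betw ?si J (f ` J)" using assms(3) by (auto simp: bij_betw_def inj_on_def)
  show "bij_betw ?si (A - J) (A - f ` J)" using g by (rule bij_betw_cong[THEN iffD1, rotated]) auto
 qed auto
 moreover have "J Un (A - J) = A" "f ` J Un (A - f ` J) = A" using assms by auto
 ultimately show ?thesis by (intro exI[of _ ?si]) auto
qed

text \<open>\<open>ta\<close> sends a good column of \<open>y\<close> to the row of its only 1. Good
  columns whose row is bad form \<open>K\<close>; on the others, \<open>J\<close>, the map
  \<open>ta\<close> is injective and extends to a permutation whose matrix agrees with
  \<open>y\<close> on the columns in \<open>J\<close>. It remains to bound the number of columns
  outside \<open>J\<close>.\<close>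

lemma round_to_permutation:
 assumes P: "op_bdd n C P" and C: "1 <= C" and y: "y : MT n" and n: "0 < n" and e: "0 <= e"
  and nat: "!!i j. i < n ==> j < n ==> EX m :: nat. y $$ (i, j) = of_nat m"
  and iso: "nm2 (adj P * P - 1\<^sub>m n) <= e" "nm2 (P * adj P - 1\<^sub>m n) <= e"
  and near: "nm2 (P - y) <= e"
 shows "EX s:permutation_mats n. nm2 (P - s) <= 20 * C^2 * e"
proof -
 note Pc = op_bddD(1)[OF P]
 obtain m :: "nat => nat => nat" where m: "!!i j. i < n ==> j < n ==> y $$ (i, j) = of_nat (m i j)"
  using nat by metis
 obtain B ta where B: "B <= {..<n}" "real (card B) <= 32 * e^2 * n"
  "!!j. j : {..<n} - B ==> ta j < n & m (ta j) j = 1 & (ALL i<n. i ~= ta j --> m i j = 0)"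
  using near_isometry_columns[OF Pc y n e m iso(1) near] by blast
 have near': "nm2 (adj P - adj y) <= e"
 proof -
  have "adj P - adj y = adj (P - y)" using Pc y by (intro eq_matI) auto
  thus ?thesis using mat_norm2_adjoint[of "P - y" n] near y by (simp add: minus_carrier_mat)
 qed
 have my: "adj y $$ (i, j) = of_nat (m j i)" if "i < n" "j < n" for i j
  using m[of j i] that y by simp
 obtain B' ta' where B': "B' <= {..<n}" "real (card B') <= 32 * e^2 * n"
  "!!j. j : {..<n} - B' ==> ta' j < n & m j (ta' j) = 1 & (ALL i<n. i ~= ta' j --> m j i = 0)"
  using near_isometry_columns[of "adj P" n "adj y" e "%i j. m j i", OF _ _ n e my _ near'] Pc y iso(2)
  unfolding mat_adjoint_adjoint by blast
 define K where "K = {j : {..<n} - B. ta j : B'}"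
 define J where "J = {j : {..<n} - B. ta j ~: B'}"
 have inj: "inj_on ta J"
 proof (rule inj_onI)
  fix i j assume ij: "i : J" "j : J" "ta i = ta j"
  hence t: "m (ta i) i = 1" "m (ta i) j = 1" "ta i : {..<n} - B'" "i < n" "j < n"
   using B(3)[of i] B(3)[of j] by (auto simp: J_def)
  thus "i = j" using B'(3)[OF t(3)] by (metis zero_neq_one)
 qed
 obtain si where si: "bij_betw si {..<n} {..<n}" "!!j. j : J ==> si j = ta j"
  using bij_betw_extend[OF _ _ inj, of "{..<n}"] B(3) by (auto simp: J_def)
 define s where "s = mat n n (%(i, j). if i = si j then 1 else 0 :: complex)"
 have s: "s : permutation_mats n" "s : MT n" using si(1) by (auto simp: s_def permutation_mats_def)
 have sum1: "(\<Sum>j<n. (cmod (P $$ (i, j)))^2) <= C^2" "(\<Sum>j<n. (cmod (P $$ (j, i)))^2) <= C^2" if i: "i < n" for i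
 proof -
  have "(\<Sum>j<n. (cmod (x $$ (j, i)))^2) <= C^2" if "op_bdd n C x" for x
  proof -
   let ?v = "%k. if k = i then 1 else 0 :: complex"
   have "mv n x ?v k = x $$ (k, i)" for k
   proof -
    have "mv n x ?v k = (\<Sum>j<n. if j = i then x $$ (k, i) else 0)" unfolding mv_def by (intro sum.cong) auto
    thus ?thesis using i by simp
   qed
   moreover have "vn n ?v = (\<Sum>k<n. if k = i then 1 else 0)" unfolding vn_def by (intro sum.cong) auto
   hence "vn n ?v = 1" using i by simp
   ultimately show ?thesis using op_bddD(3)[OF that, of ?v] by (simp add: vn_def)
  qed
  from this[OF P] this[OF op_bdd_adjoint[OF P]]
  show "(\<Sum>j<n. (cmod (P $$ (i, j)))^2) <= C^2" "(\<Sum>j<n. (cmod (P $$ (j, i)))^2) <= C^2"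
   using Pc i by simp_all
 qed
 have c: "P - y : MT n" "P - s : MT n" using y s by (auto intro!: minus_carrier_mat)
 have D: "(\<Sum>i<n. \<Sum>j<n. (cmod (P $$ (i, j) - of_nat (m i j)))^2) <= e^2 * n"
 proof -
  have "(\<Sum>i<n. \<Sum>j<n. (cmod (P $$ (i, j) - of_nat (m i j)))^2) = (\<Sum>i<n. \<Sum>j<n. (cmod ((P - y) $$ (i, j)))^2)"
   using y m by (intro sum.cong refl) auto
  also have "... = (nm2 (P - y))^2 * n" using n unfolding mat_norm2_sq[OF c(1)] by simp
  also have "... <= e^2 * n" by (intro mult_right_mono power_mono near mat_norm2_nonneg[OF c(1)]) simp
  finally show ?thesis .
 qed
 \<comment> \<open>Every column in \<open>K\<close> puts an entry 1 of \<open>y\<close> into a bad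
   row. The mass of \<open>y\<close> in the bad rows is controlled by that of \<open>P\<close>, at
   most \<open>C^2\<close> per row, and by the distance of \<open>P\<close> to
   \<open>y\<close>.\<close>
 have "real (card K) = (\<Sum>j\<in>K. (\<Sum>i\<in>B'. if i = ta j then 1 else 0))"
  using B'(1) by (simp add: K_def finite_subset)
 also have "... <= (\<Sum>j\<in>K. \<Sum>i\<in>B'. (cmod (of_nat (m i j)))^2)"
  by (intro sum_mono) (use B(3) in \<open>auto simp: K_def\<close>)
 also have "... <= (\<Sum>j<n. \<Sum>i\<in>B'. (cmod (of_nat (m i j)))^2)"
  by (intro sum_mono2) (auto simp: K_def sum_nonneg)
 also have "... = (\<Sum>i\<in>B'. \<Sum>j<n. (cmod (of_nat (m i j)))^2)" by (rule sum.swap)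
 also have "... <= (\<Sum>i\<in>B'. 5 / 4 * (\<Sum>j<n. (cmod (P $$ (i, j)))^2) + 5 * (\<Sum>j<n. (cmod (P $$ (i, j) - of_nat (m i j)))^2))"
  by (intro sum_mono sum_cmod_sq_le)
 also have "... <= (\<Sum>i\<in>B'. 5 / 4 * C^2 + 5 * (\<Sum>j<n. (cmod (P $$ (i, j) - of_nat (m i j)))^2))"
  by (intro sum_mono add_right_mono mult_left_mono sum1) (use B'(1) in auto)
 also have "... = 5 / 4 * C^2 * card B' + 5 * (\<Sum>i\<in>B'. \<Sum>j<n. (cmod (P $$ (i, j) - of_nat (m i j)))^2)"
  by (simp add: sum.distrib sum_distrib_left)
 also have "... <= 5 / 4 * C^2 * (32 * e^2 * n) + 5 * (e^2 * n)"
 proof (intro add_mono mult_left_mono)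
  have "(\<Sum>i\<in>B'. \<Sum>j<n. (cmod (P $$ (i, j) - of_nat (m i j)))^2) <= (\<Sum>i<n. \<Sum>j<n. (cmod (P $$ (i, j) - of_nat (m i j)))^2)"
   by (intro sum_mono2) (use B'(1) in \<open>auto intro!: sum_nonneg\<close>)
  thus "(\<Sum>i\<in>B'. \<Sum>j<n. (cmod (P $$ (i, j) - of_nat (m i j)))^2) <= e^2 * n" using D by linarith
 qed (use B'(2) in auto)
 finally have K: "real (card K) <= 40 * C^2 * (e^2 * n) + 5 * (e^2 * n)" by (simp add: mult_ac)
 have C2: "1 <= C^2" using C by simp
 have "n * (nm2 (P - s))^2 = (\<Sum>i<n. \<Sum>j<n. (cmod ((P - s) $$ (i, j)))^2)"
  using n unfolding mat_norm2_sq[OF c(2)] by simp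
 also have "... = (\<Sum>j<n. \<Sum>i<n. (cmod ((P - s) $$ (i, j)))^2)" by (rule sum.swap)
 also have "... <= (\<Sum>j<n. (\<Sum>i<n. (cmod (P $$ (i, j) - of_nat (m i j)))^2) + (if j : J then 0 else 4 * C^2))"
 proof (rule sum_mono)
  fix j assume j: "j : {..<n}"
  show "(\<Sum>i<n. (cmod ((P - s) $$ (i, j)))^2) \<le>
    (\<Sum>i<n. (cmod (P $$ (i, j) - of_nat (m i j)))^2) + (if j : J then 0 else 4 * C^2)"
  proof (cases "j : J")
   case True
   have "s $$ (i, j) = of_nat (m i j)" if "i < n" for i
    using that j True B(3)[of j] si(2)[OF True] by (auto simp: s_def J_def)
   thus ?thesis using True j s(2) by (auto intro!: sum_mono)
  next
   case False
   have sj: "si j < n" using si(1) j by (auto simp: bij_betw_def)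
   have "(\<Sum>i<n. (cmod ((P - s) $$ (i, j)))^2) <= (\<Sum>i<n. 2 * (cmod (P $$ (i, j)))^2 + (if i = si j then 2 else 0))"
   proof (rule sum_mono)
    fix i assume i: "i : {..<n}"
    have "(cmod ((P - s) $$ (i, j)))^2 <= 2 * (cmod (P $$ (i, j)))^2 + 2 * (cmod (s $$ (i, j)))^2"
     using cmod_add_sq_le[of 1 "P $$ (i, j)" "- s $$ (i, j)"] i j s(2) by simp
    also have "2 * (cmod (s $$ (i, j)))^2 = (if i = si j then 2 else 0)" using i j by (simp add: s_def)
    finally show "(cmod ((P - s) $$ (i, j)))^2 <= 2 * (cmod (P $$ (i, j)))^2 + (if i = si j then 2 else 0)" by simp
   qed
   also have "... = 2 * (\<Sum>i<n. (cmod (P $$ (i, j)))^2) + 2" using sj by (simp add: sum.distrib sum_distrib_left)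
   also have "... <= 4 * C^2" using sum1(2)[of j] j C2 by simp
   finally show ?thesis using False by (simp add: add_increasing sum_nonneg)
  qed
 qed
 also have "... = (\<Sum>i<n. \<Sum>j<n. (cmod (P $$ (i, j) - of_nat (m i j)))^2) + 4 * C^2 * card ({..<n} - J)"
 proof -
  have "(\<Sum>j<n. if j : J then 0 else 4 * C^2) = (\<Sum>j\<in>{..<n} - J. 4 * C^2)"
   by (rule sum.mono_neutral_cong_right) auto
  thus ?thesis unfolding sum.distrib by (subst sum.swap) simp
 qed
 \<comment> \<open>A column outside \<open>J\<close> costs at most 2 C^2 + 2 <= 4 C^2. Their number
   gives 77 = 32 + 5 + 40 from \<open>B\<close> and \<open>K\<close>, and 4 * 77 + 1 = 309 is below
   400 = 20^2.\<close>
 also have "... <= e^2 * n + 4 * C^2 * (77 * C^2 * (e^2 * n))"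
 proof (intro add_mono D mult_left_mono)
  have "{..<n} - J <= B Un K" by (auto simp: J_def K_def)
  hence "card ({..<n} - J) <= card (B Un K)" by (intro card_mono) (use B(1) in \<open>auto simp: K_def finite_subset\<close>)
  also have "... <= card B + card K" by (rule card_Un_le)
  finally have "real (card ({..<n} - J)) <= 37 * (e^2 * n) + 40 * C^2 * (e^2 * n)" using B(2) K by simp
  also have "37 * (e^2 * n) <= 37 * (C^2 * (e^2 * n))" using C2 mult_right_mono[OF C2, of "e^2 * n"] by simp
  finally show "real (card ({..<n} - J)) <= 77 * C^2 * (e^2 * n)" by (simp add: mult_ac)
 qed simp
 also have "... <= 309 * (C^2)^2 * (e^2 * n)"
 proof -
  have "1 * (e^2 * n) <= (C^2)^2 * (e^2 * n)" by (intro mult_right_mono one_le_power[OF C2]) auto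
  thus ?thesis by (simp add: power2_eq_square algebra_simps)
 qed
 also have "... <= n * (20 * C^2 * e)^2" using mult_right_mono[of 309 400 "(C^2)^2 * (e^2 * n)"] by (simp add: power_mult_distrib algebra_simps)
 finally have "(nm2 (P - s))^2 <= (20 * C^2 * e)^2" using n by simp
 hence "nm2 (P - s) <= 20 * C^2 * e" by (rule power2_le_imp_le) (use e in simp)
 thus ?thesis using s(1) by blast
qed

lemma permutation_mats_carrier: "s : permutation_mats n ==> s : MT n"
 by (auto simp: permutation_mats_def)

lemma one_permutation: "1\<^sub>m n : permutation_mats n"
 unfolding permutation_mats_def by (intro CollectI exI[of _ id]) (auto intro!: eq_matI)

lemma op_bdd_permutation:
 assumes "s : permutation_mats n" shows "op_bdd n 1 s"
proof -
 obtain si where si: "bij_betw si {..<n} {..<n}" "s = mat n n (%(i, j). if i = si j then 1 else 0)"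
  using assms by (auto simp: permutation_mats_def)
 have mv: "mv n s v (si j) = v j" if j: "j < n" for v j
 proof -
  have sj: "si j < n" using si(1) j by (auto simp: bij_betw_def)
  have "mv n s v (si j) = (\<Sum>l<n. if l = j then v j else 0)"
   unfolding mv_def
  proof (intro sum.cong refl)
   fix l assume l: "l : {..<n}"
   have "si j = si l <-> l = j" using si(1) j l by (auto simp: bij_betw_def inj_on_def)
   thus "s $$ (si j, l) * v l = (if l = j then v j else 0)" using sj l by (simp add: si(2))
  qed
  thus ?thesis using j by simp
 qed
 have "vn n (mv n s v) = vn n v" for v
 proof -
  have "vn n (mv n s v) = (\<Sum>j<n. (cmod (mv n s v (si j)))^2)"
   unfolding vn_def by (rule sum.reindex_bij_betw[OF si(1), symmetric])
  also have "... = vn n v" unfolding vn_def by (intro sum.cong) (auto simp: mv)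
  finally show ?thesis .
 qed
 thus ?thesis by (simp add: op_bdd_def si(2))
qed

section \<open>Permutation and diagonal matrices in the image of the extension\<close>

context matrix_approx begin

text \<open>\<open>approx\<close> provides some pair of \<open>R\<close> close to \<open>xi\<close>
  and \<open>Y\<close>; any other pair close to \<open>xi\<close> is close to it, because distances
  in the algebra are limits of distances of matrices.\<close>

lemma approx_near:
 assumes Y: "approx Y xi" and xi: "xi : Hs" and a: "(a, y) : R"
  and e: "0 < e" "Hi.nm (Hi.sb xi (dvec a)) < e"
 shows "eventually (%k. nm2 (Y k - y k) < 3 * e) om"
proof -
 obtain b z where b: "(b, z) : R" "Hi.nm (Hi.sb xi (dvec b)) < e" "eventually (%k. nm2 (Y k - z k) < e) om"
  by (rule approxE[OF Y e(1)])
 note ba = R_carrier[OF b(1)] R_carrier[OF a]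
 have "tn (Ai.sb b a) = Hi.nm (Hi.sb (dvec b) (dvec a))" using ba by (simp add: dense_sb)
 also have "... <= Hi.nm (Hi.sb (dvec b) xi) + Hi.nm (Hi.sb xi (dvec a))"
  by (rule Hi.nm_sb_triangle) (use ba xi in auto)
 also have "... < 2 * e" using b(2) e(2) Hi.nm_sb_commute[of "dvec b" xi] ba xi by simp
 finally have "eventually (%k. nm2 (z k - y k) < 2 * e) om" by (rule order_tendstoD(2)[OF R_dist[OF b(1) a]])
 thus ?thesis using b(3)
 proof eventually_elim
  case (elim k)
  thus ?case
   using mat_norm2_triangle[OF approx_mat[OF Y] R_mat[OF b(1)] R_mat[OF a], of k] by linarith
 qed
qed

text \<open>\<open>p\<close> is unitary, so its matrices \<open>P\<close> are unitary up to a small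
  2-norm error. Rounding nearby matrices with natural entries gives permutation matrices for every
  accuracy, and saturation merges them into one sequence.\<close>

lemma extension_permutation:
 assumes p: "p : carrier A" "star A p \<otimes> p = \<one>" "p \<otimes> star A p = \<one>"
  and near: "!!ep. 0 < ep ==> EX a y. (a, y) : R & tn (Ai.sb p a) < ep \<and>
   (ALL k. ALL i<n k. ALL j<n k. EX m :: nat. y k $$ (i, j) = of_nat m)"
 shows "extension (gns_rep A p) : ultraproduct_subset om n (%k. permutation_mats (n k))"
proof -
 define P where "P = class_rep (extension (gns_rep A p))"
 note T = gns_rep_right_modular[OF p(1)] gns_rep_right_modular[OF star_closed[OF p(1)]]
 have P: "P : bounded_mat_seqs n" "approx P (dvec p)" "extension (gns_rep A p) = up_class om n P"
  using extension_rep(2-4)[OF T(1)] p(1) by (auto simp: P_def gns_rep_dense)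
 note Pc = bounded_mat_seqs_carrier[OF P(1)]
 obtain C where C: "1 <= C" "!!k. op_bdd (n k) C (P k)" by (rule bounded_mat_seqsE[OF P(1)]) blast
 have Ps: "approx (%k. adj (P k)) (dvec (star A p))"
  using approx_star[OF T(1), of P] P(2) p(1) by (simp add: gns_rep_dense adjoint_gns_rep)
 have "approx (%k. adj (P k) * P k) (gns_rep A (star A p) (dvec p))"
  by (rule approx_mult[OF T(2) _ bounded_mat_seqs_adjoint[OF P(1)] P(2)]) (use Ps p(1) in \<open>simp_all add: gns_rep_dense\<close>)
 hence 1: "approx (%k. adj (P k) * P k) vac" using p by (simp add: gns_rep_dense)
 have "approx (%k. P k * adj (P k)) (gns_rep A p (dvec (star A p)))"
  by (rule approx_mult[OF T(1) _ P(1) Ps]) (use P(2) p(1) in \<open>simp_all add: gns_rep_dense\<close>)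
 hence 2: "approx (%k. P k * adj (P k)) vac" using p by (simp add: gns_rep_dense)
 have iso: "eventually (%k. nm2 (adj (P k) * P k - 1\<^sub>m (n k)) < e) om"
  "eventually (%k. nm2 (P k * adj (P k) - 1\<^sub>m (n k)) < e) om" if "0 < e" for e
  using approx_near[OF 1 _ R_one, of "e / 3"] approx_near[OF 2 _ R_one, of "e / 3"] that by simp_all
 have close: "eventually (%k. EX s. s : permutation_mats (n k) & nm2 (P k - s) < ep) om" if ep: "0 < ep" for ep
 proof -
  \<comment> \<open>Makes the rounding error \<open>20 * C^2 * e\<close> half of
    \<open>ep\<close>.\<close>
  define e where "e = ep / (40 * C^2)"
  have e: "0 < e" "20 * C^2 * e < ep" using ep C(1) by (auto simp: e_def)
  obtain a y where a: "(a, y) : R" "tn (Ai.sb p a) < e / 3"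
   "!!k i j. i < n k ==> j < n k ==> EX m :: nat. y k $$ (i, j) = of_nat m"
   using near[of "e / 3"] e(1) by auto
  have "Hi.nm (Hi.sb (dvec p) (dvec a)) < e / 3" using a(2) p(1) R_carrier[OF a(1)] by (simp add: dense_sb)
  hence "eventually (%k. nm2 (P k - y k) < e) om"
   using approx_near[OF P(2) _ a(1), of "e / 3"] e(1) p(1) by simp
  thus ?thesis using iso[OF e(1)]
  proof eventually_elim
   case (elim k)
   have "EX s:permutation_mats (n k). nm2 (P k - s) <= 20 * C^2 * e"
    by (rule round_to_permutation[OF C(2) C(1) R_mat[OF a(1)] n_pos]) (use e(1) a(3) elim in auto)
   thus ?case using e(2) by (metis order.strict_trans1)
  qed
 qed
 obtain s where s: "!!k. s k : permutation_mats (n k)" "!!j. eventually (%k. nm2 (P k - s k) < 1 / Suc j) om"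
 proof (rule filter_saturation[OF omega_seq, of "%k s. s : permutation_mats (n k)" "%j k s. nm2 (P k - s) < 1 / Suc j"])
  show "EX x. x : permutation_mats (n k)" for k using one_permutation by blast
  fix J
  have "eventually (%k. EX s. s : permutation_mats (n k) & nm2 (P k - s) < 1 / Suc J) om" by (rule close) simp
  thus "eventually (%k. EX s. s : permutation_mats (n k) & (ALL j<=J. nm2 (P k - s) < 1 / Suc j)) om"
  proof eventually_elim
   case (elim k)
   then obtain s where s: "s : permutation_mats (n k)" "nm2 (P k - s) < 1 / Suc J" by blast
   have "nm2 (P k - s) < 1 / Suc j" if "j <= J" for j
    using s(2) that frac_le[of 1 1 "Suc j" "Suc J"] by simp
   thus ?case using s(1) by blast
  qed
 qed blast
 have sb: "s : bounded_mat_seqs n" unfolding bounded_mat_seqs_iff using op_bdd_permutation[OF s(1)] by blast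
 have "((%k. nm2 (P k - s k)) \<longlongrightarrow> 0) om"
  unfolding tendsto_norm2_zero_iff[of P n s, OF Pc permutation_mats_carrier[OF s(1)]]
 proof (intro allI impI)
  fix e :: real assume "0 < e"
  then obtain j where j: "1 / Suc j < e" using reals_Archimedean by (metis inverse_eq_divide)
  show "eventually (%k. nm2 (P k - s k) < e) om" using s(2)[of j] by eventually_elim (use j in linarith)
 qed
 hence "extension (gns_rep A p) = up_class om n s" unfolding P(3) by (rule up_class_eqI[OF P(1) sb])
 thus ?thesis using sb s(1) by (auto simp: ultraproduct_subset_def)
qed

text \<open>The diagonal parts of the matrices \<open>P k\<close> keep their norm bound, since it
  bounds each entry, and among diagonal matrices they are closest to \<open>P k\<close> in
  2-norm.\<close>

lemma extension_diagonal:
 assumes T: "T : rmod"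
  and near: "!!ep. 0 < ep ==> EX a y. (a, y) : R & Hi.nm (Hi.sb (T vac) (dvec a)) < ep \<and>
   (ALL k. y k : diagonal_mats (n k))"
 shows "extension T : ultraproduct_subset om n (%k. diagonal_mats (n k))"
proof -
 define P where "P = class_rep (extension T)"
 have P: "P : bounded_mat_seqs n" "approx P (T vac)" "extension T = up_class om n P"
  using extension_rep(2-4)[OF T] by (auto simp: P_def)
 have T1: "T vac : Hs" by (simp add: bopD(1)[OF rmodD(1)[OF T]])
 note Pc = bounded_mat_seqs_carrier[OF P(1)]
 obtain C where C: "1 <= C" "!!k. op_bdd (n k) C (P k)" by (rule bounded_mat_seqsE[OF P(1)]) blast
 define s where "s k = mat (n k) (n k) (%(i, j). if i = j then P k $$ (i, j) else 0)" for k
 have s: "s k : diagonal_mats (n k)" "s k : MT (n k)" for k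
  by (auto simp: diagonal_mats_def diagonal_mat_def s_def)
 have "op_bdd (n k) C (s k)" for k
 proof -
  have "mv (n k) (s k) v i = P k $$ (i, i) * v i" if i: "i < n k" for v i
  proof -
   have "mv (n k) (s k) v i = (\<Sum>j<n k. if j = i then P k $$ (i, i) * v i else 0)"
    unfolding mv_def by (intro sum.cong refl) (use i in \<open>auto simp: s_def\<close>)
   thus ?thesis using i by simp
  qed
  hence "vn (n k) (mv (n k) (s k) v) <= (\<Sum>i<n k. C^2 * (cmod (v i))^2)" for v
   unfolding vn_def
   by (intro sum_mono) (auto simp: norm_mult power_mult_distrib intro!: mult_right_mono power_mono op_bdd_entry[OF C(2)])
  thus ?thesis using s C(1) by (simp add: op_bdd_def vn_def sum_distrib_left)
 qed
 hence sb: "s : bounded_mat_seqs n" unfolding bounded_mat_seqs_iff by blast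
 have "((%k. nm2 (P k - s k)) \<longlongrightarrow> 0) om"
  unfolding tendsto_norm2_zero_iff[of P n s, OF Pc s(2)]
 proof (intro allI impI)
  fix e :: real assume e: "0 < e"
  obtain a y where a: "(a, y) : R" "Hi.nm (Hi.sb (T vac) (dvec a)) < e / 3" "!!k. y k : diagonal_mats (n k)"
   using near[of "e / 3"] e by auto
  have "eventually (%k. nm2 (P k - y k) < e) om" using approx_near[OF P(2) T1 a(1), of "e / 3"] a(2) e by simp
  thus "eventually (%k. nm2 (P k - s k) < e) om"
  proof eventually_elim
   case (elim k)
   have "nm2 (P k - s k) <= nm2 (P k - y k)"
   proof (rule mat_norm2_mono[of _ "n k"])
    fix i j assume ij: "i < n k" "j < n k"
    have "i ~= j ==> y k $$ (i, j) = 0" using a(3)[of k] ij by (auto simp: diagonal_mats_def diagonal_mat_def)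
    thus "cmod ((P k - s k) $$ (i, j)) <= cmod ((P k - y k) $$ (i, j))"
     using ij R_mat[OF a(1), of k] Pc[of k] by (cases "i = j") (auto simp: s_def)
   qed (use R_mat[OF a(1), of k] s in \<open>auto intro!: minus_carrier_mat\<close>)
   thus ?case using elim by linarith
  qed
 qed
 hence "extension T = up_class om n s" unfolding P(3) by (rule up_class_eqI[OF P(1) sb])
 thus ?thesis using sb s(1) by (auto simp: ultraproduct_subset_def)
qed

end

section \<open>Functions of operators\<close>

lemma ennreal_lin:
 "0 <= u ==> 0 <= v ==> 0 <= w ==> 0 <= z ==>
  ennreal (u * v + w * z) = ennreal u * ennreal v + ennreal w * ennreal z"
 by (simp add: ennreal_mult)

text \<open>Removes the factor 1 + t that the triangle inequality for squared norms introduces, by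
  letting \<open>t\<close> tend to 0.\<close>

lemma ennreal_le_if_perturbed:
 fixes a b :: ennreal
 assumes "!!t :: real. 0 < t ==> a <= ennreal (1 + t) * b" shows "a <= b"
proof (rule ennreal_le_epsilon)
 fix e :: real assume b: "b < Orderings.top_class.top" and e: "0 < e"
 obtain r where r: "b = ennreal r" "0 <= r" using b by (cases b rule: ennreal_cases) auto
 define t where "t = e / (r + 1)"
 have t: "0 < t" "t * r <= e" using r(2) e by (auto simp: t_def field_simps)
 have "a <= ennreal (1 + t) * b" by (rule assms[OF t(1)])
 also have "... = ennreal (r + t * r)" using t r by (simp add: ennreal_mult'[symmetric] distrib_right)
 also have "... <= ennreal (r + e)" using t r e by (intro ennreal_leI) simp
 also have "... = b + ennreal e" using r e by simp
 finally show "a <= b + ennreal e" .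
qed

lemma ennreal_zero_if_small:
 fixes a :: ennreal
 assumes "!!de :: real. 0 < de ==> a <= ennreal (K * de)" shows "a = 0"
proof -
 have "a <= 0 + ennreal e" if e: "0 < e" for e :: real
 proof -
  have "K * (e / (\<bar>K\<bar> + 1)) <= e" using e
   by (cases "0 <= K") (auto simp: field_simps mult_nonneg_nonpos intro: order.trans[of _ 0])
  moreover have "0 < e / (\<bar>K\<bar> + 1)" using e by (intro divide_pos_pos) auto
  ultimately show ?thesis using assms[of "e / (\<bar>K\<bar> + 1)"] by (auto intro: order.trans ennreal_leI)
 qed
 hence "a <= 0" by (rule ennreal_le_epsilon)
 thus ?thesis by simp
qed

context orbit_relation begin

abbreviation MR :: "('a * 'a => complex) set" where "MR == measurable_on_rel M E"
abbreviation vdist where "vdist xi a == A0.Hi.nm (A0.Hi.sb xi (A0.dvec a))"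

lemma MRI: "f : BM ==> (!!p. p ~: E ==> f p = 0) ==> f : MR"
 by (simp add: measurable_on_rel_def)

lemma MRD: "f : MR ==> f : BM" "f : MR ==> p ~: E ==> f p = 0"
 unfolding measurable_on_rel_def by blast+

lemma A0_MR: "a : carrier A0 ==> a : MR"
 using A0_meas A0_zero by (intro MRI) auto

lemma MR_diff: "f : MR ==> f' : MR ==> (%p. f p - f' p) : MR"
 by (intro MRI borel_measurable_diff) (simp_all add: MRD)

lemma MR_mult: "f : MR ==> h : BM ==> (%p. h p * f p) : MR"
 by (intro MRI borel_measurable_times) (simp_all add: MRD)

lemma MR_swap: "f : MR ==> (%(x, y). cnj (f (y, x))) : MR"
proof (rule MRI)
 assume f: "f : MR"
 have [measurable]: "f : BM" by (rule MRD[OF f])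
 have [measurable]: "cnj : borel_measurable borel" by (intro borel_measurable_continuous_onI continuous_intros)
 have "(%p. cnj (f (snd p, fst p))) : BM" by measurable
 thus "(%(x, y). cnj (f (y, x))) : BM" by (simp add: case_prod_beta')
 fix p assume "p ~: E" thus "(case p of (x, y) => cnj (f (y, x))) = 0"
  using MRD(2)[OF f] E_sym by (cases p) auto
qed

definition coln :: "('a * 'a => complex) => 'a => ennreal" where
 "coln f y = (\<Uplus>x. ennreal ((cmod (f (x, y)))^2))"

lemma qn_coln: "qn f = (\<integral>\<^sup>+y. coln f y \<partial>N)"
 by (simp add: qn_def coln_def)

lemma coln_meas [measurable]: "f : MR ==> coln f : borel_measurable N"
proof -
 assume f: "f : MR"
 have [measurable]: "f : BM" by (rule MRD[OF f])
 have "(%y. \<Uplus>x. ennreal ((cmod (f (x, y)))^2)) : borel_measurable N"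
  by (rule count_meas(2)[of "%p. ennreal ((cmod (f p))^2)"]) (auto simp: MRD(2)[OF f])
 thus ?thesis by (simp add: coln_def[abs_def])
qed

lemma qn_swap:
 assumes f: "f : MR" shows "qn (%(x, y). cnj (f (y, x))) = qn f"
proof -
 have [measurable]: "f : BM" by (rule MRD[OF f])
 show ?thesis using mass_transport[of "%p. ennreal ((cmod (f p))^2)"] MRD(2)[OF f] by (simp add: qn_def)
qed

lemma qn_mono: "(!!p. cmod (f p) <= cmod (f' p)) ==> qn f <= qn f'"
 unfolding qn_def by (intro nn_integral_mono ennreal_leI power_mono) auto

text \<open>A triangle inequality for squared norms, valid also when they are infinite; a small
  \<open>t\<close> keeps the first term almost unchanged when the second tends to 0.\<close>

lemma qn_add_le:
 assumes f: "f : MR" and f': "f' : MR" and t: "0 < (t :: real)" and h: "!!p. h p = f p + f' p"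
 shows "qn h <= ennreal (1 + t) * qn f + ennreal (1 + 1 / t) * qn f'"
proof -
 have "coln h y <= ennreal (1 + t) * coln f y + ennreal (1 + 1 / t) * coln f' y" for y
 proof -
  have "coln h y <= (\<Uplus>x. (ennreal (1 + t) * ennreal ((cmod (f (x, y)))^2)
    + ennreal (1 + 1 / t) * ennreal ((cmod (f' (x, y)))^2)))"
   unfolding coln_def
  proof (rule nn_integral_mono)
   fix x
   have "ennreal ((cmod (h (x, y)))^2) <= ennreal ((1 + t) * (cmod (f (x, y)))^2 + (1 + 1 / t) * (cmod (f' (x, y)))^2)"
    unfolding h by (intro ennreal_leI cmod_add_sq_le t)
   also have "... = ennreal (1 + t) * ennreal ((cmod (f (x, y)))^2) + ennreal (1 + 1 / t) * ennreal ((cmod (f' (x, y)))^2)"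
    using t by (intro ennreal_lin) auto
   finally show "ennreal ((cmod (h (x, y)))^2) <= ..." .
  qed
  also have "... = ennreal (1 + t) * coln f y + ennreal (1 + 1 / t) * coln f' y"
   unfolding coln_def by (simp add: nn_integral_add nn_integral_cmult)
  finally show ?thesis .
 qed
 hence "qn h <= (\<integral>\<^sup>+y. (ennreal (1 + t) * coln f y + ennreal (1 + 1 / t) * coln f' y) \<partial>N)"
  unfolding qn_coln by (intro nn_integral_mono)
 also have "... = ennreal (1 + t) * qn f + ennreal (1 + 1 / t) * qn f'"
  unfolding qn_coln using f f' by (simp add: nn_integral_add nn_integral_cmult coln_meas)
 finally show ?thesis .
qed

lemma qn_add_le2:
 assumes "f : MR" "f' : MR" "!!p. h p = f p + f' p" "qn f <= ennreal u" "qn f' <= ennreal v" "0 <= u" "0 <= v"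
 shows "qn h <= ennreal (2 * u + 2 * v)"
proof -
 have "qn h <= ennreal 2 * qn f + ennreal 2 * qn f'" using qn_add_le[of f f' 1 h] assms by simp
 also have "... <= ennreal 2 * ennreal u + ennreal 2 * ennreal v" by (intro add_mono mult_left_mono assms) simp_all
 also have "... = ennreal (2 * u + 2 * v)" using assms by (intro ennreal_lin[symmetric]) auto
 finally show ?thesis .
qed

lemma qn_zero_AE:
 assumes f: "f : MR" and 0: "qn f = 0"
 shows "AE y in N. ALL x. f (x, y) = 0" "AE x in N. ALL y. f (x, y) = 0"
proof -
 have *: "AE y in N. ALL x. f (x, y) = 0" if f: "f : MR" "qn f = 0" for f
 proof -
  have "AE y in N. coln f y = 0"
   using f(2) nn_integral_0_iff_AE[OF coln_meas[OF f(1)]] by (simp add: qn_coln)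
  thus ?thesis
  proof eventually_elim
   fix y assume "coln f y = 0"
   hence "AE x in count_space UNIV. ennreal ((cmod (f (x, y)))^2) = 0"
    unfolding coln_def by (subst (asm) nn_integral_0_iff_AE) auto
   thus "ALL x. f (x, y) = 0" by (simp add: AE_count_space)
  qed
 qed
 show "AE y in N. ALL x. f (x, y) = 0" by (rule *[OF f 0])
 show "AE x in N. ALL y. f (x, y) = 0" using *[OF MR_swap[OF f]] qn_swap[OF f] 0 by simp
qed

text \<open>The function \<open>f\<close> represents the vector \<open>xi\<close> of the completion \<open>L^2(E)\<close>.\<close>

definition repr :: "(nat => 'a * 'a => complex) set => ('a * 'a => complex) => bool" where
 "repr xi f <-> xi : A0.Hs & f : MR & (ALL a:carrier A0. qn (%p. a p - f p) = ennreal ((vdist xi a)^2))"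

lemma reprD:
 assumes "repr xi f"
 shows "xi : A0.Hs" "f : MR" "a : carrier A0 ==> qn (%p. a p - f p) = ennreal ((vdist xi a)^2)"
 using assms by (auto simp: repr_def)

lemma vdist_nonneg: "xi : A0.Hs ==> a : carrier A0 ==> 0 <= vdist xi a"
 by simp

lemma vdist_dense:
 assumes "a : carrier A0" "b : carrier A0"
 shows "vdist (A0.dvec b) a = nrm (%p. a p - b p)"
proof -
 have "vdist (A0.dvec b) a = nrm (A0.Ai.sb b a)" using assms by (simp add: A0.dense_sb)
 also have "... = nrm (A0.Ai.sb a b)" by (rule A0.Ai.nm_sb_commute[OF assms(2,1)])
 finally show ?thesis unfolding A0_sb[OF assms] .
qed

lemma vdist_triangle:
 assumes "xi : A0.Hs" "a : carrier A0" "b : carrier A0"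
 shows "vdist xi a <= vdist xi b + nrm (%p. a p - b p)"
 using A0.Hi.nm_sb_triangle[of xi "A0.dvec b" "A0.dvec a"] assms vdist_dense[OF assms(2,3)] by simp

lemma diff_A0: "a : carrier A0 ==> b : carrier A0 ==> (%p. a p - b p) : carrier A0"
 using A0.Ai.sb_closed[of a b] by (simp add: A0_sb)

lemma repr_dense: "b : carrier A0 ==> repr (A0.dvec b) b"
 unfolding repr_def using A0_MR vdist_dense norm2_qn(1)[OF diff_A0] by simp

text \<open>The distance of \<open>a\<close> to the vector and its distance to the function are both
  limits of the distances of \<open>a\<close> to the elements \<open>b i\<close>, hence
  equal.\<close>

lemma reprI_seq:
 assumes xi: "xi : A0.Hs" and f: "f : MR" and b: "!!i :: nat. b i : carrier A0"
  and lim: "(%i. vdist xi (b i)) ----> 0" "(%i. qn (%p. b i p - f p)) ----> 0"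
 shows "repr xi f"
 unfolding repr_def
proof (intro conjI ballI xi f)
 fix a assume a: "a : carrier A0"
 note m = MR_diff[OF A0_MR[OF a] A0_MR[OF b]] MR_diff[OF A0_MR[OF b] f] MR_diff[OF A0_MR[OF a] f]
  MR_diff[OF f A0_MR[OF b]]
 have "(%i. vdist (A0.dvec (b i)) a) ----> vdist xi a"
 proof (rule LIM_zero_cancel, rule tendsto_rabs_zero_cancel, rule tendsto_sandwich[OF always_eventually always_eventually tendsto_const lim(1)], safe)
  fix i
  have "\<bar>A0.Hi.nm (A0.Hi.sb (A0.dvec (b i)) (A0.dvec a)) - A0.Hi.nm (A0.Hi.sb xi (A0.dvec a))\<bar> <= vdist xi (b i)"
   using A0.Hi.nm_sb_triangle[of "A0.dvec (b i)" xi "A0.dvec a"]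
    A0.Hi.nm_sb_triangle[of xi "A0.dvec (b i)" "A0.dvec a"]
    A0.Hi.nm_sb_commute[of "A0.dvec (b i)" xi] a b xi by simp
  thus "\<bar>vdist (A0.dvec (b i)) a - vdist xi a\<bar> <= vdist xi (b i)" .
 qed simp
 hence L: "(%i. qn (%p. a p - b i p)) ----> ennreal ((vdist xi a)^2)"
  unfolding norm2_qn(1)[OF diff_A0[OF a b], symmetric] vdist_dense[OF a b, symmetric]
  by (intro tendsto_ennrealI tendsto_power)
 have c: "(%i. ennreal (1 + t) * qn (%p. a p - b i p) + ennreal (1 + 1 / t) * qn (%p. b i p - f p)) ---->
   ennreal (1 + t) * ennreal ((vdist xi a)^2) + ennreal (1 + 1 / t) * 0" for t
  by (intro tendsto_add ennreal_tendsto_cmult L lim(2)) auto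
 have c': "(%i. ennreal (1 + t) * qn (%p. a p - f p) + ennreal (1 + 1 / t) * qn (%p. b i p - f p)) ---->
   ennreal (1 + t) * qn (%p. a p - f p) + ennreal (1 + 1 / t) * 0" for t
  by (intro tendsto_add ennreal_tendsto_cmult tendsto_const lim(2)) auto
 show "qn (%p. a p - f p) = ennreal ((vdist xi a)^2)"
 proof (rule antisym)
  show "qn (%p. a p - f p) <= ennreal ((vdist xi a)^2)"
  proof (rule ennreal_le_if_perturbed)
   fix t :: real assume t: "0 < t"
   have "qn (%p. a p - f p) <= ennreal (1 + t) * ennreal ((vdist xi a)^2) + ennreal (1 + 1 / t) * 0"
    by (rule LIMSEQ_le_const[OF c], intro exI allI impI, rule qn_add_le[OF m(1,2) t]) simp
   thus "qn (%p. a p - f p) <= ennreal (1 + t) * ennreal ((vdist xi a)^2)" by simp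
  qed
  show "ennreal ((vdist xi a)^2) <= qn (%p. a p - f p)"
  proof (rule ennreal_le_if_perturbed)
   fix t :: real assume t: "0 < t"
   have "qn (%p. a p - b i p) <= ennreal (1 + t) * qn (%p. a p - f p) + ennreal (1 + 1 / t) * qn (%p. f p - b i p)" for i
    by (rule qn_add_le[OF m(3,4) t]) simp
   moreover have "qn (%p. f p - b i p) = qn (%p. b i p - f p)" for i
    unfolding qn_def by (simp add: norm_minus_commute)
   ultimately have "ennreal ((vdist xi a)^2) <= ennreal (1 + t) * qn (%p. a p - f p) + ennreal (1 + 1 / t) * 0"
    by (intro LIMSEQ_le[OF L c']) auto
   thus "ennreal ((vdist xi a)^2) <= ennreal (1 + t) * qn (%p. a p - f p)" by simp
  qed
 qed
qed

lemma reprI: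
 assumes xi: "xi : A0.Hs" and f: "f : MR"
  and ex: "!!ep. 0 < ep ==> EX b:carrier A0. vdist xi b <= ep & qn (%p. b p - f p) <= ennreal ep"
 shows "repr xi f"
proof -
 have "EX b. b : carrier A0 & vdist xi b <= 1 / Suc i & qn (%p. b p - f p) <= ennreal (1 / Suc i)" for i :: nat
  using ex[of "1 / Suc i"] by auto
 hence "ALL i :: nat. EX b. b : carrier A0 & vdist xi b <= 1 / Suc i & qn (%p. b p - f p) <= ennreal (1 / Suc i)" ..
 from choice[OF this] obtain b where
  b: "ALL i :: nat. b i : carrier A0 & vdist xi (b i) <= 1 / Suc i & qn (%p. b i p - f p) <= ennreal (1 / Suc i)" by (elim exE)
 have z: "(%i. 1 / real (Suc i)) ----> 0" using LIMSEQ_inverse_real_of_nat by (simp add: inverse_eq_divide)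
 show ?thesis
 proof (rule reprI_seq[OF xi f])
  show "b i : carrier A0" for i using b by blast
  show "(%i. vdist xi (b i)) ----> 0"
   by (rule tendsto_sandwich[OF always_eventually always_eventually tendsto_const z]) (use b xi in auto)
  show "(%i. qn (%p. b i p - f p)) ----> 0"
   by (rule tendsto_sandwich[OF always_eventually always_eventually tendsto_const tendsto_ennrealI[OF z, unfolded ennreal_0]])
    (use b in auto)
 qed
qed

lemma repr_approx:
 assumes "repr xi f" "0 < ep"
 shows "EX a:carrier A0. vdist xi a < ep & qn (%p. a p - f p) <= ennreal (ep^2)"
proof -
 obtain a where a: "a : carrier A0" "vdist xi a < ep" using A0.gns_dense[OF reprD(1)[OF assms(1)] assms(2)] by blast
 have "qn (%p. a p - f p) <= ennreal (ep^2)"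
  unfolding reprD(3)[OF assms(1) a(1)] using a(2) vdist_nonneg[OF reprD(1)[OF assms(1)] a(1)]
  by (intro ennreal_leI power_mono) auto
 thus ?thesis using a by blast
qed

lemma repr_norm: assumes r: "repr xi f" shows "qn f = ennreal ((A0.Hi.nm xi)^2)"
proof -
 let ?z = "%p. 0 :: complex"
 have z: "?z : carrier A0" using zero_A0 by (simp add: A0_sel)
 note xi = reprD(1)[OF r]
 have nz: "A0.Hi.nm (A0.dvec ?z) = 0" using norm2_qn[OF z] z by (simp add: qn_def)
 have "vdist xi ?z = A0.Hi.nm xi"
 proof (rule antisym)
  show "vdist xi ?z <= A0.Hi.nm xi"
   using A0.Hi.nm_diff_abs[of xi "A0.Hi.sb xi (A0.dvec ?z)"] xi z nz
    A0.Hi.nm_cong[of "A0.Hi.sb xi (A0.Hi.sb xi (A0.dvec ?z))" "A0.dvec ?z"]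
   by (auto simp: A0.Hi.nm_add)
  show "A0.Hi.nm xi <= vdist xi ?z" using A0.Hi.nm_le_sb[of xi "A0.dvec ?z"] xi z nz by simp
 qed
 moreover have "qn (%p. ?z p - f p) = qn f" by (simp add: qn_def)
 ultimately show ?thesis using reprD(3)[OF r z] by simp
qed

lemma qn_count_space:
 assumes "f : MR"
 shows "(\<integral>\<^sup>+x. (\<integral>\<^sup>+y. ennreal ((cmod (f (y, x)))^2) \<partial>count_space (space M)) \<partial>N) = qn f"
 unfolding qn_def
 by (intro nn_integral_cong nn_integral_count_space_eq) (use MRD(2)[OF assms] E_space in force)+

text \<open>\<open>is_function_of\<close> quantifies over all sequences in the class of the vector;
  the distances to elements of the algebra carry the same information independently of
  representatives.\<close>

lemma function_iff_repr:
 assumes xi: "T (gns_unit A0) : A0.Hs"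
 shows "is_function_of M E T f <-> repr (T (gns_unit A0)) f"
proof -
 obtain x where x: "x : gns_cauchy A0" "T (gns_unit A0) = gns_vec A0 x" using xi by (auto simp: A0.gns_carrier)
 have eq: "(\<integral>\<^sup>+s. (\<integral>\<^sup>+y. ennreal ((cmod (a n (y, s) - f (y, s)))^2) \<partial>count_space (space M)) \<partial>N) = qn (%p. a n p - f p)"
  if "f : MR" "a : gns_cauchy A0" for a n
  using qn_count_space[OF MR_diff[OF A0_MR[OF A0.gns_cauchyD[OF that(2)]] that(1)]] .
 show ?thesis
 proof
  assume f: "is_function_of M E T f"
  hence "f : MR" by (simp add: is_function_of_def)
  moreover have "(%n. qn (%p. x n p - f p)) ----> 0"
   using f A0.gns_vec_self[OF x(1)] unfolding is_function_of_def x(2) eq[OF \<open>f : MR\<close> x(1), symmetric] by blast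
  ultimately show "repr (T (gns_unit A0)) f"
   using A0.gns_approx[OF x(1)] A0.gns_cauchyD[OF x(1)] xi unfolding x(2) by (intro reprI_seq[of _ f x])
 next
  assume r: "repr (T (gns_unit A0)) f"
  have "(%n. qn (%p. a n p - f p)) ----> 0" if "a : T (gns_unit A0)" for a
  proof -
   have a: "a : gns_cauchy A0" "gns_vec A0 a = gns_vec A0 x"
    using that x A0.gns_vec_iff[OF x(1)] A0.gns_vec_eq_iff[OF x(1), of a] by (auto simp: A0.gns_cauchyD)
   have "(%n. ennreal ((vdist (T (gns_unit A0)) (a n))^2)) ----> ennreal (0^2)"
    using A0.gns_approx[OF a(1)] unfolding x(2) a(2) by (intro tendsto_ennrealI tendsto_power)
   thus ?thesis unfolding reprD(3)[OF r A0.gns_cauchyD[OF a(1)]] by simp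
  qed
  moreover have "a : gns_cauchy A0" if "a : T (gns_unit A0)" for a
   using that x A0.gns_vec_iff[OF x(1)] by auto
  ultimately show "is_function_of M E T f" using reprD(2)[OF r] by (simp add: is_function_of_def eq)
 qed
qed

text \<open>The Riesz-Fischer argument: a fast Cauchy sequence converges pointwise in almost every
  column, and Fatou's lemma bounds its distance to the limit.\<close>

lemma repr_ex: assumes xi: "xi : A0.Hs" shows "EX f. repr xi f"
proof -
 have "EX a:carrier A0. vdist xi a < (1 / 2) ^ Suc i" for i :: nat by (rule A0.gns_dense[OF xi]) simp
 then obtain a where a: "!!i. a i : carrier A0" "!!i. vdist xi (a i) < (1 / 2) ^ Suc i" by metis
 have d: "qn (%p. a i p - a j p) <= ennreal ((1 / 4) ^ i)" if "i <= j" for i j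
 proof -
  have "nrm (%p. a i p - a j p) <= vdist xi (a j) + vdist xi (a i)"
   using A0.Hi.nm_sb_triangle[of "A0.dvec (a j)" xi "A0.dvec (a i)"] vdist_dense[OF a(1)[of i] a(1)[of j]]
    A0.Hi.nm_sb_commute[of "A0.dvec (a j)" xi] a(1) xi by simp
  also have "... <= (1 / 2) ^ Suc j + (1 / 2) ^ Suc i" using a(2)[of i] a(2)[of j] by linarith
  also have "... <= (1 / 2) ^ Suc i + (1 / 2) ^ Suc i" using that by (intro add_right_mono power_decreasing) auto
  finally have "nrm (%p. a i p - a j p) <= (1 / 2) ^ i" by simp
  hence "(nrm (%p. a i p - a j p))^2 <= ((1 / 2) ^ i)^2" using norm2_qn(2)[OF diff_A0[OF a(1) a(1)]] by (intro power_mono) auto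
  also have "... = (1 / 4) ^ i" unfolding power_mult[symmetric] mult.commute[of i] unfolding power_mult by (simp add: power2_eq_square)
  finally show ?thesis unfolding norm2_qn(1)[OF diff_A0[OF a(1) a(1)], symmetric] by (rule ennreal_leI)
 qed
 define De where "De i p = a i p - a (Suc i) p" for i p
 have De: "De i : MR" for i unfolding De_def by (intro MR_diff A0_MR a)
 \<comment> \<open>Where the sequence diverges this is an unspecified value; that concerns only a
   null set of columns.\<close>
 define f where "f p = lim (%i. a i p)" for p
 have am [measurable]: "a i : BM" for i by (rule A0_meas[OF a(1)])
 have f: "f : MR"
 proof (rule MRI)
  show "f : BM" unfolding f_def[abs_def] by measurable
  show "f p = 0" if "p ~: E" for p using A0_zero[OF a(1) that] by (simp add: f_def)
 qed
 \<comment> \<open>The increments have squared norms at most 4^-i, so the weights 2^i leave a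
   convergent series. A finite value of \<open>S y\<close> forces geometric decay of the increments
   at every point of column \<open>y\<close>.\<close>
 define S where "S y = (\<Sum>i. ennreal (2 ^ i) * coln (De i) y)" for y
 have Sm: "S : borel_measurable N" unfolding S_def using coln_meas[OF De] by measurable
 have "(\<integral>\<^sup>+y. S y \<partial>N) = (\<Sum>i. ennreal (2 ^ i) * qn (De i))"
  unfolding S_def qn_coln using coln_meas[OF De] by (simp add: nn_integral_suminf nn_integral_cmult)
 also have "... <= (\<Sum>i. ennreal ((1 / 2) ^ i))"
 proof (rule suminf_le)
  fix i
  have "ennreal (2 ^ i) * qn (De i) <= ennreal (2 ^ i) * ennreal ((1 / 4) ^ i)"
   using d[of i "Suc i"] by (intro mult_left_mono) (auto simp: De_def[abs_def])
  also have "... = ennreal (2 ^ i * (1 / 4) ^ i)" by (rule ennreal_mult[symmetric]) auto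
  also have "2 ^ i * (1 / 4) ^ i = (1 / 2 :: real) ^ i"
   by (subst power_mult_distrib[symmetric], rule arg_cong[of _ _ "%t. t ^ i"]) simp
  finally show "ennreal (2 ^ i) * qn (De i) <= ennreal ((1 / 2) ^ i)" .
 qed auto
 also have "... = ennreal (\<Sum>i. (1 / 2) ^ i)" by (rule suminf_ennreal2) (auto intro: summable_geometric)
 also have "... < \<infinity>" by simp
 finally have "AE y in N. S y ~= \<infinity>" by (intro nn_integral_noteq_infinite Sm) auto
 hence lim: "AE y in N. ALL x. (%i. a i (x, y)) ----> f (x, y)"
 proof eventually_elim
  fix y assume "S y ~= \<infinity>"
  then obtain s where s: "S y = ennreal s" "0 <= s" by (cases "S y" rule: ennreal_cases) auto
  show "ALL x. (%i. a i (x, y)) ----> f (x, y)"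
  proof
   fix x
   have "cmod (De i (x, y)) <= sqrt s * (sqrt (1 / 2)) ^ i" for i
   proof -
    have "ennreal ((cmod (De i (x, y)))^2) = (\<Uplus>z. ennreal ((cmod (De i (z, y)))^2) * indicator {x} z)"
     by simp
    also have "... <= coln (De i) y" unfolding coln_def by (intro nn_integral_mono) (auto split: split_indicator)
    finally have "ennreal (2 ^ i) * ennreal ((cmod (De i (x, y)))^2) <= ennreal (2 ^ i) * coln (De i) y"
     by (intro mult_left_mono) auto
    also have "... <= S y" unfolding S_def
     using sum_le_suminf[of "%i. ennreal (2 ^ i) * coln (De i) y" "{i}"] by (simp add: summableI)
    finally have "2 ^ i * (cmod (De i (x, y)))^2 <= s" using s by (simp add: ennreal_mult[symmetric])
    hence "(cmod (De i (x, y)))^2 <= s * (1 / 2) ^ i" by (simp add: field_simps power_one_over)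
    also have "... = (sqrt s * (sqrt (1 / 2)) ^ i)^2"
     unfolding power_mult_distrib power_mult[symmetric] mult.commute[of i] unfolding power_mult using s(2) by simp
    finally show ?thesis by (rule power2_le_imp_le) (use s in simp)
   qed
   moreover have "summable (%i. sqrt s * (sqrt (1 / 2)) ^ i)"
    by (intro summable_mult summable_geometric) (simp add: real_sqrt_divide)
   ultimately have "summable (%i. De i (x, y))" by (rule summable_comparison_test'[of _ 0, rotated])
   hence "convergent (%n. \<Sum>i<n. De i (x, y))" by (simp add: summable_iff_convergent)
   moreover have "(\<Sum>i<n. De i (x, y)) = a 0 (x, y) - a n (x, y)" for n
    unfolding De_def by (induction n) auto
   ultimately have "convergent (%n. a 0 (x, y) - a n (x, y))" by simp
   from convergent_diff[OF convergent_const[of "a 0 (x, y)"] this]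
   have "convergent (%n. a n (x, y))" by simp
   thus "(%i. a i (x, y)) ----> f (x, y)" unfolding f_def by (simp add: convergent_LIMSEQ_iff)
  qed
 qed
 have bound: "qn (%p. a k p - f p) <= ennreal ((1 / 4) ^ k)" for k
 proof -
  have "qn (%p. a k p - f p) = (\<integral>\<^sup>+y. coln (%p. a k p - f p) y \<partial>N)" by (rule qn_coln)
  also have "... <= (\<integral>\<^sup>+y. liminf (%i. coln (%p. a k p - a i p) y) \<partial>N)"
  proof (rule nn_integral_mono_AE, use lim in eventually_elim)
   fix y assume l: "ALL x. (%i. a i (x, y)) ----> f (x, y)"
   have "coln (%p. a k p - f p) y = (\<Uplus>x. liminf (%i. ennreal ((cmod (a k (x, y) - a i (x, y)))^2)))"
    unfolding coln_def
   proof (rule nn_integral_cong)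
    fix x
    have "(%i. ennreal ((cmod (a k (x, y) - a i (x, y)))^2)) ----> ennreal ((cmod (a k (x, y) - f (x, y)))^2)"
     using l by (intro tendsto_intros tendsto_ennrealI) auto
    thus "ennreal ((cmod (a k (x, y) - f (x, y)))^2) = liminf (%i. ennreal ((cmod (a k (x, y) - a i (x, y)))^2))"
     by (rule lim_imp_Liminf[OF sequentially_bot, symmetric])
   qed
   also have "... <= liminf (%i. coln (%p. a k p - a i p) y)"
    unfolding coln_def by (rule nn_integral_liminf) simp
   finally show "coln (%p. a k p - f p) y <= liminf (%i. coln (%p. a k p - a i p) y)" .
  qed
  also have "... <= liminf (%i. \<integral>\<^sup>+y. coln (%p. a k p - a i p) y \<partial>N)"
   by (rule nn_integral_liminf) (intro coln_meas MR_diff A0_MR a)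
  also have "... <= ennreal ((1 / 4) ^ k)"
   unfolding qn_coln[symmetric] by (rule Liminf_le) (auto intro: eventually_sequentiallyI[of k] d)
  finally show ?thesis .
 qed
 have "repr xi f"
 proof (rule reprI_seq[OF xi f a(1)])
  have z: "(%i. (1 / 2 :: real) ^ Suc i) ----> 0" by (rule LIMSEQ_Suc) (simp add: LIMSEQ_power_zero)
  show "(%i. vdist xi (a i)) ----> 0"
   by (rule tendsto_sandwich[OF always_eventually always_eventually tendsto_const z])
    (use a xi less_imp_le[OF a(2)] in auto)
  have z4: "(%i. (1 / 4 :: real) ^ i) ----> 0" by (simp add: LIMSEQ_power_zero)
  show "(%i. qn (%p. a i p - f p)) ----> 0"
   by (rule tendsto_sandwich[OF always_eventually always_eventually tendsto_const tendsto_ennrealI[OF z4, unfolded ennreal_0]])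
    (use bound in auto)
 qed
 thus ?thesis by blast
qed

end

section \<open>Diagonal functions, adjoints and isometries acting on functions\<close>

context orbit_relation begin

text \<open>The group is countable and its elements preserve null sets.\<close>

lemma AE_act:
 assumes "AE x in N. P x" shows "AE x in N. ALL w:FG. P (act w x)"
proof -
 have "AE x in N. P (act (fw i) x)" for i
 proof (rule AE_distrD[OF act_meas[OF fw_FG]])
  show "AE x in distr N N (act (fw i)). P x" unfolding act_distr[OF fw_FG] by (rule assms)
 qed
 hence "AE x in N. ALL i. P (act (fw i) x)" by (simp add: AE_all_countable)
 thus ?thesis
 proof eventually_elim
  fix x assume "ALL i. P (act (fw i) x)"
  hence "ALL w:range fw. P (act w x)" by blast
  thus "ALL w:FG. P (act w x)" unfolding range_fw .
 qed
qed

lemma qn_mult_le: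
 assumes f: "f : MR" and k: "!!p. cmod (k p) <= C * cmod (f p)" and C: "0 <= C"
 shows "qn k <= ennreal (C^2) * qn f"
proof -
 have "qn k <= (\<integral>\<^sup>+y. (\<Uplus>x. ennreal (C^2) * ennreal ((cmod (f (x, y)))^2)) \<partial>N)"
  unfolding qn_def
 proof (intro nn_integral_mono)
  fix y x
  have "(cmod (k (x, y)))^2 <= (C * cmod (f (x, y)))^2" by (intro power_mono k) simp
  hence "ennreal ((cmod (k (x, y)))^2) <= ennreal (C^2 * (cmod (f (x, y)))^2)"
   by (simp add: power_mult_distrib ennreal_leI)
  thus "ennreal ((cmod (k (x, y)))^2) <= ennreal (C^2) * ennreal ((cmod (f (x, y)))^2)"
   by (simp add: ennreal_mult)
 qed
 also have "... = (\<integral>\<^sup>+y. ennreal (C^2) * coln f y \<partial>N)"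
  unfolding coln_def by (intro nn_integral_cong nn_integral_cmult) simp
 also have "... = ennreal (C^2) * qn f"
  unfolding qn_coln by (rule nn_integral_cmult) (rule coln_meas[OF f])
 finally show ?thesis .
qed

lemma MR_add: "f : MR ==> f' : MR ==> (%p. f p + f' p) : MR"
 by (intro MRI borel_measurable_add) (simp_all add: MRD)

definition dg :: "('a => complex) => 'a * 'a => complex" where
 "dg k = (%(x, y). if x : space M & x = y then k x else 0)"

lemma dg_MR: assumes [measurable]: "k : borel_measurable N" shows "dg k : MR"
proof (rule MRI)
 have [measurable]: "Measurable.pred (N \<Otimes>\<^sub>M N) (%p. fst p = snd p)" by (rule eq_meas) measurable
 have "(%p. if fst p = snd p then k (fst p) else 0) : BM" by measurable
 also have "?this <-> dg k : BM"
  by (rule measurable_cong) (auto simp: dg_def space_pair_measure)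
 finally show "dg k : BM" .
 show "dg k p = 0" if "p ~: E" for p using that E_refl by (cases p) (auto simp: dg_def)
qed

lemma dg_A0:
 assumes k: "k : borel_measurable N" and C: "!!x. cmod (k x) <= C" shows "dg k : carrier A0"
proof (rule A0I[of _ C 1])
 show "dg k p = 0" if "p ~: E" for p
  using MRD(2)[OF dg_MR[OF k] that] .
 show "dg k : BM" using MRD[OF dg_MR[OF k]] by blast
 show "cmod (dg k p) <= C" for p
  using C[of "fst p"] order.trans[OF norm_ge_zero C] by (cases p) (auto simp: dg_def)
 fix x
 have sub: "rs (dg k) x <= {x}" "cs (dg k) x <= {x}" by (auto simp: rs_def cs_def dg_def split: if_splits)
 show "finite (rs (dg k) x) & card (rs (dg k) x) <= 1" "finite (cs (dg k) x) & card (cs (dg k) x) <= 1"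
  using card_mono[OF _ sub(1)] card_mono[OF _ sub(2)] finite_subset[OF sub(1)] finite_subset[OF sub(2)] by simp_all
qed

lemma dg_mult:
 assumes a: "a : carrier A0"
 shows "dg k \<star> a = (%p. k (fst p) * a p)" "a \<star> dg k = (%p. a p * k (snd p))"
proof -
 have a0: "a (x, y) = 0" if "x ~: space M \<or> y ~: space M" for x y
  using A0_zero[OF a, of "(x, y)"] E_space that by blast
 show "dg k \<star> a = (%p. k (fst p) * a p)"
 proof
  fix p :: "'a * 'a"
  obtain x y where p: "p = (x, y)" by (cases p)
  have "(dg k \<star> a) (x, y) = (\<Sum>z\<in>{x}. dg k (x, z) * a (z, y))"
   by (rule A0_mult_rows) (auto simp: rs_def dg_def split: if_splits)
  thus "(dg k \<star> a) p = k (fst p) * a p" using a0 by (auto simp: p dg_def)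
 qed
 show "a \<star> dg k = (%p. a p * k (snd p))"
 proof
  fix p :: "'a * 'a"
  obtain x y where p: "p = (x, y)" by (cases p)
  have "(a \<star> dg k) (x, y) = (\<Sum>z\<in>{y}. a (x, z) * dg k (z, y))"
   by (rule A0_mult_cols) (use A0_fin[OF a] in \<open>auto simp: cs_def dg_def split: if_splits\<close>)
  thus "(a \<star> dg k) p = a p * k (snd p)" using a0 by (auto simp: p dg_def)
 qed
qed

lemma qn_diag:
 assumes "!!p. f p ~= 0 ==> fst p = snd p"
 shows "qn f = (\<integral>\<^sup>+y. ennreal ((cmod (f (y, y)))^2) \<partial>N)"
 unfolding qn_def
proof (rule nn_integral_cong)
 fix y
 have "(\<Uplus>x. ennreal ((cmod (f (x, y)))^2)) = ennreal (\<Sum>x\<in>{y}. (cmod (f (x, y)))^2)"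
  by (rule nn_integral_count_space_finite_support) (use assms in force)+
 thus "(\<Uplus>x. ennreal ((cmod (f (x, y)))^2)) = ennreal ((cmod (f (y, y)))^2)" by simp
qed

text \<open>Restricting an approximant to the diagonal discards only its values where
  \<open>f\<close> vanishes, so the distance does not grow. The restriction is bounded, although
  \<open>f\<close> is not known to be.\<close>

lemma repr_diag_approx:
 assumes r: "repr xi f" and diag: "!!p. f p ~= 0 ==> fst p = snd p" and ep: "0 < ep"
 shows "EX k C. k : borel_measurable N & (ALL y. cmod (k y) <= C) & vdist xi (dg k) < ep"
proof -
 obtain a where a: "a : carrier A0" "vdist xi a < ep / 2" "qn (%p. a p - f p) <= ennreal ((ep / 2)^2)"
  using repr_approx[OF r half_gt_zero[OF ep]] by blast
 obtain C m where C: "1 <= C" "!!p. cmod (a p) <= C" "!!x. card (rs a x) <= m" "!!x. card (cs a x) <= m" by (rule A0E[OF a(1)]) blast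
 define k where "k y = a (y, y)" for y
 have [measurable]: "a : BM" by (rule A0_meas[OF a(1)])
 have km: "k : borel_measurable N" unfolding k_def by measurable
 have kb: "cmod (k y) <= C" for y by (simp add: k_def C)
 note dk = dg_A0[OF km kb]
 have "cmod (dg k p - f p) <= cmod (a p - f p)" for p
 proof (cases "fst p = snd p")
  case True
  hence "dg k p = a p" using A0_zero[OF a(1), of p] E_space by (cases p) (auto simp: dg_def k_def)
  thus ?thesis by simp
 next
  case False
  hence "f p = 0" using diag by blast
  thus ?thesis using False by (cases p) (auto simp: dg_def)
 qed
 hence "qn (%p. dg k p - f p) <= qn (%p. a p - f p)" by (rule qn_mono)
 from order.trans[OF this a(3)] have "ennreal ((vdist xi (dg k))^2) <= ennreal ((ep / 2)^2)"
  unfolding reprD(3)[OF r dk] .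
 hence "(vdist xi (dg k))^2 <= (ep / 2)^2" by simp
 hence "vdist xi (dg k) <= ep / 2" by (rule power2_le_imp_le) (use ep in simp)
 hence "vdist xi (dg k) < ep" using ep by simp
 thus ?thesis using km kb by blast
qed

lemma vdist_mult:
 assumes T: "T : A0.rmod" and b: "b : carrier A0"
 shows "EX K>0. ALL a:carrier A0.
  vdist (T (A0.dvec b)) (a \<star> b) <= K * vdist (T A0.vac) a"
proof -
 obtain K where K: "0 < K" "!!c. c : carrier A0 ==> nrm (c \<star> star A0 b) <= K * nrm c"
  by (rule A0.right_bddE[OF A0.star_closed[OF b]]) blast
 have "vdist (T (A0.dvec b)) (a \<star> b) <= K * vdist (T A0.vac) a" if a: "a : carrier A0" for a
 proof (rule A0.rmod_mult_close[OF T a b subset_refl])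
  show "EX w:carrier A0. nrm (A0.Ai.sb c w) < ep" if "c : carrier A0" "0 < ep" for c ep
   using that by (intro bexI[of _ c]) auto
  show "0 <= K" using K(1) by simp
  show "nrm (c \<star> star A0 b) <= K * nrm c" if "c : carrier A0" for c by (rule K(2)[OF that])
 qed
 thus ?thesis using K(1) by blast
qed

text \<open>Right multiplication by a bounded diagonal function is bounded both on approximants of
  the vector and pointwise on functions, so the formula passes from the algebra to the
  limit.\<close>

lemma repr_right_dg:
 assumes T: "T : A0.rmod" and r: "repr (T A0.vac) f"
  and k: "k : borel_measurable N" and C: "!!x. cmod (k x) <= C"
 shows "repr (T (A0.dvec (dg k))) (%p. k (snd p) * f p)"
proof (rule reprI)
 note dk = dg_A0[OF k C]
 note f = reprD(2)[OF r]
 have C0: "0 <= C" using order.trans[OF norm_ge_zero C] .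
 show "T (A0.dvec (dg k)) : A0.Hs" by (rule A0.bopD(1)[OF A0.rmodD(1)[OF T] A0.dense_in[OF dk]])
 show "(%p. k (snd p) * f p) : MR"
  by (rule MR_mult[OF f]) (use k in measurable)
 fix ep :: real assume ep: "0 < ep"
 obtain K where K: "0 < K" "!!a. a : carrier A0 ==>
  vdist (T (A0.dvec (dg k))) (a \<star> dg k) <= K * vdist (T A0.vac) a"
  using vdist_mult[OF T dk] by blast
 define L where "L = K + C^2"
 have L: "0 < L" "K <= L" "C^2 <= L" using K(1) by (auto simp: L_def add_pos_nonneg)
 define de where "de = min 1 (ep / L)"
 have de: "0 < de" "de <= 1" "L * de <= ep" using ep L by (auto simp: de_def min_def field_simps)
 obtain a where a: "a : carrier A0" "vdist (T A0.vac) a < de" "qn (%p. a p - f p) <= ennreal (de^2)"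
  using repr_approx[OF r de(1)] by blast
 show "EX b:carrier A0. vdist (T (A0.dvec (dg k))) b <= ep & qn (%p. b p - k (snd p) * f p) <= ennreal ep"
 proof (intro bexI[of _ "a \<star> dg k"] conjI mult_A0 a dk)
  have "vdist (T (A0.dvec (dg k))) (a \<star> dg k) <= K * vdist (T A0.vac) a" by (rule K(2)[OF a(1)])
  also have "... <= K * de" using a(2) K(1) by (intro mult_left_mono) auto
  also have "... <= L * de" using L de by (intro mult_right_mono) auto
  finally show "vdist (T (A0.dvec (dg k))) (a \<star> dg k) <= ep" using de(3) by simp
  have "qn (%p. (a \<star> dg k) p - k (snd p) * f p) <= ennreal (C^2) * qn (%p. a p - f p)"
  proof (rule qn_mult_le[OF MR_diff[OF A0_MR[OF a(1)] f] _ C0])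
   fix p
   have "(a \<star> dg k) p - k (snd p) * f p = k (snd p) * (a p - f p)"
    by (simp add: dg_mult(2)[OF a(1)] algebra_simps)
   thus "cmod ((a \<star> dg k) p - k (snd p) * f p) <= C * cmod (a p - f p)"
    by (simp add: norm_mult mult_right_mono C)
  qed
  also have "... <= ennreal (C^2) * ennreal (de^2)" by (intro mult_left_mono a(3)) simp
  also have "... = ennreal (C^2 * de^2)" by (simp add: ennreal_mult)
  also have "... <= ennreal ep"
  proof (rule ennreal_leI)
   have "C^2 * de^2 <= C^2 * de" using de by (intro mult_left_mono) (auto simp: power2_eq_square mult_le_cancel_left1)
   also have "... <= L * de" using L de by (intro mult_right_mono) auto
   finally show "C^2 * de^2 <= ep" using de(3) by simp
  qed
  finally show "qn (%p. (a \<star> dg k) p - k (snd p) * f p) <= ennreal ep" .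
 qed
qed

text \<open>A diagonal factor on the left acts on rows, so the norm is first rewritten as an
  integral over rows by \<open>qn_swap\<close>.\<close>

lemma qn_left_mult:
 assumes a: "a : carrier A0" and C: "!!p. cmod (a p) <= C" "!!x. card (rs a x) <= m" and v: "dg v : MR"
  and u: "!!x y. cmod (u (x, y)) <= cmod (v x) * cmod (a (x, y))" and um: "u : MR"
 shows "qn u <= ennreal (C^2 * real m) * qn (dg v)"
proof -
 have C0: "0 <= C" using order.trans[OF norm_ge_zero C(1)] .
 have "qn u = qn (%(x, y). cnj (u (y, x)))" by (rule qn_swap[OF um, symmetric])
 also have "... = (\<integral>\<^sup>+x. (\<Uplus>y. ennreal ((cmod (u (x, y)))^2)) \<partial>N)" by (simp add: qn_def)
 also have "... <= (\<integral>\<^sup>+x. ennreal (C^2 * real m) * coln (dg v) x \<partial>N)"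
 proof (rule nn_integral_mono)
  fix x assume x: "x : space N"
  have "(\<Uplus>y. ennreal ((cmod (u (x, y)))^2)) = ennreal (\<Sum>y\<in>rs a x. (cmod (u (x, y)))^2)"
  proof (rule nn_integral_count_space_finite_support)
   show "finite (rs a x)" by (rule A0_fin[OF a])
   fix y assume "y ~: rs a x"
   thus "(cmod (u (x, y)))^2 = 0" using u[of x y] by (simp add: rs_def)
  qed simp
  also have "(\<Sum>y\<in>rs a x. (cmod (u (x, y)))^2) <= (\<Sum>y\<in>rs a x. C^2 * (cmod (v x))^2)"
  proof (rule sum_mono)
   fix y
   have "cmod (u (x, y)) <= cmod (v x) * C" using u[of x y] mult_left_mono[OF C(1)[of "(x, y)"], of "cmod (v x)"] by simp
   hence "(cmod (u (x, y)))^2 <= (cmod (v x) * C)^2" by (rule power_mono) simp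
   thus "(cmod (u (x, y)))^2 <= C^2 * (cmod (v x))^2" by (simp add: power_mult_distrib mult.commute)
  qed
  also have "... = real (card (rs a x)) * (C^2 * (cmod (v x))^2)" by simp
  also have "... <= real m * (C^2 * (cmod (v x))^2)" using C(2)[of x] by (intro mult_right_mono) auto
  also have "ennreal (real m * (C^2 * (cmod (v x))^2)) = ennreal (C^2 * real m) * ennreal ((cmod (v x))^2)"
   by (simp add: ennreal_mult[symmetric] mult_ac)
  also have "ennreal ((cmod (v x))^2) = coln (dg v) x"
  proof -
   have "coln (dg v) x = ennreal (\<Sum>y\<in>{x}. (cmod (dg v (y, x)))^2)"
    unfolding coln_def by (rule nn_integral_count_space_finite_support) (auto simp: dg_def)
   thus ?thesis using x by (simp add: dg_def)
  qed
  finally show "(\<Uplus>y. ennreal ((cmod (u (x, y)))^2)) <= ennreal (C^2 * real m) * coln (dg v) x"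
   by (simp add: ennreal_leI)
 qed
 also have "... = ennreal (C^2 * real m) * qn (dg v)"
  unfolding qn_coln by (rule nn_integral_cmult[OF coln_meas[OF v]])
 finally show ?thesis .
qed

text \<open>Bounded diagonal functions \<open>k\<close> approximate \<open>T vac\<close> and
  elements \<open>a\<close> approximate \<open>xi\<close>, so that \<open>F\<close> is close to k a.
  Since \<open>q\<close> is not known to be bounded at this stage, the formula is proved on the rows
  where its modulus is at most \<open>K\<close>, for every natural number \<open>K\<close>.\<close>

lemma repr_left_diag:
 assumes T: "T : A0.rmod" and r1: "repr (T A0.vac) q"
  and diag: "!!p. q p ~= 0 ==> fst p = snd p" and r: "repr xi f" and r2: "repr (T xi) F"
 shows "AE x in N. ALL y. F (x, y) = q (x, x) * f (x, y)"
proof -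
 note f = reprD(2)[OF r] note F = reprD(2)[OF r2] note xi = reprD(1)[OF r]
 note Tb = A0.rmodD(1)[OF T]
 have qm [measurable]: "q : BM" by (rule MRD[OF reprD(2)[OF r1]])
 have fm [measurable]: "f : BM" by (rule MRD[OF f])
 have Fm [measurable]: "F : BM" by (rule MRD[OF F])
 define kp where "kp K p = (if cmod (q (fst p, fst p)) <= real K then 1 else 0 :: complex)" for K and p :: "'a * 'a"
 have kpm [measurable]: "kp K : BM" for K unfolding kp_def by measurable
 define G where "G K p = kp K p * (F p - q (fst p, fst p) * f p)" for K p
 have GM: "G K : MR" for K unfolding G_def by (intro MR_mult MR_diff F f) measurable
 obtain Kb where Kb: "1 <= Kb" "!!et. et : A0.Hs ==> A0.Hi.nm (T et) <= Kb * A0.Hi.nm et" by (rule A0.bopE[OF Tb]) blast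
 have G0: "qn (G K) = 0" for K
 proof (rule ennreal_zero_if_small)
  fix et :: real assume "0 < et"
  define de where "de = min 1 et"
  have de: "0 < de" "de <= 1" "de <= et" using \<open>0 < et\<close> by (auto simp: de_def)
  obtain a where a: "a : carrier A0" "vdist xi a < de" "qn (%p. a p - f p) <= ennreal (de^2)"
   using repr_approx[OF r de(1)] by blast
  have am [measurable]: "a : BM" by (rule A0_meas[OF a(1)])
  obtain C m where C: "1 <= C" "!!p. cmod (a p) <= C" "!!x. card (rs a x) <= m" "!!x. card (cs a x) <= m" by (rule A0E[OF a(1)]) blast
  obtain Ka where Ka: "0 < Ka" "!!c. c : carrier A0 ==>
   vdist (T (A0.dvec a)) (c \<star> a) <= Ka * vdist (T A0.vac) c"
   using vdist_mult[OF T a(1)] by blast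
  \<comment> \<open>\<open>k\<close> is chosen after \<open>a\<close>: its accuracy
    \<open>de / L\<close> compensates for the norm \<open>Ka\<close> of right multiplication by
    \<open>a\<close> and for the row bound of \<open>a\<close>.\<close>
  define L where "L = Ka + C^2 * real m + 1"
  have L: "1 <= L" "Ka <= L" "C^2 * real m <= L" using Ka(1) by (auto simp: L_def)
  define de' where "de' = de / L"
  have de': "0 < de'" "L * de' = de" using de L by (auto simp: de'_def)
  obtain k C' where k: "k : borel_measurable N" "!!y. cmod (k y) <= C'" "vdist (T A0.vac) (dg k) < de'"
   using repr_diag_approx[OF r1 diag de'(1)] by blast
  note km [measurable] = k(1)
  note dk = dg_A0[OF k(1,2)]
  note ca = mult_A0[OF dk a(1)]
  have T1: "T A0.vac : A0.Hs" "T (A0.dvec a) : A0.Hs" "T xi : A0.Hs"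
   using A0.bopD(1)[OF Tb] xi a(1) one_A0 by auto
  have qd: "qn (%p. dg k p - q p) <= ennreal (de'^2)"
   unfolding reprD(3)[OF r1 dk] using k(3) vdist_nonneg[OF T1(1) dk] by (intro ennreal_leI power_mono) auto
  have "vdist (T xi) (dg k \<star> a) \<le>
    A0.Hi.nm (A0.Hi.sb (T xi) (T (A0.dvec a))) + vdist (T (A0.dvec a)) (dg k \<star> a)"
   by (rule A0.Hi.nm_sb_triangle) (use T1 ca in auto)
  also have "A0.Hi.sb (T xi) (T (A0.dvec a)) = T (A0.Hi.sb xi (A0.dvec a))"
   by (rule A0.bopD(4)[OF Tb, symmetric]) (use xi a in auto)
  also have "A0.Hi.nm (T (A0.Hi.sb xi (A0.dvec a))) <= Kb * de"
  proof (rule order.trans[OF Kb(2)])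
   show "A0.Hi.sb xi (A0.dvec a) : A0.Hs" using xi a by simp
   show "Kb * vdist xi a <= Kb * de" using a(2) Kb(1) by (intro mult_left_mono) auto
  qed
  also have "vdist (T (A0.dvec a)) (dg k \<star> a) <= L * de'"
  proof (rule order.trans[OF Ka(2)[OF dk]])
   show "Ka * vdist (T A0.vac) (dg k) <= L * de'"
    using k(3) L Ka(1) vdist_nonneg[OF T1(1) dk] by (intro mult_mono) auto
  qed
  finally have "vdist (T xi) (dg k \<star> a) <= (Kb + 1) * de" unfolding de'(2) by (simp add: algebra_simps)
  hence F1: "qn (%p. (dg k \<star> a) p - F p) <= ennreal (((Kb + 1) * de)^2)"
   unfolding reprD(3)[OF r2 ca] using vdist_nonneg[OF T1(3) ca] by (intro ennreal_leI power_mono) auto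
  have kp1: "cmod (kp K p) <= 1" for K p by (simp add: kp_def)
  \<comment> \<open>The difference F - q f is split into (F - k a) + (k - q) a + q (a - f), each
    term multiplied by the cut-off.\<close>
  let ?u1 = "%p. kp K p * (F p - k (fst p) * a p)"
  let ?u2 = "%p. kp K p * ((k (fst p) - q (fst p, fst p)) * a p)"
  let ?u3 = "%p. kp K p * (q (fst p, fst p) * (a p - f p))"
  have M1: "?u1 : MR"
  proof (intro MR_mult MR_diff F A0_MR a)
   show "(%p. k (fst p)) : BM" by measurable
  qed measurable
  have M2: "?u2 : MR"
  proof (intro MR_mult A0_MR a)
   show "(%p. k (fst p) - q (fst p, fst p)) : BM" by measurable
  qed measurable
  have M3: "?u3 : MR"
  proof (intro MR_mult MR_diff f A0_MR a)
   show "(%p. q (fst p, fst p)) : BM" by measurable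
  qed measurable
  have M23: "(%p. ?u2 p + ?u3 p) : MR"
   by (rule MR_add[OF M2 M3])
  have 1: "qn ?u1 <= ennreal (((Kb + 1) * de)^2)"
  proof (rule order.trans[OF qn_mono F1])
   fix p
   have "cmod (kp K p * (F p - k (fst p) * a p)) <= 1 * cmod (F p - k (fst p) * a p)"
    unfolding norm_mult by (rule mult_right_mono[OF kp1]) simp
   thus "cmod (kp K p * (F p - k (fst p) * a p)) <= cmod ((dg k \<star> a) p - F p)"
    by (simp add: dg_mult(1)[OF a(1)] norm_minus_commute)
  qed
  have 2: "qn ?u2 <= ennreal (de^2)"
  proof -
   let ?v = "%x. k x - q (x, x)"
   have dv: "dg ?v : MR" by (rule dg_MR) measurable
   have "qn ?u2 <= ennreal (C^2 * real m) * qn (dg ?v)"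
   proof (rule qn_left_mult[OF a(1) C(2,3) dv _ M2])
    fix x y
    have "cmod (kp K (x, y) * (?v x * a (x, y))) <= 1 * cmod (?v x * a (x, y))"
     unfolding norm_mult[of "kp K (x, y)"] by (rule mult_right_mono[OF kp1]) simp
    thus "cmod (kp K (x, y) * ((k (fst (x, y)) - q (fst (x, y), fst (x, y))) * a (x, y))) <= cmod (?v x) * cmod (a (x, y))"
     by (simp add: norm_mult)
   qed
   also have "dg ?v = (%p. dg k p - q p)"
   proof
    fix p :: "'a * 'a"
    obtain x y where p: "p = (x, y)" by (cases p)
    show "dg ?v p = dg k p - q p"
    proof (cases "x = y & x : space M")
     case False
     hence "q (x, y) = 0"
      using diag[of "(x, y)"] MRD(2)[OF reprD(2)[OF r1], of "(x, y)"] E_space by (metis fst_conv snd_conv)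
     thus ?thesis using False by (auto simp: dg_def p)
    qed (auto simp: dg_def p)
   qed
   also have "ennreal (C^2 * real m) * qn (%p. dg k p - q p) <= ennreal (C^2 * real m) * ennreal (de'^2)"
    by (intro mult_left_mono qd) simp
   also have "... = ennreal (C^2 * real m * de'^2)" by (simp add: ennreal_mult)
   also have "... <= ennreal (de^2)"
   proof (rule ennreal_leI)
    have "C^2 * real m * de'^2 <= L * de'^2" by (intro mult_right_mono L) simp
    also have "... <= L * (L * de'^2)" using L(1) by (intro mult_left_mono) (auto simp: mult_le_cancel_right1)
    also have "... = de^2" unfolding de'(2)[symmetric] by (simp add: power2_eq_square)
    finally show "C^2 * real m * de'^2 <= de^2" .
   qed
   finally show ?thesis .
  qed
  have 3: "qn ?u3 <= ennreal ((real K)^2 * de^2)"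
  proof -
   have "qn ?u3 <= ennreal ((real K)^2) * qn (%p. a p - f p)"
   proof (rule qn_mult_le[OF MR_diff[OF A0_MR[OF a(1)] f]])
    fix p
    have "cmod (kp K p) * cmod (q (fst p, fst p)) <= real K" by (simp add: kp_def)
    hence "cmod (kp K p) * cmod (q (fst p, fst p)) * cmod (a p - f p) <= real K * cmod (a p - f p)"
     by (rule mult_right_mono) simp
    thus "cmod (kp K p * (q (fst p, fst p) * (a p - f p))) <= real K * cmod (a p - f p)"
     by (simp add: norm_mult mult.assoc)
   qed simp
   also have "... <= ennreal ((real K)^2) * ennreal (de^2)" by (intro mult_left_mono a(3)) simp
   finally show ?thesis by (simp add: ennreal_mult)
  qed
  have 23: "qn (%p. ?u2 p + ?u3 p) <= ennreal (2 * de^2 + 2 * ((real K)^2 * de^2))"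
   by (rule qn_add_le2[OF M2 M3 refl 2 3]) auto
  have "qn (G K) <= ennreal (2 * ((Kb + 1) * de)^2 + 2 * (2 * de^2 + 2 * ((real K)^2 * de^2)))"
   by (rule qn_add_le2[OF M1 M23 _ 1 23]) (auto simp: G_def algebra_simps)
  also have "... = ennreal ((2 * (Kb + 1)^2 + 4 + 4 * (real K)^2) * de^2)" unfolding power_mult_distrib by (rule arg_cong[of _ _ ennreal]) (simp add: algebra_simps)
  also have "... <= ennreal ((2 * (Kb + 1)^2 + 4 + 4 * (real K)^2) * et)"
  proof (intro ennreal_leI mult_left_mono)
   have "de^2 <= 1 * de" unfolding power2_eq_square using de by (intro mult_right_mono) auto
   thus "de^2 <= et" using de(3) by simp
  qed (auto intro: add_nonneg_nonneg)
  finally show "qn (G K) <= ennreal ((2 * (Kb + 1)^2 + 4 + 4 * (real K)^2) * et)" .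
 qed
 have "AE x in N. ALL K y. G K (x, y) = 0"
  using qn_zero_AE(2)[OF GM G0] by (simp add: AE_all_countable)
 thus ?thesis
 proof eventually_elim
  fix x assume x: "ALL K y. G K (x, y) = 0"
  obtain K :: nat where "cmod (q (x, x)) <= real K" using real_arch_simple by blast
  thus "ALL y. F (x, y) = q (x, x) * f (x, y)" using x by (auto simp: G_def kp_def dest: spec[of _ K])
 qed
qed

lemma repr_adjoint:
 assumes T: "T : A0.rmod" and r: "repr (T A0.vac) f"
 shows "repr (operator_adjoint A0.GA T A0.vac) (%(x, y). cnj (f (y, x)))"
proof (rule reprI)
 note Ta = A0.operator_adjoint(1)[OF T]
 show "operator_adjoint A0.GA T A0.vac : A0.Hs"
  by (rule A0.bopD(1)[OF A0.rmodD(1)[OF Ta] A0.dense_in[OF one_A0]])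
 show "(%(x, y). cnj (f (y, x))) : MR" by (rule MR_swap[OF reprD(2)[OF r]])
 fix ep :: real assume ep: "0 < ep"
 have de: "0 < min 1 ep" using ep by simp
 obtain a where a: "a : carrier A0" "vdist (T A0.vac) a < min 1 ep" "qn (%p. a p - f p) <= ennreal ((min 1 ep)^2)"
  using repr_approx[OF r de] by blast
 show "EX b:carrier A0. vdist (operator_adjoint A0.GA T A0.vac) b <= ep \<and>
   qn (%p. b p - (case p of (x, y) => cnj (f (y, x)))) <= ennreal ep"
 proof (intro bexI[of _ "star A0 a"] conjI star_A0 a)
  show "vdist (operator_adjoint A0.GA T A0.vac) (star A0 a) <= ep"
   using A0.adjoint_close[OF T a(1)] a(2) by simp
  have "(%p. star A0 a p - (case p of (x, y) => cnj (f (y, x)))) = (%(x, y). cnj ((%p. a p - f p) (y, x)))"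
   by (auto simp: A0_sel)
  hence "qn (%p. star A0 a p - (case p of (x, y) => cnj (f (y, x)))) = qn (%p. a p - f p)"
   using qn_swap[OF MR_diff[OF A0_MR[OF a(1)] reprD(2)[OF r]]] by simp
  also have "... <= ennreal ((min 1 ep)^2)" by (rule a(3))
  also have "... <= ennreal ep"
  proof (rule ennreal_leI)
   have "(min 1 ep)^2 <= 1 * min 1 ep" unfolding power2_eq_square using de by (intro mult_right_mono) auto
   thus "(min 1 ep)^2 <= ep" by simp
  qed
  finally show "qn (%p. star A0 a p - (case p of (x, y) => cnj (f (y, x)))) <= ennreal ep" .
 qed
qed

lemma repr_cong_dense:
 assumes r: "repr xi f" and f': "f' : carrier A0" and eq: "AE y in N. ALL x. f (x, y) = f' (x, y)"
 shows "xi = A0.dvec f'"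
proof (rule A0.hnm_zero_eq[OF reprD(1)[OF r] A0.dense_in[OF f']])
 have "qn (%p. f' p - f p) = (\<integral>\<^sup>+y. 0 \<partial>N)"
  unfolding qn_def by (rule nn_integral_cong_AE, use eq in eventually_elim) simp
 hence "ennreal ((vdist xi f')^2) = 0" using reprD(3)[OF r f'] by simp
 thus "vdist xi f' = 0" by (simp add: ennreal_eq_0_iff)
qed

text \<open>Applying the isometry to the indicator of \<open>B\<close> shows that the integral of
  \<open>coln f\<close> over \<open>B\<close> is the measure of \<open>B\<close>, for every
  measurable \<open>B\<close>.\<close>

lemma isometry_coln:
 assumes T: "T : A0.rmod" and r: "repr (T A0.vac) f"
  and iso: "!!xi. xi : A0.Hs ==> A0.Hi.nm (T xi) = A0.Hi.nm xi"
 shows "AE y in N. coln f y = 1"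
proof (rule N.density_unique2)
 show "coln f : borel_measurable N" by (rule coln_meas[OF reprD(2)[OF r]])
 fix B assume B: "B : sets N"
 let ?k = "indicator B :: 'a => complex"
 have k: "?k : borel_measurable N" "cmod (?k x) <= 1" for x using B by (auto split: split_indicator)
 note dk = dg_A0[OF k]
 have "repr (T (A0.dvec (dg ?k))) (%p. ?k (snd p) * f p)" by (rule repr_right_dg[OF T r k])
 hence "qn (%p. ?k (snd p) * f p) = ennreal ((A0.Hi.nm (T (A0.dvec (dg ?k))))^2)" by (rule repr_norm)
 also have "... = qn (dg ?k)" using iso[OF A0.dense_in[OF dk]] norm2_qn(1)[OF dk] dk by simp
 also have "... = (\<integral>\<^sup>+y. ennreal ((cmod (dg ?k (y, y)))^2) \<partial>N)" by (rule qn_diag) (auto simp: dg_def split: if_splits)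
 also have "... = (\<integral>\<^sup>+y. 1 * indicator B y \<partial>N)" by (intro nn_integral_cong) (auto simp: dg_def split: split_indicator)
 also have "qn (%p. ?k (snd p) * f p) = (\<integral>\<^sup>+y. coln f y * indicator B y \<partial>N)"
  unfolding qn_def coln_def by (intro nn_integral_cong) (auto split: split_indicator)
 finally show "(\<integral>\<^sup>+y\<in>B. coln f y \<partial>N) = (\<integral>\<^sup>+y\<in>B. 1 \<partial>N)" .
qed simp

end

section \<open>The normalizer\<close>

context orbit_relation begin

text \<open>Diagonal unitaries times permutations, required at every point and not just almost
  everywhere, so that the products of such functions below are exact.\<close>

definition perm_fun :: "('a * 'a => complex) => bool" where
 "perm_fun a <-> a : MR & (ALL x:space M. \<exists>!y. a (x, y) ~= 0) & (ALL y:space M. \<exists>!x. a (x, y) ~= 0) \<and>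
  (ALL p. a p ~= 0 --> cmod (a p) = 1)"

lemma perm_funI:
 assumes "a : MR" "!!x. x : space M ==> \<exists>!y. a (x, y) ~= 0" "!!y. y : space M ==> \<exists>!x. a (x, y) ~= 0"
  "!!p. a p ~= 0 ==> cmod (a p) = 1"
 shows "perm_fun a"
 using assms by (simp add: perm_fun_def)

lemma perm_funD:
 assumes "perm_fun a"
 shows "a : MR" "x : space M ==> \<exists>!y. a (x, y) ~= 0" "y : space M ==> \<exists>!x. a (x, y) ~= 0"
  "a p ~= 0 ==> cmod (a p) = 1"
proof -
 note c = assms[unfolded perm_fun_def]
 show "a : MR" by (rule conjunct1[OF c])
 show "x : space M ==> \<exists>!y. a (x, y) ~= 0" by (rule bspec[OF conjunct1[OF conjunct2[OF c]]])
 show "y : space M ==> \<exists>!x. a (x, y) ~= 0" by (rule bspec[OF conjunct1[OF conjunct2[OF conjunct2[OF c]]]])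
 show "a p ~= 0 ==> cmod (a p) = 1" by (rule mp[OF spec[OF conjunct2[OF conjunct2[OF conjunct2[OF c]]]]])
qed

lemma MR_space: "f : MR ==> f (x, y) ~= 0 ==> (x, y) : E & x : space M & y : space M"
 using MRD(2)[of f "(x, y)"] E_space by blast

lemma perm_fun_A0: assumes a: "perm_fun a" shows "a : carrier A0"
proof (rule A0I[of _ 1 1])
 note MR = perm_funD(1)[OF a]
 show "a : BM" by (rule MRD[OF MR])
 show "a p = 0" if "p ~: E" for p by (rule MRD(2)[OF MR that])
 show "cmod (a p) <= 1" for p using perm_funD(4)[OF a, of p] by (cases "a p = 0") auto
 fix x
 have "EX y. rs a x <= {y}"
 proof (cases "x : space M")
  case True
  then obtain y where "!!z. a (x, z) ~= 0 ==> z = y" using perm_funD(2)[OF a] by blast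
  thus ?thesis by (auto simp: rs_def)
 next
  case False
  thus ?thesis using MR_space[OF MR] by (auto simp: rs_def)
 qed
 thus "finite (rs a x) & card (rs a x) <= 1" using card_mono[of "{_}" "rs a x"] finite_subset[of "rs a x" "{_}"] by auto
 have "EX y. cs a x <= {y}"
 proof (cases "x : space M")
  case True
  then obtain y where "!!z. a (z, x) ~= 0 ==> z = y" using perm_funD(3)[OF a] by blast
  thus ?thesis by (auto simp: cs_def)
 next
  case False
  thus ?thesis using MR_space[OF MR] by (auto simp: cs_def)
 qed
 thus "finite (cs a x) & card (cs a x) <= 1" using card_mono[of "{_}" "cs a x"] finite_subset[of "cs a x" "{_}"] by auto
qed

lemma perm_fun_star: "perm_fun a ==> perm_fun (star A0 a)"
 unfolding perm_fun_def A0_sel using MR_swap by auto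

lemma perm_fun_star_mult:
 assumes a: "perm_fun a" shows "star A0 a \<star> a = one0"
proof
 fix p :: "'a * 'a"
 obtain x z where p: "p = (x, z)" by (cases p)
 note MR = perm_funD(1)[OF a]
 show "(star A0 a \<star> a) p = one0 p"
 proof (cases "x : space M")
  case True
  then obtain y where y: "a (y, x) ~= 0" "!!w. a (w, x) ~= 0 ==> w = y" using perm_funD(3)[OF a] by blast
  have ys: "y : space M" using MR_space[OF MR y(1)] by blast
  have "(star A0 a \<star> a) (x, z) = (\<Sum>w\<in>{y}. star A0 a (x, w) * a (w, z))"
   by (rule A0_mult_rows) (use y(2) in \<open>auto simp: rs_def A0_sel\<close>)
  also have "... = a (y, z) * cnj (a (y, x))" by (simp add: A0_sel)
  also have "... = (if x = z then 1 else 0)"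
  proof (cases "x = z")
   case True
   have "a (y, x) * cnj (a (y, x)) = cr ((cmod (a (y, x)))^2)" by (rule complex_norm_square[symmetric])
   thus ?thesis using True perm_funD(4)[OF a y(1)] by simp
  next
   case False
   hence "a (y, z) = 0" using perm_funD(2)[OF a ys] y(1) by blast
   thus ?thesis using False by simp
  qed
  finally show ?thesis using True by (simp add: p A0_sel)
 next
  case False
  have "(star A0 a \<star> a) (x, z) = (\<Sum>w\<in>{}. star A0 a (x, w) * a (w, z))"
   by (rule A0_mult_rows) (use MR_space[OF MR] False in \<open>auto simp: rs_def A0_sel\<close>)
  thus ?thesis using False by (simp add: p A0_sel)
 qed
qed

lemma perm_fun_mult_star:
 assumes a: "perm_fun a" shows "a \<star> star A0 a = one0"
 using perm_fun_star_mult[OF perm_fun_star[OF a]] perm_fun_A0[OF a] by simp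

lemma coln_zero: assumes "coln f y ~= 0" shows "EX x. f (x, y) ~= 0"
proof (rule ccontr)
 assume "~ (EX x. f (x, y) ~= 0)"
 hence "coln f y = 0" by (simp add: coln_def)
 thus False using assms by simp
qed

text \<open>In terms of functions, the relation b u = u 1_U of \<open>norm\<close> says 1_U(y) f(x,
  y) = q(x, x) f(x, y). Hence all nonzero entries of a row lie at points that no \<open>U i\<close>
  tells apart, that is, at one point. Rows and columns of norm 1 supply existence and
  modulus.\<close>

lemma normalizer_function:
 assumes T: "u : A0.rmod"
  and iso: "!!xi. xi : A0.Hs ==> A0.Hi.nm (u xi) = A0.Hi.nm xi"
  and iso': "!!xi. xi : A0.Hs ==> A0.Hi.nm (operator_adjoint A0.GA u xi) = A0.Hi.nm xi"
  and norm: "!!i. EX q b. b : A0.rmod & repr (b A0.vac) q & (ALL p. q p ~= 0 --> fst p = snd p) \<and>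
   b (u A0.vac) = u (A0.dvec (dg (indicator (U i))))"
 shows "EX f. perm_fun f & u A0.vac = A0.dvec f"
proof -
 have u1: "u A0.vac : A0.Hs"
  by (rule A0.bopD(1)[OF A0.rmodD(1)[OF T] A0.dense_in[OF one_A0]])
 obtain f where r: "repr (u A0.vac) f" using repr_ex[OF u1] by blast
 note f = reprD(2)[OF r]
 define f' where "f' = (%(x, y). cnj (f (y, x)))"
 have 1: "AE y in N. coln f y = 1" by (rule isometry_coln[OF T r iso])
 have 2: "AE y in N. coln f' y = 1"
  unfolding f'_def by (rule isometry_coln[OF A0.operator_adjoint(1)[OF T] repr_adjoint[OF T r] iso'])
 have "AE x in N. EX c. ALL y. indicator (U i) y * f (x, y) = c * f (x, y)" for i
 proof -
  obtain q b where b: "b : A0.rmod" "repr (b A0.vac) q" "!!p. q p ~= 0 ==> fst p = snd p"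
   "b (u A0.vac) = u (A0.dvec (dg (indicator (U i))))"
   using norm[of i] by blast
  have "U i : sets N" using U_sets by auto
  hence k: "indicator (U i) : borel_measurable N" by (rule borel_measurable_indicator)
  have k1: "cmod (indicator (U i) x) <= 1" for x by (auto split: split_indicator)
  have r2: "repr (b (u A0.vac)) (%p. indicator (U i) (snd p) * f p)"
   unfolding b(4) by (rule repr_right_dg[OF T r k k1])
  have "AE x in N. ALL y. indicator (U i) (snd (x, y)) * f (x, y) = q (x, x) * f (x, y)"
   by (rule repr_left_diag[OF b(1,2) _ r r2]) (rule b(3))
  thus ?thesis by eventually_elim auto
 qed
 hence 3: "AE x in N. ALL i. EX c. ALL y. indicator (U i) y * f (x, y) = c * f (x, y)" by (simp add: AE_all_countable)
 define P where "P x <-> coln f x = 1 & coln f' x = 1 & (ALL i. EX c. ALL y. indicator (U i) y * f (x, y) = c * f (x, y))" for x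
 have "AE x in N. P x" using 1 2 3 by eventually_elim (simp add: P_def)
 hence AEP: "AE x in N. ALL w:FG. P (act w x)" by (rule AE_act)
 define X1 where "X1 = {x : X0. ALL w:FG. P (act w x)}"
 have X1: "AE x in N. x : X1" using AEP AE_X0 by eventually_elim (simp add: X1_def)
 have X1_sub: "X1 <= space M" using X0_sub by (auto simp: X1_def)
 have X1_sets: "X1 : sets N"
 proof -
  have "{x : space N. ~ x : X1} : null_sets N" using X1 unfolding completion.AE_iff_null_sets .
  hence "space N - {x : space N. ~ x : X1} : sets N" by (intro sets.compl_sets) auto
  moreover have "space N - {x : space N. ~ x : X1} = X1" using X1_sub by auto
  ultimately show ?thesis by simp
 qed
 have X1_E: "y : X1" if x: "x : X1" and xy: "(x, y) : E" for x y
 proof -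
  have x0: "x : X0" using x by (simp add: X1_def)
  then obtain v where v: "v : FG" "y = act v x" using xy by (auto simp: X0_def)
  have "P (act w y)" if w: "w : FG" for w
  proof -
   have "act w y = act (w \<cdot> v) x" using act_mult[OF w v(1)] x X1_sub v(2) by auto
   thus ?thesis using x w v(1) by (simp add: X1_def)
  qed
  thus ?thesis using X0_E[OF x0 xy] by (simp add: X1_def)
 qed
 have X1_P: "P x" if "x : X1" for x
 proof -
  have "P (act [] x)" using that by (simp add: X1_def)
  thus ?thesis using act_one that X1_sub by auto
 qed
 have row: "y = y'" if x: "x : X1" and nz: "f (x, y) ~= 0" "f (x, y') ~= 0" for x y y'
 proof (rule U_sep)
  show "y : space M" "y' : space M" using MR_space[OF f] nz by blast+
  fix i
  obtain c where c: "!!y. indicator (U i) y * f (x, y) = c * f (x, y)" using X1_P[OF x] by (auto simp: P_def)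
  have "indicator (U i) y = c" "indicator (U i) y' = c" using c[of y] c[of y'] nz by auto
  hence "indicator (U i) y = (indicator (U i) y' :: complex)" by simp
  thus "y : U i <-> y' : U i" by (auto split: split_indicator_asm)
 qed
 have mod: "cmod (f (x, y)) = 1" if x: "x : X1" and nz: "f (x, y) ~= 0" for x y
 proof -
  have "coln f' x = ennreal (\<Sum>z\<in>{y}. (cmod (f' (z, x)))^2)"
   unfolding coln_def by (rule nn_integral_count_space_finite_support) (use row[OF x nz] in \<open>auto simp: f'_def\<close>)
  hence "ennreal ((cmod (f (x, y)))^2) = 1" using X1_P[OF x] by (simp add: P_def f'_def)
  hence "(cmod (f (x, y)))^2 = 1" by (simp add: ennreal_eq_1)
  thus ?thesis by (simp add: power2_eq_1_iff) (use norm_ge_zero[of "f (x, y)"] in linarith)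
 qed
 have row_ex: "EX y. f (x, y) ~= 0" if x: "x : X1" for x
  using coln_zero[of f' x] X1_P[OF x] by (auto simp: P_def f'_def)
 have col_ex: "EX x. f (x, y) ~= 0" if y: "y : X1" for y
  using coln_zero[of f y] X1_P[OF y] by (auto simp: P_def)
 have inX1: "x : X1 <-> y : X1" if "f (x, y) ~= 0" for x y
  using MR_space[OF f that] X1_E E_sym by blast
 \<comment> \<open>Two entries of modulus 1 would give the column a squared norm of at least
   2.\<close>
 have col: "x = x'" if y: "y : X1" and nz: "f (x, y) ~= 0" "f (x', y) ~= 0" for x x' y
 proof (rule ccontr)
  assume ne: "x ~= x'"
  have "(\<Uplus>z. indicator {x, x'} z) <= coln f y"
   unfolding coln_def
   by (intro nn_integral_mono) (use mod[of x y] mod[of x' y] inX1[OF nz(1)] inX1[OF nz(2)] y nz in \<open>auto split: split_indicator\<close>)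
  moreover have "(\<Uplus>z. indicator {x, x'} z) = (2 :: ennreal)"
   using ne by (simp add: emeasure_count_space)
  ultimately have "(2 :: ennreal) <= 1" using X1_P[OF y] by (simp add: P_def)
  thus False by simp
 qed
 \<comment> \<open>On the complement of \<open>X1\<close>, an invariant null set, the identity is
   substituted; by invariance rows and columns of the two parts do not interfere.\<close>
 define F where "F p = (if fst p : X1 then f p else dg (%_. 1) p)" for p
 have one: "dg (%_. 1) : MR" by (rule dg_MR) simp
 have F_MR: "F : MR"
 proof (rule MRI)
  have [measurable]: "f : BM" "dg (%_. 1) : BM" "X1 : sets N"
   using MRD[OF f] MRD[OF one] X1_sets by auto
  show "F : BM" unfolding F_def[abs_def] by measurable
  show "F p = 0" if "p ~: E" for p using MRD(2)[OF f that] MRD(2)[OF one that] by (simp add: F_def)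
 qed
 have Fin: "F (x, y) = f (x, y)" if "x : X1" for x y using that by (simp add: F_def)
 have Fout: "F (x, y) ~= 0 <-> y = x" if "x : space M" "x ~: X1" for x y using that by (auto simp: F_def dg_def)
 have "perm_fun F"
 proof (rule perm_funI[OF F_MR])
  fix x assume x: "x : space M"
  show "\<exists>!y. F (x, y) ~= 0"
  proof (cases "x : X1")
   case True
   thus ?thesis unfolding Fin[OF True] using row_ex[OF True] row[OF True] by blast
  next
   case False
   thus ?thesis unfolding Fout[OF x False] by blast
  qed
 next
  fix y assume y: "y : space M"
  show "\<exists>!x. F (x, y) ~= 0"
  proof (cases "y : X1")
   case True
   have eq: "F (x, y) ~= 0 <-> f (x, y) ~= 0" for x
   proof (cases "x : X1")
    case False
    hence "f (x, y) = 0" using inX1[of x y] True by blast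
    moreover have "F (x, y) = 0" using False True by (auto simp: F_def dg_def)
    ultimately show ?thesis by simp
   qed (simp add: Fin)
   show ?thesis unfolding eq using col_ex[OF True] col[OF True] by blast
  next
   case False
   have "F (x, y) ~= 0 <-> x = y" for x
   proof (cases "x : X1")
    case True
    thus ?thesis using inX1[of x y] False by (auto simp: Fin)
   next
    case Fx: False
    thus ?thesis using y by (auto simp: F_def dg_def)
   qed
   thus ?thesis by simp
  qed
 next
  fix p assume p: "F p ~= 0"
  obtain x y where xy: "p = (x, y)" by (cases p)
  show "cmod (F p) = 1"
   using p mod[of x y] by (cases "x : X1") (auto simp: xy F_def dg_def split: if_splits)
 qed
 moreover have "AE y in N. ALL x. f (x, y) = F (x, y)"
  using X1
 proof eventually_elim
  fix y assume y: "y : X1"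
  show "ALL x. f (x, y) = F (x, y)"
  proof
   fix x show "f (x, y) = F (x, y)"
   proof (cases "x : X1")
    case False
    hence "f (x, y) = 0" using inX1[of x y] y by blast
    thus ?thesis using False y by (auto simp: F_def dg_def)
   qed (simp add: Fin)
  qed
 qed
 ultimately show ?thesis using repr_cong_dense[OF r perm_fun_A0] by blast
qed

lemma full_group_perm_fun:
 assumes th: "th : full_group M E"
 shows "perm_fun (%(x, y). if y : space M & x = th y then 1 else 0)" (is "perm_fun ?p")
proof (rule perm_funI)
 have tm: "th : measurable M M" and bij: "bij_betw th (space M) (space M)" and Eth: "!!x. x : space M ==> (x, th x) : E"
  using th by (auto simp: full_group_def)
 have [measurable]: "th : measurable N M" by (rule measurable_completion[OF tm])
 have [measurable]: "U i : sets N" "U i : sets M" for i using U_sets by auto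
 show "?p : MR"
 proof (rule MRI)
  have "(%p. if ALL i. fst p : U i <-> th (snd p) : U i then 1 else 0 :: complex) : BM" by measurable
  also have "?this <-> ?p : BM"
  proof (rule measurable_cong)
   fix p assume "p : space (N \<Otimes>\<^sub>M N)"
   then obtain x y where p: "p = (x, y)" "x : space M" "y : space M" by (auto simp: space_pair_measure)
   have "(ALL i. x : U i <-> th y : U i) <-> x = th y"
    using U_sep[OF p(2) measurable_space[OF tm p(3)]] by blast
   thus "(if ALL i. fst p : U i <-> th (snd p) : U i then 1 else 0 :: complex) = ?p p" using p by simp
  qed
  finally show "?p : BM" .
  show "?p p = 0" if "p ~: E" for p using that Eth E_sym by (cases p) auto
 qed
 show "\<exists>!y. ?p (x, y) ~= 0" if xs: "x : space M" for x
 proof -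
  have "x : th ` space M" using bij xs by (simp add: bij_betw_def)
  then obtain y where y: "y : space M" "x = th y" by blast
  thus ?thesis using bij by (intro ex1I[of _ y]) (auto simp: bij_betw_def inj_on_def split: if_splits)
 qed
 show "\<exists>!x. ?p (x, y) ~= 0" if "y : space M" for y
  using that by (intro ex1I[of _ "th y"]) (auto split: if_splits)
 show "cmod (?p p) = 1" if "?p p ~= 0" for p using that by (cases p) (auto split: if_splits)
qed

section \<open>The algebra M(E), its diagonal subalgebra and its normalizer\<close>

lemma vN_sel:
 "carrier (vN_rel M E) = weak_operator_closure A0.GA (gns_rep A0 ` carrier A0)"
 "S \<otimes>\<^bsub>vN_rel M E\<^esub> T = compose A0.Hs S T" "\<one>\<^bsub>vN_rel M E\<^esub> = (\<lambda>xi\<in>A0.Hs. xi)"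
 "star (vN_rel M E) = operator_adjoint A0.GA"
 by (simp_all add: vN_rel_def gns_closure_def Let_def)

lemma vN_right_modular: "T : carrier (vN_rel M E) ==> T : A0.rmod"
 by (simp add: vN_sel A0.weak_closure_right_modular)

lemma gns_rep_vN: assumes "a : carrier A0" shows "gns_rep A0 a : carrier (vN_rel M E)"
proof -
 have "gns_rep A0 a : bounded_operators A0.GA" by (rule A0.rmodD(1)[OF A0.gns_rep_right_modular[OF assms]])
 thus ?thesis
  unfolding vN_sel weak_operator_closure_def
  by (intro CollectI conjI allI impI bexI[of _ "gns_rep A0 a"]) (use assms in auto)
qed

lemma cartan_iff:
 "T : cartan_rel M E <-> T : carrier (vN_rel M E) \<and>
  (EX f. repr (T A0.vac) f & (ALL p. f p ~= 0 --> fst p = snd p))"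
proof -
 have "is_function_of M E T f <-> repr (T A0.vac) f" if "T : carrier (vN_rel M E)" for f
  unfolding A0.gns_unit_dense[symmetric]
  by (rule function_iff_repr)
   (simp add: A0.gns_unit_dense A0.bopD(1)[OF A0.rmodD(1)[OF vN_right_modular[OF that]]] one_A0)
 moreover have "{p. f p ~= 0} <= Id <-> (ALL p. f p ~= 0 --> fst p = snd p)" for f :: "'a * 'a => complex" by auto
 ultimately show ?thesis unfolding cartan_rel_def by auto
qed

lemma gns_rep_unit: "a : carrier A0 ==> gns_rep A0 a A0.vac = A0.dvec a"
 by (simp add: A0.gns_rep_dense one_A0)

lemma gns_rep_cartan:
 assumes a: "a : carrier A0" and "!!p. a p ~= 0 ==> fst p = snd p"
 shows "gns_rep A0 a : cartan_rel M E"
 unfolding cartan_iff gns_rep_unit[OF a] using gns_rep_vN[OF a] repr_dense[OF a] assms(2) by blast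

end

context sofic_model begin

lemma fval_nat: "unit_fsum s ==> EX m :: nat. fval ga d' s x y = of_nat m"
proof (induction s)
 case (Cons t s)
 obtain c Q w where t: "t = (c, Q, w)" by (metis surj_pair)
 have c: "c = 1" "unit_fsum s" using Cons.prems by (auto simp: unit_fsum_def t)
 obtain m :: nat where "fval ga d' s x y = of_nat m" using Cons.IH[OF c(2)] by blast
 hence "fval ga d' (t # s) x y = of_nat (if kern ga d' Q w x y then Suc m else m)" by (simp add: fval_Cons tval_def t c(1))
 thus ?case by blast
qed simp

lemma extension_perm_fun:
 assumes p: "perm_fun p" and 01: "!!q. p q : {0, 1}"
 shows "MA.extension (gns_rep A0 p) : ultraproduct_subset om n (%k. permutation_mats (n k))"
proof (rule MA.extension_permutation[OF perm_fun_A0[OF p] perm_fun_star_mult[OF p] perm_fun_mult_star[OF p]])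
 fix ep :: real assume ep: "0 < ep"
 note pA = perm_fun_A0[OF p]
 obtain s where s: "wf_fsum s" "unit_fsum s" "nrm (%q. aX s q - p q) < ep" using dense_aX[OF pA ep] 01 by blast
 have "nrm (A0.Ai.sb p (aX s)) < ep"
  using A0.Ai.nm_sb_commute[OF pA aX_carrier[OF s(1)]] A0_sb[OF aX_carrier[OF s(1)] pA] s(3) by simp
 moreover have "EX m :: nat. aY s k $$ (i, j) = of_nat m" if "i < n k" "j < n k" for k i j
  using fval_nat[OF s(2)] that by (simp add: aY_def)
 ultimately show "EX a y. (a, y) : R & nrm (A0.Ai.sb p a) < ep & (ALL k. ALL i<n k. ALL j<n k. EX m :: nat. y k $$ (i, j) = of_nat m)"
  using R_I[OF s(1)] by blast
qed

lemma extension_cartan: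
 assumes T: "T : cartan_rel M E"
 shows "MA.extension T : ultraproduct_subset om n (%k. diagonal_mats (n k))"
proof -
 have Tr: "T : A0.rmod" using T vN_right_modular unfolding cartan_iff by blast
 obtain f where f: "repr (T A0.vac) f" "!!p. f p ~= 0 ==> fst p = snd p" using T unfolding cartan_iff by blast
 show ?thesis
 proof (rule MA.extension_diagonal[OF Tr])
  fix ep :: real assume ep: "0 < ep"
  obtain k C where k: "k : borel_measurable N" "!!y. cmod (k y) <= C" "vdist (T A0.vac) (dg k) < ep / 2"
   using repr_diag_approx[OF f half_gt_zero[OF ep]] by blast
  note dk = dg_A0[OF k(1,2)]
  have loc: "loc k [] = dg k" by (auto simp: loc_def dg_def act_one)
  obtain s where s: "wf_fsum s" "const_word [] s" "nrm (%p. aX s p - dg k p) < ep / 2"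
   using approximable_bounded[OF k(1,2) one_FG] half_gt_zero[OF ep] unfolding approximable_def loc by blast
  have "vdist (T A0.vac) (aX s) < ep"
   using vdist_triangle[OF reprD(1)[OF f(1)] aX_carrier[OF s(1)] dk] k(3) s(3) by simp
  moreover have "aY s l : diagonal_mats (n l)" for l
  proof -
   have "aY s l $$ (i, j) = 0" if ij: "i < n l" "j < n l" "i ~= j" for i j
   proof (rule ccontr)
    assume "aY s l $$ (i, j) ~= 0"
    hence "fval (be l) (d l) s (h l i) (h l j) ~= 0" using ij by (simp add: aY_def)
    from fval_nz[OF this] obtain c Q w where w: "(c, Q, w) : set s" "h l i = be l w (h l j)" by blast
    hence "w = []" using s(2) by (auto simp: const_word_def)
    hence "h l i = h l j" using w(2) fg_actD(2)[OF be h_in[OF ij(2)]] by simp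
    thus False using h_bij[of l] ij by (auto simp: bij_betw_def inj_on_def)
   qed
   thus ?thesis by (auto simp: diagonal_mats_def diagonal_mat_def carrier_matD[OF aY_carrier])
  qed
  ultimately show "EX a y. (a, y) : R & vdist (T A0.vac) a < ep & (ALL k. y k : diagonal_mats (n k))"
   using R_I[OF s(1)] by blast
 qed
qed

lemma extension_normalizer:
 assumes u: "u : unitary_normalizer (vN_rel M E) (cartan_rel M E)"
 shows "MA.extension u : (MA.extension ` unitaries_in (vN_rel M E) (cartan_rel M E)) <#>\<^bsub>ultraproduct om n\<^esub>
  ultraproduct_subset om n (%k. permutation_mats (n k))"
proof -
 let ?V = "vN_rel M E" and ?o = "A0.vac"
 define v where "v = operator_adjoint A0.GA u"
 have uV: "u : carrier ?V" and vu: "compose A0.Hs v u = (\<lambda>xi\<in>A0.Hs. xi)" and uv: "compose A0.Hs u v = (\<lambda>xi\<in>A0.Hs. xi)"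
  and img: "(%a. compose A0.Hs (compose A0.Hs u a) v) ` cartan_rel M E = cartan_rel M E"
  using u unfolding unitary_normalizer_def unitaries_in_def vN_sel v_def by blast+
 note ur = vN_right_modular[OF uV]
 have vr: "v : A0.rmod" unfolding v_def by (rule A0.operator_adjoint(1)[OF ur])
 have uH: "u xi : A0.Hs" and vH: "v xi : A0.Hs" if "xi : A0.Hs" for xi
  using A0.bopD(1)[OF A0.rmodD(1)[OF ur] that] A0.bopD(1)[OF A0.rmodD(1)[OF vr] that] by auto
 have vu': "v (u xi) = xi" and uv': "u (v xi) = xi" if "xi : A0.Hs" for xi
  using fun_cong[OF vu, of xi] fun_cong[OF uv, of xi] that by (auto simp: compose_eq)
 note adj = A0.operator_adjoint(2)[OF ur, folded v_def]
 have iso: "A0.Hi.nm (u xi) = A0.Hi.nm xi" "A0.Hi.nm (v xi) = A0.Hi.nm xi" if xi: "xi : A0.Hs" for xi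
  using adj[OF xi uH[OF xi]] adj[OF vH[OF xi] xi] vu'[OF xi] uv'[OF xi] by (simp_all add: A0.Hi.nm_def)
 have one: "?o : A0.Hs" by (rule A0.dense_in[OF one_A0])
 have "EX f. perm_fun f & u ?o = A0.dvec f"
 proof (rule normalizer_function[OF ur iso(1) iso(2)[unfolded v_def]])
  fix i
  let ?k = "indicator (U i) :: 'a => complex"
  have "U i : sets N" using U_sets by auto
  hence k: "?k : borel_measurable N" by (rule borel_measurable_indicator)
  have k1: "cmod (?k x) <= 1" for x by (auto split: split_indicator)
  note dk = dg_A0[OF k k1]
  have c: "gns_rep A0 (dg ?k) : cartan_rel M E"
   by (rule gns_rep_cartan[OF dk]) (auto simp: dg_def split: if_splits)
  define b where "b = compose A0.Hs (compose A0.Hs u (gns_rep A0 (dg ?k))) v"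
  have "b : cartan_rel M E" unfolding b_def using c img by blast
  then obtain q where q: "b : carrier ?V" "repr (b ?o) q" "!!p. q p ~= 0 ==> fst p = snd p" unfolding cartan_iff by blast
  have "b (u ?o) = u (A0.dvec (dg ?k))"
   using one uH[OF one] vu'[OF one] gns_rep_unit[OF dk] by (simp add: b_def compose_eq)
  thus "EX q b. b : A0.rmod & repr (b ?o) q & (ALL p. q p ~= 0 --> fst p = snd p) \<and>
    b (u ?o) = u (A0.dvec (dg ?k))"
   using vN_right_modular[OF q(1)] q(2,3) by blast
 qed
 then obtain f where f: "perm_fun f" "u ?o = A0.dvec f" by blast
 \<comment> \<open>The 0/1 support of \<open>f\<close>. The values of \<open>f\<close> go into the
   diagonal function \<open>D1\<close>, the product of \<open>f\<close> with the star of
   \<open>p\<close>, so that the product of \<open>D1\<close> and \<open>p\<close> is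
   \<open>f\<close>.\<close>
 define p where "p q = (if f q = 0 then 0 else 1 :: complex)" for q
 have p: "perm_fun p"
 proof (rule perm_funI)
  have [measurable]: "f : BM" by (rule MRD[OF perm_funD(1)[OF f(1)]])
  show "p : MR"
  proof (rule MRI)
   show "p : BM" unfolding p_def[abs_def] by measurable
  qed (simp add: p_def MRD(2)[OF perm_funD(1)[OF f(1)]])
  have eq: "p q ~= 0 <-> f q ~= 0" for q by (simp add: p_def)
  show "\<exists>!y. p (x, y) ~= 0" if "x : space M" for x unfolding eq by (rule perm_funD(2)[OF f(1) that])
  show "\<exists>!x. p (x, y) ~= 0" if "y : space M" for y unfolding eq by (rule perm_funD(3)[OF f(1) that])
  show "cmod (p q) = 1" if "p q ~= 0" for q using that by (auto simp: p_def split: if_splits)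
 qed
 note fA = perm_fun_A0[OF f(1)] and pA = perm_fun_A0[OF p]
 define D1 where "D1 = f \<star> star A0 p"
 have dA: "D1 : carrier A0" unfolding D1_def by (intro mult_A0 star_A0 fA pA)
 have diag: "fst q = snd q" if "D1 q ~= 0" for q
 proof -
  obtain x z where q: "q = (x, z)" by (cases q)
  have "(\<Sum>y\<in>rs f x. f (x, y) * star A0 p (y, z)) ~= 0" using that by (simp add: q D1_def A0_sel)
  then obtain y where "f (x, y) * star A0 p (y, z) ~= 0" by (meson sum.neutral)
  hence nz: "f (x, y) ~= 0" "f (z, y) ~= 0" by (auto simp: A0_sel p_def split: if_splits)
  have "y : space M" using MR_space[OF perm_funD(1)[OF f(1)] nz(1)] by blast
  thus ?thesis using perm_funD(3)[OF f(1)] nz by (auto simp: q)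
 qed
 have Dp: "D1 \<star> p = f"
  unfolding D1_def using fA pA by (simp add: A0.m_assoc star_A0 perm_fun_star_mult[OF p])
 have sD: "star A0 D1 = p \<star> star A0 f" unfolding D1_def using fA pA by (simp add: A0.star_mult star_A0)
 have "star A0 D1 \<star> D1 = p \<star> ((star A0 f \<star> f) \<star> star A0 p)"
  unfolding sD unfolding D1_def using fA pA by (simp add: A0.m_assoc star_A0 mult_A0)
 hence u1: "star A0 D1 \<star> D1 = one0" using pA by (simp add: perm_fun_star_mult[OF f(1)] perm_fun_mult_star[OF p] star_A0)
 have "D1 \<star> star A0 D1 = f \<star> ((star A0 p \<star> p) \<star> star A0 f)"
  unfolding sD unfolding D1_def using fA pA by (simp add: A0.m_assoc star_A0 mult_A0)
 hence u2: "D1 \<star> star A0 D1 = one0" using fA by (simp add: perm_fun_star_mult[OF p] perm_fun_mult_star[OF f(1)] star_A0)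
 have dU: "gns_rep A0 D1 : unitaries_in ?V (cartan_rel M E)"
  unfolding unitaries_in_def vN_sel
  by (simp add: gns_rep_cartan[OF dA diag] A0.adjoint_gns_rep[OF dA] A0.gns_rep_compose dA star_A0 u1 u2 A0.gns_rep_one)
 \<comment> \<open>The operators \<open>u\<close> and \<open>gns_rep A0 f\<close> have the same
   vector, and \<open>extension\<close> depends on nothing else.\<close>
 have "MA.extension u = MA.extension (gns_rep A0 f)" unfolding MA.extension_def f(2) gns_rep_unit[OF fA] ..
 also have "... = MA.extension (compose A0.Hs (gns_rep A0 D1) (gns_rep A0 p))" unfolding A0.gns_rep_compose[OF dA pA] Dp ..
 also have "... = MA.extension (gns_rep A0 D1) \<otimes>\<^bsub>ultraproduct om n\<^esub> MA.extension (gns_rep A0 p)"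
  by (rule MA.extension_compose[OF A0.gns_rep_right_modular[OF dA] A0.gns_rep_right_modular[OF pA]])
 finally have eq: "MA.extension u = MA.extension (gns_rep A0 D1) \<otimes>\<^bsub>ultraproduct om n\<^esub> MA.extension (gns_rep A0 p)" .
 have pU: "MA.extension (gns_rep A0 p) : ultraproduct_subset om n (%k. permutation_mats (n k))"
  by (rule extension_perm_fun[OF p]) (simp add: p_def)
 show ?thesis unfolding set_mult_def eq by (intro UN_I[OF imageI[OF dU]] UN_I[OF pU] singletonI)
qed

theorem sofic_model_sofic:
 "sofic_rel om M E" "sofic_embedding om n M E MA.extension"
proof -
 have 1: "tracial_embedding (vN_rel M E) (ultraproduct om n) MA.extension"
  unfolding vN_rel_def by (rule MA.tracial_embedding_extension)
 have 2: "MA.extension ` cartan_rel M E <= ultraproduct_subset om n (%k. diagonal_mats (n k))"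
  using extension_cartan by blast
 have 3: "MA.extension ` unitary_normalizer (vN_rel M E) (cartan_rel M E) \<subseteq>
   (MA.extension ` unitaries_in (vN_rel M E) (cartan_rel M E)) <#>\<^bsub>ultraproduct om n\<^esub>
   ultraproduct_subset om n (%k. permutation_mats (n k))"
  using extension_normalizer by blast
 have 4: "MA.extension (u_elem M E th) : ultraproduct_subset om n (%k. permutation_mats (n k))" if "th : full_group M E" for th
  unfolding u_elem_def by (rule extension_perm_fun[OF full_group_perm_fun[OF that]]) auto
 show "sofic_rel om M E" unfolding sofic_rel_def using 1 2 3 n_pos by blast
 show "sofic_embedding om n M E MA.extension" unfolding sofic_embedding_def using 1 2 4 by blast
qed

end

section \<open>Density of the dyadic sets\<close>

text \<open>In a Hausdorff space a countable base separates points; the empty set is added so that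
  there is a nonempty family to enumerate.\<close>

lemma standard_separating:
 assumes "standard_prob_space M"
 obtains U :: "nat => 'a set" where "!!i. U i : sets M"
  "!!x y. x : space M ==> y : space M ==> (!!i. x : U i <-> y : U i) ==> x = y"
proof -
 have "EX T. topspace T = space M & completely_metrizable_space T & second_countable T \<and>
   sets M = sigma_sets (space M) {U. openin T U}"
  using assms unfolding standard_prob_space_def by (rule conjunct2)
 then obtain T where T0: "topspace T = space M & completely_metrizable_space T & second_countable T \<and>
   sets M = sigma_sets (space M) {U. openin T U}" ..
 note T = conjunct1[OF T0] conjunct1[OF conjunct2[OF T0]] conjunct1[OF conjunct2[OF conjunct2[OF T0]]]
  conjunct2[OF conjunct2[OF conjunct2[OF T0]]]
 obtain \<B> where B0: "countable \<B> & (ALL V:\<B>. openin T V) \<and>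
   (ALL U x. openin T U & x : U --> (EX V:\<B>. x : V & V <= U))"
  using T(3) unfolding second_countable_def ..
 have B: "countable \<B>" "!!V. V : \<B> ==> openin T V"
  "!!U x. openin T U ==> x : U ==> EX V:\<B>. x : V & V <= U"
  using B0 by simp_all
 have H: "Hausdorff_space T"
  by (intro metrizable_imp_Hausdorff_space completely_metrizable_imp_metrizable_space T(2))
 define U where "U = from_nat_into (insert {} \<B>)"
 have ran: "range U = insert {} \<B>" unfolding U_def by (rule range_from_nat_into) (use B(1) in auto)
 show ?thesis
 proof (rule that[of U])
  fix i
  have "U i : insert {} \<B>" using ran by auto
  hence "openin T (U i)" using B(2) by auto
  thus "U i : sets M" unfolding T(4) by (intro sigma_sets.Basic) simp
 next
  fix x y assume xy: "x : space M" "y : space M" "!!i. x : U i <-> y : U i"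
  show "x = y"
  proof (rule ccontr)
   assume "x ~= y"
   then obtain V W where V: "openin T V" "openin T W" "x : V" "y : W" "disjnt V W"
    using H xy(1,2) unfolding Hausdorff_space_def T(1) by blast
   obtain V' where V': "V' : \<B>" "x : V'" "V' <= V" using B(3)[OF V(1,3)] by blast
   have "V' : range U" unfolding ran using V'(1) by simp
   then obtain i where "V' = U i" by blast
   hence "y : V" using xy(3)[of i] V' by blast
   thus False using V(4,5) by (auto simp: disjnt_def)
  qed
 qed
qed

text \<open>Replacing each set by its two halves brings unions of different levels to a common
  level.\<close>

lemma dyadic_refine:
 assumes e: "dyadic_splitting S e" and I: "I <= {1..2 ^ m}"
 shows "\<exists>J\<subseteq>{1..2 ^ (m + k)}. (\<Union>i\<in>I. e i m) = (\<Union>j\<in>J. e j (m + k))"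
proof (induction k)
 case 0
 thus ?case using I by (intro exI[of _ I]) simp
next
 case (Suc k)
 then obtain J where J: "J <= {1..2 ^ (m + k)}" "(\<Union>i\<in>I. e i m) = (\<Union>j\<in>J. e j (m + k))" by blast
 have E: "e (2 * i - 1) l Un e (2 * i) l = e i (l - 1)" if "1 <= l" "i : {1..2 ^ (l - 1)}" for l i
  using e that unfolding dyadic_splitting_def by blast
 have step: "e (2 * j - 1) (m + Suc k) Un e (2 * j) (m + Suc k) = e j (m + k)" if "j : J" for j
 proof -
  have "j : {1..2 ^ (m + Suc k - 1)}" using J(1) that by auto
  thus ?thesis using E[of "m + Suc k" j] by simp
 qed
 define J' where "J' = (%j. 2 * j - 1) ` J Un (%j. 2 * j) ` J"
 have "(\<Union>j\<in>J'. e j (m + Suc k)) = (\<Union>j\<in>J. e (2 * j - 1) (m + Suc k) Un e (2 * j) (m + Suc k))"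
  unfolding J'_def by blast
 also have "... = (\<Union>j\<in>J. e j (m + k))" by (rule SUP_cong[OF refl step])
 finally have "(\<Union>j\<in>J'. e j (m + Suc k)) = (\<Union>i\<in>I. e i m)" using J(2) by simp
 moreover have "J' <= {1..2 ^ (m + Suc k)}"
 proof
  fix i assume "i : J'"
  then obtain j where j: "j : J" "i = 2 * j - 1 \<or> i = 2 * j" by (auto simp: J'_def)
  hence "1 <= j" "j <= 2 ^ (m + k)" using J(1) by auto
  thus "i : {1..2 ^ (m + Suc k)}" using j(2) by auto
 qed
 ultimately show ?case by (intro exI[of _ J']) auto
qed

lemma (in finite_measure) measure_sym_diff_triangle:
 assumes "A : sets M" "B : sets M" "C : sets M"
 shows "measure M ((A - C) Un (C - A)) <= measure M ((A - B) Un (B - A)) + measure M ((B - C) Un (C - B))"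
proof -
 have "measure M ((A - C) Un (C - A)) <= measure M (((A - B) Un (B - A)) Un ((B - C) Un (C - B)))"
  by (rule finite_measure_mono) (use assms in auto)
 also have "... <= measure M ((A - B) Un (B - A)) + measure M ((B - C) Un (C - B))"
  by (rule measure_Un_le) (use assms in auto)
 finally show ?thesis .
qed

context
 fixes M :: "'a measure" and e :: "nat => nat => 'a set"
 assumes P: "prob_space M" and e: "dyadic_splitting (space M) e"
  and em: "!!m i. i : {1..2 ^ m} ==> e i m : sets M"
begin

interpretation prob_space M by (rule P)

text \<open>These sets form an algebra; \<open>dyadic_close\<close> below is its closure for the
  measure of symmetric differences.\<close>

definition dyadic_union :: "'a set => bool" where
 "dyadic_union S <-> (EX m. \<exists>I\<subseteq>{1..2 ^ m}. S = (\<Union>i\<in>I. e i m))"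

lemma dyadic_union_sets: assumes "dyadic_union S" shows "S : sets M"
proof -
 obtain m I where I: "I <= {1..2 ^ m}" "S = (\<Union>i\<in>I. e i m)" using assms unfolding dyadic_union_def by blast
 have "finite I" using I(1) finite_subset by blast
 thus ?thesis unfolding I(2) using I(1) em by (intro sets.finite_UN) auto
qed

lemma dyadic_union_Un: assumes "dyadic_union S" "dyadic_union S'" shows "dyadic_union (S Un S')"
proof -
 obtain m I where I: "I <= {1..2 ^ m}" "S = (\<Union>i\<in>I. e i m)" using assms(1) unfolding dyadic_union_def by blast
 obtain l J where J: "J <= {1..2 ^ l}" "S' = (\<Union>i\<in>J. e i l)" using assms(2) unfolding dyadic_union_def by blast
 obtain I' where I': "I' <= {1..2 ^ (m + l)}" "S = (\<Union>i\<in>I'. e i (m + l))" using dyadic_refine[OF e I(1), of l] I(2) by auto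
 obtain J' where J': "J' <= {1..2 ^ (m + l)}" "S' = (\<Union>i\<in>J'. e i (m + l))"
  using dyadic_refine[OF e J(1), of m] J(2) by (auto simp: add.commute)
 have "S Un S' = (\<Union>i\<in>I' Un J'. e i (m + l))" unfolding I'(2) J'(2) by blast
 thus ?thesis unfolding dyadic_union_def using I'(1) J'(1) by (intro exI[of _ "m + l"] exI[of _ "I' Un J'"]) auto
qed

lemma dyadic_union_compl: assumes "dyadic_union S" shows "dyadic_union (space M - S)"
proof -
 obtain m I where I: "I <= {1..2 ^ m}" "S = (\<Union>i\<in>I. e i m)" using assms unfolding dyadic_union_def by blast
 have "space M - S = (\<Union>i\<in>{1..2 ^ m} - I. e i m)"
 proof (rule Set.set_eqI, rule iffI)
  fix x assume x: "x : space M - S"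
  then obtain i where "i : {1..2 ^ m}" "x : e i m" using dyadic_unique[OF e, of x m] by blast
  thus "x : (\<Union>i\<in>{1..2 ^ m} - I. e i m)" using x I(2) by blast
 next
  fix x assume "x : (\<Union>i\<in>{1..2 ^ m} - I. e i m)"
  then obtain i where i: "i : {1..2 ^ m}" "i ~: I" "x : e i m" by blast
  have xs: "x : space M" using em[OF i(1)] i(3) sets.sets_into_space by blast
  have "x ~: e j m" if "j : I" for j
   using dyadic_unique[OF e xs, of m] i I(1) that by blast
  thus "x : space M - S" using xs I(2) by blast
 qed
 thus ?thesis unfolding dyadic_union_def by (intro exI[of _ m] exI[of _ "{1..2 ^ m} - I"]) auto
qed

definition dyadic_close :: "'a set => bool" where
 "dyadic_close S <-> S : sets M & (ALL ep>0. EX S'. dyadic_union S' & measure M ((S - S') Un (S' - S)) < ep)"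

lemma dyadic_union_close: "dyadic_union S ==> dyadic_close S"
 unfolding dyadic_close_def using dyadic_union_sets by (auto intro!: exI[of _ S])

lemma dyadic_close_Un: assumes "dyadic_close A" "dyadic_close B" shows "dyadic_close (A Un B)"
 unfolding dyadic_close_def
proof (intro conjI allI impI)
 have m: "A : sets M" "B : sets M" using assms by (auto simp: dyadic_close_def)
 thus "A Un B : sets M" by auto
 fix ep :: real assume "0 < ep"
 hence ep: "0 < ep / 2" by simp
 obtain A' where A': "dyadic_union A'" "measure M ((A - A') Un (A' - A)) < ep / 2" using assms(1) ep unfolding dyadic_close_def by blast
 obtain B' where B': "dyadic_union B'" "measure M ((B - B') Un (B' - B)) < ep / 2" using assms(2) ep unfolding dyadic_close_def by blast
 note m' = dyadic_union_sets[OF A'(1)] dyadic_union_sets[OF B'(1)]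
 have "measure M ((A Un B - (A' Un B')) Un (A' Un B' - (A Un B))) \<le>
   measure M (((A - A') Un (A' - A)) Un ((B - B') Un (B' - B)))"
  by (rule finite_measure_mono) (use m m' in auto)
 also have "... <= measure M ((A - A') Un (A' - A)) + measure M ((B - B') Un (B' - B))"
  by (rule measure_Un_le) (use m m' in auto)
 finally show "EX S'. dyadic_union S' & measure M ((A Un B - S') Un (S' - (A Un B))) < ep"
  using A' B' dyadic_union_Un by (intro exI[of _ "A' Un B'"]) auto
qed

text \<open>The closure of the algebra is closed under countable unions, because these are
  approximated from below in measure by finite unions.\<close>

lemma sigma_dyadic_close:
 assumes "S : sigma_sets (space M) {e i m | i m. i : {1..2 ^ m}}" shows "dyadic_close S"
 using assms
proof (induction rule: sigma_sets.induct)
 case (Basic a)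
 then obtain i m where "a = e i m" "i : {1..2 ^ m}" by blast
 hence "dyadic_union a" unfolding dyadic_union_def by (intro exI[of _ m] exI[of _ "{i}"]) auto
 thus ?case by (rule dyadic_union_close)
next
 case Empty
 have "dyadic_union {}" unfolding dyadic_union_def by (intro exI[of _ 0] exI[of _ "{}"]) auto
 thus ?case by (rule dyadic_union_close)
next
 case (Compl a)
 have a: "a : sets M" using Compl.IH by (simp add: dyadic_close_def)
 show ?case
  unfolding dyadic_close_def
 proof (intro conjI allI impI)
  show "space M - a : sets M" using a by auto
  fix ep :: real assume "0 < ep"
  then obtain S' where S': "dyadic_union S'" "measure M ((a - S') Un (S' - a)) < ep" using Compl.IH unfolding dyadic_close_def by blast
  have "(space M - a - (space M - S')) Un (space M - S' - (space M - a)) = (a - S') Un (S' - a)"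
   using sets.sets_into_space[OF a] sets.sets_into_space[OF dyadic_union_sets[OF S'(1)]] by blast
  thus "EX S'. dyadic_union S' & measure M ((space M - a - S') Un (S' - (space M - a))) < ep"
   using S' dyadic_union_compl by (intro exI[of _ "space M - S'"]) auto
 qed
next
 case (Union a)
 have am: "a i : sets M" for i using Union.IH by (simp add: dyadic_close_def)
 define b where "b k = (\<Union>i\<le>k. a i)" for k :: nat
 have b: "dyadic_close (b k)" for k
 proof (induction k)
  case (Suc k)
  have "b (Suc k) = b k Un a (Suc k)" by (auto simp: b_def le_Suc_eq)
  thus ?case using dyadic_close_Un[OF Suc Union.IH] by simp
 qed (simp add: b_def Union.IH)
 have bm: "b k : sets M" for k using b by (simp add: dyadic_close_def)
 have "(%k. measure M (b k)) ----> measure M (\<Union>k. b k)"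
 proof (rule finite_Lim_measure_incseq)
  show "range b <= sets M" using bm by blast
  show "incseq b" unfolding incseq_def b_def by (intro allI impI UN_mono) auto
 qed
 moreover have Ub: "(\<Union>k. b k) = (\<Union>i. a i)" unfolding b_def by auto
 ultimately have lim: "(%k. measure M (b k)) ----> measure M (\<Union>i. a i)" by simp
 show ?case
  unfolding dyadic_close_def
 proof (intro conjI allI impI)
  show Um: "(\<Union>i. a i) : sets M" using am by auto
  fix ep :: real assume ep: "0 < ep"
  have "eventually (%k. measure M (\<Union>i. a i) - ep / 2 < measure M (b k)) sequentially"
   by (rule order_tendstoD(1)[OF lim]) (use ep in simp)
  then obtain k where k: "measure M (\<Union>i. a i) - ep / 2 < measure M (b k)" by (auto simp: eventually_sequentially)
  have sub: "b k <= (\<Union>i. a i)" unfolding b_def by auto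
  obtain S' where S': "dyadic_union S'" "measure M ((b k - S') Un (S' - b k)) < ep / 2"
   using b[of k] half_gt_zero[OF ep] unfolding dyadic_close_def by blast
  have "measure M (((\<Union>i. a i) - b k) Un (b k - (\<Union>i. a i))) = measure M ((\<Union>i. a i) - b k)"
   using sub by (intro arg_cong[of _ _ "measure M"]) blast
  also have "... = measure M (\<Union>i. a i) - measure M (b k)" by (rule finite_measure_Diff[OF Um bm sub])
  finally have "measure M (((\<Union>i. a i) - b k) Un (b k - (\<Union>i. a i))) < ep / 2" using k by simp
  hence "measure M (((\<Union>i. a i) - S') Un (S' - (\<Union>i. a i))) < ep"
   using measure_sym_diff_triangle[OF Um bm dyadic_union_sets[OF S'(1)], of k] S'(2) by linarith
  thus "EX S'. dyadic_union S' & measure M (((\<Union>i. a i) - S') Un (S' - (\<Union>i. a i))) < ep" using S'(1) by blast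
 qed
qed

text \<open>The difference of an indicator function and its conditional expectation is orthogonal to
 all \<open>e i m\<close>, hence vanishes by weak density.\<close>

lemma basic_sequence_dense:
 assumes basic: "basic_sequence M e" and B: "B : sets M" and ep: "0 < ep"
 shows "EX m I. I <= {1..2 ^ m} & measure M ((B - (\<Union>i\<in>I. e i m)) Un ((\<Union>i\<in>I. e i m) - B)) < ep"
proof -
 define C where "C = {e i m | i m. i : {1..2 ^ m}}"
 have Cs: "C <= sets M" using em by (auto simp: C_def)
 hence Cp: "C <= Pow (space M)" using sets.space_closed by blast
 define F where "F = sigma (space M) C"
 have sF: "sets F = sigma_sets (space M) C" "space F = space M" unfolding F_def using Cp by (simp_all add: sets_measure_of)
 have "subalgebra M F" unfolding subalgebra_def sF using sets.sigma_sets_subset[OF Cs] by simp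
 hence "finite_measure_subalgebra M F"
  unfolding finite_measure_subalgebra_def finite_measure_subalgebra_axioms_def using finite_measure_axioms by blast
 then interpret sigma_finite_subalgebra M F by (rule finite_measure_subalgebra_is_sigma_finite)
 let ?i = "indicator B :: 'a => real"
 have ii: "integrable M ?i" using B by (simp add: integrable_indicator_iff emeasure_eq_measure)
 define c where "c = real_cond_exp M F ?i"
 have ci: "integrable M c" unfolding c_def by (rule real_cond_exp_int(1)[OF ii])
 have cF: "c : borel_measurable F" unfolding c_def by (rule borel_measurable_cond_exp)
 define k where "k x = ?i x - c x" for x
 have ki: "integrable M k" unfolding k_def by (intro Bochner_Integration.integrable_diff ii ci)
 have km [measurable]: "k : borel_measurable M" using ki by simp
 have ke: "(\<integral>x. indicator A x * k x \<partial>M) = 0" if A: "A : C" for A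
 proof -
  have A': "A : sets F" "A : sets M" using A Cs unfolding sF by auto
  have "(\<integral>x\<in>A. ?i x \<partial>M) = (\<integral>x\<in>A. c x \<partial>M)" unfolding c_def by (rule real_cond_exp_intA[OF ii A'(1)])
  moreover have "(\<integral>x. indicator A x * k x \<partial>M) = (\<integral>x\<in>A. ?i x \<partial>M) - (\<integral>x\<in>A. c x \<partial>M)"
   unfolding set_lebesgue_integral_def k_def
   using integrable_mult_indicator[OF A'(2) ii] integrable_mult_indicator[OF A'(2) ci]
   by (subst Bochner_Integration.integral_diff[symmetric]) (auto simp: algebra_simps)
  ultimately show ?thesis by simp
 qed
 have orth: "(\<integral>x. indicator A x * k x \<partial>M) = 0" if A: "A : sets M" for A
 proof -
  \<comment> \<open>\<open>k\<close> is only integrable, so it is factored into two square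
    integrable functions, as the test vectors of the weak topology on L^2 require.\<close>
  define xi et where "xi x = cr (if 0 <= k x then sqrt \<bar>k x\<bar> else - sqrt \<bar>k x\<bar>)" and "et x = cr (sqrt \<bar>k x\<bar>)" for x
  have prod: "xi x * cnj (et x) = cr (k x)" for x
  proof -
   have "(if 0 <= k x then sqrt \<bar>k x\<bar> else - sqrt \<bar>k x\<bar>) * sqrt \<bar>k x\<bar> = k x" by simp
   thus ?thesis unfolding xi_def et_def complex_cnj_complex_of_real of_real_mult[symmetric] by simp
  qed
  have sq: "(cmod (xi x))^2 = \<bar>k x\<bar>" "(cmod (et x))^2 = \<bar>k x\<bar>" for x
   unfolding xi_def et_def norm_of_real by auto
  have ka: "integrable M (%x. \<bar>k x\<bar>)" using ki by simp
  have L2: "xi : L2_functions M" "et : L2_functions M"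
  proof -
   have of_real: "(%x. cr (f x)) : borel_measurable M" if "f : borel_measurable M" for f
    by (rule measurable_compose[OF that]) (intro borel_measurable_continuous_onI continuous_intros)
   have "xi : borel_measurable M" "et : borel_measurable M"
    unfolding xi_def[abs_def] et_def[abs_def] by (rule of_real, measurable)+
   thus "xi : L2_functions M" "et : L2_functions M" using ka by (simp_all add: L2_functions_def sq)
  qed
  let ?f = "indicator A :: 'a => complex"
  have fm: "?f : borel_measurable M" using A by simp
  have fb: "EX C. ALL x:space M. cmod (?f x) <= C" by (intro exI[of _ 1]) (auto split: split_indicator)
  have "\<bar>\<integral>x. indicator A x * k x \<partial>M\<bar> < de" if de: "0 < de" for de :: real
  proof -
   have dens: "\<forall>F (ep::real). finite F & F <= L2_functions M \<times> L2_functions M & ep > 0 -->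
     (\<exists>I (c :: nat \<times> nat => complex).
      finite I & I <= {(i, m). 1 <= i & i <= 2 ^ m} \<and>
      (ALL (xi, et):F.
        cmod (\<integral>x. (?f x - (\<Sum>(i, m)\<in>I. c (i, m) * indicator (e i m) x)) *
             xi x * cnj (et x) \<partial>M) < ep))"
    using basic fm fb unfolding basic_sequence_def by blast
   have "finite {(xi, et)} & {(xi, et)} <= L2_functions M \<times> L2_functions M & de > 0" using L2 de by simp
   from mp[OF spec[OF spec[OF dens, of "{(xi, et)}"], of de] this]
   obtain I and a :: "nat \<times> nat => complex" where I: "finite I" "I <= {(i, m). 1 <= i & i <= 2 ^ m}"
    "cmod (\<integral>x. (?f x - (\<Sum>(i, m)\<in>I. a (i, m) * indicator (e i m) x)) * xi x * cnj (et x) \<partial>M) < de"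
    by auto
   have IC: "e (fst p) (snd p) : C" if "p : I" for p using I(2) that by (cases p) (auto simp: C_def)
   have int: "integrable M (%x. indicator S x * cr (k x))" if S: "S : sets M" for S
    using integrable_mult_indicator[OF S, of "%x. cr (k x)"] ki by (simp add: scaleR_conv_of_real)
    (rule back_subst[of "integrable M"], assumption, auto split: split_indicator)
   have intr: "(\<integral>x. indicator S x * cr (k x) \<partial>M) = cr (\<integral>x. indicator S x * k x \<partial>M)" for S
    unfolding integral_complex_of_real[symmetric] by (intro Bochner_Integration.integral_cong) (auto split: split_indicator)
   have "(\<integral>x. (?f x - (\<Sum>(i, m)\<in>I. a (i, m) * indicator (e i m) x)) * xi x * cnj (et x) \<partial>M) =
     (\<integral>x. ?f x * cr (k x) - (\<Sum>p\<in>I. a p * (indicator (e (fst p) (snd p)) x * cr (k x))) \<partial>M)"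
    by (intro Bochner_Integration.integral_cong refl)
     (simp add: mult.assoc prod left_diff_distrib sum_distrib_right case_prod_beta')
   also have "... = (\<integral>x. ?f x * cr (k x) \<partial>M) - (\<Sum>p\<in>I. a p * (\<integral>x. indicator (e (fst p) (snd p)) x * cr (k x) \<partial>M))"
    using int[OF A] int IC Cs
    by (subst Bochner_Integration.integral_diff) (auto intro!: Bochner_Integration.integrable_sum integrable_mult_right simp: Bochner_Integration.integral_sum subset_eq)
   also have "(\<Sum>p\<in>I. a p * (\<integral>x. indicator (e (fst p) (snd p)) x * cr (k x) \<partial>M)) = 0"
    unfolding intr by (intro sum.neutral ballI) (simp add: ke[OF IC])
   finally have "cmod (cr (\<integral>x. indicator A x * k x \<partial>M)) < de" using I(3) unfolding intr by simp
   thus ?thesis unfolding norm_of_real .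
  qed
  \<comment> \<open>The modulus of the integral is itself taken as the accuracy, which is
    contradictory unless it is 0.\<close>
  from this[of "\<bar>\<integral>x. indicator A x * k x \<partial>M\<bar>"] show ?thesis by (cases "(\<integral>x. indicator A x * k x \<partial>M) = 0") auto
 qed
 have "AE x in M. k x = 0"
 proof (rule density_unique_real[OF ki])
  show "(\<integral>x\<in>A. k x \<partial>M) = (\<integral>x\<in>A. 0 \<partial>M)" if "A : sets M" for A
   using orth[OF that] by (simp add: set_lebesgue_integral_def)
 qed simp
 \<comment> \<open>\<open>c\<close> equals the indicator of \<open>B\<close> almost everywhere, so
   its level set at 1/2 is a version of \<open>B\<close> in the sigma-algebra generated by the
   dyadic sets.\<close>
 define B' where "B' = {x : space M. 1 / 2 < c x}"
 have "B' : sets F" unfolding B'_def sF(2)[symmetric] using cF by measurable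
 hence cl: "dyadic_close B'" using sigma_dyadic_close unfolding sF C_def by simp
 hence B'm: "B' : sets M" by (simp add: dyadic_close_def)
 obtain S' where S': "dyadic_union S'" "measure M ((B' - S') Un (S' - B')) < ep" using cl ep unfolding dyadic_close_def by blast
 have "AE x in M. x ~: (B - B') Un (B' - B)"
  using \<open>AE x in M. k x = 0\<close> AE_space
 proof eventually_elim
  fix x assume x: "k x = 0" "x : space M"
  thus "x ~: (B - B') Un (B' - B)" by (auto simp: k_def B'_def split: split_indicator_asm)
 qed
 hence "measure M ((B - B') Un (B' - B)) = 0" using B B'm by (subst (asm) prob_eq_0[symmetric]) auto
 hence "measure M ((B - S') Un (S' - B)) < ep"
  using measure_sym_diff_triangle[OF B B'm dyadic_union_sets[OF S'(1)]] S'(2) by linarith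
 thus ?thesis using S'(1) unfolding dyadic_union_def by blast
qed

end

theorem proposition4p5:
  fixes M :: "'a measure"
    and E :: "('a \<times> 'a) set"
    and e :: "nat \<Rightarrow> nat \<Rightarrow> 'a set"
    and \<omega> :: "nat filter"
  assumes "free_ultrafilter \<omega>"
    and "standard_prob_space M"
    and "basic_sequence M e"
    and "invariant_equiv_rel M E"
    and "EL_sofic_rel M e E"
  shows "sofic_rel \<omega> M E \<and>
         (\<exists>n \<Theta>. (\<forall>k. 0 < n k) \<and> sofic_embedding \<omega> n M E \<Theta>)"
proof -
 interpret prob_space M using assms(2) by (simp add: standard_prob_space_def)
 obtain U :: "nat => 'a set" where U: "!!i. U i : sets M"
  "!!x y. x : space M ==> y : space M ==> (!!i. x : U i <-> y : U i) ==> x = y"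
  by (rule standard_separating[OF assms(2)]) blast
 obtain al where al: "mp_action M al" "EL_sofic_action M e al" "AE x in M. E `` {x} = Group_Action.orbit free_group al x"
  using assms(5) unfolding EL_sofic_rel_def by blast
 have fa: "fg_act (space M) al" using al(1) fg_act_group_action unfolding mp_action_def by blast
 have am: "al w : measurable M M" "distr M M (al w) = M" if "w : FG" for w
  using al(1) that unfolding mp_action_def by blast+
 have eqE: "equiv (space M) E" and cntE: "!!x. x : space M ==> countable (E `` {x})"
  using assms(4) unfolding invariant_equiv_rel_def by blast+
 let ?N = "completion M"
 interpret FG: group free_group by (rule group_free_group)
 have one_FG: "[] : FG" using FG.one_closed by (simp add: one_free_group)
 define X where "X = {x : space M. E `` {x} = {al w x |w. w : FG}}"
 have AEX: "AE x in M. x : X" using al(3) AE_space by eventually_elim (simp add: X_def orbit_def)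
 have X_sub: "X <= space M" by (auto simp: X_def)
 have X_null: "space M - X : null_sets ?N"
 proof -
  have "{x : space ?N. ~ x : X} : null_sets ?N" using AE_completion[OF AEX] unfolding completion.AE_iff_null_sets .
  moreover have "{x : space ?N. ~ x : X} = space M - X" by auto
  ultimately show ?thesis by simp
 qed
 have null_sub: "A : sets ?N" if "A <= space M - X" for A
  using completion.complete2[OF that X_null] by auto
 have X_sets: "X : sets ?N"
 proof -
  have "space ?N - (space M - X) : sets ?N" by (intro sets.compl_sets) (use X_null in auto)
  moreover have "space ?N - (space M - X) = X" using X_sub by auto
  ultimately show ?thesis by simp
 qed
 have X_E: "(x, al w x) : E" if "x : X" "w : FG" for x w using that by (auto simp: X_def)
 have X_inv: "al w x : X" if x: "x : X" and w: "w : FG" for x w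
 proof -
  have xs: "x : space M" using x X_sub by auto
  have "E `` {al w x} = E `` {x}" using equiv_class_eq[OF eqE X_E[OF x w]] by simp
  also have "... = {al v x |v. v : FG}" using x by (simp add: X_def)
  also have "... = {al v (al w x) |v. v : FG}"
  proof (rule Set.set_eqI, rule iffI; clarify)
   fix v assume v: "v : FG"
   have "al (v \<cdot> ginv w \<cdot> w) x = al (v \<cdot> ginv w) (al w x)"
    by (rule fg_actD(3)[OF fa]) (use v w xs in auto)
   hence "al v x = al (v \<cdot> ginv w) (al w x)" using v w by (simp add: FG.m_assoc FG.l_inv)
   thus "EX u. al v x = al u (al w x) & u : FG" using v w by (intro exI[of _ "v \<cdot> ginv w"]) auto
  next
   fix v assume v: "v : FG"
   show "EX u. al v (al w x) = al u x & u : FG"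
    using fg_actD(3)[OF fa v w xs] v w by (intro exI[of _ "v \<cdot> w"]) auto
  qed
  finally show ?thesis using fg_actD(1)[OF fa w xs] by (simp add: X_def)
 qed
 \<comment> \<open>The change costs Borel measurability, since \<open>X\<close> is only known to be
   measurable for the completion; invariance of \<open>X\<close> makes the result an action.\<close>
 define act where "act w x = (if x : X then al w x else x)" for w x
 have alN: "al w : measurable ?N ?N" "distr ?N ?N (al w) = ?N" if w: "w : FG" for w
 proof -
  have 1: "al w : measurable ?N M" by (rule measurable_completion[OF am(1)[OF w]])
  have 2: "distr ?N M (al w) = M" using distr_completion[OF am(1)[OF w]] am(2)[OF w] by simp
  show "al w : measurable ?N ?N" by (rule completion.measurable_completion2[OF 1]) (simp add: 2)
  show "distr ?N ?N (al w) = ?N" using completion.completion_distr_eq[OF 1] by (simp add: 2)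
 qed
 have actN: "act w : measurable ?N ?N" if w: "w : FG" for w
 proof (rule measurableI)
  fix x assume "x : space ?N"
  thus "act w x : space ?N" using fg_actD(1)[OF fa w] by (simp add: act_def)
 next
  fix A assume A: "A : sets ?N"
  have "act w -` A Int space ?N = (X Int (al w -` A Int space ?N)) Un (act w -` A Int (space M - X))"
   using X_sub by (auto simp: act_def)
  moreover have "al w -` A Int space ?N : sets ?N" by (rule measurable_sets[OF alN(1)[OF w] A])
  moreover have "act w -` A Int (space M - X) : sets ?N" by (rule null_sub) auto
  ultimately show "act w -` A Int space ?N : sets ?N" using X_sets by auto
 qed
 have AEact: "AE x in ?N. x : X" by (rule AE_completion[OF AEX])
 obtain Y :: "nat => nat set" and d be where Y: "!!k. X_set (Y k) (d k)" "!!k. group_action free_group (Y k) (be k)"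
  "!!r (G :: nat rooted_graph). 1 <= r ==> labeled_nbhd r G ==>
   (%k. nbhd_prob (uniform_count_measure (Y k)) (d k) (be k) r G) ----> nbhd_prob M e al r G"
  using al(2) unfolding EL_sofic_action_def by blast
 have be: "fg_act (Y k) (be k)" for k by (rule fg_act_group_action[OF Y(2)])
 have e: "dyadic_splitting (space M) e" and em: "!!m i. i : {1..2 ^ m} ==> e i m : sets M"
  using assms(3) unfolding basic_sequence_def by blast+
 have orb: "orbit_relation M E act U"
 proof (unfold_locales)
  show "act [] x = x" if "x : space M" for x using fg_actD(2)[OF fa that] by (simp add: act_def)
  show "act (v \<cdot> w) x = act v (act w x)" if "v : FG" "w : FG" "x : space M" for v w x
   using fg_actD(3)[OF fa that] X_inv[OF _ that(2), of x] by (simp add: act_def)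
  show "distr ?N ?N (act w) = ?N" if w: "w : FG" for w
  proof -
   have "distr ?N ?N (act w) = distr ?N ?N (al w)"
    by (rule distr_cong_AE[OF refl refl _ actN[OF w] alN(1)[OF w]], use AEact in eventually_elim) (simp add: act_def)
   thus ?thesis using alN(2)[OF w] by simp
  qed
  show "(x, act w x) : E" if "w : FG" "x : space M" for w x
   using X_E[OF _ that(1), of x] that(2) eqE by (auto simp: act_def equiv_def refl_on_def)
  show "AE x in M. E `` {x} = {act w x |w. w : FG}"
   using AEX by eventually_elim (simp add: act_def X_def)
  show "x = y" if "x : space M" "y : space M" "!!i. x : U i <-> y : U i" for x y by (rule U(2)[OF that])
 qed (rule U(1) eqE cntE actN, assumption?)+
 interpret sofic_model M E act U e Y d be \<omega>
 proof (intro sofic_model.intro sofic_model_axioms.intro orb)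
  show "EX m I. I <= {1..2 ^ m} & measure M ((B - (\<Union>i\<in>I. e i m)) Un ((\<Union>i\<in>I. e i m) - B)) < ep"
   if "B : sets M" "0 < ep" for B ep
   by (rule basic_sequence_dense[OF prob_space_axioms e em assms(3) that])
  show "\<omega> ~= bot" "\<omega> <= sequentially" using assms(1) unfolding free_ultrafilter_def cofinite_eq_sequentially by blast+
  fix Q w assume Q: "valid Q" and w: "w : FG"
  \<comment> \<open>Elek-Lippner convergence is known for \<open>al\<close>, while the model uses
    \<open>act\<close>. The two agree on \<open>X\<close>, so the diagonal events \<open>?S\<close>
    and \<open>?S'\<close> differ by a null set.\<close>
  let ?S = "{x : space M. kern al e Q w x x}" and ?S' = "{x : space M. kern act e Q w x x}"
  have S: "?S : sets M"
  proof -
   have [measurable]: "U i : sets M" for i by (rule U(1))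
   have [measurable]: "al w : measurable M M" by (rule am(1)[OF w])
   have "x = al w x <-> (ALL i. x : U i <-> al w x : U i)" if x: "x : space M" for x
   proof
    assume h: "x = al w x"
    show "ALL i. x : U i <-> al w x : U i" unfolding h[symmetric] by simp
   next
    assume "ALL i. x : U i <-> al w x : U i"
    thus "x = al w x" using U(2)[OF x fg_actD(1)[OF fa w x]] by blast
   qed
   hence "{x : space M. x = al w x} = {x : space M. ALL i. x : U i <-> al w x : U i}" by blast
   also have "... : sets M" by measurable
   finally have 1: "{x : space M. x = al w x} : sets M" .
   have 2: "{x : space M. ALL t:set Q. case t of (v, i, m) => al v x : e i m} : sets M"
   proof (rule sets.sets_Collect_finite_All)
    fix t assume t: "t : set Q"
    obtain v i m where vim: "t = (v, i, m)" by (metis surj_pair)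
    have v: "v : FG" "i : {1..2 ^ m}" using Q t by (auto simp: vim valid_def)
    have [measurable]: "al v : measurable M M" "e i m : sets M" using am(1)[OF v(1)] em[OF v(2)] by auto
    show "{x : space M. case t of (v, i, m) => al v x : e i m} : sets M" unfolding vim prod.case by measurable
   qed simp
   have "?S = {x : space M. ALL t:set Q. case t of (v, i, m) => al v x : e i m} Int {x : space M. x = al w x}"
    unfolding kern_def by blast
   thus ?thesis using 1 2 by simp
  qed
  have eq: "kern act e Q w x x <-> kern al e Q w x x" if "x : X" for x using that by (simp add: kern_def act_def)
  have S': "?S' : sets ?N"
  proof -
   have 1: "?S' = (?S Int X) Un (?S' - X)" by (auto simp: eq)
   have 2: "?S' - X : sets ?N" by (rule null_sub) auto
   show ?thesis by (subst 1) (intro sets.Un sets.Int sets_completionI_sets S X_sets 2)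
  qed
  have "AE x in ?N. x : ?S' <-> x : ?S" using AEact by eventually_elim (simp add: eq)
  hence "emeasure ?N ?S' = emeasure ?N ?S" by (rule emeasure_eq_AE[OF _ S' sets_completionI_sets[OF S]])
  hence m: "measure ?N ?S' = measure M ?S" using measure_completion[OF S] by (simp add: measure_def)
  show "(%k. real (card {y : Y k. kern (be k) (d k) Q w y y}) / real (card (Y k))) ----> measure ?N ?S'"
   unfolding m by (rule kern_convergence[OF prob_space_axioms U fa e am(1) em Y(1) be Y(3) Q w])
 qed (rule e em Y(1) be, assumption?)+
 show ?thesis using sofic_model_sofic n_pos by blast
qed

end
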